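(* Let $m\ge1$ and let rational tableaux, their bideterminants viewed in $\mathbb Z[\mathrm{GL}_{m,\mathbb Z}]$, and the $\mathbb Z$-submodules $A_{\le\lambda},A_{<\lambda},\nabla_{\mathbb Z}(\lambda),\tilde\nabla_{\mathbb Z}(\lambda)$ of $\mathbb Z[\mathrm{GL}_{m,\mathbb Z}]$ be as defined in the context, with respect to a fixed linear order $\preceq$ on $\{1,\dots,m\}$. Let $\lambda\in X^+$. (i) Let $S$ and $T$ be rational tableaux of shape $\lambda$. Then the bideterminant $(S\,|\,T)\in\mathbb Z[\mathrm{GL}_{m,\mathbb Z}]$ can be written as a linear combination $\sum_i a_i(S_i\,|\,T_i)$, where the $a_i$ are integers and the $(S_i,T_i)$ are standard rational bitableaux of shape $\le\lambda$ with the same weight as $(S,T)$. (ii) The bideterminants $(S\,|\,T)$, $(S,T)$ a rational bitableau with $S$ and $T$ standard, form a basis of $\mathbb Z[\mathrm{GL}_{m,\mathbb Z}]$. (iii) The elements $(T_\lambda\,|\,T)$, $T$ a standard rational tableau of shape $\lambda$, form a basis of $\nabla_{\mathbb Z}(\lambda)$, and the elements $(T\,|\,T_\lambda)$, $T$ a standard rational tableau of shape $\lambda$, form a basis of $\tilde\nabla_{\mathbb Z}(\lambda)$. (iv) The map $(S\,|\,T_\lambda)\otimes(T_\lambda\,|\,T)\mapsto(S\,|\,T)$ ($S,T$ rational tableaux of shape $\lambda$) defines an isomorphism $$\tilde\nabla_{\mathbb Z}(\lambda)\otimes_{\mathbb Z}\nabla_{\mathbb Z}(\lambda)\stackrel{\sim}{\to}A_{\le\lambda}/A_{<\lambda}$$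 of $\mathrm{GL}_{m,\mathbb Z}\times\mathrm{GL}_{m,\mathbb Z}$-modules.
   Context: **Functions and actions.** In $\mathbb Z[\mathrm{GL}_{m,\mathbb Z}]$ let $x_{ij}$ be the $(i,j)$ entry function and $y_{ij}$ the function $A\mapsto((A^{-1})^T)_{ij}$. $\mathrm{GL}_{m,\mathbb Z}\times\mathrm{GL}_{m,\mathbb Z}$ acts on $\mathbb Z[\mathrm{GL}_{m,\mathbb Z}]$ by $((g,h)\cdot f)(A)=f(g^{-1}Ah)$; the action of the left (right) factor is the left (right) regular action. **Weights.** $X=\mathbb Z^m$; $X^+=\{\lambda\in\mathbb Z^m:\lambda_1\ge\cdots\ge\lambda_m\}$; $|\lambda|=\sum_i\lambda_i$. $\mu\le\lambda$ means $|\mu|=|\lambda|$ and $\sum_{i=1}^j\mu_i\le\sum_{i=1}^j\lambda_i$ for all $j$ (type $A_{m-1}$ order). The length $l(\lambda)$ of a partition is its number of nonzero parts. For $\lambda^1,\lambda^2\in\mathbb Z^m$ put $[\lambda^1,\lambda^2]:=\lambda^1-(\lambda^2)^{\rm rev}$, where $\rm rev$ reverses a tuple. Every $\lambda\in X^+$ is uniquely $[\lambda^1,\lambda^2]$ with $\lambda^1,\lambda^2$ partitions satisfying $l(\lambda^1)+l(\lambda^2)\le m$. **Tableaux.** A tableau of shape a partition $\lambda$ (length $\le m$) is a map from the Young diagram $\{(i,j):1\le j\le\lambda_i\}$ to $\{1,\dots,m\}$. It is standard if, with respect to $\preceq$, entries strictly increase down columns and weakly increase along rows from left to right. Its weight is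 the vector whose $i$-th component is the number of occurrences of $i$. A rational tableau of shape $(\lambda^1,\lambda^2)$ is a pair $T=(T^1,T^2)$ with $T^i$ a tableau of shape $\lambda^i$; its weight is (weight of $T^1$) $-$ (weight of $T^2$). If $\lambda=[\lambda^1,\lambda^2]\in X^+$ with $l(\lambda^1)+l(\lambda^2)\le m$, a rational tableau of shape $(\lambda^1,\lambda^2)$ is said to have shape $\lambda$. A pair $(I^1,I^2)$ of subsets of $\{1,\dots,m\}$ is standard if $|\{i\in I^1:i\preceq j\}|+|\{i\in I^2:i\preceq j\}|\le|\{i:i\preceq j\}|$ for all $j\in\{1,\dots,m\}$. A rational tableau $(T^1,T^2)$ is standard if $T^1,T^2$ are standard and the pair of sets of entries of the first columns of $T^1$ and $T^2$ (possibly empty) is standard; then automatically $l(\lambda^1)+l(\lambda^2)\le m$. The canonical rational tableau $T_\lambda=(T^1,T^2)$ of shape $\lambda=[\lambda^1,\lambda^2]$ has all entries in row $i$ of $T^1$ equal to $i$ ($1\le i\le l(\lambda^1)$) and all entries in row $i$ of $T^2$ equal to $m-i+1$ ($1\le i\le l(\lambda^2)$). **Bideterminants.** A rational bitableau of shape $(\lambda^1,\lambda^2)$ is a pair $(S,T)$ of rational tableaux of that shape; it is standard if both $S$ and $T$ are; its weight is $(-\mu,\nu)$ with $\mu,\nu$ the weights of $S,T$. Its bideterminant is $(S\,|\,T)=(S^1\,|\,T^1)_1(S^2\,|\,T^2)_2$, where $(S^1\,|\,T^1)_1$ is the product over all columns $c$ of $\lambda^1$ of the minors $\det\big(x_{S^1(a,c)\,T^1(b,c)}\big)_{a,b}$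 ($a,b$ from $1$ to the length of column $c$), and $(S^2\,|\,T^2)_2$ is defined in the same way from $S^2,T^2,\lambda^2$ and the $y_{ij}$. **Submodules.** For $\lambda\in X^+$, $A_{\le\lambda}$ (resp. $A_{<\lambda}$) is the $\mathbb Z$-span of the bideterminants $(S\,|\,T)$ with $S,T$ rational tableaux of the same shape $\mu\in X^+$, $\mu\le\lambda$ (resp. $\mu<\lambda$). $\nabla_{\mathbb Z}(\lambda)$ (resp. $\tilde\nabla_{\mathbb Z}(\lambda)$) is the $\mathbb Z$-span of the $(T_\lambda\,|\,S)$ (resp. $(S\,|\,T_\lambda)$), $S$ a rational tableau of shape $\lambda$; it is a submodule for the right (resp. left) regular action. *)

theory Defs
  imports
    "Jordan_Normal_Form.Determinant"
    "Jordan_Normal_Form.Gauss_Jordan_Elimination"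
    "HOL-Algebra.Free_Abelian_Groups"
    "HOL-Computational_Algebra.Fraction_Field"
    "HOL-Library.Product_Lexorder"
begin

section \<open>Weights, partitions and tableaux\<close>

text \<open>Elements of \<open>\<int>\<^sup>m\<close> are lists of length \<open>m\<close>, so the \<open>i\<close>-th component of \<open>l\<close> is \<open>l ! (i - 1)\<close>.
  Partitions are padded with zeros to length \<open>m\<close>. Boxes of Young diagrams are indexed from 1.\<close>

definition Xplus :: "nat \<Rightarrow> int list set" where
  "Xplus m = {l. length l = m \<and> sorted_wrt (\<ge>) l}"

definition dom_le :: "int list \<Rightarrow> int list \<Rightarrow> bool" where
  "dom_le mu lam \<longleftrightarrow> length mu = length lam \<and> sum_list mu = sum_list lam \<and>
     (\<forall>j \<in> {1..length lam}. sum_list (take j mu) \<le> sum_list (take j lam))"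

definition dom_less :: "int list \<Rightarrow> int list \<Rightarrow> bool" where
  "dom_less mu lam \<longleftrightarrow> dom_le mu lam \<and> mu \<noteq> lam"

definition partitions :: "nat \<Rightarrow> nat list set" where
  "partitions m = {p. length p = m \<and> sorted_wrt (\<ge>) p}"

definition plen :: "nat list \<Rightarrow> nat" where
  "plen p = length (filter (\<lambda>a. a \<noteq> 0) p)"

type_synonym shape = "nat list \<times> nat list"

definition bracket :: "shape \<Rightarrow> int list" where
  "bracket = (\<lambda>(p, q). map2 (\<lambda>a b. int a - int b) p (rev q))"

definition shape_of :: "nat \<Rightarrow> int list \<Rightarrow> shape" where
  "shape_of m lam = (THE (p, q). p \<in> partitions m \<and> q \<in> partitions m \<and>
      plen p + plen q \<le> m \<and> lam = bracket (p, q))"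

definition young :: "nat list \<Rightarrow> (nat \<times> nat) set" where
  "young p = {(i, j). 1 \<le> i \<and> i \<le> length p \<and> 1 \<le> j \<and> j \<le> p ! (i - 1)}"

text \<open>Tableaux are extensional functions, so that distinct representatives are distinct tableaux.\<close>

type_synonym tableau = "nat \<times> nat \<Rightarrow> nat"
type_synonym rtableau = "tableau \<times> tableau"

definition tableaux :: "nat \<Rightarrow> nat list \<Rightarrow> tableau set" where
  "tableaux m p = young p \<rightarrow>\<^sub>E {1..m}"

definition rtableaux :: "nat \<Rightarrow> shape \<Rightarrow> rtableau set" where
  "rtableaux m = (\<lambda>(p, q). tableaux m p \<times> tableaux m q)"

definition std_tableau :: "nat rel \<Rightarrow> nat list \<Rightarrow> tableau \<Rightarrow> bool" where
  "std_tableau ord p T \<longleftrightarrow>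
     (\<forall>i i' j. i < i' \<longrightarrow> (i, j) \<in> young p \<longrightarrow> (i', j) \<in> young p \<longrightarrow>
        (T (i, j), T (i', j)) \<in> ord \<and> T (i, j) \<noteq> T (i', j)) \<and>
     (\<forall>i j j'. j < j' \<longrightarrow> (i, j) \<in> young p \<longrightarrow> (i, j') \<in> young p \<longrightarrow>
        (T (i, j), T (i, j')) \<in> ord)"

definition std_pair :: "nat \<Rightarrow> nat rel \<Rightarrow> nat set \<Rightarrow> nat set \<Rightarrow> bool" where
  "std_pair m ord I1 I2 \<longleftrightarrow>
     (\<forall>j \<in> {1..m}. card {i \<in> I1. (i, j) \<in> ord} + card {i \<in> I2. (i, j) \<in> ord}
        \<le> card {i \<in> {1..m}. (i, j) \<in> ord})"

definition first_column :: "nat list \<Rightarrow> tableau \<Rightarrow> nat set" where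
  "first_column p T = {T (i, 1) | i. (i, 1) \<in> young p}"

definition std_rtableaux :: "nat \<Rightarrow> nat rel \<Rightarrow> shape \<Rightarrow> rtableau set" where
  "std_rtableaux m ord = (\<lambda>(p, q). {(T1, T2) \<in> rtableaux m (p, q).
     std_tableau ord p T1 \<and> std_tableau ord q T2 \<and>
     std_pair m ord (first_column p T1) (first_column q T2)})"

definition wt :: "nat \<Rightarrow> shape \<Rightarrow> rtableau \<Rightarrow> int list" where
  "wt m = (\<lambda>(p, q) (T1, T2).
     map (\<lambda>i. int (card {b \<in> young p. T1 b = i}) - int (card {b \<in> young q. T2 b = i})) [1..<m + 1])"

definition bwt :: "nat \<Rightarrow> shape \<Rightarrow> rtableau \<Rightarrow> rtableau \<Rightarrow> int list \<times> int list" where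
  "bwt m s S T = (map uminus (wt m s S), wt m s T)"

definition canonical :: "nat \<Rightarrow> shape \<Rightarrow> rtableau" where
  "canonical m = (\<lambda>(p, q). (restrict (\<lambda>(i, j). i) (young p), restrict (\<lambda>(i, j). m - i + 1) (young q)))"

section \<open>The coordinate ring of the general linear group scheme\<close>

text \<open>\<open>ratfun\<close> is the fraction field of the integral polynomial ring in the variables \<open>(b, i, j)\<close>;
  for fixed \<open>b\<close> these are the entries of a generic \<open>m \<times> m\<close> matrix \<open>gen m b\<close>.
  For a set \<open>B\<close> of block numbers, \<open>coord m B\<close> is the polynomial ring over \<open>\<int>\<close> in the entries
  of the \<open>gen m b\<close> (\<open>b \<in> B\<close>) localised at their determinants, i.e. the coordinate ring of the
  product over \<open>B\<close> of copies of the group scheme \<open>GL\<^sub>m\<close> over \<open>\<int>\<close>.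
  Block 0 is used for \<open>\<int>[GL\<^sub>m]\<close> itself, blocks 1 and 2 for the left and right factor of the
  acting group \<open>GL\<^sub>m \<times> GL\<^sub>m\<close>.\<close>

type_synonym zpoly = "((nat \<times> nat \<times> nat) \<Rightarrow>\<^sub>0 nat) \<Rightarrow>\<^sub>0 int"
type_synonym ratfun = "zpoly fract"

definition var :: "nat \<Rightarrow> nat \<Rightarrow> nat \<Rightarrow> ratfun" where
  "var b i j = Fract (Poly_Mapping.single (Poly_Mapping.single (b, i, j) 1) 1) 1"

definition gen :: "nat \<Rightarrow> nat \<Rightarrow> ratfun mat" where
  "gen m b = mat m m (\<lambda>(i, j). var b (i + 1) (j + 1))"

inductive_set coord :: "nat \<Rightarrow> nat set \<Rightarrow> ratfun set" for m :: nat and B :: "nat set" where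
  one: "1 \<in> coord m B"
| entry: "b \<in> B \<Longrightarrow> i < m \<Longrightarrow> j < m \<Longrightarrow> gen m b $$ (i, j) \<in> coord m B"
| inv_det: "b \<in> B \<Longrightarrow> 1 / det (gen m b) \<in> coord m B"
| diff: "f \<in> coord m B \<Longrightarrow> g \<in> coord m B \<Longrightarrow> f - g \<in> coord m B"
| mult: "f \<in> coord m B \<Longrightarrow> g \<in> coord m B \<Longrightarrow> f * g \<in> coord m B"

abbreviation ZGL :: "nat \<Rightarrow> ratfun set" where
  "ZGL m \<equiv> coord m {0}"

definition matinv :: "'a::field mat \<Rightarrow> 'a mat" where
  "matinv A = the (mat_inverse A)"

definition xfun :: "nat \<Rightarrow> nat \<Rightarrow> nat \<Rightarrow> ratfun" where
  "xfun m i j = gen m 0 $$ (i - 1, j - 1)"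

definition yfun :: "nat \<Rightarrow> nat \<Rightarrow> nat \<Rightarrow> ratfun" where
  "yfun m i j = transpose_mat (matinv (gen m 0)) $$ (i - 1, j - 1)"

text \<open>\<open>eval_at f A\<close> is the value \<open>f(A)\<close> of \<open>f \<in> \<int>[GL\<^sub>m]\<close> at a point \<open>A\<close> of \<open>GL\<^sub>m\<close> over the
  field \<open>ratfun\<close>. The value does not depend on the chosen fraction with nonvanishing
  denominator, and for \<open>f \<in> \<int>[GL\<^sub>m]\<close> one such has a power of the determinant as denominator.\<close>

definition peval :: "zpoly \<Rightarrow> ratfun mat \<Rightarrow> ratfun" where
  "peval p A = (\<Sum>t \<in> Poly_Mapping.keys p. of_int (Poly_Mapping.lookup p t) *
     (\<Prod>(b, i, j) \<in> Poly_Mapping.keys t. A $$ (i - 1, j - 1) ^ Poly_Mapping.lookup t (b, i, j)))"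

definition eval_at :: "ratfun \<Rightarrow> ratfun mat \<Rightarrow> ratfun" where
  "eval_at f A = (THE w. \<exists>p q. f = Fract p q \<and> peval q A \<noteq> 0 \<and> w = peval p A / peval q A)"

section \<open>Bideterminants and their spans\<close>

definition bidet_factor :: "(nat \<Rightarrow> nat \<Rightarrow> ratfun) \<Rightarrow> nat list \<Rightarrow> tableau \<Rightarrow> tableau \<Rightarrow> ratfun" where
  "bidet_factor z p S T = (\<Prod>c \<in> snd ` young p.
     let r = card {i. (i, c) \<in> young p}
     in det (mat r r (\<lambda>(a, b). z (S (a + 1, c)) (T (b + 1, c)))))"

definition bidet :: "nat \<Rightarrow> shape \<Rightarrow> rtableau \<Rightarrow> rtableau \<Rightarrow> ratfun" where
  "bidet m = (\<lambda>(p, q) (S1, S2) (T1, T2).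
     bidet_factor (xfun m) p S1 T1 * bidet_factor (yfun m) q S2 T2)"

definition zscale :: "int \<Rightarrow> ratfun \<Rightarrow> ratfun" where
  "zscale n f = of_int n * f"

global_interpretation zmod: Modules.module zscale
  by unfold_locales (simp_all add: zscale_def algebra_simps)

definition is_zbasis :: "'i set \<Rightarrow> ('i \<Rightarrow> ratfun) \<Rightarrow> ratfun set \<Rightarrow> bool" where
  "is_zbasis I f M \<longleftrightarrow> inj_on f I \<and> \<not> zmod.dependent (f ` I) \<and> zmod.span (f ` I) = M"

definition A_le :: "nat \<Rightarrow> int list \<Rightarrow> ratfun set" where
  "A_le m lam = zmod.span {bidet m (shape_of m mu) S T | mu S T. mu \<in> Xplus m \<and> dom_le mu lam \<and>
     S \<in> rtableaux m (shape_of m mu) \<and> T \<in> rtableaux m (shape_of m mu)}"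

definition A_less :: "nat \<Rightarrow> int list \<Rightarrow> ratfun set" where
  "A_less m lam = zmod.span {bidet m (shape_of m mu) S T | mu S T. mu \<in> Xplus m \<and> dom_less mu lam \<and>
     S \<in> rtableaux m (shape_of m mu) \<and> T \<in> rtableaux m (shape_of m mu)}"

definition nabla :: "nat \<Rightarrow> int list \<Rightarrow> ratfun set" where
  "nabla m lam = zmod.span
     ((\<lambda>S. bidet m (shape_of m lam) (canonical m (shape_of m lam)) S) ` rtableaux m (shape_of m lam))"

definition nabla_tilde :: "nat \<Rightarrow> int list \<Rightarrow> ratfun set" where
  "nabla_tilde m lam = zmod.span
     ((\<lambda>S. bidet m (shape_of m lam) S (canonical m (shape_of m lam))) ` rtableaux m (shape_of m lam))"

section \<open>Tensor products of abelian groups\<close>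

text \<open>Abelian groups (\<open>\<int>\<close>-modules) are written as commutative group records.\<close>

definition tensor_relations ::
    "('a, 'c) monoid_scheme \<Rightarrow> ('b, 'd) monoid_scheme \<Rightarrow> ('a \<times> 'b \<Rightarrow>\<^sub>0 int) set" where
  "tensor_relations G H =
     {frag_of (a \<otimes>\<^bsub>G\<^esub> a', b) - frag_of (a, b) - frag_of (a', b) | a a' b.
        a \<in> carrier G \<and> a' \<in> carrier G \<and> b \<in> carrier H} \<union>
     {frag_of (a, b \<otimes>\<^bsub>H\<^esub> b') - frag_of (a, b) - frag_of (a, b') | a b b'.
        a \<in> carrier G \<and> b \<in> carrier H \<and> b' \<in> carrier H}"

definition tensor_null ::
    "('a, 'c) monoid_scheme \<Rightarrow> ('b, 'd) monoid_scheme \<Rightarrow> ('a \<times> 'b \<Rightarrow>\<^sub>0 int) set" where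
  "tensor_null G H =
     generate (free_Abelian_group (carrier G \<times> carrier H)) (tensor_relations G H)"

definition tensor ::
    "('a, 'c) monoid_scheme \<Rightarrow> ('b, 'd) monoid_scheme \<Rightarrow> ('a \<times> 'b \<Rightarrow>\<^sub>0 int) set monoid" where
  "tensor G H = free_Abelian_group (carrier G \<times> carrier H) Mod tensor_null G H"

definition tens ::
    "('a, 'c) monoid_scheme \<Rightarrow> ('b, 'd) monoid_scheme \<Rightarrow> 'a \<Rightarrow> 'b \<Rightarrow> ('a \<times> 'b \<Rightarrow>\<^sub>0 int) set" where
  "tens G H a b =
     tensor_null G H #>\<^bsub>free_Abelian_group (carrier G \<times> carrier H)\<^esub> frag_of (a, b)"

text \<open>The homomorphism induced by a biadditive map \<open>\<beta>\<close>. It is determined on the carrier of the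
  tensor product; its values elsewhere are irrelevant.\<close>

definition tensor_lift :: "('a, 'c) monoid_scheme \<Rightarrow> ('b, 'd) monoid_scheme \<Rightarrow>
    ('e, 'f) monoid_scheme \<Rightarrow> ('a \<Rightarrow> 'b \<Rightarrow> 'e) \<Rightarrow> ('a \<times> 'b \<Rightarrow>\<^sub>0 int) set \<Rightarrow> 'e" where
  "tensor_lift G H K \<beta> = (SOME h. h \<in> hom (tensor G H) K \<and>
     (\<forall>a \<in> carrier G. \<forall>b \<in> carrier H. h (tens G H a b) = \<beta> a b))"

text \<open>The map \<open>f \<otimes> id\<close> from \<open>G \<otimes> H\<close> to \<open>K \<otimes> H\<close>.\<close>

definition tensor_map_left :: "('a, 'c) monoid_scheme \<Rightarrow> ('e, 'f) monoid_scheme \<Rightarrow>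
    ('b, 'd) monoid_scheme \<Rightarrow> ('a \<Rightarrow> 'e) \<Rightarrow> ('a \<times> 'b \<Rightarrow>\<^sub>0 int) set \<Rightarrow> ('e \<times> 'b \<Rightarrow>\<^sub>0 int) set" where
  "tensor_map_left G K H f = tensor_lift G H (tensor K H) (\<lambda>a b. tens K H (f a) b)"

section \<open>Modules for the group scheme\<close>

definition addgrp :: "ratfun set \<Rightarrow> ratfun monoid" where
  "addgrp M = \<lparr>carrier = M, monoid.mult = (+), one = 0\<rparr>"

text \<open>The Hopf algebra of \<open>GL\<^sub>m \<times> GL\<^sub>m\<close>, as an abelian group.\<close>

abbreviation ZGG :: "nat \<Rightarrow> ratfun monoid" where
  "ZGG m \<equiv> addgrp (coord m {1, 2})"

text \<open>A module for the group scheme \<open>GL\<^sub>m \<times> GL\<^sub>m\<close> over \<open>\<int>\<close> is an abelian group \<open>M\<close> with a coaction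
  \<open>M \<rightarrow> M \<otimes> \<int>[GL\<^sub>m \<times> GL\<^sub>m]\<close>, which is the action of the generic group element
  \<open>(g, h) = (gen m 1, gen m 2)\<close> after base change. The following functions apply this generic
  element to \<open>f \<in> \<int>[GL\<^sub>m]\<close>, by the formula \<open>((g, h) \<cdot> f)(A) = f(g\<^sup>-\<^sup>1 A h)\<close> with \<open>A = gen m 0\<close>;
  in the left (right) regular action the other factor acts trivially. The result lies in
  \<open>coord m {0, 1, 2}\<close>, which is identified with \<open>coord m {0} \<otimes> coord m {1, 2}\<close> by multiplication.\<close>

definition both_act :: "nat \<Rightarrow> ratfun \<Rightarrow> ratfun" where
  "both_act m f = eval_at f (matinv (gen m 1) * gen m 0 * gen m 2)"

definition left_act :: "nat \<Rightarrow> ratfun \<Rightarrow> ratfun" where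
  "left_act m f = eval_at f (matinv (gen m 1) * gen m 0)"

definition right_act :: "nat \<Rightarrow> ratfun \<Rightarrow> ratfun" where
  "right_act m f = eval_at f (gen m 0 * gen m 2)"

text \<open>The coaction on a submodule \<open>M\<close> of \<open>\<int>[GL\<^sub>m]\<close> stable under one of these actions. As
  \<open>\<int>[GL\<^sub>m \<times> GL\<^sub>m]\<close> is flat, multiplication is injective on \<open>M \<otimes> \<int>[GL\<^sub>m \<times> GL\<^sub>m]\<close>.\<close>

definition coact :: "nat \<Rightarrow> (ratfun \<Rightarrow> ratfun) \<Rightarrow> ratfun set \<Rightarrow>
    ratfun \<Rightarrow> (ratfun \<times> ratfun \<Rightarrow>\<^sub>0 int) set" where
  "coact m act M f = (THE t. t \<in> carrier (tensor (addgrp M) (ZGG m)) \<and>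
     tensor_lift (addgrp M) (ZGG m) (addgrp UNIV) (*) t = act f)"

text \<open>The coaction on \<open>M/N\<close> for stable submodules \<open>N \<subseteq> M\<close>, induced by a coaction \<open>\<rho>\<close> on \<open>M\<close>.\<close>

definition quot_coact :: "nat \<Rightarrow> ratfun set \<Rightarrow> ratfun set \<Rightarrow>
    (ratfun \<Rightarrow> (ratfun \<times> ratfun \<Rightarrow>\<^sub>0 int) set) \<Rightarrow> ratfun set \<Rightarrow> (ratfun set \<times> ratfun \<Rightarrow>\<^sub>0 int) set" where
  "quot_coact m M N \<rho> X = the_elem
     ((\<lambda>f. tensor_map_left (addgrp M) (addgrp M Mod N) (ZGG m) (\<lambda>a. N #>\<^bsub>addgrp M\<^esub> a) (\<rho> f)) ` X)"

text \<open>The coaction on a tensor product of two modules: if \<open>\<rho> a = \<Sum> a\<^sub>k \<otimes> c\<^sub>k\<close> and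
  \<open>\<sigma> b = \<Sum> b\<^sub>l \<otimes> d\<^sub>l\<close>, then \<open>a \<otimes> b \<mapsto> \<Sum> (a\<^sub>k \<otimes> b\<^sub>l) \<otimes> c\<^sub>k d\<^sub>l\<close>.\<close>

definition tensor_coact :: "nat \<Rightarrow> ('a, 'c) monoid_scheme \<Rightarrow> ('b, 'd) monoid_scheme \<Rightarrow>
    ('a \<Rightarrow> ('a \<times> ratfun \<Rightarrow>\<^sub>0 int) set) \<Rightarrow> ('b \<Rightarrow> ('b \<times> ratfun \<Rightarrow>\<^sub>0 int) set) \<Rightarrow>
    ('a \<times> 'b \<Rightarrow>\<^sub>0 int) set \<Rightarrow> (('a \<times> 'b \<Rightarrow>\<^sub>0 int) set \<times> ratfun \<Rightarrow>\<^sub>0 int) set" where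
  "tensor_coact m G H \<rho> \<sigma> =
     (let V = tensor G H; W = tensor V (ZGG m) in
      tensor_lift G H W (\<lambda>a b.
        tensor_lift G (ZGG m) W (\<lambda>a' c.
          tensor_lift H (ZGG m) W (\<lambda>b' d. tens V (ZGG m) (tens G H a' b') (c * d)) (\<sigma> b)) (\<rho> a)))"

definition GG_iso :: "nat \<Rightarrow> ('a, 'c) monoid_scheme \<Rightarrow> ('a \<Rightarrow> ('a \<times> ratfun \<Rightarrow>\<^sub>0 int) set) \<Rightarrow>
    ('b, 'd) monoid_scheme \<Rightarrow> ('b \<Rightarrow> ('b \<times> ratfun \<Rightarrow>\<^sub>0 int) set) \<Rightarrow> ('a \<Rightarrow> 'b) \<Rightarrow> bool" where
  "GG_iso m V \<rho> W \<sigma> \<phi> \<longleftrightarrow> \<phi> \<in> iso V W \<and>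
     (\<forall>v \<in> carrier V. \<sigma> (\<phi> v) = tensor_map_left V W (ZGG m) \<phi> (\<rho> v))"

definition nabla_tensor :: "nat \<Rightarrow> int list \<Rightarrow> (ratfun \<times> ratfun \<Rightarrow>\<^sub>0 int) set monoid" where
  "nabla_tensor m lam = tensor (addgrp (nabla_tilde m lam)) (addgrp (nabla m lam))"

definition nabla_tensor_coact :: "nat \<Rightarrow> int list \<Rightarrow>
    (ratfun \<times> ratfun \<Rightarrow>\<^sub>0 int) set \<Rightarrow> ((ratfun \<times> ratfun \<Rightarrow>\<^sub>0 int) set \<times> ratfun \<Rightarrow>\<^sub>0 int) set" where
  "nabla_tensor_coact m lam =
     tensor_coact m (addgrp (nabla_tilde m lam)) (addgrp (nabla m lam))
       (coact m (left_act m) (nabla_tilde m lam)) (coact m (right_act m) (nabla m lam))"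

definition A_quot :: "nat \<Rightarrow> int list \<Rightarrow> ratfun set monoid" where
  "A_quot m lam = addgrp (A_le m lam) Mod A_less m lam"

definition A_quot_coact :: "nat \<Rightarrow> int list \<Rightarrow> ratfun set \<Rightarrow> (ratfun set \<times> ratfun \<Rightarrow>\<^sub>0 int) set" where
  "A_quot_coact m lam =
     quot_coact m (A_le m lam) (A_less m lam) (coact m (both_act m) (A_le m lam))"

end

theory Submission
 imports Defs "HOL-Combinatorics.Multiset_Permutations"
begin

text \<open>Write \<open>X\<close> for the generic matrix. By Jacobi's identity for complementary minors, a minor of the
 contragredient matrix is up to sign the complementary minor of \<open>X\<close> divided by \<open>det X\<close>. So if the
 columns of the second tableaux are replaced by their complements and put in front of the columns of
 the first tableaux, a rational bideterminant becomes a product of ordinary minors of \<open>X\<close> up to sign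
 and a power of the determinant, and a rational tableau is standard iff the resulting sequence of sets
 is a chain for the usual order of columns (\<open>chain_tableau\<close>, \<open>chain_bidet\<close>). Standardness of the pair of first columns is
 exactly the comparison at the joint.

 Straightening is thereby reduced to products of minors. A minor of \<open>X\<close> is a maximal minor of
 \<open>(X | 1)\<close>, and Sylvester's exchange identity for maximal minors, which is proved from Cramer's rule,
 rewrites a product of two minors whose columns or rows are out of order (\<open>bracket_exchange\<close>). In each
 resulting product a numerical measure of order is larger, so the rewriting ends with chains
 (\<open>straightening\<close>). The shape decreases in the dominance order and the weight is kept, which is the
 first claim. It follows that the standard bideterminants span, as the coordinate ring is generated by
 minors and the inverse of the determinant.

 Independence has two sources. Among the bideterminants \<open>(T\<^sub>\<lambda> | T)\<close>, the products of minors with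
 initial rows have leading monomials that determine \<open>T\<close> (\<open>right_independent\<close>), and transposition
 gives the same for \<open>(S | T\<^sub>\<lambda>)\<close>. To pass to general \<open>(S | T)\<close>, apply a relation to a product
 \<open>A D B\<close> with generic \<open>A\<close>, \<open>B\<close> and \<open>D\<close> diagonal in a one-parameter torus. By the Cauchy--Binet
 formula (\<open>bidet_at_mult\<close>) it becomes a sum over intermediate tableaux, and the coefficient of the
 highest power of the parameter contains only the products \<open>(S | T\<^sub>\<lambda>)(A) (T\<^sub>\<lambda> | T)(B)\<close> with
 \<open>\<lambda>\<close> maximal (\<open>highest_component\<close>). These products are independent, since functions of \<open>A\<close> and of \<open>B\<close> are
 linearly disjoint. Applied to a straightening relation, the same argument shows that the coefficients
 of \<open>(S | T)\<close> modulo lower shapes are products of those of \<open>(S | T\<^sub>\<lambda>)\<close> and \<open>(T\<^sub>\<lambda> | T)\<close>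
 (\<open>straightening_coefficients\<close>).

 That is what makes \<open>(S | T\<^sub>\<lambda>) \<otimes> (T\<^sub>\<lambda> | T) \<mapsto> (S | T)\<close> well defined on the tensor product, and the
 bases make it bijective. It is equivariant because, by Cauchy--Binet again, the coactions on both
 sides are given by the same coefficients. The coactions themselves are determined by their images
 under multiplication, since linear disjointness lets \<open>M \<otimes> \<int>[GL\<^sub>m \<times> GL\<^sub>m]\<close> embed into the functions for
 each \<open>M\<close> spanned by independent functions (\<open>multiplication_injective\<close>).\<close>

section \<open>Minors and the exchange identity\<close>

definition minor :: "('i => 'j => 'a::comm_ring_1) => nat => (nat => 'i) => (nat => 'j) => 'a" where
 "minor Z r f g = det (mat r r (%(a, b). Z (f a) (g b)))"

lemma minor_cong:
 assumes "!!a. a < r ==> f a = f' a" "!!a. a < r ==> g a = g' a"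
  and "!!a b. a < r ==> b < r ==> Z (f a) (g b) = Z' (f a) (g b)"
 shows "minor Z r f g = minor Z' r f' g'"
proof -
 have "mat r r (%(a, b). Z (f a) (g b)) = mat r r (%(a, b). Z' (f' a) (g' b))"
  by (rule eq_matI) (use assms in auto)
 then show ?thesis by (simp add: minor_def)
qed

lemma minor_0 [simp]: "minor Z 0 f g = 1"
 by (simp add: minor_def)

lemma minor_transpose: "minor Z r f g = minor (%i j. Z j i) r g f"
proof -
 have "minor Z r f g = det (transpose_mat (mat r r (%(a, b). Z (f a) (g b))))"
  unfolding minor_def by (rule det_transpose[symmetric]) auto
 also have "transpose_mat (mat r r (%(a, b). Z (f a) (g b))) = mat r r (%(a, b). Z (f b) (g a))"
  by (rule eq_matI) auto
 finally show ?thesis by (simp add: minor_def)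
qed

lemma minor_permute_rows:
 assumes "p permutes {0..<r}"
 shows "minor Z r (f \<circ> p) g = signof p * minor Z r f g"
proof -
 have p: "a < r ==> p a < r" for a
  using permutes_in_image[OF assms] by auto
 have "mat r r (%(a, b). mat r r (%(a, b). Z (f a) (g b)) $$ (p a, b)) =
   mat r r (%(a, b). Z ((f \<circ> p) a) (g b))"
  by (rule eq_matI) (auto simp: p)
 then show ?thesis
  using det_permute_rows[of "mat r r (%(a, b). Z (f a) (g b))" r p] assms
  by (simp add: minor_def)
qed

lemma minor_permute_cols:
 assumes "p permutes {0..<r}"
 shows "minor Z r f (g \<circ> p) = signof p * minor Z r f g"
 using minor_permute_rows[OF assms, of "%i j. Z j i" g f] minor_transpose[of Z r f]
 by metis

lemma minor_rows_not_inj: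
 assumes "\<not> inj_on f {0..<r}"
 shows "minor Z r f g = 0"
proof -
 obtain a b where "a < r" "b < r" "a ~= b" "f a = f b"
  using assms by (auto simp: inj_on_def)
 then show ?thesis unfolding minor_def
  by (intro det_identical_rows[of _ r a b]) auto
qed

lemma minor_cols_not_inj:
 assumes "\<not> inj_on g {0..<r}"
 shows "minor Z r f g = 0"
 using minor_rows_not_inj[OF assms] minor_transpose by metis

text \<open>Expanding along column \<open>l\<close> exhibits a minor as a linear function of its \<open>l\<close>-th column.\<close>

lemma minor_column_linear:
 assumes l: "l < r"
 shows "minor Z r f (g(l := x)) =
  (\<Sum>i<r. Z (f i) x * cofactor (mat r r (%(a, b). Z (f a) (g b))) i l)"
proof -
 let ?B = "mat r r (%(a, b). Z (f a) ((g(l := x)) b))"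
 have "minor Z r f (g(l := x)) = (\<Sum>i<r. ?B $$ (i, l) * cofactor ?B i l)"
  unfolding minor_def by (rule laplace_expansion_column) (use l in auto)
 also have "... = (\<Sum>i<r. Z (f i) x * cofactor (mat r r (%(a, b). Z (f a) (g b))) i l)"
 proof (rule sum.cong[OF refl])
  fix i assume i: "i : {..<r}"
  have "mat_delete ?B i l = mat_delete (mat r r (%(a, b). Z (f a) (g b))) i l"
   by (rule eq_matI) (use l in \<open>auto simp: mat_delete_def\<close>)
  then show "?B $$ (i, l) * cofactor ?B i l =
    Z (f i) x * cofactor (mat r r (%(a, b). Z (f a) (g b))) i l"
   using i l by (simp add: cofactor_def)
 qed
 finally show ?thesis .
qed

text \<open>Cramer's rule writes \<open>det A\<close> times a column of \<open>B\<close> as a combination of the columns of \<open>A\<close>;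
 substituting this into \<open>det B\<close> exchanges that column with each column of \<open>A\<close> in turn.\<close>

lemma minor_exchange_one:
 assumes l: "l < r"
 shows "minor Z r f g * minor Z r f h =
  (\<Sum>j<r. minor Z r f (g(j := h l)) * minor Z r f (h(l := g j)))"
proof -
 let ?A = "mat r r (%(a, b). Z (f a) (g b))"
 let ?B = "mat r r (%(a, b). Z (f a) (h b))"
 have adj: "(\<Sum>j<r. Z (f i) (g j) * cofactor ?A k j) = (if i = k then det ?A else 0)"
  if "i < r" "k < r" for i k
 proof -
  have "(?A * adj_mat ?A) $$ (i, k) = (\<Sum>j<r. Z (f i) (g j) * cofactor ?A k j)"
   unfolding times_mat_def scalar_prod_def adj_mat_def using that by (auto intro: sum.cong)
  then show ?thesis
   using that adj_mat(2)[of ?A r] by (cases "i = k") simp_all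
 qed
 have "(\<Sum>j<r. minor Z r f (g(j := h l)) * minor Z r f (h(l := g j)))
  = (\<Sum>j<r. (\<Sum>k<r. Z (f k) (h l) * cofactor ?A k j) * (\<Sum>i<r. Z (f i) (g j) * cofactor ?B i l))"
  by (rule sum.cong) (auto simp: minor_column_linear l)
 also have "... = (\<Sum>j<r. \<Sum>k<r. \<Sum>i<r. Z (f k) (h l) * cofactor ?B i l * (Z (f i) (g j) * cofactor ?A k j))"
  unfolding sum_product by (intro sum.cong refl) (simp add: ac_simps)
 also have "... = (\<Sum>k<r. \<Sum>i<r. \<Sum>j<r. Z (f k) (h l) * cofactor ?B i l * (Z (f i) (g j) * cofactor ?A k j))"
  by (subst sum.swap, rule sum.cong[OF refl], rule sum.swap)
 also have "... = (\<Sum>k<r. \<Sum>i<r. Z (f k) (h l) * cofactor ?B i l * (if i = k then det ?A else 0))"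
  by (intro sum.cong refl) (simp add: sum_distrib_left[symmetric] adj)
 also have "... = (\<Sum>k<r. Z (f k) (h l) * cofactor ?B k l * det ?A)"
  by (intro sum.cong refl) (simp add: if_distrib sum.delta cong: if_cong)
 also have "... = det ?A * (\<Sum>k<r. Z (f k) (h l) * cofactor ?B k l)"
  by (simp add: sum_distrib_left algebra_simps)
 also have "... = minor Z r f g * minor Z r f h"
  using minor_column_linear[OF l, of Z f h "h l"] by (simp add: minor_def)
 finally show ?thesis by simp
qed

text \<open>The pair \<open>(exch_left g h is, exch_right g h is)\<close> arises from \<open>(g, h)\<close> by exchanging the first
 \<open>length is\<close> entries of \<open>h\<close> with the entries of \<open>g\<close> at the positions \<open>rev is\<close>.\<close>

primrec exch_left :: "(nat => 'j) => (nat => 'j) => nat list => nat => 'j" where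
 "exch_left g h [] = g"
| "exch_left g h (i # is) = (exch_left g h is)(i := h (length is))"

primrec exch_right :: "(nat => 'j) => (nat => 'j) => nat list => nat => 'j" where
 "exch_right g h [] = h"
| "exch_right g h (i # is) = (exch_right g h is)(length is := g i)"

lemma exch_left_notin: "c \<notin> set is ==> exch_left g h is c = g c"
 by (induction "is") auto

lemma exch_left_nth:
 "distinct is ==> i < length is ==> exch_left g h is (is ! i) = h (length is - 1 - i)"
proof (induction "is" arbitrary: i)
 case (Cons a "is")
 then show ?case by (cases i) auto
qed simp

lemma exch_right_eq:
 "exch_right g h is l = (if l < length is then g (is ! (length is - 1 - l)) else h l)"
proof (induction "is")
 case (Cons a "is")
 then show ?case
  by (auto simp: nth_Cons' not_less less_Suc_eq)
qed simp

lemma exch_swap_same: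
 assumes "distinct is" "l < length is"
 defines "k \<equiv> length is"
 shows "exch_left g (h \<circ> transpose l k) is = (exch_left g h is)(is ! (k - 1 - l) := h k)"
  and "exch_right g (h \<circ> transpose l k) is = (exch_right g h is)(k := h l)"
proof -
 show "exch_left g (h \<circ> transpose l k) is = (exch_left g h is)(is ! (k - 1 - l) := h k)"
 proof
  fix c
  show "exch_left g (h \<circ> transpose l k) is c = ((exch_left g h is)(is ! (k - 1 - l) := h k)) c"
  proof (cases "c : set is")
   case False
   then have "c ~= is ! (k - 1 - l)"
    using assms(2) by (auto simp: k_def)
   then show ?thesis using False by (simp add: exch_left_notin)
  next
   case True
   then obtain i where i: "i < k" "c = is ! i"
    by (auto simp: in_set_conv_nth k_def)
   have "is ! i = is ! (k - 1 - l) \<longleftrightarrow> i = k - 1 - l"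
    using assms i by (auto simp: nth_eq_iff_index_eq)
   then show ?thesis
    using i assms exch_left_nth[OF assms(1), of i g] by (auto simp: k_def transpose_def)
  qed
 qed
 show "exch_right g (h \<circ> transpose l k) is = (exch_right g h is)(k := h l)"
  using assms(2) by (auto simp: fun_eq_iff exch_right_eq k_def transpose_def)
qed

definition exch_term ::
  "('i => 'j => 'a::comm_ring_1) => nat => (nat => 'i) => (nat => 'j) => (nat => 'j) => nat list => 'a" where
 "exch_term Z r f g h is = minor Z r f (exch_left g h is) * minor Z r f (exch_right g h is)"

definition arrangements :: "nat => nat => nat list set" where
 "arrangements r k = {is. distinct is & set is \<subseteq> {..<r} & length is = k}"

lemma arrangements_Suc:
 "arrangements r (Suc k) = (%(is, j). j # is) ` (SIGMA is : arrangements r k. {..<r} - set is)"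
proof (intro equalityI subsetI)
 fix x assume "x : arrangements r (Suc k)"
 then obtain j "is" where x: "x = j # is" and "is : arrangements r k" "j : {..<r} - set is"
  by (cases x) (auto simp: arrangements_def)
 then show "x : (%(is, j). j # is) ` (SIGMA is : arrangements r k. {..<r} - set is)"
  by (intro image_eqI[of _ _ "(is, j)"]) auto
qed (auto simp: arrangements_def)

lemma finite_arrangements: "finite (arrangements r k)"
 by (rule finite_subset[OF _ finite_lists_length_eq[of "{..<r}" k]]) (auto simp: arrangements_def)

text \<open>Apply the single exchange once more, at position \<open>k\<close>, to every term. Choosing a position
 already used amounts to swapping two entries of \<open>h\<close>, which changes the sign of the whole sum;
 each of the \<open>k\<close> used positions thus contributes one further copy of the left-hand side.\<close>

lemma exchange_arrangements:
 fixes Z :: "'i => 'j => 'a::comm_ring_1"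
 assumes "k <= r"
 shows "(\<Sum>is \<in> arrangements r k. exch_term Z r f g h is) = of_nat (fact k) * (minor Z r f g * minor Z r f h)"
 using assms
proof (induction k arbitrary: h)
 case 0
 have "arrangements r 0 = {[]}" by (auto simp: arrangements_def)
 then show ?case by (simp add: exch_term_def)
next
 case (Suc k)
 then have k: "k < r" by simp
 let ?c = "of_nat (fact k) * (minor Z r f g * minor Z r f h)"
 have step: "exch_term Z r f g h is = (\<Sum>j \<in> {..<r} - set is. exch_term Z r f g h (j # is)) +
   (\<Sum>l<k. exch_term Z r f g (h \<circ> transpose l k) is)"
  if "is : arrangements r k" for "is"
 proof -
  from that have d: "distinct is" and s: "set is \<subseteq> {..<r}" and len: "length is = k"
   by (auto simp: arrangements_def)
  let ?t = "%j. minor Z r f ((exch_left g h is)(j := exch_right g h is k)) *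
   minor Z r f ((exch_right g h is)(k := exch_left g h is j))"
  have hk: "exch_right g h is k = h k"
   by (simp add: exch_right_eq len)
  have "exch_term Z r f g h is = (\<Sum>j<r. ?t j)"
   unfolding exch_term_def by (rule minor_exchange_one[OF k])
  also have "... = (\<Sum>j \<in> {..<r} - set is. ?t j) + (\<Sum>j \<in> set is. ?t j)"
   by (rule sum.subset_diff) (use s in auto)
  also have "(\<Sum>j \<in> {..<r} - set is. ?t j) = (\<Sum>j \<in> {..<r} - set is. exch_term Z r f g h (j # is))"
   by (rule sum.cong) (auto simp: exch_term_def hk exch_left_notin len)
  also have "(\<Sum>j \<in> set is. ?t j) = (\<Sum>l<k. ?t (is ! (k - 1 - l)))"
  proof (rule sum.reindex_bij_betw[symmetric])
   have "bij_betw (%l. k - 1 - l) {..<k} {..<k}"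
    by (rule bij_betw_byWitness[where f' = "%l. k - 1 - l"]) auto
   moreover have "bij_betw ((!) is) {..<k} (set is)"
    using bij_betw_nth[OF d, of "{..<k}" "set is"] len by auto
   ultimately show "bij_betw (%l. is ! (k - 1 - l)) {..<k} (set is)"
    using bij_betw_trans[of "%l. k - 1 - l" "{..<k}" "{..<k}" "(!) is" "set is"]
    by (simp add: comp_def)
  qed
  also have "(\<Sum>l<k. ?t (is ! (k - 1 - l))) = (\<Sum>l<k. exch_term Z r f g (h \<circ> transpose l k) is)"
  proof (rule sum.cong[OF refl])
   fix l assume "l : {..<k}"
   then show "?t (is ! (k - 1 - l)) = exch_term Z r f g (h \<circ> transpose l k) is"
    using exch_swap_same[OF d, of l g h] exch_left_nth[OF d, of "k - 1 - l" g h] len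
    by (simp add: exch_term_def hk)
  qed
  finally show ?thesis .
 qed
 have swap: "minor Z r f (h \<circ> transpose l k) = - minor Z r f h" if "l < k" for l
 proof -
  have "transpose l k permutes {0..<r}"
   by (rule permutes_swap_id) (use that k in auto)
  moreover have "signof (transpose l k) = (-1 :: 'a)"
   using that by (simp add: sign_swap_id)
  ultimately show ?thesis
   using minor_permute_cols[of "transpose l k" r Z f h] by simp
 qed
 have "(\<Sum>is \<in> arrangements r k. exch_term Z r f g h is) =
   (\<Sum>is \<in> arrangements r k. \<Sum>j \<in> {..<r} - set is. exch_term Z r f g h (j # is)) +
   (\<Sum>is \<in> arrangements r k. \<Sum>l<k. exch_term Z r f g (h \<circ> transpose l k) is)"
  by (simp add: step sum.distrib)
 also have "(\<Sum>is \<in> arrangements r k. \<Sum>j \<in> {..<r} - set is. exch_term Z r f g h (j # is)) =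
   (\<Sum>is \<in> arrangements r (Suc k). exch_term Z r f g h is)"
 proof -
  have "(\<Sum>is \<in> arrangements r (Suc k). exch_term Z r f g h is) =
    (\<Sum>(is, j) \<in> (SIGMA is : arrangements r k. {..<r} - set is). exch_term Z r f g h (j # is))"
   unfolding arrangements_Suc by (subst sum.reindex) (auto simp: inj_on_def case_prod_unfold)
  then show ?thesis
   by (simp add: sum.Sigma finite_arrangements)
 qed
 also have "(\<Sum>is \<in> arrangements r k. \<Sum>l<k. exch_term Z r f g (h \<circ> transpose l k) is) =
   (\<Sum>l<k. of_nat (fact k) * (minor Z r f g * minor Z r f (h \<circ> transpose l k)))"
  using k by (subst sum.swap) (intro sum.cong refl Suc.IH, simp)
 also have "... = - (of_nat k * ?c)"
  by (simp add: swap sum_negf algebra_simps)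
 finally have "(\<Sum>is \<in> arrangements r (Suc k). exch_term Z r f g h is) = ?c + of_nat k * ?c"
  using Suc.IH[of h] k by (simp add: algebra_simps)
 then show ?case by (simp add: algebra_simps)
qed

lemma exch_term_transpose:
 assumes d: "distinct is" "set is \<subseteq> {..<r}" and ab: "a < length is" "b < length is"
 shows "exch_term Z r f g h (permute_list (transpose a b) is) = exch_term Z r f g h is"
proof (cases "a = b")
 case True
 then show ?thesis by simp
next
 case False
 let ?k = "length is" and ?t = "transpose a b"
 let ?js = "permute_list ?t is"
 have t: "?t permutes {..<?k}"
  by (rule permutes_swap_id) (use ab in auto)
 have len: "length ?js = ?k" by simp
 have nth: "?js ! i = is ! (?t i)" if "i < ?k" for i
  using that permute_list_nth[OF t] by simp
 have dj: "distinct ?js"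
  using d t by simp
 have setj: "set ?js = set is" using t by simp
 have tk: "i < ?k ==> ?t i < ?k" for i
  using ab by (auto simp: transpose_def)
 have "?k <= r"
  using d card_mono[of "{..<r}" "set is"] distinct_card[of "is"] by simp
 have L: "exch_left g h ?js = exch_left g h is \<circ> transpose (is ! a) (is ! b)"
 proof
  fix c
  show "exch_left g h ?js c = (exch_left g h is \<circ> transpose (is ! a) (is ! b)) c"
  proof (cases "c : set is")
   case False
   then have "c ~= is ! a" "c ~= is ! b" using ab by auto
   then show ?thesis using False setj by (simp add: exch_left_notin)
  next
   case True
   then obtain i where i: "i < ?k" "c = ?js ! i"
    by (metis in_set_conv_nth len setj)
   have 1: "exch_left g h ?js c = h (?k - 1 - i)"
    using exch_left_nth[OF dj, of i g h] i by simp
   have "transpose (is ! a) (is ! b) (is ! j) = is ! (?t j)" if "j < ?k" for j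
    using that ab d by (auto simp: transpose_def nth_eq_iff_index_eq)
   then have "transpose (is ! a) (is ! b) c = is ! i"
    using i nth tk by simp
   then show ?thesis
    using 1 exch_left_nth[OF d(1), of i g h] i by simp
  qed
 qed
 have R: "exch_right g h ?js = exch_right g h is \<circ> transpose (?k - 1 - a) (?k - 1 - b)"
 proof
  fix l
  show "exch_right g h ?js l = (exch_right g h is \<circ> transpose (?k - 1 - a) (?k - 1 - b)) l"
  proof (cases "l < ?k")
   case False
   then show ?thesis using ab by (auto simp: exch_right_eq transpose_def)
  next
   case True
   have "?t (?k - 1 - l) = ?k - 1 - transpose (?k - 1 - a) (?k - 1 - b) l"
    using True ab by (auto simp: transpose_def)
   moreover have "transpose (?k - 1 - a) (?k - 1 - b) l < ?k"
    using True by (auto simp: transpose_def)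
   ultimately show ?thesis
    using True by (simp add: exch_right_eq nth)
  qed
 qed
 have "is ! a : set is" "is ! b : set is" using ab by auto
 then have "is ! a < r" "is ! b < r" "is ! a ~= is ! b"
  using d(2) nth_eq_iff_index_eq[OF d(1) ab] False by blast+
 then have p1: "transpose (is ! a) (is ! b) permutes {0..<r}"
  and s1: "sign (transpose (is ! a) (is ! b)) = -1"
  by (auto intro: permutes_swap_id simp: sign_swap_id)
 have "?k - 1 - a < r" "?k - 1 - b < r" "?k - 1 - a ~= ?k - 1 - b"
  using ab False \<open>?k <= r\<close> by auto
 then have p2: "transpose (?k - 1 - a) (?k - 1 - b) permutes {0..<r}"
  and s2: "sign (transpose (?k - 1 - a) (?k - 1 - b)) = -1"
  by (auto intro: permutes_swap_id simp: sign_swap_id)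
 show ?thesis
  unfolding exch_term_def L R minor_permute_cols[OF p1] minor_permute_cols[OF p2] s1 s2
  by simp
qed

lemma exch_term_permute:
 assumes "p permutes {..<length is}" "distinct is" "set is \<subseteq> {..<r}"
 shows "exch_term Z r f g h (permute_list p is) = exch_term Z r f g h is"
proof -
 define k where "k = length is"
 have "\<forall>is. length is = k --> distinct is --> set is \<subseteq> {..<r} -->
   exch_term Z r f g h (permute_list p is) = exch_term Z r f g h is"
  using assms(1)[folded k_def] finite_lessThan
 proof (induction rule: permutes_induct)
  case (swap a b p)
  show ?case
  proof (intro allI impI)
   fix "is" :: "nat list"
   assume h: "length is = k" "distinct is" "set is \<subseteq> {..<r}"
   have t: "transpose a b permutes {..<k}"
    by (rule permutes_swap_id) (use swap in auto)
   have "permute_list (transpose a b \<circ> p) is = permute_list p (permute_list (transpose a b) is)"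
    by (rule permute_list_compose) (use swap h in auto)
   moreover have "exch_term Z r f g h (permute_list p (permute_list (transpose a b) is)) =
     exch_term Z r f g h (permute_list (transpose a b) is)"
    using swap h t by simp
   ultimately show "exch_term Z r f g h (permute_list (transpose a b \<circ> p) is) = exch_term Z r f g h is"
    using exch_term_transpose[of "is" r a b] swap h by simp
  qed
 qed simp
 then show ?thesis using assms by (simp add: k_def)
qed

text \<open>Sylvester's identity. The \<open>k!\<close> orderings of a set of exchanged positions contribute equally,
 so that in characteristic zero the factor \<open>k!\<close> can be cancelled.\<close>

theorem minor_exchange:
 fixes Z :: "'i => 'j => 'a::idom"
 assumes k: "k <= r" and char0: "of_nat (fact k) ~= (0 :: 'a)"
 shows "minor Z r f g * minor Z r f h =
  (\<Sum>K | K \<subseteq> {..<r} & card K = k. exch_term Z r f g h (sorted_list_of_set K))"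
proof -
 let ?S = "{K. K \<subseteq> {..<r} & card K = k}"
 have fin: "finite K" if "K : ?S" for K
  using that finite_subset by auto
 have arr: "arrangements r k = (\<Union>K \<in> ?S. permutations_of_set K)"
  by (auto simp: arrangements_def permutations_of_set_def distinct_card)
 have "of_nat (fact k) * (minor Z r f g * minor Z r f h) = (\<Sum>is \<in> arrangements r k. exch_term Z r f g h is)"
  by (rule exchange_arrangements[OF k, symmetric])
 also have "... = (\<Sum>K \<in> ?S. \<Sum>is \<in> permutations_of_set K. exch_term Z r f g h is)"
  unfolding arr
 proof (rule sum.UNION_disjoint)
  show "\<forall>A\<in>?S. \<forall>B\<in>?S. A ~= B --> permutations_of_set A \<inter> permutations_of_set B = {}"
   by (auto simp: permutations_of_set_def)
 qed auto
 also have "... = (\<Sum>K \<in> ?S. of_nat (fact k) * exch_term Z r f g h (sorted_list_of_set K))"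
 proof (rule sum.cong[OF refl])
  fix K assume K: "K : ?S"
  have "exch_term Z r f g h is = exch_term Z r f g h (sorted_list_of_set K)"
   if "is : permutations_of_set K" for "is"
  proof -
   from that have i: "set is = K" "distinct is" by (auto simp: permutations_of_set_def)
   have "mset is = mset (sorted_list_of_set K)"
    using i fin[OF K] set_eq_iff_mset_eq_distinct[of "is" "sorted_list_of_set K"] by simp
   then obtain p where "p permutes {..<length is}" "permute_list p is = sorted_list_of_set K"
    using mset_eq_permutation by metis
   then show ?thesis using exch_term_permute i K by (metis (no_types, lifting) mem_Collect_eq)
  qed
  then have "(\<Sum>is \<in> permutations_of_set K. exch_term Z r f g h is) =
    of_nat (card (permutations_of_set K)) * exch_term Z r f g h (sorted_list_of_set K)"
   by (simp only: sum.cong[OF refl, of "permutations_of_set K"] sum_constant)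
  then show "(\<Sum>is \<in> permutations_of_set K. exch_term Z r f g h is) =
    of_nat (fact k) * exch_term Z r f g h (sorted_list_of_set K)"
   using K fin[OF K] by (simp only: card_permutations_of_set mem_Collect_eq)
 qed
 finally show ?thesis
  using char0 by (simp add: sum_distrib_left[symmetric])
qed

section \<open>Brackets of a pair of index sets\<close>

definition pm_eq :: "'a::ring_1 => 'a => bool" where
 "pm_eq x y \<longleftrightarrow> x = y \<or> x = - y"

lemma pm_eq_refl [simp]: "pm_eq x x"
 by (simp add: pm_eq_def)

lemma pm_eq_sym: "pm_eq x y ==> pm_eq y x"
 by (auto simp: pm_eq_def)

lemma pm_eq_trans [trans]: "pm_eq x y ==> pm_eq y z ==> pm_eq x z"
 by (auto simp: pm_eq_def)

lemma pm_eq_mult: "pm_eq x y ==> pm_eq x' y' ==> pm_eq (x * x') (y * y')"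
 by (auto simp: pm_eq_def)

lemma pm_eq_prod:
 fixes f g :: "'i => 'a::comm_ring_1"
 shows "(!!i. i : A ==> pm_eq (f i) (g i)) ==> pm_eq (prod f A) (prod g A)"
 by (induction A rule: infinite_finite_induct) (auto intro: pm_eq_mult)

lemma pm_eq_signof: "pm_eq (signof p * x) (x :: 'a::comm_ring_1)"
 by (cases rule: sign_cases[of p]) (auto simp: pm_eq_def)

lemma reorder_permutation:
 fixes f f' :: "nat => 'i"
 assumes "inj_on f {0..<r}" "inj_on f' {0..<r}" "f ` {0..<r} = f' ` {0..<r}"
 shows "\<exists>p. p permutes {0..<r} & (\<forall>a<r. f' a = f (p a))"
proof -
 define p where "p a = (if a < r then inv_into {0..<r} f (f' a) else a)" for a
 have f': "a < r ==> f' a : f ` {0..<r}" for a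
  unfolding assms(3) by (rule imageI) simp
 have fp: "f (p a) = f' a" if "a < r" for a
  using f_inv_into_f[OF f'[OF that]] that by (simp add: p_def)
 have "bij_betw f' {0..<r} (f ` {0..<r})" "bij_betw (inv_into {0..<r} f) (f ` {0..<r}) {0..<r}"
  using inj_on_imp_bij_betw[OF assms(2)] bij_betw_inv_into[OF inj_on_imp_bij_betw[OF assms(1)]]
  by (simp_all only: assms(3))
 then have "bij_betw (inv_into {0..<r} f \<circ> f') {0..<r} {0..<r}"
  by (rule bij_betw_trans)
 then have "bij_betw p {0..<r} {0..<r}"
  by (rule bij_betw_cong[THEN iffD1, rotated]) (simp add: p_def)
 then have "p permutes {0..<r}"
  by (rule bij_imp_permutes) (simp add: p_def)
 then show ?thesis using fp by auto
qed

lemma minor_reorder_rows: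
 fixes Z :: "'i => 'j => 'a::comm_ring_1"
 assumes "inj_on f {0..<r}" "inj_on f' {0..<r}" "f ` {0..<r} = f' ` {0..<r}"
 shows "pm_eq (minor Z r f' g) (minor Z r f g)"
proof -
 obtain p where p: "p permutes {0..<r}" "\<forall>a<r. f' a = f (p a)" using reorder_permutation[OF assms] by blast
 have "minor Z r f' g = minor Z r (f \<circ> p) g" by (rule minor_cong) (use p(2) in auto)
 then show ?thesis using minor_permute_rows[OF p(1), of Z f g] by (simp add: pm_eq_signof)
qed

lemma minor_reorder_cols:
 fixes Z :: "'i => 'j => 'a::comm_ring_1"
 assumes "inj_on g {0..<r}" "inj_on g' {0..<r}" "g ` {0..<r} = g' ` {0..<r}"
 shows "pm_eq (minor Z r f g') (minor Z r f g)"
 using minor_reorder_rows[OF assms, of "%i j. Z j i" f] minor_transpose[of Z r f] by metis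

definition enum :: "nat set => nat => nat" where
 "enum I a = sorted_list_of_set I ! a"

definition bracket_minor :: "(nat => nat => 'a::comm_ring_1) => nat set \<times> nat set => 'a" where
 "bracket_minor X p = minor X (card (fst p)) (enum (fst p)) (enum (snd p))"

lemma enum_bij: "finite I ==> bij_betw (enum I) {0..<card I} I"
 unfolding enum_def
 by (rule bij_betw_nth) (auto simp: atLeast0LessThan)

lemma bracket_minor_transpose:
 "card I = card J ==> bracket_minor X (I, J) = bracket_minor (%i j. X j i) (J, I)"
 using minor_transpose[of X] by (simp add: bracket_minor_def)

lemma minor_bracket:
 assumes "inj_on f {0..<r}" "inj_on g {0..<r}"
 shows "pm_eq (minor X r f g) (bracket_minor X (f ` {0..<r}, g ` {0..<r}))"
proof -
 have c: "card (f ` {0..<r}) = r" "card (g ` {0..<r}) = r"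
  using assms by (auto simp: card_image)
 have e: "bij_betw (enum (f ` {0..<r})) {0..<r} (f ` {0..<r})"
  "bij_betw (enum (g ` {0..<r})) {0..<r} (g ` {0..<r})"
  using enum_bij[of "f ` {0..<r}"] enum_bij[of "g ` {0..<r}"] c by auto
 have "pm_eq (minor X r f g) (minor X r (enum (f ` {0..<r})) g)"
  by (rule minor_reorder_rows) (use assms e in \<open>auto simp: bij_betw_def\<close>)
 also have "pm_eq ... (minor X r (enum (f ` {0..<r})) (enum (g ` {0..<r})))"
  by (rule minor_reorder_cols) (use assms e in \<open>auto simp: bij_betw_def\<close>)
 finally show ?thesis by (simp add: bracket_minor_def c)
qed

text \<open>The columns of \<open>(X | 1)\<close>: \<open>Inl j\<close> is column \<open>j\<close> of \<open>X\<close> and \<open>Inr k\<close> the \<open>k\<close>-th unit vector.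
 The maximal minors of this matrix are, up to sign, the minors of all sizes of \<open>X\<close>.\<close>

fun letter_col :: "(nat => nat => 'a::comm_ring_1) => nat => nat + nat => 'a" where
 "letter_col X i (Inl j) = X i j"
| "letter_col X i (Inr k) = (if i = k then 1 else 0)"

lemma maximal_minor_bracket:
 fixes X :: "nat => nat => 'a::idom"
 assumes inj: "inj_on g {0..<m}" and im: "g ` {0..<m} = Inl ` J \<union> Inr ` K"
  and K: "K \<subseteq> {1..m}"
 shows "pm_eq (minor (letter_col X) m Suc g) (bracket_minor X ({1..m} - K, J))"
proof -
 let ?I = "{1..m} - K"
 let ?r = "card J" and ?s = "card K"
 have fin: "finite J" "finite K"
  using im finite_imageI[of "{0..<m}" g] K finite_subset[OF K]
  by (auto dest: finite_imageD simp: inj_on_def)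
 have cm: "?r + ?s = m"
 proof -
  have "card (Inl ` J \<union> Inr ` K :: (nat + nat) set) = ?r + ?s"
   using fin by (subst card_Un_disjoint) (auto simp: card_image)
  then show ?thesis using im card_image[OF inj] by simp
 qed
 have cI: "card ?I = ?r"
  using cm K by (simp add: card_Diff_subset fin)
 note eJ = enum_bij[OF fin(1)] and eK = enum_bij[OF fin(2)]
 have eI: "bij_betw (enum ?I) {0..<?r} ?I"
  using enum_bij[of ?I] cI by simp
 define \<rho> where "\<rho> a = (if a < ?r then enum ?I a else enum K (a - ?r))" for a
 define \<gamma> where "\<gamma> a = (if a < ?r then Inl (enum J a) else Inr (enum K (a - ?r)))" for a
 have split: "{0..<m} = {0..<?r} \<union> (%b. b + ?r) ` {0..<?s}"
  using cm by (auto simp: image_iff intro!: bexI[of _ "_ - card J"])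
 have rim: "\<rho> ` {0..<m} = {1..m}"
 proof -
  have "\<rho> ` {0..<m} = enum ?I ` {0..<?r} \<union> enum K ` {0..<?s}"
   unfolding split image_Un image_image by (auto simp: \<rho>_def)
  then show ?thesis using eI eK K by (auto simp: bij_betw_def)
 qed
 have gim: "\<gamma> ` {0..<m} = Inl ` J \<union> Inr ` K"
 proof -
  have "\<gamma> ` {0..<m} = Inl ` enum J ` {0..<?r} \<union> Inr ` enum K ` {0..<?s}"
   unfolding split image_Un image_image by (auto simp: \<gamma>_def)
  then show ?thesis using eJ eK by (auto simp: bij_betw_def)
 qed
 have "inj_on \<rho> {0..<m}" "inj_on \<gamma> {0..<m}"
  by (rule eq_card_imp_inj_on; use rim gim im card_image[OF inj] in simp)+
 moreover have "Suc ` {0..<m} = {1..m}"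
  by (simp add: image_Suc_atLeastLessThan atLeastLessThanSuc_atLeastAtMost)
 ultimately have "pm_eq (minor (letter_col X) m Suc g) (minor (letter_col X) m \<rho> g)"
  "pm_eq (minor (letter_col X) m \<rho> g) (minor (letter_col X) m \<rho> \<gamma>)"
  using minor_reorder_rows[of \<rho> m Suc "letter_col X" g]
   minor_reorder_cols[of \<gamma> m g "letter_col X" \<rho>] inj
  by (simp_all add: rim gim im)
 moreover have "minor (letter_col X) m \<rho> \<gamma> = bracket_minor X (?I, J)"
 proof -
  have ek: "b < ?s ==> b' < ?s ==> enum K b = enum K b' \<longleftrightarrow> b = b'" for b b'
   using eK by (auto simp: bij_betw_def inj_on_def)
  have eik: "b < ?r ==> b' < ?s ==> enum ?I b ~= enum K b'" for b b'
   using bij_betwE[OF eI] bij_betwE[OF eK] by (metis DiffD2 atLeastLessThan_iff zero_le)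
  have "mat m m (%(a, b). letter_col X (\<rho> a) (\<gamma> b)) =
   four_block_mat (mat ?r ?r (%(a, b). X (enum ?I a) (enum J b))) (0\<^sub>m ?r ?s)
    (mat ?s ?r (%(a, b). X (enum K a) (enum J b))) (1\<^sub>m ?s)"
   by (rule eq_matI) (use cm ek eik in \<open>auto simp: \<rho>_def \<gamma>_def\<close>)
  then have "minor (letter_col X) m \<rho> \<gamma> = det (mat ?r ?r (%(a, b). X (enum ?I a) (enum J b))) * det (1\<^sub>m ?s :: 'a mat)"
   unfolding minor_def by (simp add: det_four_block_mat_upper_right_zero[of _ ?r _ ?s])
  then show ?thesis
   unfolding bracket_minor_def fst_conv snd_conv cI by (simp add: minor_def)
 qed
 ultimately show ?thesis
  using pm_eq_trans by metis
qed

lemma zspan_mult_left: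
 assumes "x : zmod.span S"
 shows "c * x : zmod.span ((*) c ` S)"
 using assms
proof (induction rule: zmod.span_induct_alt)
 case base
 then show ?case by (simp add: zmod.span_zero)
next
 case (step n x y)
 have "c * (zscale n x + y) = zscale n (c * x) + c * y"
  by (simp add: zscale_def algebra_simps)
 then show ?case
  using zmod.span_add[OF zmod.span_scale[OF zmod.span_base[OF imageI[OF step(1)]]] step(2)]
  by (simp only:)
qed

lemma zspan_pm_eq:
 assumes "pm_eq x y" "y : zmod.span S"
 shows "x : zmod.span S"
 using assms zmod.span_neg by (auto simp: pm_eq_def)

lemma ratfun_of_int: "(of_int n :: ratfun) = Fract (of_int n) 1"
proof (induction n rule: int_induct[of _ 0])
 case base
 then show ?case by (simp add: Zero_fract_def)
next
 case (step1 i)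
 then show ?case by (simp add: One_fract_def)
next
 case (step2 i)
 then show ?case by (simp add: One_fract_def)
qed

lemma ratfun_of_int_eq_0 [simp]: "(of_int n :: ratfun) = 0 \<longleftrightarrow> n = 0"
 by (simp add: ratfun_of_int Zero_fract_def eq_fract)

lemma ratfun_of_nat_eq_0 [simp]: "(of_nat n :: ratfun) = 0 \<longleftrightarrow> n = 0"
 using ratfun_of_int_eq_0[of "int n"] by simp

definition valid_pair :: "nat => nat set \<times> nat set => bool" where
 "valid_pair m p \<longleftrightarrow> fst p \<subseteq> {1..m} & snd p \<subseteq> {1..m} & card (fst p) = card (snd p)"

text \<open>The exchange identity for the maximal minors of \<open>(X | 1)\<close>, where the exchanged letters of the
 second factor are the columns \<open>L\<close> of \<open>X\<close>. The letters received in return are columns \<open>KJ\<close> of \<open>X\<close>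
 and unit vectors \<open>KE\<close>; by receiving a unit vector the second minor shrinks in size.\<close>

lemma bracket_exchange:
 fixes X :: "nat => nat => ratfun"
 assumes IJ: "valid_pair m (I, J)" and IJ': "valid_pair m (I', J')" and L: "L \<subseteq> J'"
 shows "bracket_minor X (I, J) * bracket_minor X (I', J') : zmod.span
  {bracket_minor X (I \<union> KE, (J - KJ) \<union> L) * bracket_minor X (I' - KE, (J' - L) \<union> KJ) | KJ KE.
   KJ \<subseteq> J & KE \<subseteq> I' - I & card KJ + card KE = card L & (J - KJ) \<inter> L = {} & (J' - L) \<inter> KJ = {}}"
  (is "_ : zmod.span ?S")
proof -
 let ?D = "minor (letter_col X) m Suc"
 let ?A = "Inl ` J \<union> Inr ` ({1..m} - I) :: (nat + nat) set"
 let ?B = "Inl ` J' \<union> Inr ` ({1..m} - I') :: (nat + nat) set"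
 let ?k = "card L"
 have sub: "I \<subseteq> {1..m}" "J \<subseteq> {1..m}" "I' \<subseteq> {1..m}" "J' \<subseteq> {1..m}"
  and cc: "card I = card J" "card I' = card J'"
  using IJ IJ' by (auto simp: valid_pair_def)
 have fin: "finite I" "finite J" "finite I'" "finite J'" "finite L"
  using sub finite_subset[OF order_trans[OF L sub(4)]] by (auto intro: finite_subset)
 have cA: "card ?A = m"
 proof -
  have "card ?A = card J + card ({1..m} - I)"
   using fin by (subst card_Un_disjoint) (auto simp: card_image)
  then show ?thesis using sub cc card_mono[OF _ sub(1)] by (simp add: card_Diff_subset fin)
 qed
 have cB: "card ?B = m"
 proof -
  have "card ?B = card J' + card ({1..m} - I')"
   using fin by (subst card_Un_disjoint) (auto simp: card_image)
  then show ?thesis using sub cc card_mono[OF _ sub(3)] by (simp add: card_Diff_subset fin)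
 qed
 have LB: "Inl ` L \<subseteq> ?B" using L by auto
 have cL: "card (Inl ` L :: (nat + nat) set) = ?k"
  by (simp add: card_image)
 have km: "?k <= m"
  using card_mono[OF _ LB] fin cB cL by simp
 obtain g where g: "bij_betw g {0..<m} ?A"
  using ex_bij_betw_nat_finite[of ?A] fin cA by auto
 obtain h1 where h1: "bij_betw h1 {0..<?k} (Inl ` L :: (nat + nat) set)"
  using ex_bij_betw_nat_finite[of "Inl ` L :: (nat + nat) set"] fin unfolding cL by blast
 have "card (?B - Inl ` L) = m - ?k"
  using cB cL LB fin by (simp add: card_Diff_subset)
 moreover have "card {?k..<m} = m - ?k" by simp
 ultimately obtain h2 where h2: "bij_betw h2 {?k..<m} (?B - Inl ` L)"
  using finite_same_card_bij[of "{?k..<m}" "?B - Inl ` L"] fin by auto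
 define h where "h c = (if c < ?k then h1 c else h2 c)" for c
 have hL: "h ` {0..<?k} = Inl ` L"
  using h1 by (auto simp: h_def bij_betw_def)
 have hR: "h ` {?k..<m} = ?B - Inl ` L"
 proof -
  have "h ` {?k..<m} = h2 ` {?k..<m}" by (rule image_cong) (auto simp: h_def)
  then show ?thesis using h2 by (simp add: bij_betw_def)
 qed
 have him: "h ` {0..<m} = ?B"
 proof -
  have "{0..<m} = {0..<?k} \<union> {?k..<m}" using km by auto
  then show ?thesis using hL hR LB by (metis Un_Diff_cancel Un_absorb1 image_Un)
 qed
 have hinj: "inj_on h {0..<m}"
  by (rule eq_card_imp_inj_on) (use him cB in auto)
 have ginj: "inj_on g {0..<m}" and gim: "g ` {0..<m} = ?A"
  using g by (auto simp: bij_betw_def)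
 have tm: "exch_term (letter_col X) m Suc g h (sorted_list_of_set K) : zmod.span ?S"
  if K: "K \<subseteq> {..<m}" "card K = ?k" for K
 proof -
  let ?is = "sorted_list_of_set K"
  let ?l = "exch_left g h ?is" and ?r = "exch_right g h ?is"
  have finK: "finite K" using K finite_subset by auto
  have i: "distinct ?is" "length ?is = ?k" "set ?is = K"
   using finK K by auto
  show ?thesis
  proof (cases "inj_on ?l {0..<m} & inj_on ?r {0..<m}")
   case False
   then have "exch_term (letter_col X) m Suc g h ?is = 0"
    by (auto simp: exch_term_def minor_cols_not_inj)
   then show ?thesis by (simp add: zmod.span_zero)
  next
   case True
   have nthis: "(!) ?is ` {0..<?k} = K"
    using nth_image[of ?k ?is] i by simp
   have flip: "(%a. ?k - 1 - a) ` {0..<?k} = {0..<?k}"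
    by (intro bij_betw_imp_surj_on[OF bij_betw_byWitness[where f' = "%a. ?k - 1 - a"]]) auto
   have KA: "g ` K \<subseteq> ?A" using K gim by (metis atLeast0LessThan image_mono)
   have cgK: "card (g ` K) = ?k"
    using K ginj by (metis atLeast0LessThan card_image inj_on_subset)
   define KJ where "KJ = Inl -` (g ` K)"
   define KE where "KE = Inr -` (g ` K)"
   have gK: "g ` K = Inl ` KJ \<union> Inr ` KE"
   proof (intro equalityI subsetI)
    fix x assume "x : g ` K"
    then show "x : Inl ` KJ \<union> Inr ` KE"
     by (cases x) (auto simp: KJ_def KE_def)
   qed (auto simp: KJ_def KE_def)
   have KJ: "KJ \<subseteq> J" and KE: "KE \<subseteq> {1..m} - I"
    using KA by (auto simp: KJ_def KE_def)
   have finKK: "finite KJ" "finite KE"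
    using finite_subset[OF KJ fin(2)] finite_subset[OF KE] by auto
   have cKK: "card KJ + card KE = ?k"
    unfolding cgK[symmetric] gK using finKK by (subst card_Un_disjoint) (auto simp: card_image)
   have gcK: "g ` ({0..<m} - K) = ?A - g ` K"
    using gim K ginj by (subst inj_on_image_set_diff[of g "{0..<m}"]) (auto simp: atLeast0LessThan)
   have lim: "?l ` {0..<m} = (?A - g ` K) \<union> Inl ` L"
   proof -
    have "?l ` ({0..<m} - K) = g ` ({0..<m} - K)"
     by (rule image_cong) (auto simp: exch_left_notin i finK)
    moreover have "?l ` K = h ` {0..<?k}"
    proof -
     have "?l ` K = (%a. ?l (?is ! a)) ` {0..<?k}"
      using nthis by (metis image_image)
     also have "... = (%a. h (?k - 1 - a)) ` {0..<?k}"
      using exch_left_nth[OF i(1), of _ g h] i(2) by (intro image_cong) auto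
     also have "... = h ` ((%a. ?k - 1 - a) ` {0..<?k})" by (simp add: image_image)
     also have "(%a. ?k - 1 - a) ` {0..<?k} = {0..<?k}"
      by (rule flip)
     finally show ?thesis .
    qed
    moreover have "{0..<m} = ({0..<m} - K) \<union> K" using K by auto
    ultimately show ?thesis using gcK hL by (metis image_Un)
   qed
   have rim: "?r ` {0..<m} = g ` K \<union> (?B - Inl ` L)"
   proof -
    have "?r ` {0..<?k} = g ` K"
    proof -
     have "?r ` {0..<?k} = (%l. g (?is ! (?k - 1 - l))) ` {0..<?k}"
      by (rule image_cong) (auto simp: exch_right_eq i K)
     also have "... = (%l. g (?is ! l)) ` ((%a. ?k - 1 - a) ` {0..<?k})" by (simp add: image_image)
     also have "(%a. ?k - 1 - a) ` {0..<?k} = {0..<?k}"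
      by (rule flip)
     also have "(%l. g (?is ! l)) ` {0..<?k} = g ` K"
      using nthis by (metis image_image)
     finally show ?thesis .
    qed
    moreover have "?r ` {?k..<m} = h ` {?k..<m}"
     by (rule image_cong) (auto simp: exch_right_eq i K)
    moreover have "{0..<m} = {0..<?k} \<union> {?k..<m}" using km by auto
    ultimately show ?thesis using hR by (metis image_Un)
   qed
   have lim': "?l ` {0..<m} = Inl ` ((J - KJ) \<union> L) \<union> Inr ` (({1..m} - I) - KE)"
    unfolding lim gK by auto
   have rim': "?r ` {0..<m} = Inl ` ((J' - L) \<union> KJ) \<union> Inr ` (({1..m} - I') \<union> KE)"
    unfolding rim gK by auto
   have disj: "A \<inter> B = {}" if "finite A" "finite B" "card A + card B <= card (A \<union> B)"
    for A B :: "(nat + nat) set"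
    using card_Un_Int[OF that(1,2)] that by (auto simp: card_eq_0_iff)
   have d1: "(?A - g ` K) \<inter> Inl ` L = {}"
   proof (rule disj)
    have "card (?A - g ` K) = m - ?k"
     using KA cA cgK fin by (simp add: card_Diff_subset finite_subset)
    then show "card (?A - g ` K) + card (Inl ` L :: (nat + nat) set) <= card ((?A - g ` K) \<union> Inl ` L)"
     using cL km card_image[of ?l "{0..<m}"] True lim by simp
   qed (use fin in auto)
   have d2: "g ` K \<inter> (?B - Inl ` L) = {}"
   proof (rule disj)
    have "card (?B - Inl ` L) = m - ?k"
     using LB cB cL fin by (simp add: card_Diff_subset)
    then show "card (g ` K) + card (?B - Inl ` L) <= card (g ` K \<union> (?B - Inl ` L))"
     using cgK km card_image[of ?r "{0..<m}"] True rim by simp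
   qed (use fin finK in auto)
   have D1: "(J - KJ) \<inter> L = {}" using d1 unfolding gK by auto
   have D2: "(J' - L) \<inter> KJ = {}" using d2 unfolding gK by auto
   have D3: "KE \<subseteq> I'" using d2 KE unfolding gK by auto
   have e1: "{1..m} - (({1..m} - I) - KE) = I \<union> KE" using sub KE by auto
   have e2: "{1..m} - (({1..m} - I') \<union> KE) = I' - KE" using sub by auto
   have "pm_eq (?D ?l) (bracket_minor X (I \<union> KE, (J - KJ) \<union> L))"
    using maximal_minor_bracket[OF conjunct1[OF True] lim', of X] unfolding e1 by auto
   moreover have "pm_eq (?D ?r) (bracket_minor X (I' - KE, (J' - L) \<union> KJ))"
    using maximal_minor_bracket[OF conjunct2[OF True] rim', of X] KE unfolding e2 by auto
   ultimately have e: "pm_eq (exch_term (letter_col X) m Suc g h ?is)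
    (bracket_minor X (I \<union> KE, (J - KJ) \<union> L) * bracket_minor X (I' - KE, (J' - L) \<union> KJ))"
    unfolding exch_term_def by (rule pm_eq_mult)
   have "KE \<subseteq> I' - I" using D3 KE by auto
   then have "bracket_minor X (I \<union> KE, (J - KJ) \<union> L) * bracket_minor X (I' - KE, (J' - L) \<union> KJ) : ?S"
    using KJ cKK D1 D2 by blast
   then show ?thesis
    by (rule zspan_pm_eq[OF e zmod.span_base])
  qed
 qed
 have nz: "of_nat (fact ?k) ~= (0 :: ratfun)"
  by (simp only: ratfun_of_nat_eq_0) simp
 have D: "?D g * ?D h : zmod.span ?S"
  unfolding minor_exchange[OF km nz, of "letter_col X" Suc g h]
  by (intro zmod.span_sum) (use tm in auto)
 have "pm_eq (?D g) (bracket_minor X (I, J))"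
  using maximal_minor_bracket[OF ginj gim, of X] sub by (simp add: double_diff)
 moreover have "pm_eq (?D h) (bracket_minor X (I', J'))"
  using maximal_minor_bracket[OF hinj him, of X] sub by (simp add: double_diff)
 ultimately have "pm_eq (?D g * ?D h) (bracket_minor X (I, J) * bracket_minor X (I', J'))"
  by (rule pm_eq_mult)
 then show ?thesis
  by (rule zspan_pm_eq[OF pm_eq_sym D])
qed

section \<open>Straightening\<close>

locale ordered_letters =
 fixes m :: nat and ord :: "nat rel"
 assumes lin: "linear_order_on {1..m} ord"
begin

definition below :: "nat set => nat => nat" where
 "below I j = card {i : I. (i, j) : ord}"

definition pos :: "nat => nat" where
 "pos j = below {1..m} j"

text \<open>For columns listed in increasing order this says that each entry of \<open>I\<close> precedes or equals the
 entry of \<open>J\<close> in the same row, and that \<open>I\<close> is at least as long as \<open>J\<close>.\<close>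

definition col_le :: "nat set => nat set => bool" where
 "col_le I J \<longleftrightarrow> (\<forall>j \<in> {1..m}. below J j <= below I j)"

lemma ord_refl: "i : {1..m} ==> (i, i) : ord"
 using lin unfolding linear_order_on_def partial_order_on_def preorder_on_def refl_on_def by blast

lemma ord_trans: "(i, j) : ord ==> (j, k) : ord ==> (i, k) : ord"
 using lin unfolding linear_order_on_def partial_order_on_def preorder_on_def trans_def by blast

lemma ord_antisym: "(i, j) : ord ==> (j, i) : ord ==> i = j"
 using lin unfolding linear_order_on_def partial_order_on_def antisym_def by blast

lemma ord_total: "i : {1..m} ==> j : {1..m} ==> (i, j) : ord \<or> (j, i) : ord"
proof (cases "i = j")
 case False
 assume "i : {1..m}" "j : {1..m}"
 then show ?thesis
  using lin False unfolding linear_order_on_def total_on_def by blast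
qed (use ord_refl in simp)

lemma ord_in: "(i, j) : ord ==> i : {1..m} & j : {1..m}"
 using lin unfolding linear_order_on_def partial_order_on_def preorder_on_def refl_on_def by blast

lemma below_mono: "finite I ==> (j, k) : ord ==> below I j <= below I k"
 unfolding below_def by (rule card_mono) (auto intro: ord_trans)

lemma pos_less: assumes "(i, j) : ord" "i ~= j" shows "pos i < pos j"
 unfolding pos_def below_def
proof (rule psubset_card_mono)
 have "j : {k : {1..m}. (k, j) : ord}" "j \<notin> {k : {1..m}. (k, i) : ord}"
  using assms ord_in ord_refl ord_antisym by blast+
 then show "{k : {1..m}. (k, i) : ord} \<subset> {k : {1..m}. (k, j) : ord}"
  using assms ord_trans by blast
qed auto

lemma ord_iff_pos: "i : {1..m} ==> j : {1..m} ==> (i, j) : ord \<longleftrightarrow> pos i <= pos j"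
 using pos_less ord_total ord_refl by (metis linorder_not_less order_less_imp_le order_refl)

lemma inj_pos: "inj_on pos {1..m}"
 using ord_iff_pos ord_antisym by (metis inj_onI order_refl)

lemma pos_range: "j : {1..m} ==> pos j : {1..m}"
proof -
 assume j: "j : {1..m}"
 have "pos j <= card {1..m}" unfolding pos_def below_def by (rule card_mono) auto
 moreover have "pos j > 0" unfolding pos_def below_def
  using j ord_refl by (subst card_gt_0_iff) auto
 ultimately show ?thesis by simp
qed

lemma col_le_refl [simp]: "col_le I I"
 by (simp add: col_le_def)

lemma col_le_trans: "col_le I J ==> col_le J K ==> col_le I K"
 unfolding col_le_def by (meson order_trans)

definition pair_le :: "nat set \<times> nat set => nat set \<times> nat set => bool" where
 "pair_le p q \<longleftrightarrow> col_le (fst p) (fst q) & col_le (snd p) (snd q)"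

text \<open>A numerical measure of how early a pair comes in the order: large minors are early, and among
 minors of the same size those with early entries. The weight of the size outgrows all the rest.\<close>

definition wsum :: "nat set => int" where
 "wsum I = (\<Sum>i\<in>I. 2 ^ pos i)"

definition earliness :: "nat set \<times> nat set => int" where
 "earliness p = 2 ^ (m + 2) * int (card (fst p)) - wsum (fst p) - wsum (snd p)"

lemma wsum_less:
 assumes "I \<subseteq> {1..m}" "!!i. i : I ==> pos i < k"
 shows "wsum I < 2 ^ k"
proof -
 have fin: "finite I" using assms(1) finite_subset by blast
 have "wsum I = (\<Sum>k\<in>pos ` I. 2 ^ k)"
  unfolding wsum_def by (subst sum.reindex) (auto intro: inj_on_subset[OF inj_pos assms(1)])
 also have "... <= (\<Sum>k\<in>{0..<k}. 2 ^ k)"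
  by (rule sum_mono2) (use assms(2) in auto)
 also have "... = 2 ^ k - (1::int)"
  by (induction k) auto
 finally show ?thesis by simp
qed

lemma wsum_nonneg: "0 <= wsum I"
 by (simp add: wsum_def sum_nonneg)

lemma wsum_bound: "I \<subseteq> {1..m} ==> wsum I < 2 ^ (m + 1)"
 by (rule wsum_less) (use pos_range in \<open>auto simp: less_Suc_eq_le subset_iff\<close>)

lemma earliness_bounds:
 assumes "valid_pair m p"
 shows "earliness p <= 2 ^ (m + 2) * int (card (fst p))"
  and "2 ^ (m + 2) * (int (card (fst p)) - 1) < earliness p"
 using wsum_nonneg[of "fst p"] wsum_nonneg[of "snd p"] wsum_bound[of "fst p"] wsum_bound[of "snd p"] assms
 by (auto simp: earliness_def valid_pair_def algebra_simps)

lemma earliness_card: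
 assumes "valid_pair m p" "valid_pair m q" "earliness q <= earliness p"
 shows "card (fst q) <= card (fst p)"
proof -
 have "(2 ^ (m + 2) :: int) * (int (card (fst q)) - 1) < 2 ^ (m + 2) * int (card (fst p))"
  using earliness_bounds[OF assms(1)] earliness_bounds[OF assms(2)] assms(3) by linarith
 then have "int (card (fst q)) - 1 < int (card (fst p))"
  by (simp only: mult_less_cancel_left_pos[of "2 ^ (m + 2)"] zero_less_power)
 then show ?thesis by simp
qed

lemma abs_earliness_le:
 assumes "valid_pair m p"
 shows "\<bar>earliness p\<bar> <= 2 ^ (m + 2) * (int m + 1)"
proof -
 have "card (fst p) <= m"
  using assms card_mono[of "{1..m}" "fst p"] by (auto simp: valid_pair_def)
 then have "(2 ^ (m + 2) :: int) * int (card (fst p)) <= 2 ^ (m + 2) * (int m + 1)"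
  "(2 ^ (m + 2) :: int) * (int (card (fst p)) - 1) \<ge> 2 ^ (m + 2) * (- 1)"
  by (intro mult_left_mono; simp)+
 moreover have "(2 ^ (m + 2) :: int) * (- 1) \<ge> - (2 ^ (m + 2) * (int m + 1))"
  by (simp add: algebra_simps)
 ultimately show ?thesis
  using earliness_bounds[OF assms] by linarith
qed

text \<open>The exchange of two pairs: \<open>p'\<close> gains in earliness what \<open>q'\<close> loses, and no letter gets lost.\<close>

definition exchanged :: "nat set \<times> nat set => nat set \<times> nat set =>
  nat set \<times> nat set => nat set \<times> nat set => bool" where
 "exchanged p q p' q' \<longleftrightarrow> valid_pair m p' & valid_pair m q' & earliness p < earliness p' \<and>
   (\<forall>i. of_bool (i : fst p') + of_bool (i : fst q') = (of_bool (i : fst p) + of_bool (i : fst q) :: nat)) \<and>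
   (\<forall>i. of_bool (i : snd p') + of_bool (i : snd q') = (of_bool (i : snd p) + of_bool (i : snd q) :: nat))"

lemma sum_subset_of_bool:
 fixes f :: "nat => int"
 assumes "A \<subseteq> {1..m}"
 shows "sum f A = (\<Sum>i\<in>{1..m}. int (of_bool (i : A)) * f i)"
proof -
 have "(\<Sum>i\<in>{1..m}. int (of_bool (i : A)) * f i) = (\<Sum>i\<in>{1..m}. if i : A then f i else 0)"
  by (rule sum.cong) auto
 also have "... = sum f ({1..m} \<inter> A)"
  by (simp add: sum.inter_restrict)
 finally show ?thesis using assms by (simp add: Int_absorb1)
qed

lemma sum_content:
 fixes f :: "nat => int"
 assumes "A \<subseteq> {1..m}" "B \<subseteq> {1..m}" "A' \<subseteq> {1..m}" "B' \<subseteq> {1..m}"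
  and "!!i. of_bool (i : A') + of_bool (i : B') = (of_bool (i : A) + of_bool (i : B) :: nat)"
 shows "sum f A' + sum f B' = sum f A + sum f B"
proof -
 have "int (of_bool (i : A')) * f i + int (of_bool (i : B')) * f i =
   int (of_bool (i : A)) * f i + int (of_bool (i : B)) * f i" for i
  unfolding distrib_right[symmetric] of_nat_add[symmetric] assms(5) ..
 then show ?thesis
  unfolding sum_subset_of_bool[OF assms(1), of f] sum_subset_of_bool[OF assms(2), of f]
   sum_subset_of_bool[OF assms(3), of f] sum_subset_of_bool[OF assms(4), of f] sum.distrib[symmetric]
  by (intro sum.cong refl)
qed

lemma exchanged_earliness:
 assumes "valid_pair m p" "valid_pair m q" "exchanged p q p' q'"
 shows "earliness p' + earliness q' = earliness p + earliness q"
  and "card (fst p') + card (fst q') = card (fst p) + card (fst q)"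
proof -
 have sub: "fst p \<subseteq> {1..m}" "snd p \<subseteq> {1..m}" "fst q \<subseteq> {1..m}" "snd q \<subseteq> {1..m}"
  "fst p' \<subseteq> {1..m}" "snd p' \<subseteq> {1..m}" "fst q' \<subseteq> {1..m}" "snd q' \<subseteq> {1..m}"
  using assms by (auto simp: exchanged_def valid_pair_def)
 have f: "sum f (fst p') + sum f (fst q') = sum f (fst p) + sum f (fst q)" for f :: "nat => int"
  by (rule sum_content) (use sub assms(3) in \<open>auto simp: exchanged_def\<close>)
 have s: "sum f (snd p') + sum f (snd q') = sum f (snd p) + sum f (snd q)" for f :: "nat => int"
  by (rule sum_content) (use sub assms(3) in \<open>auto simp: exchanged_def\<close>)
 show c: "card (fst p') + card (fst q') = card (fst p) + card (fst q)"
  using f[of "%_. 1"] by simp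
 have "2 ^ (m + 2) * int (card (fst p')) + 2 ^ (m + 2) * int (card (fst q')) =
   2 ^ (m + 2) * int (card (fst p)) + 2 ^ (m + 2) * int (card (fst q))"
  unfolding distrib_left[symmetric] of_nat_add[symmetric] c ..
 then show "earliness p' + earliness q' = earliness p + earliness q"
  using f[of "%i. 2 ^ pos i"] s[of "%i. 2 ^ pos i"] by (simp add: earliness_def wsum_def)
qed

text \<open>If the columns \<open>J\<close>, \<open>J'\<close> are out of order, witnessed by the letter \<open>z\<close>, the entries of \<open>J'\<close> up
 to \<open>z\<close> are exchanged into \<open>J\<close>. They cannot all be traded for entries of \<open>J\<close> up to \<open>z\<close>, as \<open>J\<close> has
 fewer of those; so the first minor gains in size, or a later letter makes room for earlier ones.\<close>

lemma exchange_step_snd: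
 fixes X :: "nat => nat => ratfun"
 assumes p: "valid_pair m p" and q: "valid_pair m q" and ncol: "\<not> col_le (snd p) (snd q)"
 shows "bracket_minor X p * bracket_minor X q : zmod.span
  {bracket_minor X p' * bracket_minor X q' | p' q'. exchanged p q p' q'}"
proof -
 obtain I J where pe: "p = (I, J)" by (cases p)
 obtain I' J' where qe: "q = (I', J')" by (cases q)
 have sub: "I \<subseteq> {1..m}" "J \<subseteq> {1..m}" "I' \<subseteq> {1..m}" "J' \<subseteq> {1..m}"
  and cc: "card I = card J" "card I' = card J'"
  using p q by (auto simp: valid_pair_def pe qe)
 have fin: "finite I" "finite J" "finite I'" "finite J'"
  using sub by (auto intro: finite_subset)
 obtain z where z: "z : {1..m}" and lt: "below J z < below J' z"
  using ncol by (auto simp: col_le_def pe qe not_le)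
 define L where "L = {j : J'. (j, z) : ord}"
 have L: "L \<subseteq> J'" and cL: "card L = below J' z"
  by (auto simp: L_def below_def)
 have finL: "finite L" using L fin finite_subset by blast
 have "exchanged p q (I \<union> KE, (J - KJ) \<union> L) (I' - KE, (J' - L) \<union> KJ)"
  if KJ: "KJ \<subseteq> J" and KE: "KE \<subseteq> I' - I" and c: "card KJ + card KE = card L"
   and d1: "(J - KJ) \<inter> L = {}" and d2: "(J' - L) \<inter> KJ = {}" for KJ KE
 proof -
  have finK: "finite KJ" "finite KE"
   using KJ KE fin finite_subset by (blast, meson finite_Diff finite_subset)
  have c1: "card (I \<union> KE) = card I + card KE"
   using KE fin finK by (subst card_Un_disjoint) auto
  have c2: "card ((J - KJ) \<union> L) = card J - card KJ + card L"
   using KJ fin finK finL d1 by (subst card_Un_disjoint) (auto simp: card_Diff_subset)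
  have c3: "card (I' - KE) = card I' - card KE"
   using KE fin finK by (subst card_Diff_subset) auto
  have c4: "card ((J' - L) \<union> KJ) = card J' - card L + card KJ"
   using L fin finK finL d2 by (subst card_Un_disjoint) (auto simp: card_Diff_subset)
  have le: "card KJ <= card J" "card L <= card J'"
   using KJ L fin by (auto intro: card_mono)
  have v1: "valid_pair m (I \<union> KE, (J - KJ) \<union> L)"
   using sub KJ KE L c1 c2 cc c le by (auto simp: valid_pair_def)
  have v2: "valid_pair m (I' - KE, (J' - L) \<union> KJ)"
   using sub KJ KE L c3 c4 cc c le by (auto simp: valid_pair_def)
  have "earliness (I, J) < earliness (I \<union> KE, (J - KJ) \<union> L)"
  proof (cases "KE = {}")
   case False
   then have "card KE \<ge> 1" using finK by (simp add: Suc_le_eq card_gt_0_iff)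
   then have "(2 ^ (m + 2) :: int) * int (card I) <= 2 ^ (m + 2) * (int (card (I \<union> KE)) - 1)"
    using c1 by (intro mult_left_mono) auto
   then show ?thesis
    using earliness_bounds(1)[OF p] earliness_bounds(2)[OF v1] unfolding pe fst_conv by linarith
  next
   case True
   then have cKL: "card KJ = card L" using c by simp
   obtain k where k: "k : KJ" "(k, z) \<notin> ord"
   proof -
    have "\<not> KJ \<subseteq> {j : J. (j, z) : ord}"
     using card_mono[of "{j : J. (j, z) : ord}" KJ] fin lt cKL cL by (auto simp: below_def)
    then show thesis using that KJ by blast
   qed
   have kz: "pos z < pos k"
    using k KJ sub z ord_iff_pos[of k z] by (auto simp: not_le)
   have "wsum L < 2 ^ pos k"
    by (rule wsum_less) (use L sub kz ord_iff_pos[OF _ z] in \<open>auto simp: L_def\<close>)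
   also have "2 ^ pos k <= wsum KJ"
    unfolding wsum_def by (rule member_le_sum[OF k(1)]) (use finK in auto)
   finally have "wsum L < wsum KJ" .
   moreover have "wsum ((J - KJ) \<union> L) = wsum (J - KJ) + wsum L"
    unfolding wsum_def using fin finL d1 by (subst sum.union_disjoint) auto
   moreover have "wsum J = wsum (J - KJ) + wsum KJ"
    unfolding wsum_def by (rule sum.subset_diff[OF KJ fin(2)])
   ultimately show ?thesis using True by (simp add: earliness_def)
  qed
  moreover have "of_bool (i : I \<union> KE) + of_bool (i : I' - KE) = (of_bool (i : I) + of_bool (i : I') :: nat)" for i
   using KE by auto
  moreover have "of_bool (i : (J - KJ) \<union> L) + of_bool (i : (J' - L) \<union> KJ) = (of_bool (i : J) + of_bool (i : J') :: nat)" for i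
   using KJ L d1 d2 by auto
  ultimately show ?thesis
   using v1 v2 by (simp add: exchanged_def pe qe)
 qed
 then have "{bracket_minor X (I \<union> KE, (J - KJ) \<union> L) * bracket_minor X (I' - KE, (J' - L) \<union> KJ) | KJ KE.
   KJ \<subseteq> J & KE \<subseteq> I' - I & card KJ + card KE = card L & (J - KJ) \<inter> L = {} & (J' - L) \<inter> KJ = {}}
  \<subseteq> {bracket_minor X p' * bracket_minor X q' | p' q'. exchanged p q p' q'}"
  by blast
 then show ?thesis
  using bracket_exchange[of m I J I' J' L X] p q L zmod.span_mono unfolding pe qe by blast
qed

lemma valid_pair_swap: "valid_pair m (prod.swap p) = valid_pair m p"
 by (auto simp: valid_pair_def)

lemma exchanged_swap:
 assumes "valid_pair m p" "exchanged (prod.swap p) (prod.swap q) p' q'"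
 shows "exchanged p q (prod.swap p') (prod.swap q')"
proof -
 have "earliness (prod.swap r) = earliness r" if "valid_pair m r" for r
  using that by (simp add: earliness_def valid_pair_def)
 then show ?thesis
  using assms valid_pair_swap by (simp add: exchanged_def)
qed

lemma exchange_step:
 fixes X :: "nat => nat => ratfun"
 assumes p: "valid_pair m p" and q: "valid_pair m q" and npair: "\<not> pair_le p q"
 shows "bracket_minor X p * bracket_minor X q : zmod.span
  {bracket_minor X p' * bracket_minor X q' | p' q'. exchanged p q p' q'}"
proof (cases "col_le (snd p) (snd q)")
 case False
 then show ?thesis by (rule exchange_step_snd[OF p q])
next
 case True
 let ?Y = "%i j. X j i"
 have sw: "bracket_minor X r = bracket_minor ?Y (prod.swap r)" if "valid_pair m r" for r
  using that bracket_minor_transpose[of "fst r" "snd r" X] by (simp add: valid_pair_def prod.swap_def)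
 have "\<not> col_le (snd (prod.swap p)) (snd (prod.swap q))"
  using True npair by (simp add: pair_le_def)
 then have h1: "bracket_minor ?Y (prod.swap p) * bracket_minor ?Y (prod.swap q) : zmod.span
   {bracket_minor ?Y p' * bracket_minor ?Y q' | p' q'. exchanged (prod.swap p) (prod.swap q) p' q'}"
  by (intro exchange_step_snd) (use p q valid_pair_swap in auto)
 have h2: "{bracket_minor ?Y p' * bracket_minor ?Y q' | p' q'. exchanged (prod.swap p) (prod.swap q) p' q'}
   \<subseteq> {bracket_minor X p' * bracket_minor X q' | p' q'. exchanged p q p' q'}"
 proof clarify
  fix p' q' assume e: "exchanged (prod.swap p) (prod.swap q) p' q'"
  then have "valid_pair m (prod.swap p')" "valid_pair m (prod.swap q')"
   using valid_pair_swap by (auto simp: exchanged_def)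
  then have "bracket_minor ?Y p' * bracket_minor ?Y q' =
    bracket_minor X (prod.swap p') * bracket_minor X (prod.swap q')"
   using sw[of "prod.swap p'"] sw[of "prod.swap q'"] by simp
  then show "\<exists>p'' q''. bracket_minor ?Y p' * bracket_minor ?Y q' = bracket_minor X p'' * bracket_minor X q'' \<and>
    exchanged p q p'' q''"
   using exchanged_swap[OF p e] by blast
 qed
 show ?thesis
  unfolding sw[OF p] sw[OF q] by (rule subsetD[OF zmod.span_mono[OF h2] h1])
qed

definition valid_list :: "(nat set \<times> nat set) list => bool" where
 "valid_list ws \<longleftrightarrow> (\<forall>p \<in> set ws. valid_pair m p)"

definition brackets :: "(nat => nat => ratfun) => (nat set \<times> nat set) list => ratfun" where
 "brackets X ws = prod_list (map (bracket_minor X) ws)"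

text \<open>\<open>ws'\<close> has as many columns as \<open>ws\<close>, the same contents, and a smaller shape. The latter is
 expressed through the number of boxes in the first \<open>j\<close> rows, which does not depend on the order
 of the columns.\<close>

definition improves :: "(nat set \<times> nat set) list => (nat set \<times> nat set) list => bool" where
 "improves ws' ws \<longleftrightarrow> valid_list ws' & length ws' = length ws \<and>
   (\<forall>i. (\<Sum>p\<leftarrow>ws'. of_bool (i : fst p)) = (\<Sum>p\<leftarrow>ws. of_bool (i : fst p) :: nat)) \<and>
   (\<forall>i. (\<Sum>p\<leftarrow>ws'. of_bool (i : snd p)) = (\<Sum>p\<leftarrow>ws. of_bool (i : snd p) :: nat)) \<and>
   (\<forall>j. (\<Sum>p\<leftarrow>ws'. min j (card (fst p))) <= (\<Sum>p\<leftarrow>ws. min j (card (fst p))))"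

lemma improves_trans: "improves a b ==> improves b c ==> improves a c"
 unfolding improves_def by (auto intro: order_trans)

lemma sum_list_mset_cong:
 fixes f :: "_ => 'b::comm_monoid_add"
 assumes "mset xs = mset ys"
 shows "(\<Sum>x\<leftarrow>xs. f x) = (\<Sum>x\<leftarrow>ys. f x)"
 using arg_cong[OF assms, of "%M. sum_mset (image_mset f M)"]
 by (simp add: sum_mset_sum_list flip: mset_map)

lemma improves_perm:
 assumes "valid_list ws" "mset ws' = mset ws"
 shows "improves ws' ws"
proof -
 have s: "(\<Sum>p\<leftarrow>ws'. f p) = (\<Sum>p\<leftarrow>ws. f p)" for f :: "_ => nat"
  by (rule sum_list_mset_cong[OF assms(2)])
 have "valid_list ws'" using assms mset_eq_setD by (metis valid_list_def)
 then show ?thesis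
  using s assms(2) mset_eq_length by (auto simp: improves_def)
qed

lemma improves_exchanged:
 assumes v: "valid_list (us @ p # vs @ q # ts)" and e: "exchanged p q p' q'"
  and pq: "earliness q <= earliness p"
 shows "improves (us @ p' # vs @ q' # ts) (us @ p # vs @ q # ts)"
  and "(\<Sum>x\<leftarrow>us @ p # vs @ q # ts. (earliness x)\<^sup>2) < (\<Sum>x\<leftarrow>us @ p' # vs @ q' # ts. (earliness x)\<^sup>2)"
proof -
 have vp: "valid_pair m p" "valid_pair m q" using v by (auto simp: valid_list_def)
 have vp': "valid_pair m p'" "valid_pair m q'" using e by (auto simp: exchanged_def)
 note eq = exchanged_earliness[OF vp e]
 have lt: "earliness p < earliness p'" using e by (simp add: exchanged_def)
 have c1: "card (fst q) <= card (fst p)"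
  by (rule earliness_card[OF vp pq])
 have c2: "card (fst p) <= card (fst p')"
  by (rule earliness_card[OF vp'(1) vp(1)]) (use lt in simp)
 have dom: "min j (card (fst p')) + min j (card (fst q')) <= min j (card (fst p)) + min j (card (fst q))" for j
  using c1 c2 eq(2) by linarith
 have "of_bool (i : fst p') + of_bool (i : fst q') = (of_bool (i : fst p) + of_bool (i : fst q) :: nat)"
  "of_bool (i : snd p') + of_bool (i : snd q') = (of_bool (i : snd p) + of_bool (i : snd q) :: nat)" for i
  using e by (auto simp: exchanged_def)
 then have cont: "of_bool (i : fst p') + (x + (of_bool (i : fst q') + y)) = (of_bool (i : fst p) + (x + (of_bool (i : fst q) + y)) :: nat)"
  "of_bool (i : snd p') + (x + (of_bool (i : snd q') + y)) = (of_bool (i : snd p) + (x + (of_bool (i : snd q) + y)) :: nat)" for i x y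
  by (metis (no_types, opaque_lifting) add.assoc add.left_commute)+
 have "min j (card (fst p')) + (x + (min j (card (fst q')) + y)) <= min j (card (fst p)) + (x + (min j (card (fst q)) + y))" for j x y
  using dom[of j] by linarith
 then show "improves (us @ p' # vs @ q' # ts) (us @ p # vs @ q # ts)"
  using v vp' cont by (auto simp: improves_def valid_list_def)
 define d where "d = earliness p' - earliness p"
 have d: "d > 0" "earliness p' = earliness p + d" "earliness q' = earliness q - d"
  using lt eq(1) by (auto simp: d_def)
 have "(earliness p')\<^sup>2 + (earliness q')\<^sup>2 =
   (earliness p)\<^sup>2 + (earliness q)\<^sup>2 + 2 * d * (earliness p - earliness q) + 2 * d * d"
  unfolding d by (simp add: power2_eq_square algebra_simps)
 moreover have "2 * d * (earliness p - earliness q) \<ge> 0" "2 * d * d > 0"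
  using d pq by auto
 ultimately have "(earliness p)\<^sup>2 + (earliness q)\<^sup>2 < (earliness p')\<^sup>2 + (earliness q')\<^sup>2"
  by linarith
 then show "(\<Sum>x\<leftarrow>us @ p # vs @ q # ts. (earliness x)\<^sup>2) < (\<Sum>x\<leftarrow>us @ p' # vs @ q' # ts. (earliness x)\<^sup>2)"
  by simp
qed

lemma not_sorted_wrt_split:
 assumes "\<not> sorted_wrt R xs"
 obtains us x vs y ts where "xs = us @ x # vs @ y # ts" "\<not> R x y"
proof -
 have "\<exists>us x vs y ts. xs = us @ x # vs @ y # ts & \<not> R x y"
  using assms
 proof (induction xs)
  case (Cons a xs)
  show ?case
  proof (cases "sorted_wrt R xs")
   case True
   then obtain y where "y : set xs" "\<not> R a y" using Cons.prems by auto
   then show ?thesis by (metis append_Nil split_list)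
  next
   case False
   then show ?thesis using Cons.IH by (metis append_Cons)
  qed
 qed simp
 then show thesis using that by blast
qed

text \<open>Each exchange of two pairs increases the sum of the squares of the earlinesses, as a convex
 function of two numbers with fixed sum increases when they move apart. This sum is bounded, so
 that the process of exchanging ends.\<close>

theorem straightening:
 fixes X :: "nat => nat => ratfun"
 assumes "valid_list ws"
 shows "brackets X ws : zmod.span {brackets X ws' | ws'. improves ws' ws & sorted_wrt pair_le ws'}"
 using assms
proof (induction "nat (int (length ws) * (2 ^ (m + 2) * (int m + 1))\<^sup>2 - (\<Sum>p\<leftarrow>ws. (earliness p)\<^sup>2))"
  arbitrary: ws rule: less_induct)
 case less
 let ?C = "(2 ^ (m + 2) * (int m + 1))\<^sup>2"
 define w0 where "w0 = rev (sort_key earliness ws)"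
 have ms: "mset w0 = mset ws" by (simp add: w0_def)
 have imp0: "improves w0 ws" by (rule improves_perm[OF less.prems ms])
 then have v0: "valid_list w0" by (simp add: improves_def)
 have br: "brackets X ws = brackets X w0"
  unfolding brackets_def using ms by (metis mset_map prod_mset_prod_list)
 have desc: "sorted_wrt (%x y. earliness y <= earliness x) w0"
  unfolding w0_def sorted_wrt_rev by (metis sorted_map sorted_sort_key)
 show ?case
 proof (cases "sorted_wrt pair_le w0")
  case True
  then show ?thesis
   using imp0 br by (auto intro!: zmod.span_base)
 next
  case False
  then obtain us x vs y ts where w0: "w0 = us @ x # vs @ y # ts" and nle: "\<not> pair_le x y"
   by (rule not_sorted_wrt_split)
  have xy: "earliness y <= earliness x" using desc by (simp add: w0 sorted_wrt_append)
  have vxy: "valid_pair m x" "valid_pair m y" using v0 by (auto simp: valid_list_def w0)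
  let ?c = "brackets X us * brackets X vs * brackets X ts"
  let ?T = "{brackets X ws' | ws'. improves ws' ws & sorted_wrt pair_le ws'}"
  have cm: "brackets X (us @ x' # vs @ y' # ts) = ?c * (bracket_minor X x' * bracket_minor X y')" for x' y'
   by (simp add: brackets_def algebra_simps)
  have "?c * (bracket_minor X x * bracket_minor X y) \<in>
    zmod.span ((*) ?c ` {bracket_minor X p' * bracket_minor X q' | p' q'. exchanged x y p' q'})"
   by (rule zspan_mult_left[OF exchange_step[OF vxy nle]])
  also have "... \<subseteq> zmod.span ?T"
  proof (rule zmod.span_minimal[OF _ zmod.subspace_span], clarify)
   fix p' q' assume e: "exchanged x y p' q'"
   let ?w1 = "us @ p' # vs @ q' # ts"
   note imp1 = improves_exchanged[OF v0[unfolded w0] e xy]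
   have imp: "improves ?w1 ws"
    using imp1(1) imp0 improves_trans unfolding w0 by blast
   then have v1: "valid_list ?w1" and len: "length ?w1 = length ws" by (simp_all only: improves_def)
   have s0: "(\<Sum>p\<leftarrow>w0. (earliness p)\<^sup>2) = (\<Sum>p\<leftarrow>ws. (earliness p)\<^sup>2)"
    by (rule sum_list_mset_cong[OF ms])
   have "(\<Sum>p\<leftarrow>?w1. (earliness p)\<^sup>2) <= (\<Sum>p\<leftarrow>?w1. ?C)"
   proof (rule sum_list_mono)
    fix p assume "p : set ?w1"
    then have "\<bar>earliness p\<bar> <= 2 ^ (m + 2) * (int m + 1)"
     using v1 abs_earliness_le by (simp only: valid_list_def)
    then show "(earliness p)\<^sup>2 <= ?C" by (rule abs_le_square_iff[THEN iffD1, OF order_trans]) simp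
   qed
   also have "... = int (length ?w1) * ?C" by (simp only: sum_list_triv of_nat_id)
   finally have "nat (int (length ?w1) * ?C - (\<Sum>p\<leftarrow>?w1. (earliness p)\<^sup>2))
     < nat (int (length ws) * ?C - (\<Sum>p\<leftarrow>ws. (earliness p)\<^sup>2))"
    using imp1(2) s0 unfolding len w0 by linarith
   then have "brackets X ?w1 : zmod.span {brackets X ws' | ws'. improves ws' ?w1 & sorted_wrt pair_le ws'}"
    using v1 by (rule less.hyps)
   moreover have "{brackets X ws' | ws'. improves ws' ?w1 & sorted_wrt pair_le ws'} \<subseteq> ?T"
    using imp improves_trans by blast
   ultimately show "?c * (bracket_minor X p' * bracket_minor X q') : zmod.span ?T"
    unfolding cm[symmetric] using zmod.span_mono by blast
  qed
  finally show ?thesis unfolding br w0 cm .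
 qed
qed

end

section \<open>Evaluation of rational functions\<close>

abbreviation (input) "plook \<equiv> Poly_Mapping.lookup"
abbreviation (input) "pkeys \<equiv> Poly_Mapping.keys"

text \<open>The evaluation map behind \<open>peval\<close>, for arbitrary variables and values; the algebra of
 evaluation is developed here and transported to rational functions.\<close>

definition monom_ev :: "('v => 'a::comm_ring_1) => ('v \<Rightarrow>\<^sub>0 nat) => 'a" where
 "monom_ev \<alpha> t = (\<Prod>v \<in> pkeys t. \<alpha> v ^ plook t v)"

definition poly_ev :: "('v => 'a::comm_ring_1) => (('v \<Rightarrow>\<^sub>0 nat) \<Rightarrow>\<^sub>0 int) => 'a" where
 "poly_ev \<alpha> p = (\<Sum>t \<in> pkeys p. of_int (plook p t) * monom_ev \<alpha> t)"

lemma monom_ev_superset: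
 "finite S ==> pkeys t \<subseteq> S ==> monom_ev \<alpha> t = (\<Prod>v \<in> S. \<alpha> v ^ plook t v)"
 unfolding monom_ev_def by (rule prod.mono_neutral_left) (auto simp: in_keys_iff)

lemma monom_ev_add: "monom_ev \<alpha> (s + t) = monom_ev \<alpha> s * monom_ev \<alpha> t"
proof -
 let ?S = "pkeys s \<union> pkeys t"
 have "pkeys (s + t) \<subseteq> ?S" by (rule keys_add)
 then show ?thesis
  by (simp add: monom_ev_superset[of ?S] lookup_add power_add prod.distrib)
qed

lemma poly_ev_superset:
 "finite S ==> pkeys p \<subseteq> S ==>
  poly_ev \<alpha> p = (\<Sum>t \<in> S. of_int (plook p t) * monom_ev \<alpha> t)"
 unfolding poly_ev_def by (rule sum.mono_neutral_left) (auto simp: in_keys_iff)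

lemma poly_ev_add: "poly_ev \<alpha> (p + q) = poly_ev \<alpha> p + poly_ev \<alpha> q"
proof -
 let ?S = "pkeys p \<union> pkeys q"
 have "pkeys (p + q) \<subseteq> ?S" by (rule keys_add)
 then show ?thesis
  by (simp add: poly_ev_superset[of ?S] lookup_add distrib_right sum.distrib)
qed

lemma poly_ev_0 [simp]: "poly_ev \<alpha> 0 = 0"
 by (simp add: poly_ev_def)

lemma poly_ev_single: "poly_ev \<alpha> (Poly_Mapping.single t n) = of_int n * monom_ev \<alpha> t"
 by (subst poly_ev_superset[of "{t}"]) auto

lemma poly_ev_sum: "poly_ev \<alpha> (sum f A) = (\<Sum>a\<in>A. poly_ev \<alpha> (f a))"
 by (induction A rule: infinite_finite_induct) (auto simp: poly_ev_add)

lemma poly_mapping_sum_single: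
 "(\<Sum>t \<in> pkeys p. Poly_Mapping.single t (plook p t)) = p"
proof (rule poly_mapping_eqI)
 fix k
 have "plook (\<Sum>t \<in> pkeys p. Poly_Mapping.single t (plook p t)) k =
   (\<Sum>t \<in> pkeys p. if t = k then plook p k else 0)"
  unfolding lookup_sum by (rule sum.cong) (auto simp: lookup_single when_def)
 then show "plook (\<Sum>t \<in> pkeys p. Poly_Mapping.single t (plook p t)) k =
   plook p k"
  by (simp add: in_keys_iff)
qed

lemma poly_mult_sum:
 fixes p q :: "('v \<Rightarrow>\<^sub>0 nat) \<Rightarrow>\<^sub>0 int"
 shows "p * q = (\<Sum>s \<in> pkeys p. \<Sum>t \<in> pkeys q.
  Poly_Mapping.single (s + t) (plook p s * plook q t))"
proof -
 have "p * q = (\<Sum>s \<in> pkeys p. Poly_Mapping.single s (plook p s)) *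
   (\<Sum>t \<in> pkeys q. Poly_Mapping.single t (plook q t))"
  by (simp only: poly_mapping_sum_single)
 then show ?thesis by (simp only: sum_product mult_single)
qed

lemma poly_ev_mult: "poly_ev \<alpha> (p * q) = poly_ev \<alpha> p * poly_ev \<alpha> q"
proof -
 have "poly_ev \<alpha> (p * q) = (\<Sum>s \<in> pkeys p. \<Sum>t \<in> pkeys q.
   (of_int (plook p s) * monom_ev \<alpha> s) * (of_int (plook q t) * monom_ev \<alpha> t))"
  unfolding poly_mult_sum[of p q] poly_ev_sum poly_ev_single
  by (intro sum.cong refl) (simp add: monom_ev_add ac_simps)
 then show ?thesis by (simp only: sum_product poly_ev_def)
qed

lemma poly_ev_1 [simp]: "poly_ev \<alpha> 1 = 1"
 using poly_ev_single[of \<alpha> 0 1] by (simp add: monom_ev_def)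

lemma poly_ev_diff: "poly_ev \<alpha> (p - q) = poly_ev \<alpha> p - poly_ev \<alpha> q"
 using poly_ev_add[of \<alpha> "p - q" q] by simp

lemma peval_eq: "peval p A = poly_ev (%(b, i, j). A $$ (i - 1, j - 1)) p"
 by (simp add: peval_def poly_ev_def monom_ev_def case_prod_unfold)

definition evaluable :: "ratfun mat => ratfun => bool" where
 "evaluable A f \<longleftrightarrow> (\<exists>p q. f = Fract p q & peval q A ~= 0)"

lemma peval_nonzero: "peval q A ~= 0 ==> q ~= 0"
 by (auto simp: peval_eq)

lemma eval_at_Fract:
 assumes "peval q A ~= 0"
 shows "eval_at (Fract p q) A = peval p A / peval q A"
 unfolding eval_at_def
proof (rule the_equality)
 show "\<exists>p' q'. Fract p q = Fract p' q' & peval q' A ~= 0 & peval p A / peval q A = peval p' A / peval q' A"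
  using assms by blast
next
 fix w assume "\<exists>p' q'. Fract p q = Fract p' q' & peval q' A ~= 0 & w = peval p' A / peval q' A"
 then obtain p' q' where h: "Fract p q = Fract p' q'" "peval q' A ~= 0" "w = peval p' A / peval q' A"
  by blast
 then have "p * q' = p' * q"
  using peval_nonzero[OF assms] peval_nonzero[OF h(2)] by (simp add: eq_fract)
 then have "peval p A * peval q' A = peval p' A * peval q A"
  unfolding peval_eq poly_ev_mult[symmetric] by simp
 then show "w = peval p A / peval q A"
  using assms h by (simp add: frac_eq_eq)
qed

lemma evaluable_ops:
 assumes "evaluable A f" "evaluable A g"
 shows "evaluable A (f + g)" "eval_at (f + g) A = eval_at f A + eval_at g A"
  and "evaluable A (f - g)" "eval_at (f - g) A = eval_at f A - eval_at g A"
  and "evaluable A (f * g)" "eval_at (f * g) A = eval_at f A * eval_at g A"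
proof -
 obtain p q p' q' where f: "f = Fract p q" "peval q A ~= 0" and g: "g = Fract p' q'" "peval q' A ~= 0"
  using assms by (auto simp: evaluable_def)
 have nz: "q ~= 0" "q' ~= 0" using f g peval_nonzero by auto
 have qq: "peval (q * q') A ~= 0" using f g by (simp add: peval_eq poly_ev_mult)
 have e: "f + g = Fract (p * q' + p' * q) (q * q')" "f - g = Fract (p * q' - p' * q) (q * q')"
  "f * g = Fract (p * p') (q * q')"
  using nz by (simp_all add: f g)
 show "evaluable A (f + g)" "evaluable A (f - g)" "evaluable A (f * g)"
  unfolding e evaluable_def using qq by blast+
 show "eval_at (f + g) A = eval_at f A + eval_at g A" "eval_at (f - g) A = eval_at f A - eval_at g A"
  "eval_at (f * g) A = eval_at f A * eval_at g A"
  unfolding e eval_at_Fract[OF qq] using f g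
  by (simp_all add: eval_at_Fract peval_eq poly_ev_add poly_ev_diff poly_ev_mult field_simps)
qed

lemma evaluable_inverse:
 assumes "evaluable A f" "eval_at f A ~= 0"
 shows "evaluable A (1 / f)" "eval_at (1 / f) A = 1 / eval_at f A"
proof -
 obtain p q where f: "f = Fract p q" "peval q A ~= 0" using assms by (auto simp: evaluable_def)
 then have p: "peval p A ~= 0" using assms(2) by (simp add: eval_at_Fract)
 have e: "1 / f = Fract q p" by (simp add: f(1) One_fract_def)
 show "evaluable A (1 / f)" unfolding e evaluable_def using p by blast
 have "eval_at (1 / f) A = peval q A / peval p A" by (simp only: e eval_at_Fract[OF p])
 moreover have "eval_at f A = peval p A / peval q A" by (simp only: f(1) eval_at_Fract[OF f(2)])
 ultimately show "eval_at (1 / f) A = 1 / eval_at f A" by simp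
qed

lemma evaluable_Fract_1: "evaluable A (Fract p 1)" "eval_at (Fract p 1) A = peval p A"
proof -
 have n: "peval 1 A ~= 0" by (simp add: peval_eq)
 then show "evaluable A (Fract p 1)" unfolding evaluable_def by blast
 show "eval_at (Fract p 1) A = peval p A"
  using eval_at_Fract[OF n, of p] by (simp add: peval_eq)
qed

lemma evaluable_of_int: "evaluable A (of_int n)" "eval_at (of_int n) A = of_int n"
proof -
 have "peval (of_int n) A = of_int n"
  by (simp add: peval_eq poly_ev_single[of _ 0, simplified] flip: single_of_int) (simp add: poly_ev_single monom_ev_def)
 then show "evaluable A (of_int n)" "eval_at (of_int n) A = of_int n"
  unfolding ratfun_of_int using evaluable_Fract_1[where A = A and p = "of_int n"] by (simp_all add: ratfun_of_int)
qed

lemma evaluable_0_1 [simp]: "evaluable A 0" "eval_at 0 A = 0" "evaluable A 1" "eval_at 1 A = 1"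
 using evaluable_of_int[where A = A and n = 0] evaluable_of_int[where A = A and n = 1] by simp_all

lemma evaluable_sum:
 assumes "!!i. i : I ==> evaluable A (f i)"
 shows "evaluable A (sum f I) & eval_at (sum f I) A = (\<Sum>i\<in>I. eval_at (f i) A)"
 using assms by (induction I rule: infinite_finite_induct) (auto simp: evaluable_ops)

lemma evaluable_prod:
 assumes "!!i. i : I ==> evaluable A (f i)"
 shows "evaluable A (prod f I) & eval_at (prod f I) A = (\<Prod>i\<in>I. eval_at (f i) A)"
 using assms by (induction I rule: infinite_finite_induct) (auto simp: evaluable_ops)

lemma evaluable_det:
 assumes M: "M : carrier_mat n n" and e: "!!i j. i < n ==> j < n ==> evaluable A (M $$ (i, j))"
 shows "evaluable A (det M)" "eval_at (det M) A = det (map_mat (%f. eval_at f A) M)"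
proof -
 let ?P = "{p. p permutes {0..<n}}"
 have d: "det M = (\<Sum>p\<in>?P. signof p * (\<Prod>i = 0..<n. M $$ (i, p i)))"
  by (rule det_def'[OF M])
 have P: "evaluable A (\<Prod>i = 0..<n. M $$ (i, p i)) \<and>
   eval_at (\<Prod>i = 0..<n. M $$ (i, p i)) A = (\<Prod>i = 0..<n. eval_at (M $$ (i, p i)) A)"
  if "p : ?P" for p
  using that by (intro evaluable_prod e) (auto dest: permutes_in_image)
 have T: "evaluable A (signof p * (\<Prod>i = 0..<n. M $$ (i, p i)))"
  "eval_at (signof p * (\<Prod>i = 0..<n. M $$ (i, p i))) A = signof p * (\<Prod>i = 0..<n. eval_at (M $$ (i, p i)) A)"
  if "p : ?P" for p
  using P[OF that] evaluable_of_int[where A = A and n = "sign p"] by (simp_all add: evaluable_ops)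
 show "evaluable A (det M)"
  unfolding d by (rule evaluable_sum[THEN conjunct1]) (rule T(1))
 have "eval_at (det M) A = (\<Sum>p\<in>?P. signof p * (\<Prod>i = 0..<n. eval_at (M $$ (i, p i)) A))"
  unfolding d using evaluable_sum[of ?P A "%p. signof p * (\<Prod>i = 0..<n. M $$ (i, p i))"] T by simp
 also have "... = det (map_mat (%f. eval_at f A) M)"
 proof -
  have mc: "map_mat (%f. eval_at f A) M : carrier_mat n n" using M by simp
  have "(\<Prod>i = 0..<n. map_mat (%f. eval_at f A) M $$ (i, p i)) = (\<Prod>i = 0..<n. eval_at (M $$ (i, p i)) A)"
   if "p : ?P" for p
   by (rule prod.cong[OF refl]) (use M that permutes_in_image[of p "{0..<n}"] in auto)
  then show ?thesis
   unfolding det_def'[OF mc] by (intro sum.cong refl) (simp only:)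
 qed
 finally show "eval_at (det M) A = det (map_mat (%f. eval_at f A) M)" .
qed

lemma gen_carrier [simp]: "gen m b : carrier_mat m m"
 by (simp add: gen_def)

lemma gen_dim [simp]: "dim_row (gen m b) = m" "dim_col (gen m b) = m"
 by (simp_all add: gen_def)

lemma evaluable_gen:
 assumes "i < m" "j < m"
 shows "evaluable A (gen m b $$ (i, j))" "eval_at (gen m b $$ (i, j)) A = A $$ (i, j)"
proof -
 have "poly_ev \<alpha> (Poly_Mapping.single (Poly_Mapping.single v 1) 1) = \<alpha> v"
  for \<alpha> :: "nat \<times> nat \<times> nat => ratfun" and v
  by (simp add: poly_ev_single monom_ev_def)
 then show "evaluable A (gen m b $$ (i, j))" "eval_at (gen m b $$ (i, j)) A = A $$ (i, j)"
  using assms evaluable_Fract_1 by (simp_all add: gen_def var_def peval_eq)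
qed

lemma map_mat_eval_gen: "A : carrier_mat m m ==> map_mat (%f. eval_at f A) (gen m b) = A"
 by (rule eq_matI) (auto simp: evaluable_gen)

lemma eval_det_gen:
 assumes "A : carrier_mat m m"
 shows "evaluable A (det (gen m b))" "eval_at (det (gen m b)) A = det A"
 using evaluable_det[OF gen_carrier, where A = A] evaluable_gen map_mat_eval_gen[OF assms] by auto

lemma det_gen_nonzero: "det (gen m b) ~= 0"
 using eval_det_gen(2)[of "1\<^sub>m m" m b] by auto

lemma matinv_eq:
 fixes A :: "'a::field mat"
 assumes A: "A : carrier_mat m m" and d: "det A ~= 0"
 shows "matinv A = (1 / det A) \<cdot>\<^sub>m adj_mat A"
  and "matinv A : carrier_mat m m" "A * matinv A = 1\<^sub>m m" "matinv A * A = 1\<^sub>m m"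
proof -
 have "A : Units (ring_mat TYPE('a) m ())"
  by (rule det_non_zero_imp_unit[OF A d])
 then obtain B where B: "mat_inverse A = Some B"
  using mat_inverse(1)[OF A, of "()"] by (cases "mat_inverse A") auto
 then show c: "matinv A : carrier_mat m m" and ar: "A * matinv A = 1\<^sub>m m" and al: "matinv A * A = 1\<^sub>m m"
  using mat_inverse(2)[OF A B] by (auto simp: matinv_def)
 let ?C = "(1 / det A) \<cdot>\<^sub>m adj_mat A"
 have C: "?C : carrier_mat m m" using adj_mat[OF A] by simp
 have AC: "A * ?C = 1\<^sub>m m"
 proof -
  have "A * ?C = (1 / det A) \<cdot>\<^sub>m (det A \<cdot>\<^sub>m 1\<^sub>m m)"
   using mult_smult_distrib[OF A adj_mat(1)[OF A], of "1 / det A"] adj_mat(2)[OF A] by simp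
  then show ?thesis using d by (auto intro!: eq_matI)
 qed
 have "matinv A = matinv A * (A * ?C)" using AC c by simp
 also have "... = (matinv A * A) * ?C" using assoc_mult_mat[OF c A C] by simp
 also have "... = ?C" unfolding al by (rule left_mult_one_mat[OF C])
 finally show "matinv A = ?C" .
qed

lemma matinv_entry:
 fixes A :: "'a::field mat"
 assumes "A : carrier_mat m m" "det A ~= 0" "i < m" "j < m"
 shows "matinv A $$ (i, j) = (1 / det A) * cofactor A j i"
 using assms by (simp add: matinv_eq(1)) (simp add: adj_mat_def)

lemma matinv_unique:
 fixes A :: "'a::field mat"
 assumes A: "A : carrier_mat m m" and B: "B : carrier_mat m m" and AB: "A * B = 1\<^sub>m m"
 shows "matinv A = B" "det A ~= 0"
proof -
 have "det A * det B = 1" using det_mult[OF A B] AB by simp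
 then show d: "det A ~= 0" by auto
 note inv = matinv_eq(2-)[OF A d]
 have "matinv A = matinv A * (A * B)" using AB inv by simp
 also have "... = (matinv A * A) * B" using assoc_mult_mat[OF inv(1) A B] by simp
 finally show "matinv A = B" using inv B by simp
qed

lemma det_matinv:
 fixes A :: "'a::field mat"
 assumes "A : carrier_mat m m" "det A ~= 0"
 shows "det (matinv A) = 1 / det A" "det (matinv A) ~= 0"
proof -
 have "det A * det (matinv A) = 1"
  using det_mult[OF assms(1) matinv_eq(2)[OF assms]] matinv_eq(3)[OF assms] by simp
 then show "det (matinv A) = 1 / det A" "det (matinv A) ~= 0"
  using assms(2) by (auto simp: field_simps)
qed

lemma evaluable_matinv_gen:
 assumes A: "A : carrier_mat m m" and d: "det A ~= 0" and ij: "i < m" "j < m"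
 shows "evaluable A (matinv (gen m b) $$ (i, j))"
  and "eval_at (matinv (gen m b) $$ (i, j)) A = matinv A $$ (i, j)"
proof -
 let ?G = "gen m b"
 have md: "mat_delete ?G j i : carrier_mat (m - 1) (m - 1)"
  by (rule mat_delete_carrier) simp
 have en: "evaluable A (mat_delete ?G j i $$ (k, l)) & eval_at (mat_delete ?G j i $$ (k, l)) A = mat_delete A j i $$ (k, l)"
  if "k < m - 1" "l < m - 1" for k l
  using that A evaluable_gen[where m = m and A = A and b = b] by (auto simp: mat_delete_def)
 have mm: "map_mat (%f. eval_at f A) (mat_delete ?G j i) = mat_delete A j i"
  by (rule eq_matI) (use en A in auto)
 have c1: "(-1) ^ (j + i) = (of_int ((-1) ^ (j + i)) :: ratfun)" by simp
 have cof: "evaluable A (cofactor ?G j i)" "eval_at (cofactor ?G j i) A = cofactor A j i"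
  using evaluable_det[OF md, of A] en mm evaluable_of_int[where A = A and n = "(-1) ^ (j + i)"]
  unfolding cofactor_def c1 by (auto simp: evaluable_ops)
 have id: "evaluable A (1 / det ?G)" "eval_at (1 / det ?G) A = 1 / det A"
  using evaluable_inverse[of A "det ?G"] eval_det_gen[OF A, of b] d by auto
 show "evaluable A (matinv ?G $$ (i, j))" "eval_at (matinv ?G $$ (i, j)) A = matinv A $$ (i, j)"
  unfolding matinv_entry[OF gen_carrier det_gen_nonzero ij] matinv_entry[OF A d ij]
  using cof id evaluable_ops(5,6)[OF id(1) cof(1)] by simp_all
qed

lemma evaluable_coord:
 assumes "f : coord m B" "A : carrier_mat m m" "det A ~= 0"
 shows "evaluable A f"
 using assms(1)
proof induction
 case (inv_det b)
 then show ?case using evaluable_inverse[of A "det (gen m b)"] eval_det_gen[OF assms(2), of b] assms(3) by simp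
qed (use evaluable_gen in \<open>auto simp: evaluable_ops\<close>)

section \<open>Coordinate rings\<close>

lemma coord_0: "0 : coord m B"
 using coord.diff[OF coord.one coord.one] by simp

lemma coord_uminus: "f : coord m B ==> - f : coord m B"
 using coord.diff[OF coord_0] by fastforce

lemma coord_add: "f : coord m B ==> g : coord m B ==> f + g : coord m B"
 using coord.diff[of f m B "- g"] coord_uminus by simp

lemma coord_sum: "(!!i. i : I ==> f i : coord m B) ==> sum f I : coord m B"
 by (induction I rule: infinite_finite_induct) (auto intro: coord_0 coord_add)

lemma coord_prod: "(!!i. i : I ==> f i : coord m B) ==> prod f I : coord m B"
 by (induction I rule: infinite_finite_induct) (auto intro: coord.one coord.mult)

lemma coord_of_int: "of_int n : coord m B"
proof (induction n rule: int_induct[of _ 0])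
 case base
 then show ?case by (simp add: coord_0)
next
 case (step1 i)
 then show ?case by (simp add: coord_add coord.one)
next
 case (step2 i)
 then show ?case by (simp add: coord.diff coord.one)
qed

lemma coord_det:
 assumes M: "M : carrier_mat n n" and e: "!!i j. i < n ==> j < n ==> M $$ (i, j) : coord m B"
 shows "det M : coord m B"
 unfolding det_def'[OF M]
 by (intro coord_sum coord.mult coord_prod e coord_of_int) (auto dest: permutes_in_image)

lemma coord_matinv_gen:
 assumes b: "b : B" and ij: "i < m" "j < m"
 shows "matinv (gen m b) $$ (i, j) : coord m B"
proof -
 have "det (mat_delete (gen m b) j i) : coord m B"
  by (rule coord_det[OF mat_delete_carrier[OF gen_carrier]])
   (use b ij in \<open>auto simp: mat_delete_def intro!: coord.entry\<close>)
 then have "cofactor (gen m b) j i : coord m B"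
  unfolding cofactor_def using coord_of_int[of "(-1) ^ (j + i)" m B] by (intro coord.mult) auto
 then show ?thesis
  unfolding matinv_entry[OF gen_carrier det_gen_nonzero ij] by (intro coord.mult coord.inv_det b)
qed

text \<open>Rational functions in disjoint sets of variables are linearly disjoint: a relation between
 products splits into its coefficients at the monomials of the second set of variables.\<close>

definition poly_in :: "nat set => zpoly => bool" where
 "poly_in B p \<longleftrightarrow> (\<forall>t \<in> pkeys p. fst ` pkeys t \<subseteq> B)"

definition ratfun_in :: "nat set => ratfun set" where
 "ratfun_in B = {Fract p q | p q. q ~= 0 & poly_in B p & poly_in B q}"

lemma poly_in_diff: "poly_in B p ==> poly_in B q ==> poly_in B (p - q)"
 unfolding poly_in_def using keys_diff[of p q] by blast

lemma poly_in_mult: "poly_in B p ==> poly_in B q ==> poly_in B (p * q)"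
 unfolding poly_in_def
proof
 fix t assume p: "\<forall>t \<in> pkeys p. fst ` pkeys t \<subseteq> B"
  and q: "\<forall>t \<in> pkeys q. fst ` pkeys t \<subseteq> B" and "t : pkeys (p * q)"
 then obtain a b where "t = a + b" "a : pkeys p" "b : pkeys q"
  using keys_mult[of p q] by auto
 then show "fst ` pkeys t \<subseteq> B"
  using keys_add[of a b] p q by blast
qed

lemma poly_in_1: "poly_in B 1"
 by (simp add: poly_in_def)

lemma ratfun_in_ops:
 assumes "f : ratfun_in B" "g : ratfun_in B"
 shows "f - g : ratfun_in B" "f * g : ratfun_in B"
proof -
 obtain p q p' q' where f: "f = Fract p q" "q ~= 0" "poly_in B p" "poly_in B q"
  and g: "g = Fract p' q'" "q' ~= 0" "poly_in B p'" "poly_in B q'"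
  using assms by (auto simp: ratfun_in_def)
 have "f - g = Fract (p * q' - p' * q) (q * q')" "f * g = Fract (p * p') (q * q')"
  using f g by simp_all
 then show "f - g : ratfun_in B" "f * g : ratfun_in B"
  unfolding ratfun_in_def using f g by (auto intro!: exI poly_in_mult poly_in_diff)
qed

lemma ratfun_in_inverse: "f : ratfun_in B ==> f ~= 0 ==> 1 / f : ratfun_in B"
proof -
 assume "f : ratfun_in B" and nz: "f ~= 0"
 then obtain p q where f: "f = Fract p q" "q ~= 0" "poly_in B p" "poly_in B q"
  by (auto simp: ratfun_in_def)
 have "p ~= 0" using nz f by (auto simp: Zero_fract_def eq_fract)
 moreover have "1 / f = Fract q p" by (simp add: f(1) One_fract_def)
 ultimately show ?thesis using f(3,4) unfolding ratfun_in_def by blast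
qed

lemma ratfun_in_1: "1 : ratfun_in B"
 unfolding ratfun_in_def One_fract_def using poly_in_1 by (auto intro!: exI)

lemma ratfun_in_0: "0 : ratfun_in B"
 using ratfun_in_ops(1)[OF ratfun_in_1 ratfun_in_1] by simp

lemma ratfun_in_add: "f : ratfun_in B ==> g : ratfun_in B ==> f + g : ratfun_in B"
 using ratfun_in_ops(1)[of f B "0 - g"] ratfun_in_ops(1)[of 0 B g] ratfun_in_0 by simp

lemma ratfun_in_sum: "(!!i. i : I ==> f i : ratfun_in B) ==> sum f I : ratfun_in B"
 by (induction I rule: infinite_finite_induct) (auto intro: ratfun_in_0 ratfun_in_add)

lemma ratfun_in_prod: "(!!i. i : I ==> f i : ratfun_in B) ==> prod f I : ratfun_in B"
 by (induction I rule: infinite_finite_induct) (auto intro: ratfun_in_1 ratfun_in_ops)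

lemma ratfun_in_var: "b : B ==> var b i j : ratfun_in B"
 unfolding ratfun_in_def var_def
 by (intro CollectI exI conjI refl) (auto simp: poly_in_def split: if_splits)

lemma ratfun_in_of_int: "of_int n : ratfun_in B"
proof (induction n rule: int_induct[of _ 0])
 case base
 then show ?case by (simp add: ratfun_in_0)
next
 case (step1 i)
 then show ?case by (simp add: ratfun_in_add ratfun_in_1)
next
 case (step2 i)
 then show ?case by (simp add: ratfun_in_ops ratfun_in_1)
qed

lemma coord_ratfun_in: "f : coord m B ==> f : ratfun_in B"
proof (induction rule: coord.induct)
 case (entry b i j)
 then show ?case by (simp add: gen_def ratfun_in_var)
next
 case (inv_det b)
 have "det (gen m b) : ratfun_in B"
  unfolding det_def'[OF gen_carrier]
 proof (intro ratfun_in_sum ratfun_in_ops(2) ratfun_in_prod)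
  fix p i assume "p : {p. p permutes {0..<m}}" "i : {0..<m}"
  then have "i < m" "p i < m" by (auto dest: permutes_in_image)
  then show "gen m b $$ (i, p i) : ratfun_in B" using inv_det by (simp add: gen_def ratfun_in_var)
 qed (rule ratfun_in_of_int)
 then show ?case by (rule ratfun_in_inverse[OF _ det_gen_nonzero])
qed (auto intro: ratfun_in_1 ratfun_in_ops)

lemma common_denominator:
 assumes "finite I" "!!i. i : I ==> f i : ratfun_in B"
 shows "\<exists>p q. q ~= 0 & poly_in B q & (\<forall>i\<in>I. poly_in B (p i) & f i = Fract (p i) q)"
 using assms
proof (induction I rule: finite_induct)
 case empty
 then show ?case using poly_in_1 by (intro exI[of _ "%_. 0"] exI[of _ 1]) auto
next
 case (insert a I)
 then obtain p q where pq: "q ~= 0" "poly_in B q" "\<forall>i\<in>I. poly_in B (p i) & f i = Fract (p i) q"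
  by auto
 obtain p' q' where a: "f a = Fract p' q'" "q' ~= 0" "poly_in B p'" "poly_in B q'"
  using insert.prems[of a] by (auto simp: ratfun_in_def)
 define P where "P i = (if i = a then p' * q else p i * q')" for i
 have "\<forall>i\<in>insert a I. poly_in B (P i) & f i = Fract (P i) (q * q')"
  using pq a insert.hyps(2) by (auto simp: P_def eq_fract intro: poly_in_mult)
 then show ?case
  using pq a by (intro exI[of _ P] exI[of _ "q * q'"]) (auto intro: poly_in_mult)
qed

lemma lookup_mult_disjoint:
 assumes p: "poly_in B p" and r: "poly_in B' r" and d: "B \<inter> B' = {}"
  and s: "fst ` pkeys s \<subseteq> B" and t: "fst ` pkeys t \<subseteq> B'"
 shows "plook (p * r) (s + t) = plook p s * plook r t"
proof -
 have uniq: "a = s & b = t" if ab: "a + b = s + t" "fst ` pkeys a \<subseteq> B" "fst ` pkeys b \<subseteq> B'" for a b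
 proof -
  have ba: "fst v \<notin> B ==> plook a v = 0 & plook s v = 0"
   "fst v \<notin> B' ==> plook b v = 0 & plook t v = 0" for v
   using ab s t by (auto simp: in_keys_iff[symmetric] not_in_keys_iff_lookup_eq_zero[symmetric])
  have e: "plook a v + plook b v = plook s v + plook t v" for v
   using ab(1) by (metis lookup_add)
  have "plook a v = plook s v & plook b v = plook t v" for v
   using ba[of v] e[of v] d by (metis IntI add.right_neutral add_0 emptyE)
  then show ?thesis by (auto intro: poly_mapping_eqI)
 qed
 have "plook (p * r) (s + t) = (\<Sum>a \<in> pkeys p. \<Sum>b \<in> pkeys r.
   if a = s & b = t then plook p s * plook r t else 0)"
  unfolding poly_mult_sum[of p r] lookup_sum lookup_single when_def
  using uniq p r unfolding poly_in_def by (intro sum.cong refl if_cong) metis+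
 also have "... = (\<Sum>a \<in> pkeys p. if a = s then
   (\<Sum>b \<in> pkeys r. if b = t then plook p s * plook r t else 0) else 0)"
  by (intro sum.cong refl) auto
 also have "... = plook p s * plook r t"
  by (auto simp: in_keys_iff)
 finally show ?thesis .
qed

lemma lookup_of_int_mult: "plook (of_int z * x) u = z * plook x u"
 for x :: zpoly
proof -
 have "of_int z = (Poly_Mapping.single 0 z :: zpoly)"
  by (rule poly_mapping_eqI) (simp add: lookup_of_int lookup_single when_def)
 then have "of_int z * x = Poly_Mapping.map ((*) z) x"
  by (simp only: mult_map_scale_conv_mult)
 then show ?thesis by (simp add: Poly_Mapping.map.rep_eq when_def)
qed

theorem linearly_disjoint:
 assumes fin: "finite I" and e: "!!i. i : I ==> e i : ratfun_in B" and c: "!!i. i : I ==> c i : ratfun_in B'"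
  and d: "B \<inter> B' = {}" and rel: "(\<Sum>i\<in>I. e i * c i) = 0"
  and indep: "!!n :: _ => int. (\<Sum>i\<in>I. of_int (n i) * e i) = 0 ==> \<forall>i\<in>I. n i = 0"
 shows "\<forall>i\<in>I. c i = 0"
proof -
 have "\<exists>p q. q ~= 0 & poly_in B q & (\<forall>i\<in>I. poly_in B (p i) & e i = Fract (p i) q)"
  by (rule common_denominator[OF fin e])
 then obtain p q where q: "q ~= 0" and p': "\<forall>i\<in>I. poly_in B (p i) & e i = Fract (p i) q"
  by blast
 then have p: "!!i. i : I ==> poly_in B (p i)" "!!i. i : I ==> e i = Fract (p i) q" by blast+
 have "\<exists>r s. s ~= 0 & poly_in B' s & (\<forall>i\<in>I. poly_in B' (r i) & c i = Fract (r i) s)"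
  by (rule common_denominator[OF fin c])
 then obtain r s where s: "s ~= 0" and r': "\<forall>i\<in>I. poly_in B' (r i) & c i = Fract (r i) s"
  by blast
 then have r: "!!i. i : I ==> poly_in B' (r i)" "!!i. i : I ==> c i = Fract (r i) s" by blast+
 have Fsum: "(\<Sum>i\<in>I. Fract (f i) u) = Fract (\<Sum>i\<in>I. f i) u" if "u ~= 0" for f :: "_ => zpoly" and u
  using fin that
  by (induction I rule: finite_induct) (simp_all add: Zero_fract_def eq_fract algebra_simps)
 have "Fract (\<Sum>i\<in>I. p i * r i) (q * s) = 0"
 proof -
  have "(\<Sum>i\<in>I. e i * c i) = (\<Sum>i\<in>I. Fract (p i * r i) (q * s))"
   by (rule sum.cong) (auto simp: p r)
  then show ?thesis using rel Fsum[of "q * s"] q s by simp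
 qed
 then have pr: "(\<Sum>i\<in>I. p i * r i) = 0" using q s by (simp add: Zero_fract_def eq_fract)
 have "plook (r k) t = 0" if k: "k : I" for k t
 proof (cases "fst ` pkeys t \<subseteq> B'")
  case False
  then show ?thesis using r(1)[OF k] unfolding poly_in_def
   using not_in_keys_iff_lookup_eq_zero by metis
 next
  case True
  have "(\<Sum>i\<in>I. of_int (plook (r i) t) * p i) = 0"
  proof (rule poly_mapping_eqI)
   fix u
   have "plook (\<Sum>i\<in>I. of_int (plook (r i) t) * p i) u =
     (\<Sum>i\<in>I. plook (p i) u * plook (r i) t)"
    unfolding lookup_sum lookup_of_int_mult by (intro sum.cong refl mult.commute)
   also have "... = 0"
   proof (cases "fst ` pkeys u \<subseteq> B")
    case False
    then have "i : I ==> plook (p i) u = 0" for i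
     using p(1)[of i] unfolding poly_in_def using not_in_keys_iff_lookup_eq_zero by metis
    then show ?thesis by simp
   next
    case tr: True
    have "(\<Sum>i\<in>I. plook (p i) u * plook (r i) t) =
      (\<Sum>i\<in>I. plook (p i * r i) (u + t))"
     by (rule sum.cong) (auto simp: lookup_mult_disjoint[OF p(1) r(1) d tr True])
    also have "... = plook (\<Sum>i\<in>I. p i * r i) (u + t)" by (simp add: lookup_sum)
    finally show ?thesis using pr by simp
   qed
   finally show "plook (\<Sum>i\<in>I. of_int (plook (r i) t) * p i) u = plook 0 u"
    by simp
  qed
  moreover have "(\<Sum>i\<in>I. of_int (plook (r i) t) * e i) =
    Fract (\<Sum>i\<in>I. of_int (plook (r i) t) * p i) q"
   unfolding Fsum[OF q, symmetric] using q by (intro sum.cong refl) (simp add: p ratfun_of_int)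
  ultimately have "(\<Sum>i\<in>I. of_int (plook (r i) t) * e i) = 0"
   by (simp add: Zero_fract_def eq_fract q)
  then show ?thesis using indep[of "%i. plook (r i) t"] k by blast
 qed
 then have "r k = 0" if "k : I" for k
  using that by (intro poly_mapping_eqI) simp
 then show ?thesis by (simp add: r Zero_fract_def eq_fract s)
qed

section \<open>Young diagrams and their columns\<close>

definition clen :: "nat list => nat => nat" where
 "clen p c = card {i. (i, c) : young p}"

definition fits :: "nat list => nat => bool" where
 "fits p k \<longleftrightarrow> (\<forall>c>k. clen p c = 0)"

definition colset :: "nat list => tableau => nat => nat set" where
 "colset p T c = (%i. T (i, c)) ` {1..clen p c}"

definition col_inj :: "nat list => tableau => bool" where
 "col_inj p T \<longleftrightarrow> (\<forall>c. inj_on (%i. T (i, c)) {1..clen p c})"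

definition conj_partition :: "nat => (nat => nat) => nat => nat list" where
 "conj_partition m r k = map (%i. card {c : {1..k}. i <= r c}) [1..<Suc m]"

lemma partitions_mono:
 assumes "p : partitions m" "i <= j" "j < m"
 shows "p ! j <= p ! i"
 using assms sorted_wrt_nth_less[of "(\<ge>)" p i j] by (cases "i = j") (auto simp: partitions_def)

lemma partitions_length: "p : partitions m ==> length p = m"
 by (simp add: partitions_def)

lemma young_initial:
 assumes p: "p : partitions m"
 shows "{i. (i, c) : young p} = {1..clen p c}" and "clen p c <= m"
proof -
 let ?S = "{i. (i, c) : young p}"
 have sub: "?S \<subseteq> {1..m}" using partitions_length[OF p] by (auto simp: young_def)
 then have fin: "finite ?S" using finite_subset by blast
 have down: "i : ?S ==> 1 <= j ==> j <= i ==> j : ?S" for i j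
 proof -
  assume i: "i : ?S" and j: "1 <= j" "j <= i"
  then have "p ! (i - 1) <= p ! (j - 1)"
   using partitions_length[OF p] by (intro partitions_mono[OF p]) (auto simp: young_def)
  then show "j : ?S" using i j by (auto simp: young_def)
 qed
 show "?S = {1..clen p c}"
 proof (cases "?S = {}")
  case True
  then show ?thesis by (simp add: clen_def)
 next
  case False
  have "?S = {1..Max ?S}"
  proof (intro equalityI subsetI)
   fix j assume "j : {1..Max ?S}"
   then show "j : ?S" using down[OF Max_in[OF fin False], of j] by auto
  qed (use fin sub in auto)
  then show ?thesis unfolding clen_def by (metis card_atLeastAtMost diff_Suc_1)
 qed
 show "clen p c <= m"
  unfolding clen_def using card_mono[OF _ sub] by simp
qed

lemma in_young_iff:
 assumes "p : partitions m"
 shows "(i, c) : young p \<longleftrightarrow> 1 <= i & i <= clen p c"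
 using young_initial(1)[OF assms, of c] by (metis (mono_tags, lifting) atLeastAtMost_iff mem_Collect_eq)

lemma clen_0 [simp]: "clen p 0 = 0"
 by (simp add: clen_def young_def)

lemma le_clen_iff:
 assumes "p : partitions m" "1 <= i" "1 <= c"
 shows "i <= clen p c \<longleftrightarrow> i <= m & c <= p ! (i - 1)"
 using in_young_iff[OF assms(1), of i c] assms partitions_length[OF assms(1)] by (auto simp: young_def)

lemma clen_antimono:
 assumes "p : partitions m" "1 <= c" "c <= c'"
 shows "clen p c' <= clen p c"
proof (cases "clen p c' = 0")
 case False
 then show ?thesis
  using le_clen_iff[OF assms(1), of "clen p c'" c'] le_clen_iff[OF assms(1), of "clen p c'" c] assms by auto
qed simp

lemma young_Sigma:
 assumes "p : partitions m" "fits p k"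
 shows "young p = (%(c, i). (i, c)) ` (SIGMA c : {1..k}. {1..clen p c})"
proof (intro equalityI subsetI)
 fix b assume b: "b : young p"
 then obtain i c where e: "b = (i, c)" by (cases b)
 then have ic: "1 <= i" "i <= clen p c" using in_young_iff[OF assms(1)] b by auto
 then have "c ~= 0" using clen_0 by (metis le_zero_eq not_one_le_zero order_trans)
 moreover have "c <= k" using assms(2) ic by (auto simp: fits_def not_le[symmetric])
 ultimately show "b : (%(c, i). (i, c)) ` (SIGMA c : {1..k}. {1..clen p c})"
  using ic e by force
qed (use in_young_iff[OF assms(1)] in auto)

lemma young_le_sum_list: "(i, c) : young p ==> 1 <= i & i <= length p & 1 <= c & c <= sum_list p"
proof -
 assume b: "(i, c) : young p"
 then have "p ! (i - 1) <= sum_list p" by (intro elem_le_sum_list) (auto simp: young_def)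
 then show ?thesis using b by (auto simp: young_def)
qed

lemma finite_young: "p : partitions m ==> finite (young p)"
 by (rule finite_subset[of _ "{1..length p} \<times> {1..sum_list p}"])
  (auto dest: young_le_sum_list)

lemma fits_sum_list: "fits p (sum_list p)"
proof -
 have "young p \<subseteq> UNIV \<times> {1..sum_list p}"
  by (auto dest: young_le_sum_list)
 then have "{i. (i, c) : young p} = {}" if "c > sum_list p" for c using that by auto
 then show ?thesis by (simp add: fits_def clen_def)
qed

lemma fits_mono: "fits p k ==> k <= k' ==> fits p k'"
 by (auto simp: fits_def)

lemma partition_conj:
 assumes "p : partitions m" "fits p k"
 shows "p = conj_partition m (clen p) k"
proof (rule nth_equalityI)
 fix i assume i: "i < length p"
 have len: "length p = m" using assms(1) by (rule partitions_length)
 have "{c : {1..k}. Suc i <= clen p c} = {1..p ! i}"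
 proof (intro equalityI subsetI)
  fix c assume "c : {1..p ! i}"
  then have "Suc i <= clen p c" using le_clen_iff[OF assms(1), of "Suc i" c] i len by auto
  moreover from this have "c <= k" using assms(2) by (auto simp: fits_def not_le[symmetric])
  ultimately show "c : {c : {1..k}. Suc i <= clen p c}" using \<open>c : {1..p ! i}\<close> by auto
 next
  fix c assume "c : {c : {1..k}. Suc i <= clen p c}"
  then show "c : {1..p ! i}" using le_clen_iff[OF assms(1), of "Suc i" c] by auto
 qed
 then show "p ! i = conj_partition m (clen p) k ! i"
  using i len by (simp add: conj_partition_def del: upt_Suc)
qed (use assms(1) in \<open>simp add: conj_partition_def partitions_def\<close>)

lemma conj_partition:
 assumes anti: "!!c c'. 1 <= c ==> c <= c' ==> c' <= k ==> r c' <= r c"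
  and le: "!!c. 1 <= c ==> c <= k ==> r c <= m"
 shows "conj_partition m r k : partitions m"
  and "1 <= c ==> clen (conj_partition m r k) c = (if c <= k then r c else 0)"
  and "fits (conj_partition m r k) k"
proof -
 let ?p = "conj_partition m r k"
 have nth: "?p ! i = card {c : {1..k}. Suc i <= r c}" if "i < m" for i
  using that by (simp add: conj_partition_def del: upt_Suc)
 show p: "?p : partitions m"
  unfolding partitions_def sorted_wrt_iff_nth_less
 proof (intro CollectI conjI allI impI)
  show len: "length ?p = m" by (simp add: conj_partition_def)
  fix i j assume "i < j" "j < length ?p"
  then show "?p ! j <= ?p ! i" by (auto simp: nth len intro!: card_mono)
 qed
 have cl: "clen ?p c = (if c <= k then r c else 0)" if c: "1 <= c" for c
 proof -
  have iff: "i <= clen ?p c \<longleftrightarrow> c <= k & i <= r c" if i: "1 <= i" for i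
  proof -
   have set_eq: "c <= card {c : {1..k}. i <= r c} \<longleftrightarrow> c <= k & i <= r c"
   proof
    assume "c <= k & i <= r c"
    then have "{1..c} \<subseteq> {c : {1..k}. i <= r c}" using anti[of _ c] by (auto intro: order_trans)
    then show "c <= card {c : {1..k}. i <= r c}" using card_mono[of "{c : {1..k}. i <= r c}" "{1..c}"] by simp
   next
    assume h: "c <= card {c : {1..k}. i <= r c}"
    show "c <= k & i <= r c"
    proof (rule ccontr)
     assume n: "\<not> (c <= k & i <= r c)"
     have "{c : {1..k}. i <= r c} \<subseteq> {1..<c}"
     proof
      fix d assume d: "d : {c : {1..k}. i <= r c}"
      then have "\<not> c <= d" using n anti[of c d] c by (auto dest: order_trans)
      then show "d : {1..<c}" using d by auto
     qed
     then have "card {c : {1..k}. i <= r c} <= c - 1" using card_mono[of "{1..<c}"] by fastforce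
     then show False using h c by simp
    qed
   qed
   show ?thesis
   proof (cases "i <= m")
    case True
    then have "?p ! (i - 1) = card {c : {1..k}. i <= r c}" using nth[of "i - 1"] i by simp
    then show ?thesis using le_clen_iff[OF p i c] set_eq True by simp
   next
    case False
    then show ?thesis using le_clen_iff[OF p i c] le[OF c] by auto
   qed
  qed
  show ?thesis
  proof (rule antisym)
   show "clen ?p c <= (if c <= k then r c else 0)"
    using iff[of "clen ?p c"] by (cases "clen ?p c = 0") auto
   show "(if c <= k then r c else 0) <= clen ?p c"
    using iff[of "r c"] by (cases "r c = 0") auto
  qed
 qed
 then show "1 <= c ==> clen ?p c = (if c <= k then r c else 0)" .
 show "fits ?p k" unfolding fits_def using cl by auto
qed

lemma bidet_factor_minors:
 assumes "p : partitions m" "fits p k"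
 shows "bidet_factor z p S T = (\<Prod>c\<in>{1..k}. minor z (clen p c) (%a. S (a + 1, c)) (%b. T (b + 1, c)))"
proof -
 have sub: "snd ` young p \<subseteq> {1..k}"
  using young_Sigma[OF assms] by auto
 have "bidet_factor z p S T = (\<Prod>c\<in>snd ` young p. minor z (clen p c) (%a. S (a + 1, c)) (%b. T (b + 1, c)))"
  unfolding bidet_factor_def by (intro prod.cong refl) (simp add: clen_def minor_def Let_def)
 also have "... = (\<Prod>c\<in>{1..k}. minor z (clen p c) (%a. S (a + 1, c)) (%b. T (b + 1, c)))"
 proof (rule prod.mono_neutral_left[OF _ sub], safe)
  fix c assume "c : {1..k}" "c \<notin> snd ` young p"
  then have "clen p c = 0" using in_young_iff[OF assms(1), of 1 c] by (force simp: image_iff)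
  then show "minor z (clen p c) (%a. S (a + 1, c)) (%b. T (b + 1, c)) = 1" by simp
 qed
 finally show ?thesis .
qed

lemma colset_image: "colset p T c = (%a. T (a + 1, c)) ` {0..<clen p c}"
proof -
 have "{1..clen p c} = Suc ` {0..<clen p c}"
  by (simp add: image_Suc_atLeastLessThan atLeastLessThanSuc_atLeastAtMost)
 then show ?thesis by (simp only: colset_def image_image Suc_eq_plus1)
qed

lemma col_inj_shift: "inj_on (%i. T (i, c)) {1..clen p c} \<longleftrightarrow> inj_on (%a. T (a + 1, c)) {0..<clen p c}"
proof -
 have e: "{1..clen p c} = Suc ` {0..<clen p c}"
  by (simp add: image_Suc_atLeastLessThan atLeastLessThanSuc_atLeastAtMost)
 show ?thesis
  unfolding e Suc_eq_plus1[symmetric]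
  using comp_inj_on_iff[of Suc "{0..<clen p c}" "%i. T (i, c)"] by (simp only: comp_def inj_Suc)
qed

lemma card_colset: "col_inj p T ==> card (colset p T c) = clen p c"
 by (simp add: colset_def col_inj_def card_image)

lemma colset_range:
 assumes "p : partitions m" "T : tableaux m p"
 shows "colset p T c \<subseteq> {1..m}"
 using assms in_young_iff[OF assms(1)] by (auto simp: colset_def tableaux_def dest!: PiE_mem)

lemma finite_colset [simp]: "finite (colset p T c)"
 by (simp add: colset_def)

section \<open>Bideterminants at a matrix\<close>

definition x_at :: "ratfun mat => nat => nat => ratfun" where
 "x_at A i j = A $$ (i - 1, j - 1)"

definition y_at :: "ratfun mat => nat => nat => ratfun" where
 "y_at A i j = transpose_mat (matinv A) $$ (i - 1, j - 1)"

definition bidet_at :: "ratfun mat => shape => rtableau => rtableau => ratfun" where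
 "bidet_at A = (%(p, q) (S1, S2) (T1, T2).
   bidet_factor (x_at A) p S1 T1 * bidet_factor (y_at A) q S2 T2)"

lemma xfun_eq: "xfun m = x_at (gen m 0)" and yfun_eq: "yfun m = y_at (gen m 0)"
 by (simp_all add: fun_eq_iff xfun_def x_at_def yfun_def y_at_def)

lemma bidet_eq: "bidet m = bidet_at (gen m 0)"
 by (simp add: bidet_def bidet_at_def xfun_eq yfun_eq)

text \<open>Jacobi's identity for complementary minors. Multiplying \<open>(A\<inverse> | 1)\<close> by \<open>A\<close> gives \<open>(1 | A)\<close>, so
 that the maximal minors of the two matrices with corresponding columns differ by the factor \<open>det A\<close>.\<close>

lemma jacobi_minor:
 assumes A: "A : carrier_mat m m" and d: "det A ~= 0"
  and IJ: "I \<subseteq> {1..m}" "J \<subseteq> {1..m}" "card I = card J"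
 shows "pm_eq (bracket_minor (y_at A) (I, J)) (1 / det A * bracket_minor (x_at A) ({1..m} - I, {1..m} - J))"
proof -
 note inv = matinv_eq(2-)[OF A d]
 let ?B = "matinv A"
 let ?S = "Inl ` I \<union> Inr ` ({1..m} - J) :: (nat + nat) set"
 have fin: "finite I" "finite J" using IJ finite_subset by blast+
 have cS: "card ?S = m"
 proof -
  have "card ?S = card I + card ({1..m} - J)"
   using fin by (subst card_Un_disjoint) (auto simp: card_image)
  then show ?thesis using IJ card_mono[OF _ IJ(2)] fin by (simp add: card_Diff_subset)
 qed
 obtain f where "bij_betw f {0..<m} ?S"
  using ex_bij_betw_nat_finite[of ?S] fin cS by auto
 then have f: "inj_on f {0..<m}" "f ` {0..<m} = ?S" by (auto simp: bij_betw_def)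
 define sw :: "nat + nat => nat + nat" where "sw l = (case l of Inl i => Inr i | Inr k => Inl k)" for l
 have sw_inj: "inj sw" by (auto simp: inj_def sw_def split: sum.splits)
 let ?f' = "sw \<circ> f"
 have f': "inj_on ?f' {0..<m}" "?f' ` {0..<m} = Inl ` ({1..m} - J) \<union> Inr ` I"
 proof -
  show "inj_on ?f' {0..<m}" using f(1) sw_inj by (simp add: comp_inj_on inj_on_subset)
  have "sw ` ?S = Inl ` ({1..m} - J) \<union> Inr ` I" by (auto simp: sw_def image_Un image_image)
  then show "?f' ` {0..<m} = Inl ` ({1..m} - J) \<union> Inr ` I" using f(2) by (metis image_comp)
 qed
 have range: "f c : ?S" if "c < m" for c using f(2) that by auto
 have cong: "(\<Sum>k = 0..<m. A $$ (a, k) * letter_col (x_at ?B) (Suc k) l) = letter_col (x_at A) (Suc a) (sw l)"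
  if a: "a < m" and l: "l : ?S" for a l
 proof (cases l)
  case (Inl i)
  then have i: "1 <= i" "i <= m" using l IJ by auto
  have "(\<Sum>k = 0..<m. A $$ (a, k) * letter_col (x_at ?B) (Suc k) l) = (A * ?B) $$ (a, i - 1)"
   using Inl a i A inv(1) by (auto simp: x_at_def scalar_prod_def intro!: sum.cong)
  also have "... = (if Suc a = i then 1 else 0)" using inv(2) a i by auto
  finally show ?thesis using Inl by (simp add: sw_def)
 next
  case (Inr k)
  then have k: "1 <= k" "k <= m" using l by auto
  have "(\<Sum>k' = 0..<m. A $$ (a, k') * letter_col (x_at ?B) (Suc k') l) =
    (\<Sum>k' = 0..<m. if k' = k - 1 then A $$ (a, k - 1) else 0)"
   using Inr k by (intro sum.cong) auto
  then show ?thesis using Inr k a by (simp add: sw_def x_at_def)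
 qed
 let ?M = "mat m m (%(a, b). letter_col (x_at ?B) (Suc a) (f b))"
 have "A * ?M = mat m m (%(a, b). letter_col (x_at A) (Suc a) (?f' b))"
  by (rule eq_matI) (use A range cong in \<open>auto simp: scalar_prod_def\<close>)
 then have "det A * minor (letter_col (x_at ?B)) m Suc f = minor (letter_col (x_at A)) m Suc ?f'"
  using det_mult[OF A, of ?M] by (simp add: minor_def)
 moreover have "pm_eq (minor (letter_col (x_at ?B)) m Suc f) (bracket_minor (x_at ?B) (J, I))"
  using maximal_minor_bracket[OF f, of "x_at ?B"] IJ by (simp add: double_diff)
 moreover have "pm_eq (minor (letter_col (x_at A)) m Suc ?f') (bracket_minor (x_at A) ({1..m} - I, {1..m} - J))"
  using maximal_minor_bracket[OF f', of "x_at A"] IJ by simp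
 ultimately have "pm_eq (det A * bracket_minor (x_at ?B) (J, I)) (bracket_minor (x_at A) ({1..m} - I, {1..m} - J))"
  using pm_eq_trans[OF pm_eq_mult[OF pm_eq_refl[of "det A"] pm_eq_sym]] by metis
 then have "pm_eq (1 / det A * (det A * bracket_minor (x_at ?B) (J, I)))
   (1 / det A * bracket_minor (x_at A) ({1..m} - I, {1..m} - J))"
  by (rule pm_eq_mult[OF pm_eq_refl])
 then have "pm_eq (bracket_minor (x_at ?B) (J, I)) (1 / det A * bracket_minor (x_at A) ({1..m} - I, {1..m} - J))"
  using d by simp
 moreover have "bracket_minor (y_at A) (I, J) = bracket_minor (x_at ?B) (J, I)"
 proof -
  have e: "y_at A i j = x_at ?B j i" if "i : I" "j : J" for i j
  proof -
   have "i - 1 < m" "j - 1 < m"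
    using subsetD[OF IJ(1) that(1)] subsetD[OF IJ(2) that(2)] by auto
   then show ?thesis using inv(1) by (simp add: y_at_def x_at_def)
  qed
  have "bracket_minor (y_at A) (I, J) = minor (%i j. x_at ?B j i) (card I) (enum I) (enum J)"
   unfolding bracket_minor_def fst_conv snd_conv
   using bij_betwE[OF enum_bij[OF fin(1)]] bij_betwE[OF enum_bij[OF fin(2)]] IJ(3)
   by (intro minor_cong e) auto
  then show ?thesis
   using bracket_minor_transpose[of I J "%i j. x_at ?B j i"] IJ(3) by (simp add: bracket_minor_def)
 qed
 ultimately show ?thesis by simp
qed

text \<open>The columns of a rational tableau as a single sequence of sets: the complements of the columns
 of the second tableau from right to left, then the columns of the first tableau from left to right.
 The numbers \<open>k\<close>, \<open>l\<close> bound the widths of the two tableaux; missing columns count as empty.\<close>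

definition column_list :: "nat => nat => nat => shape => rtableau => nat set list" where
 "column_list m k l = (%(p, q) (T1, T2).
   map (%c. {1..m} - colset q T2 (k - c)) [0..<k] @ map (%c. colset p T1 (Suc c)) [0..<l])"

lemma length_column_list [simp]: "length (column_list m k l s T) = k + l"
 by (simp add: column_list_def split: prod.splits)

lemma prod_list_upt: "prod_list (map f [0..<n]) = (\<Prod>c\<in>{0..<n}. f c)"
 for f :: "nat => 'a::comm_monoid_mult"
 by (induction n) (auto simp: mult.commute)

lemma bidet_at_brackets:
 assumes A: "A : carrier_mat m m" and d: "det A ~= 0"
  and p: "p : partitions m" and q: "q : partitions m" and fits: "fits p l" "fits q k"
  and S: "(S1, S2) : rtableaux m (p, q)" and T: "(T1, T2) : rtableaux m (p, q)"
  and inj: "col_inj p S1" "col_inj q S2" "col_inj p T1" "col_inj q T2"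
 shows "pm_eq (bidet_at A (p, q) (S1, S2) (T1, T2))
  ((1 / det A) ^ k * (\<Prod>x\<leftarrow>zip (column_list m k l (p, q) (S1, S2)) (column_list m k l (p, q) (T1, T2)). bracket_minor (x_at A) x))"
proof -
 have tab: "S1 : tableaux m p" "S2 : tableaux m q" "T1 : tableaux m p" "T2 : tableaux m q"
  using S T by (auto simp: rtableaux_def)
 have m: "pm_eq (minor z (clen r c) (%a. U (a + 1, c)) (%b. V (b + 1, c))) (bracket_minor z (colset r U c, colset r V c))"
  if "col_inj r U" "col_inj r V" for z :: "nat => nat => ratfun" and r U V c
  unfolding colset_image using that[unfolded col_inj_def col_inj_shift]
  by (intro minor_bracket) blast+
 have P: "pm_eq (bidet_factor (x_at A) p S1 T1) (\<Prod>c\<in>{1..l}. bracket_minor (x_at A) (colset p S1 c, colset p T1 c))"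
  unfolding bidet_factor_minors[OF p fits(1)] by (intro pm_eq_prod m inj)
 have "pm_eq (bidet_factor (y_at A) q S2 T2) (\<Prod>c\<in>{1..k}. 1 / det A *
   bracket_minor (x_at A) ({1..m} - colset q S2 c, {1..m} - colset q T2 c))"
  unfolding bidet_factor_minors[OF q fits(2)]
 proof (intro pm_eq_prod)
  fix c
  show "pm_eq (minor (y_at A) (clen q c) (%a. S2 (a + 1, c)) (%b. T2 (b + 1, c)))
    (1 / det A * bracket_minor (x_at A) ({1..m} - colset q S2 c, {1..m} - colset q T2 c))"
   by (rule pm_eq_trans[OF m jacobi_minor[OF A d]])
    (use inj colset_range[OF q] tab card_colset in auto)
 qed
 then have Q: "pm_eq (bidet_factor (y_at A) q S2 T2) ((1 / det A) ^ k * (\<Prod>c\<in>{1..k}.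
   bracket_minor (x_at A) ({1..m} - colset q S2 c, {1..m} - colset q T2 c)))"
  unfolding prod.distrib by simp
 have "(\<Prod>x\<leftarrow>zip (column_list m k l (p, q) (S1, S2)) (column_list m k l (p, q) (T1, T2)). bracket_minor (x_at A) x) =
   (\<Prod>c\<in>{0..<k}. bracket_minor (x_at A) ({1..m} - colset q S2 (k - c), {1..m} - colset q T2 (k - c))) *
   (\<Prod>c\<in>{0..<l}. bracket_minor (x_at A) (colset p S1 (Suc c), colset p T1 (Suc c)))"
  by (simp add: column_list_def zip_append map_zip_map zip_map_map comp_def zip_same_conv_map prod_list_upt[symmetric])
 also have "(\<Prod>c\<in>{0..<l}. bracket_minor (x_at A) (colset p S1 (Suc c), colset p T1 (Suc c))) =
   (\<Prod>c\<in>{1..l}. bracket_minor (x_at A) (colset p S1 c, colset p T1 c))"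
  by (rule prod.reindex_bij_witness[of _ "%c. c - 1" Suc]) auto
 also have "(\<Prod>c\<in>{0..<k}. bracket_minor (x_at A) ({1..m} - colset q S2 (k - c), {1..m} - colset q T2 (k - c))) =
   (\<Prod>c\<in>{1..k}. bracket_minor (x_at A) ({1..m} - colset q S2 c, {1..m} - colset q T2 c))"
  by (rule prod.reindex_bij_witness[of _ "%c. k - c" "%c. k - c"]) auto
 finally show ?thesis
  using pm_eq_mult[OF P Q] by (simp add: bidet_at_def ac_simps)
qed

lemma bidet_at_not_inj:
 assumes p: "p : partitions m" and q: "q : partitions m"
  and "\<not> (col_inj p S1 & col_inj q S2 & col_inj p T1 & col_inj q T2)"
 shows "bidet_at A (p, q) (S1, S2) (T1, T2) = 0"
proof -
 have z: "bidet_factor z r U V = 0"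
  if r: "r : partitions m" and n: "\<not> col_inj r U \<or> \<not> col_inj r V" for z r U V
 proof -
  obtain c where c: "\<not> inj_on (%a. U (a + 1, c)) {0..<clen r c} \<or> \<not> inj_on (%a. V (a + 1, c)) {0..<clen r c}"
   using n unfolding col_inj_def col_inj_shift by blast
  then have cr: "clen r c ~= 0" by (metis atLeastLessThan0 inj_on_empty)
  then have "c ~= 0" using clen_0 by metis
  with cr have "c : {1..sum_list r}"
   using fits_sum_list[of r] unfolding fits_def by (metis One_nat_def Suc_leI atLeastAtMost_iff gr0I linorder_not_less)
  moreover have "minor z (clen r c) (%a. U (a + 1, c)) (%b. V (b + 1, c)) = 0"
   using c minor_rows_not_inj minor_cols_not_inj by blast
  ultimately show ?thesis
   unfolding bidet_factor_minors[OF r fits_sum_list] by (intro prod_zero) auto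
 qed
 show ?thesis using assms z by (auto simp: bidet_at_def)
qed

section \<open>Standard rational tableaux as chains of column sets\<close>

context ordered_letters
begin

lemma below_less:
 assumes "finite C" "y : C" "(x, y) : ord" "x ~= y"
 shows "below C x < below C y"
 unfolding below_def
proof (rule psubset_card_mono)
 have "y : {i : C. (i, y) : ord}" "y \<notin> {i : C. (i, x) : ord}"
  using assms ord_in ord_refl ord_antisym by blast+
 then show "{i : C. (i, x) : ord} \<subset> {i : C. (i, y) : ord}"
  using assms ord_trans by blast
qed (use assms in auto)

lemma below_bij:
 assumes "C \<subseteq> {1..m}"
 shows "bij_betw (below C) C {1..card C}"
proof -
 have fin: "finite C" using assms finite_subset by blast
 have inj: "inj_on (below C) C"
 proof (rule inj_onI)
  fix x y assume xy: "x : C" "y : C" "below C x = below C y"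
  then show "x = y"
   using below_less[OF fin, of y x] below_less[OF fin, of x y] ord_total[of x y] assms
   by (metis less_irrefl subsetD)
 qed
 have "below C ` C \<subseteq> {1..card C}"
 proof clarify
  fix x assume x: "x : C"
  have "x : {i : C. (i, x) : ord}" using x assms ord_refl by auto
  then have "below C x ~= 0" unfolding below_def using fin by auto
  moreover have "below C x <= card C" unfolding below_def by (rule card_mono[OF fin]) auto
  ultimately show "below C x : {1..card C}" by simp
 qed
 moreover have "card (below C ` C) = card {1..card C}" using card_image[OF inj] by simp
 ultimately have "below C ` C = {1..card C}" by (intro card_subset_eq) auto
 then show ?thesis using inj by (simp add: bij_betw_def)
qed

definition nth_letter :: "nat set => nat => nat" where
 "nth_letter C i = inv_into C (below C) i"

lemma nth_letter:
 assumes "C \<subseteq> {1..m}" "1 <= i" "i <= card C"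
 shows "nth_letter C i : C" "below C (nth_letter C i) = i"
proof -
 have "i : below C ` C" using below_bij[OF assms(1)] assms by (auto simp: bij_betw_def)
 then show "nth_letter C i : C" "below C (nth_letter C i) = i"
  unfolding nth_letter_def by (auto intro: inv_into_into f_inv_into_f)
qed

lemma nth_letter_eqI:
 assumes "C \<subseteq> {1..m}" "x : C" "below C x = i"
 shows "nth_letter C i = x"
 unfolding nth_letter_def assms(3)[symmetric]
 using below_bij[OF assms(1)] assms(2) by (intro inv_into_f_f) (auto simp: bij_betw_def)

text \<open>Counting letters up to \<open>j\<close> locates the \<open>i\<close>-th letter; this turns the counting order
 \<open>col_le\<close> into the entrywise comparison in the definition of standard tableaux.\<close>

lemma le_below_iff:
 assumes C: "C \<subseteq> {1..m}" and j: "j : {1..m}" and i: "1 <= i"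
 shows "i <= below C j \<longleftrightarrow> i <= card C & (nth_letter C i, j) : ord"
proof
 have fin: "finite C" using C finite_subset by blast
 assume h: "i <= below C j"
 have "below C j <= card C" unfolding below_def by (rule card_mono[OF fin]) auto
 with h have ic: "i <= card C" by simp
 note n = nth_letter[OF C i ic]
 have "(nth_letter C i, j) : ord"
 proof (rule ccontr)
  assume "\<not> ?thesis"
  then have "(j, nth_letter C i) : ord" "j ~= nth_letter C i"
   using ord_total[of j "nth_letter C i"] ord_refl j n C by auto
  then have "below C j < below C (nth_letter C i)" by (rule below_less[OF fin n(1)])
  then show False using n h by simp
 qed
 with ic show "i <= card C & (nth_letter C i, j) : ord" by simp
next
 have fin: "finite C" using C finite_subset by blast
 assume "i <= card C & (nth_letter C i, j) : ord"
 then show "i <= below C j" using nth_letter[OF C i] below_mono[OF fin, of "nth_letter C i" j] by auto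
qed

lemma col_le_iff_nth:
 assumes C: "C \<subseteq> {1..m}" and C': "C' \<subseteq> {1..m}"
 shows "col_le C C' \<longleftrightarrow> (\<forall>i. 1 <= i --> i <= card C' --> i <= card C & (nth_letter C i, nth_letter C' i) : ord)"
proof
 assume le: "col_le C C'"
 show "\<forall>i. 1 <= i --> i <= card C' --> i <= card C & (nth_letter C i, nth_letter C' i) : ord"
 proof (intro allI impI)
  fix i assume i: "1 <= i" "i <= card C'"
  note n = nth_letter[OF C' i]
  have j: "nth_letter C' i : {1..m}" using n C' by auto
  have "i <= below C (nth_letter C' i)" using le j n unfolding col_le_def by metis
  then show "i <= card C & (nth_letter C i, nth_letter C' i) : ord"
   using le_below_iff[OF C j i(1)] by simp
 qed
next
 assume h: "\<forall>i. 1 <= i --> i <= card C' --> i <= card C & (nth_letter C i, nth_letter C' i) : ord"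
 show "col_le C C'"
  unfolding col_le_def
 proof
  fix j assume j: "j : {1..m}"
  show "below C' j <= below C j"
  proof (cases "below C' j = 0")
   case False
   then have i: "1 <= below C' j" by simp
   then have "below C' j <= card C'" "(nth_letter C' (below C' j), j) : ord"
    using le_below_iff[OF C' j i] by auto
   then show ?thesis using h i le_below_iff[OF C j i] ord_trans by blast
  qed simp
 qed
qed

lemma col_le_card:
 assumes "C \<subseteq> {1..m}" "C' \<subseteq> {1..m}" "col_le C C'"
 shows "card C' <= card C"
 using assms col_le_iff_nth[OF assms(1,2)] by (cases "card C' = 0") auto

lemma col_le_empty: "col_le C {}"
 by (simp add: col_le_def below_def)

lemma below_compl:
 assumes "A \<subseteq> {1..m}"
 shows "below ({1..m} - A) j + below A j = pos j"
proof -
 have "{i : {1..m}. (i, j) : ord} = {i : {1..m} - A. (i, j) : ord} \<union> {i : A. (i, j) : ord}"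
  using assms by auto
 moreover have "finite A" using assms finite_subset by blast
 ultimately show ?thesis unfolding pos_def below_def by (simp add: card_Un_disjoint Int_def disjoint_iff)
qed

lemma col_le_compl:
 assumes "A \<subseteq> {1..m}" "B \<subseteq> {1..m}"
 shows "col_le ({1..m} - A) ({1..m} - B) \<longleftrightarrow> col_le B A"
 unfolding col_le_def
proof (intro ball_cong refl)
 fix j
 show "(below ({1..m} - B) j <= below ({1..m} - A) j) = (below A j <= below B j)"
  using below_compl[OF assms(1), of j] below_compl[OF assms(2), of j] by linarith
qed

text \<open>The condition on first columns compares the complement of the second with the first.\<close>

lemma std_pair_iff:
 assumes "I2 \<subseteq> {1..m}"
 shows "std_pair m ord I1 I2 \<longleftrightarrow> col_le ({1..m} - I2) I1"
 unfolding std_pair_def col_le_def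
proof (intro ball_cong refl)
 fix j
 show "(card {i : I1. (i, j) : ord} + card {i : I2. (i, j) : ord} <= card {i : {1..m}. (i, j) : ord}) =
   (below I1 j <= below ({1..m} - I2) j)"
  using below_compl[OF assms, of j] unfolding pos_def below_def by linarith
qed

text \<open>The tableau whose \<open>c\<close>-th column consists of the letters of \<open>C c\<close> in increasing order.\<close>

definition tab_of :: "nat list => (nat => nat set) => tableau" where
 "tab_of p C = restrict (%(i, c). nth_letter (C c) i) (young p)"

lemma tab_of:
 assumes C: "!!c. 1 <= c ==> c <= k ==> C c \<subseteq> {1..m}"
  and chain: "!!c c'. 1 <= c ==> c < c' ==> c' <= k ==> col_le (C c) (C c')"
 defines "p \<equiv> conj_partition m (%c. card (C c)) k"
 shows "p : partitions m" "fits p k"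
  and "tab_of p C : tableaux m p" "std_tableau ord p (tab_of p C)"
  and "1 <= c ==> c <= k ==> colset p (tab_of p C) c = C c"
proof -
 have anti: "card (C c') <= card (C c)" if "1 <= c" "c <= c'" "c' <= k" for c c'
  using col_le_card[OF C C chain, of c c'] that by (cases "c = c'") auto
 have le: "card (C c) <= m" if "1 <= c" "c <= k" for c
  using card_mono[OF _ C[OF that]] by simp
 note cp = conj_partition[of k "%c. card (C c)" m, OF anti le, folded p_def]
 show p: "p : partitions m" and f: "fits p k" using cp by auto
 have cl: "clen p c = card (C c)" if "1 <= c" "c <= k" for c
  using cp(2)[of c] that by simp
 have yc: "1 <= i & i <= card (C c) & 1 <= c & c <= k" if "(i, c) : young p" for i c
 proof -
  have "b : young p ==> 1 <= snd b & snd b <= k" for b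
   unfolding young_Sigma[OF p f] by auto
  from this[OF that] show ?thesis using cl[of c] in_young_iff[OF p, of i c] that by auto
 qed
 have val: "tab_of p C (i, c) = nth_letter (C c) i" if "(i, c) : young p" for i c
  using that by (simp add: tab_of_def)
 note n = nth_letter[OF C]
 show "tab_of p C : tableaux m p"
  unfolding tableaux_def tab_of_def
 proof (rule restrict_PiE_iff[THEN iffD2], rule ballI)
  fix b assume "b : young p"
  moreover obtain i c where b: "b = (i, c)" by (cases b)
  ultimately have "nth_letter (C c) i : {1..m}" using yc[of i c] n[of c i] C[of c] by blast
  then show "(case b of (i, c) => nth_letter (C c) i) : {1..m}" using b by simp
 qed
 show "std_tableau ord p (tab_of p C)"
  unfolding std_tableau_def
 proof (rule conjI; intro allI impI)
  fix i i' j assume ii: "i < i'" "(i, j) : young p" "(i', j) : young p"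
  note y = yc[OF ii(2)] yc[OF ii(3)]
  have b: "below (C j) (nth_letter (C j) i) = i" "below (C j) (nth_letter (C j) i') = i'"
   "nth_letter (C j) i : C j" "nth_letter (C j) i' : C j"
   using n[of j i] n[of j i'] y by auto
  then have ne: "nth_letter (C j) i ~= nth_letter (C j) i'" using ii by auto
  have "(nth_letter (C j) i, nth_letter (C j) i') : ord"
   using le_below_iff[OF C, of j "nth_letter (C j) i'" i] b y ii(1) C[of j] by auto
  then show "(tab_of p C (i, j), tab_of p C (i', j)) : ord & tab_of p C (i, j) ~= tab_of p C (i', j)"
   using ne val ii by simp
 next
  fix i j j' assume jj: "j < j'" "(i, j) : young p" "(i, j') : young p"
  note y = yc[OF jj(2)] yc[OF jj(3)]
  have "col_le (C j) (C j')" using chain y jj(1) by simp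
  then show "(tab_of p C (i, j), tab_of p C (i, j')) : ord"
   using col_le_iff_nth[OF C C, of j j'] y val jj by auto
 qed
 show "colset p (tab_of p C) c = C c" if c: "1 <= c" "c <= k"
 proof -
  have "colset p (tab_of p C) c = nth_letter (C c) ` {1..card (C c)}"
   unfolding colset_def cl[OF c]
   by (intro image_cong refl val) (use in_young_iff[OF p] cl[OF c] in auto)
  also have "... = C c"
   using bij_betw_inv_into[OF below_bij[OF C[OF c]]] unfolding nth_letter_def[abs_def]
   by (simp add: bij_betw_def)
  finally show ?thesis .
 qed
qed

lemma std_tableau_columns:
 assumes p: "p : partitions m" and T: "T : tableaux m p" and s: "std_tableau ord p T"
 shows "col_inj p T"
  and "1 <= c ==> c <= c' ==> col_le (colset p T c) (colset p T c')"
  and "(i, c) : young p ==> T (i, c) = nth_letter (colset p T c) i"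
proof -
 have lt: "(T (i, c), T (i', c)) : ord & T (i, c) ~= T (i', c)"
  if "i < i'" "1 <= i" "i' <= clen p c" for i i' c
  using s that in_young_iff[OF p] unfolding std_tableau_def by auto
 have inj: "inj_on (%i. T (i, c)) {1..clen p c}" for c
 proof (rule inj_onI)
  fix i i' assume "i : {1..clen p c}" "i' : {1..clen p c}" "T (i, c) = T (i', c)"
  then show "i = i'" using lt[of i i' c] lt[of i' i c] by (cases i i' rule: linorder_cases) auto
 qed
 then show ci: "col_inj p T" by (simp add: col_inj_def)
 note range = colset_range[OF p T]
 have bel: "below (colset p T c) (T (i, c)) = i" if i: "1 <= i" "i <= clen p c" for i c
 proof -
  have "T (i, c) : colset p T c" using i by (auto simp: colset_def)
  then have Ti: "T (i, c) : {1..m}" using range[of c] by blast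
  have "{x : colset p T c. (x, T (i, c)) : ord} = (%i. T (i, c)) ` {1..i}"
  proof (intro equalityI subsetI)
   fix x assume "x : {x : colset p T c. (x, T (i, c)) : ord}"
   then obtain i' where i': "x = T (i', c)" "1 <= i'" "i' <= clen p c" "(x, T (i, c)) : ord"
    by (auto simp: colset_def)
   have "\<not> i < i'" using lt[of i i' c] i i' ord_antisym by auto
   then show "x : (%i. T (i, c)) ` {1..i}" using i' by auto
  next
   fix x assume "x : (%i. T (i, c)) ` {1..i}"
   then obtain i' where i': "x = T (i', c)" "1 <= i'" "i' <= i" by auto
   then show "x : {x : colset p T c. (x, T (i, c)) : ord}"
    using lt[of i' i c] i Ti ord_refl by (cases "i' = i") (auto simp: colset_def)
  qed
  then show ?thesis
   unfolding below_def using card_image[OF inj_on_subset[OF inj[of c], of "{1..i}"]] i by simp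
 qed
 show nth: "T (i, c) = nth_letter (colset p T c) i" if "(i, c) : young p" for i c
 proof -
  have i: "1 <= i" "i <= clen p c" using that in_young_iff[OF p] by auto
  then have "T (i, c) : colset p T c" by (auto simp: colset_def)
  then show ?thesis using nth_letter_eqI[OF range _ bel[OF i]] by simp
 qed
 show "col_le (colset p T c) (colset p T c')" if c: "1 <= c" "c <= c'"
 proof (cases "c = c'")
  case False
  show ?thesis
   unfolding col_le_iff_nth[OF range range] card_colset[OF ci]
  proof (intro allI impI)
   fix i assume i: "1 <= i" "i <= clen p c'"
   then have i': "i <= clen p c" using clen_antimono[OF p c] by simp
   have y: "(i, c) : young p" "(i, c') : young p" using i i' in_young_iff[OF p] by auto
   then have "(T (i, c), T (i, c')) : ord"
    using s c False unfolding std_tableau_def by (metis le_neq_implies_less)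
   then show "i <= clen p c & (nth_letter (colset p T c) i, nth_letter (colset p T c') i) : ord"
    using nth y i' by simp
  qed
 qed simp
qed

lemma first_column_eq: "p : partitions m ==> first_column p T = colset p T 1"
 unfolding first_column_def colset_def using in_young_iff[of p m] by auto

lemma std_rtableaux_iff:
 "(S1, S2) : std_rtableaux m ord (p, q) \<longleftrightarrow> S1 : tableaux m p & S2 : tableaux m q \<and>
   std_tableau ord p S1 & std_tableau ord q S2 & std_pair m ord (first_column p S1) (first_column q S2)"
 by (auto simp: std_rtableaux_def rtableaux_def)

lemma std_rtableaux_subset: "std_rtableaux m ord s \<subseteq> rtableaux m s"
 by (auto simp: std_rtableaux_def rtableaux_def split: prod.splits)

lemma std_rtableaux_facts:
 assumes p: "p : partitions m" and q: "q : partitions m" and S: "(S1, S2) : std_rtableaux m ord (p, q)"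
 shows "(S1, S2) : rtableaux m (p, q)" "col_inj p S1" "col_inj q S2"
  and "clen p 1 + clen q 1 <= m"
  and "sorted_wrt col_le (column_list m k l (p, q) (S1, S2))"
proof -
 have S': "S1 : tableaux m p" "S2 : tableaux m q" "std_tableau ord p S1" "std_tableau ord q S2"
  "std_pair m ord (colset p S1 1) (colset q S2 1)"
  using S p q by (auto simp: std_rtableaux_iff first_column_eq)
 show "(S1, S2) : rtableaux m (p, q)" using S' by (simp add: rtableaux_def)
 note c1 = std_tableau_columns[OF p S'(1,3)] and c2 = std_tableau_columns[OF q S'(2,4)]
 show ci: "col_inj p S1" "col_inj q S2" using c1 c2 by auto
 note r1 = colset_range[OF p S'(1)] and r2 = colset_range[OF q S'(2)]
 have mid: "col_le ({1..m} - colset q S2 1) (colset p S1 1)"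
  using S'(5) std_pair_iff[OF r2] by simp
 have "card (colset p S1 1) <= card ({1..m} - colset q S2 1)"
  by (rule col_le_card[OF _ r1 mid]) auto
 then show "clen p 1 + clen q 1 <= m"
  using ci card_colset r2[of 1] card_mono[OF _ r2[of 1]] by (simp add: card_Diff_subset)
 show "sorted_wrt col_le (column_list m k l (p, q) (S1, S2))"
  unfolding column_list_def prod.case sorted_wrt_append
 proof (intro conjI ballI)
  show "sorted_wrt col_le (map (%c. {1..m} - colset q S2 (k - c)) [0..<k])"
   unfolding sorted_wrt_iff_nth_less
  proof (intro allI impI)
   fix i j assume "i < j" "j < length (map (%c. {1..m} - colset q S2 (k - c)) [0..<k])"
   moreover from this have "col_le ({1..m} - colset q S2 (k - i)) ({1..m} - colset q S2 (k - j))"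
    unfolding col_le_compl[OF r2 r2] by (intro c2(2)) auto
   ultimately show "col_le (map (%c. {1..m} - colset q S2 (k - c)) [0..<k] ! i)
     (map (%c. {1..m} - colset q S2 (k - c)) [0..<k] ! j)" by simp
  qed
  show "sorted_wrt col_le (map (%c. colset p S1 (Suc c)) [0..<l])"
   unfolding sorted_wrt_iff_nth_less using c1(2) by auto
  fix x y assume "x : set (map (%c. {1..m} - colset q S2 (k - c)) [0..<k])"
   and "y : set (map (%c. colset p S1 (Suc c)) [0..<l])"
  then obtain c c' where c: "c < k" "x = {1..m} - colset q S2 (k - c)" and c': "y = colset p S1 (Suc c')"
   by auto
  have "col_le x ({1..m} - colset q S2 1)"
   unfolding c col_le_compl[OF r2 r2] by (rule c2(2)) (use c in auto)
  moreover have "col_le (colset p S1 1) y" unfolding c' by (rule c1(2)) auto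
  ultimately show "col_le x y" using mid col_le_trans by blast
 qed
qed

end

definition size_list :: "nat => nat => nat => shape => nat list" where
 "size_list m k l = (%(p, q). map (%c. m - clen q (k - c)) [0..<k] @ map (%c. clen p (Suc c)) [0..<l])"

definition shape_from_sizes :: "nat => nat => nat => nat list => shape" where
 "shape_from_sizes m k l r =
   (conj_partition m (%c. r ! (k + c - 1)) l, conj_partition m (%c. m - r ! (k - c)) k)"

lemma conj_partition_cong:
 "(!!c. 1 <= c ==> c <= k ==> r c = r' c) ==> conj_partition m r k = conj_partition m r' k"
 unfolding conj_partition_def by (intro map_cong refl arg_cong[of _ _ card]) auto

lemma shape_from_size_list:
 assumes "p : partitions m" "q : partitions m" "fits p l" "fits q k"
 shows "shape_from_sizes m k l (size_list m k l (p, q)) = (p, q)"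
proof -
 have "conj_partition m (%c. size_list m k l (p, q) ! (k + c - 1)) l = conj_partition m (clen p) l"
  by (rule conj_partition_cong) (auto simp: size_list_def nth_append)
 moreover have "conj_partition m (%c. m - size_list m k l (p, q) ! (k - c)) k = conj_partition m (clen q) k"
  by (rule conj_partition_cong) (use young_initial(2)[OF assms(2)] in \<open>auto simp: size_list_def nth_append\<close>)
 ultimately show ?thesis
  using partition_conj[OF assms(1,3)] partition_conj[OF assms(2,4)] by (simp add: shape_from_sizes_def)
qed

lemma card_column_list:
 assumes "p : partitions m" "q : partitions m" "(S1, S2) : rtableaux m (p, q)" "col_inj p S1" "col_inj q S2"
 shows "map card (column_list m k l (p, q) (S1, S2)) = size_list m k l (p, q)"
proof -
 have "colset q S2 c \<subseteq> {1..m}" for c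
  using assms colset_range[of q m S2] by (auto simp: rtableaux_def)
 then show ?thesis
  using assms card_colset by (auto simp: column_list_def size_list_def card_Diff_subset)
qed

lemma column_list_range:
 assumes "p : partitions m" "(S1, S2) : rtableaux m (p, q)" "C : set (column_list m k l (p, q) (S1, S2))"
 shows "C \<subseteq> {1..m}"
 using assms colset_range[of p m S1] by (auto simp: column_list_def rtableaux_def)

context ordered_letters
begin

text \<open>The sizes of the columns recover the shape, and each standard tableau is recovered from its
 column sets.\<close>

lemma column_list_inj:
 assumes p: "p : partitions m" and q: "q : partitions m" and f: "fits p l" "fits q k"
  and p': "p' : partitions m" and q': "q' : partitions m" and f': "fits p' l" "fits q' k"
  and S: "(S1, S2) : std_rtableaux m ord (p, q)" and S': "(S1', S2') : std_rtableaux m ord (p', q')"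
  and eq: "column_list m k l (p, q) (S1, S2) = column_list m k l (p', q') (S1', S2')"
 shows "(p, q) = (p', q') & (S1, S2) = (S1', S2')"
proof -
 note F = std_rtableaux_facts[OF p q S] and F' = std_rtableaux_facts[OF p' q' S']
 have sz: "size_list m k l (p, q) = size_list m k l (p', q')"
  using card_column_list[OF p q F(1-3), of k l] card_column_list[OF p' q' F'(1-3), of k l] eq by simp
 have "(p, q) = shape_from_sizes m k l (size_list m k l (p, q))"
  by (rule shape_from_size_list[OF p q f, symmetric])
 also have "... = (p', q')"
  unfolding sz by (rule shape_from_size_list[OF p' q' f'])
 finally have pq: "p = p'" "q = q'" by auto
 have len: "length (map (%c. {1..m} - colset q S2 (k - c)) [0..<k]) =
   length (map (%c. {1..m} - colset q' S2' (k - c)) [0..<k])" by simp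
 have e1: "map (%c. {1..m} - colset q S2 (k - c)) [0..<k] = map (%c. {1..m} - colset q' S2' (k - c)) [0..<k]"
  and e2: "map (%c. colset p S1 (Suc c)) [0..<l] = map (%c. colset p' S1' (Suc c)) [0..<l]"
  using eq append_eq_append_conv[of "map (%c. {1..m} - colset q S2 (k - c)) [0..<k]"
   "map (%c. {1..m} - colset q' S2' (k - c)) [0..<k]"] len
  by (simp_all add: column_list_def)
 have tabs: "S1 : tableaux m p" "S2 : tableaux m q" "S1' : tableaux m p" "S2' : tableaux m q"
  "std_tableau ord p S1" "std_tableau ord q S2" "std_tableau ord p S1'" "std_tableau ord q S2'"
  using S S' pq by (auto simp: std_rtableaux_iff)
 have c1: "colset p S1 c = colset p S1' c" if "1 <= c" "c <= l" for c
  using arg_cong[OF e2, of "%xs. xs ! (c - 1)"] that pq by simp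
 have c2: "colset q S2 c = colset q S2' c" if "1 <= c" "c <= k" for c
 proof -
  have "{1..m} - colset q S2 c = {1..m} - colset q S2' c"
   using arg_cong[OF e1, of "%xs. xs ! (k - c)"] that pq by simp
  then show ?thesis
   using colset_range[OF q tabs(2), of c] colset_range[OF q tabs(4), of c] by blast
 qed
 have uniq: "T = T'" if r: "r : partitions m" "fits r n" and T: "T : tableaux m r" "T' : tableaux m r"
  and s: "std_tableau ord r T" "std_tableau ord r T'"
  and c: "!!c. 1 <= c ==> c <= n ==> colset r T c = colset r T' c" for r n T T'
 proof (rule PiE_ext)
  show "T : young r \<rightarrow>\<^sub>E {1..m}" "T' : young r \<rightarrow>\<^sub>E {1..m}" using T by (auto simp: tableaux_def)
  fix b assume b: "b : young r"
  then obtain i c' where bb: "b = (i, c')" "1 <= c'" "c' <= n"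
   using young_Sigma[OF r] by auto
  then show "T b = T' b"
   using std_tableau_columns(3)[OF r(1) T(1) s(1), of i c'] std_tableau_columns(3)[OF r(1) T(2) s(2), of i c'] c b
   by simp
 qed
 have "S1 = S1'" by (rule uniq[OF p f(1) tabs(1,3,5,7) c1])
 moreover have "S2 = S2'" by (rule uniq[OF q f(2) tabs(2,4,6,8) c2])
 ultimately show ?thesis using pq by simp
qed

text \<open>The order is reversed by complements, so the first \<open>k\<close> members of a chain give the columns of
 the second tableau in reverse, and the other members those of the first.\<close>

lemma chain_tableau:
 assumes L: "!!C. C : set L ==> C \<subseteq> {1..m}" and len: "length L = k + l" and chain: "sorted_wrt col_le L"
  and pq: "(p, q) = shape_from_sizes m k l (map card L)"
 shows "p : partitions m" "q : partitions m" "fits p l" "fits q k"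
  and "\<exists>S \<in> std_rtableaux m ord (p, q). column_list m k l (p, q) S = L"
proof -
 let ?C = "%c. L ! (k + c - 1)" and ?D = "%c. {1..m} - L ! (k - c)"
 have sub: "L ! i \<subseteq> {1..m}" if "i < k + l" for i using L[of "L ! i"] that len by simp
 have le: "col_le (L ! i) (L ! j)" if "i < j" "j < k + l" for i j
  using chain that len by (simp add: sorted_wrt_iff_nth_less)
 have p_eq: "p = conj_partition m (%c. card (?C c)) l"
  using pq len unfolding shape_from_sizes_def by (auto intro!: conj_partition_cong)
 have q_eq: "q = conj_partition m (%c. card (?D c)) k"
 proof -
  have "card (?D c) = m - card (L ! (k - c))" if "1 <= c" "c <= k" for c
   using sub[of "k - c"] that finite_subset[OF sub[of "k - c"]] by (subst card_Diff_subset) auto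
  then show ?thesis using pq len unfolding shape_from_sizes_def by (auto intro!: conj_partition_cong)
 qed
 have C: "?C c \<subseteq> {1..m}" if "1 <= c" "c <= l" for c using sub[of "k + c - 1"] that by simp
 have CC: "col_le (?C c) (?C c')" if "1 <= c" "c < c'" "c' <= l" for c c'
  using le[of "k + c - 1" "k + c' - 1"] that by simp
 have DD: "col_le (?D c) (?D c')" if "1 <= c" "c < c'" "c' <= k" for c c'
  using le[of "k - c'" "k - c"] that col_le_compl[OF sub sub, of "k - c" "k - c'"] by simp
 note t1 = tab_of[where C = ?C and k = l, OF C CC, folded p_eq]
 note t2 = tab_of[where C = ?D and k = k, OF _ DD, folded q_eq]
 show p: "p : partitions m" "fits p l" and q: "q : partitions m" "fits q k" using t1 t2 by auto
 let ?S1 = "tab_of p ?C" and ?S2 = "tab_of q ?D"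
 have z: "colset r T 1 = {}" if "fits r 0" for r T
  using that by (simp add: colset_def fits_def)
 have "col_le ({1..m} - colset q ?S2 1) (colset p ?S1 1)"
 proof (cases "l = 0")
  case True
  then show ?thesis using z p(2) col_le_empty by auto
 next
  case l: False
  then have c1: "colset p ?S1 1 = L ! k" using t1(5)[of 1] by simp
  show ?thesis
  proof (cases "k = 0")
   case True
   then have "{1..m} - colset q ?S2 1 = {1..m}" using z q(2) by auto
   moreover have "below (L ! k) j <= below {1..m} j" for j
    unfolding below_def by (rule card_mono) (use sub[of k] l in auto)
   ultimately show ?thesis unfolding c1 col_le_def by simp
  next
   case False
   then have "colset q ?S2 1 = {1..m} - L ! (k - 1)" using t2(5)[of 1] by simp
   then have "{1..m} - colset q ?S2 1 = L ! (k - 1)" using sub[of "k - 1"] False by (simp add: double_diff)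
   then show ?thesis unfolding c1 using le[of "k - 1" k] False l by simp
  qed
 qed
 then have S: "(?S1, ?S2) : std_rtableaux m ord (p, q)"
  using t1 t2 p q colset_range[OF q(1), of ?S2] by (simp add: std_rtableaux_iff first_column_eq std_pair_iff)
 have "column_list m k l (p, q) (?S1, ?S2) = L"
 proof (rule nth_equalityI)
  fix i assume "i < length (column_list m k l (p, q) (?S1, ?S2))"
  then have i: "i < k + l" by simp
  show "column_list m k l (p, q) (?S1, ?S2) ! i = L ! i"
  proof (cases "i < k")
   case True
   then have "colset q ?S2 (k - i) = {1..m} - L ! i" using t2(5)[of "k - i"] by simp
   then show ?thesis using True sub[OF i] by (auto simp: column_list_def nth_append)
  next
   case False
   then have "colset p ?S1 (Suc (i - k)) = L ! i" using t1(5)[of "Suc (i - k)"] i by simp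
   moreover have "i - k < l" using False i by simp
   ultimately show ?thesis using False by (simp add: column_list_def nth_append)
  qed
 qed (simp add: len)
 then show "\<exists>S \<in> std_rtableaux m ord (p, q). column_list m k l (p, q) S = L" using S by blast
qed

end

section \<open>Weights and shapes\<close>

definition good_shape :: "nat => shape => bool" where
 "good_shape m = (%(p, q). p : partitions m & q : partitions m & plen p + plen q <= m)"

lemma plen_eq_clen: "p : partitions m ==> plen p = clen p 1"
proof -
 assume p: "p : partitions m"
 have "{i. (i, 1) : young p} = Suc ` {i. i < length p & p ! i ~= 0}"
 proof (intro equalityI subsetI)
  fix i assume "i : {i. (i, 1) : young p}"
  then show "i : Suc ` {i. i < length p & p ! i ~= 0}"
   by (intro image_eqI[of _ _ "i - 1"]) (auto simp: young_def)
 qed (auto simp: young_def)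
 then show ?thesis
  by (simp add: clen_def plen_def length_filter_conv_card card_image)
qed

lemma nonzero_iff_plen: "p : partitions m ==> i < m ==> p ! i ~= 0 \<longleftrightarrow> i < plen p"
 using le_clen_iff[of p m "Suc i" 1] by (auto simp: plen_eq_clen)

lemma bracket_nth:
 assumes "length p = m" "length q = m" "i < m"
 shows "bracket (p, q) ! i = int (p ! i) - int (q ! (m - 1 - i))"
 using assms by (simp add: bracket_def rev_nth)

lemma length_bracket [simp]: "length (bracket (p, q)) = min (length p) (length q)"
 by (simp add: bracket_def)

lemma good_shape_parts:
 assumes "good_shape m (p, q)" "i < m"
 shows "int (p ! i) = max 0 (bracket (p, q) ! i)" "int (q ! (m - 1 - i)) = max 0 (- bracket (p, q) ! i)"
proof -
 have pq: "p : partitions m" "q : partitions m" and le: "plen p + plen q <= m"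
  using assms(1) by (auto simp: good_shape_def)
 have "p ! i = 0 \<or> q ! (m - 1 - i) = 0"
  using nonzero_iff_plen[OF pq(1), of i] nonzero_iff_plen[OF pq(2), of "m - 1 - i"] le assms(2) by linarith
 moreover have "bracket (p, q) ! i = int (p ! i) - int (q ! (m - 1 - i))"
  using bracket_nth[of p m q i] pq assms(2) by (simp add: partitions_length)
 ultimately show "int (p ! i) = max 0 (bracket (p, q) ! i)" "int (q ! (m - 1 - i)) = max 0 (- bracket (p, q) ! i)"
  by auto
qed

lemma bracket_inj:
 assumes s: "good_shape m (p, q)" and s': "good_shape m (p', q')" and eq: "bracket (p, q) = bracket (p', q')"
 shows "p = p' & q = q'"
proof -
 have len: "length p = m" "length q = m" "length p' = m" "length q' = m"
  using s s' partitions_length by (auto simp: good_shape_def)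
 have "p = p'"
 proof (rule nth_equalityI)
  fix i assume "i < length p"
  then have "int (p ! i) = int (p' ! i)"
   using good_shape_parts(1)[OF s] good_shape_parts(1)[OF s'] eq len by simp
  then show "p ! i = p' ! i" by simp
 qed (simp add: len)
 moreover have "q = q'"
 proof (rule nth_equalityI)
  fix i assume i: "i < length q"
  then have "m - 1 - (m - 1 - i) = i" using len by simp
  then have "int (q ! i) = int (q' ! i)"
   using good_shape_parts(2)[OF s, of "m - 1 - i"] good_shape_parts(2)[OF s', of "m - 1 - i"] eq len i by simp
  then show "q ! i = q' ! i" by simp
 qed (simp add: len)
 ultimately show ?thesis by simp
qed

lemma bracket_in_Xplus:
 assumes "p : partitions m" "q : partitions m"
 shows "bracket (p, q) : Xplus m"
 unfolding Xplus_def sorted_wrt_iff_nth_less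
proof (intro CollectI conjI allI impI)
 show len: "length (bracket (p, q)) = m" using assms by (simp add: partitions_length)
 fix i j assume ij: "i < j" "j < length (bracket (p, q))"
 then have j: "j < m" by (simp only: len)
 have "p ! j <= p ! i" by (rule partitions_mono[OF assms(1)]) (use ij j in auto)
 moreover have "q ! (m - 1 - i) <= q ! (m - 1 - j)"
  by (rule partitions_mono[OF assms(2)]) (use ij j in auto)
 ultimately show "bracket (p, q) ! j <= bracket (p, q) ! i"
  using bracket_nth[of p m q] partitions_length assms ij j by simp
qed

lemma Xplus_shape:
 assumes "lam : Xplus m"
 shows "\<exists>p q. good_shape m (p, q) & bracket (p, q) = lam"
proof -
 have len: "length lam = m" and dec: "!!i j. i < j ==> j < m ==> lam ! j <= lam ! i"
  using assms by (auto simp: Xplus_def sorted_wrt_iff_nth_less)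
 define p where "p = map nat lam"
 define q where "q = rev (map (%a. nat (- a)) lam)"
 have nth: "i < m ==> p ! i = nat (lam ! i)" "i < m ==> q ! (m - 1 - i) = nat (- lam ! i)" for i
  using len by (auto simp: p_def q_def rev_nth)
 have p: "p : partitions m"
  using len dec by (auto simp: p_def partitions_def sorted_wrt_iff_nth_less nat_mono)
 have q: "q : partitions m"
  using len dec by (auto simp: q_def partitions_def sorted_wrt_iff_nth_less rev_nth nat_mono)
 have "plen p + plen q <= m"
 proof (rule ccontr)
  assume n: "\<not> plen p + plen q <= m"
  have le: "plen p <= m" "plen q <= m"
   using p q by (auto simp: plen_def partitions_length intro: order_trans[OF length_filter_le])
  let ?i = "plen p - 1"
  have "?i < m" "?i < plen p" "m - 1 - ?i < plen q" "m - 1 - ?i < m" using n le by auto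
  then have "p ! ?i ~= 0" "q ! (m - 1 - ?i) ~= 0"
   using nonzero_iff_plen[OF p] nonzero_iff_plen[OF q] by blast+
  then show False using nth[of ?i] \<open>?i < m\<close> by auto
 qed
 moreover have "bracket (p, q) = lam"
  by (rule nth_equalityI)
   (use bracket_nth[of p m q] p q len nth in \<open>auto simp: partitions_length\<close>)
 ultimately show ?thesis using p q by (auto simp: good_shape_def)
qed

lemma shape_of_bracket:
 assumes "good_shape m (p, q)"
 shows "shape_of m (bracket (p, q)) = (p, q)"
 unfolding shape_of_def
proof (rule the_equality)
 show "case (p, q) of (p', q') => p' : partitions m & q' : partitions m & plen p' + plen q' <= m \<and>
   bracket (p, q) = bracket (p', q')"
  using assms by (auto simp: good_shape_def)
 fix s assume "case s of (p', q') => p' : partitions m & q' : partitions m & plen p' + plen q' <= m \<and>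
   bracket (p, q) = bracket (p', q')"
 then show "s = (p, q)"
  using bracket_inj[OF _ assms] by (cases s) (auto simp: good_shape_def)
qed

lemma shape_of_good:
 assumes "lam : Xplus m"
 shows "good_shape m (shape_of m lam)" "bracket (shape_of m lam) = lam"
 using Xplus_shape[OF assms] shape_of_bracket by auto

lemma card_eq_sum_of_bool: "finite A ==> card {x : A. P x} = (\<Sum>x\<in>A. of_bool (P x))"
 by (simp add: Int_def flip: sum.inter_filter)

lemma sum_partition_parts:
 assumes p: "p : partitions m" and f: "fits p k" and I: "finite I" "I \<subseteq> {..<m}"
 shows "(\<Sum>i\<in>I. p ! i) = (\<Sum>c\<in>{1..k}. card {i : I. Suc i <= clen p c})"
proof -
 have "(\<Sum>i\<in>I. p ! i) = (\<Sum>i\<in>I. \<Sum>c\<in>{1..k}. of_bool (Suc i <= clen p c))"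
 proof (rule sum.cong[OF refl])
  fix i assume "i : I"
  then have "p ! i = card {c : {1..k}. Suc i <= clen p c}"
   using I by (subst partition_conj[OF p f]) (auto simp: conj_partition_def simp del: upt_Suc)
  then show "p ! i = (\<Sum>c\<in>{1..k}. of_bool (Suc i <= clen p c))"
   by (simp only: card_eq_sum_of_bool[OF finite_atLeastAtMost])
 qed
 also have "... = (\<Sum>c\<in>{1..k}. card {i : I. Suc i <= clen p c})"
  by (subst sum.swap) (simp only: card_eq_sum_of_bool[OF I(1)])
 finally show ?thesis .
qed

lemma sum_list_upt: "sum_list (map f [0..<n]) = (\<Sum>c\<in>{0..<n}. f c)"
 for f :: "nat => 'a::comm_monoid_add"
 by (induction n) (auto simp: add.commute)

text \<open>The number of boxes in the first \<open>j\<close> rows, column by column.\<close>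

lemma partial_sum_bracket:
 assumes p: "p : partitions m" and q: "q : partitions m" and f: "fits p l" "fits q k" and j: "j <= m"
 shows "sum_list (take j (bracket (p, q))) = int (\<Sum>r\<leftarrow>size_list m k l (p, q). min j r) - int (j * k)"
proof -
 have len: "length p = m" "length q = m" using p q by (auto simp: partitions_length)
 have "sum_list (take j (bracket (p, q))) = (\<Sum>i\<in>{0..<j}. bracket (p, q) ! i)"
  using j len by (simp add: sum_list_sum_nth)
 also have "... = (\<Sum>i\<in>{0..<j}. int (p ! i) - int (q ! (m - 1 - i)))"
  by (rule sum.cong) (use j len in \<open>auto simp: bracket_nth\<close>)
 also have "... = int (\<Sum>i\<in>{0..<j}. p ! i) - int (\<Sum>i\<in>{0..<j}. q ! (m - 1 - i))"
  by (simp add: sum_subtractf)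
 also have "(\<Sum>i\<in>{0..<j}. p ! i) = (\<Sum>c\<in>{1..l}. min j (clen p c))"
 proof -
  have "{i : {0..<j}. Suc i <= x} = {0..<min j x}" for x by auto
  then show ?thesis
   using sum_partition_parts[OF p f(1), of "{0..<j}"] j by (simp add: subset_iff)
 qed
 also have "(\<Sum>i\<in>{0..<j}. q ! (m - 1 - i)) = (\<Sum>c\<in>{1..k}. j - min j (m - clen q c))"
 proof -
  have "(\<Sum>i\<in>{0..<j}. q ! (m - 1 - i)) = (\<Sum>i\<in>{m - j..<m}. q ! i)"
   by (rule sum.reindex_bij_witness[of _ "%i. m - 1 - i" "%i. m - 1 - i"]) (use j in auto)
  also have "... = (\<Sum>c\<in>{1..k}. card {i : {m - j..<m}. Suc i <= clen q c})"
   by (rule sum_partition_parts[OF q f(2)]) auto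
  also have "... = (\<Sum>c\<in>{1..k}. j - min j (m - clen q c))"
  proof (rule sum.cong[OF refl])
   fix c
   have "{i : {m - j..<m}. Suc i <= clen q c} = {m - j..<clen q c}"
    using young_initial(2)[OF q, of c] by auto
   then show "card {i : {m - j..<m}. Suc i <= clen q c} = j - min j (m - clen q c)"
    using young_initial(2)[OF q, of c] j by simp
  qed
  finally show ?thesis .
 qed
 also have "int (\<Sum>c\<in>{1..k}. j - min j (m - clen q c)) = int (j * k) - int (\<Sum>c\<in>{1..k}. min j (m - clen q c))"
  by (simp add: sum_subtractf of_nat_diff)
 finally have "sum_list (take j (bracket (p, q))) =
   int ((\<Sum>c\<in>{1..k}. min j (m - clen q c)) + (\<Sum>c\<in>{1..l}. min j (clen p c))) - int (j * k)" by simp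
 also have "(\<Sum>c\<in>{1..k}. min j (m - clen q c)) + (\<Sum>c\<in>{1..l}. min j (clen p c)) =
   (\<Sum>r\<leftarrow>size_list m k l (p, q). min j r)"
 proof -
  have "(\<Sum>c\<in>{1..k}. min j (m - clen q c)) = (\<Sum>c\<in>{0..<k}. min j (m - clen q (k - c)))"
   by (rule sum.reindex_bij_witness[of _ "%c. k - c" "%c. k - c"]) auto
  moreover have "(\<Sum>c\<in>{1..l}. min j (clen p c)) = (\<Sum>c\<in>{0..<l}. min j (clen p (Suc c)))"
   by (rule sum.reindex_bij_witness[of _ Suc "%c. c - 1"]) auto
  ultimately show ?thesis
   by (simp add: size_list_def comp_def sum_list_upt)
 qed
 finally show ?thesis .
qed

lemma dom_le_bracket:
 assumes p: "p : partitions m" and q: "q : partitions m" and f: "fits p l" "fits q k"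
  and p': "p' : partitions m" and q': "q' : partitions m" and f': "fits p' l" "fits q' k"
  and le: "!!j. (\<Sum>r\<leftarrow>size_list m k l (p', q'). min j r) <= (\<Sum>r\<leftarrow>size_list m k l (p, q). min j r)"
  and eq: "sum_list (size_list m k l (p', q')) = sum_list (size_list m k l (p, q))"
 shows "dom_le (bracket (p', q')) (bracket (p, q))"
proof -
 have len: "length (bracket (p, q)) = m" "length (bracket (p', q')) = m"
  using p q p' q' by (auto simp: partitions_length)
 have top: "(\<Sum>r\<leftarrow>size_list m k l (a, b). min m r) = sum_list (size_list m k l (a, b))"
  if "a : partitions m" for a b
 proof -
  have "\<forall>r \<in> set (size_list m k l (a, b)). min m r = r"
   using young_initial(2)[OF that] by (auto simp: size_list_def)
  then have "map (min m) (size_list m k l (a, b)) = size_list m k l (a, b)" by (simp add: map_idI)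
  then show ?thesis by simp
 qed
 note ps = partial_sum_bracket[OF p q f] and ps' = partial_sum_bracket[OF p' q' f']
 have "sum_list (bracket (p', q')) = sum_list (bracket (p, q))"
  using ps[of m] ps'[of m] len eq by (simp add: top p p')
 moreover have "sum_list (take j (bracket (p', q'))) <= sum_list (take j (bracket (p, q)))" if "j <= m" for j
  using ps[OF that] ps'[OF that] le[of j] by simp
 ultimately show ?thesis using len by (simp add: dom_le_def)
qed

lemma card_young_content:
 assumes p: "p : partitions m" and f: "fits p k" and inj: "col_inj p T"
 shows "card {b : young p. T b = i} = (\<Sum>c\<in>{1..k}. of_bool (i : colset p T c))"
proof -
 let ?R = "%c. {a : {1..clen p c}. T (a, c) = i}"
 have "{b : young p. T b = i} = (%(c, a). (a, c)) ` (SIGMA c : {1..k}. ?R c)"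
  unfolding young_Sigma[OF p f] by auto
 moreover have "inj_on (%(c, a). (a, c)) (SIGMA c : {1..k}. ?R c)"
  by (auto simp: inj_on_def)
 ultimately have "card {b : young p. T b = i} = (\<Sum>c\<in>{1..k}. card (?R c))"
  by (simp add: card_image)
 also have "... = (\<Sum>c\<in>{1..k}. of_bool (i : colset p T c))"
 proof (rule sum.cong[OF refl])
  fix c
  have i: "inj_on (%a. T (a, c)) {1..clen p c}" using inj by (simp add: col_inj_def)
  show "card (?R c) = of_bool (i : colset p T c)"
  proof (cases "i : colset p T c")
   case True
   then obtain a where a: "a : {1..clen p c}" "T (a, c) = i" by (auto simp: colset_def)
   have "x = a" if "x : ?R c" for x using inj_onD[OF i, of x a] a that by auto
   then have "?R c = {a}" using a by blast
   then show ?thesis using True by simp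
  next
   case False
   then have "?R c = {}" by (auto simp: colset_def)
   then show ?thesis using False by (simp only: card.empty) simp
  qed
 qed
 finally show ?thesis .
qed

lemma wt_column_list:
 assumes p: "p : partitions m" and q: "q : partitions m" and f: "fits p l" "fits q k"
  and S: "(S1, S2) : rtableaux m (p, q)" and inj: "col_inj p S1" "col_inj q S2"
 shows "wt m (p, q) (S1, S2) = map (%i. int (\<Sum>C\<leftarrow>column_list m k l (p, q) (S1, S2). of_bool (i : C)) - int k) [1..<m + 1]"
 unfolding wt_def prod.case
proof (intro map_cong refl)
 fix i assume "i : set [1..<m + 1]"
 then have i: "i : {1..m}" by auto
 have r: "colset q S2 c \<subseteq> {1..m}" for c
  using colset_range[OF q] S by (auto simp: rtableaux_def)
 have "(\<Sum>C\<leftarrow>column_list m k l (p, q) (S1, S2). of_bool (i : C)) =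
   (\<Sum>c\<in>{0..<k}. of_bool (i : {1..m} - colset q S2 (k - c))) + (\<Sum>c\<in>{0..<l}. of_bool (i : colset p S1 (Suc c)) :: nat)"
  by (simp only: column_list_def prod.case map_append sum_list_append map_map comp_def sum_list_upt)
 also have "(\<Sum>c\<in>{0..<l}. of_bool (i : colset p S1 (Suc c)) :: nat) = (\<Sum>c\<in>{1..l}. of_bool (i : colset p S1 c))"
  by (rule sum.reindex_bij_witness[of _ "%c. c - 1" Suc]) auto
 also have "(\<Sum>c\<in>{0..<k}. of_bool (i : {1..m} - colset q S2 (k - c)) :: nat) =
   (\<Sum>c\<in>{1..k}. of_bool (i : {1..m} - colset q S2 c))"
  by (rule sum.reindex_bij_witness[of _ "%c. k - c" "%c. k - c"]) auto
 also have "int ((\<Sum>c\<in>{1..k}. of_bool (i : {1..m} - colset q S2 c)) + (\<Sum>c\<in>{1..l}. of_bool (i : colset p S1 c))) =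
   int k - int (\<Sum>c\<in>{1..k}. of_bool (i : colset q S2 c)) + int (\<Sum>c\<in>{1..l}. of_bool (i : colset p S1 c))"
 proof -
  have "(\<Sum>c\<in>{1..k}. of_bool (i : {1..m} - colset q S2 c) :: int) = (\<Sum>c\<in>{1..k}. 1 - of_bool (i : colset q S2 c))"
   by (rule sum.cong) (use i in auto)
  then show ?thesis by (simp add: sum_subtractf)
 qed
 finally show "int (card {b : young p. S1 b = i}) - int (card {b : young q. S2 b = i}) =
   int (\<Sum>C\<leftarrow>column_list m k l (p, q) (S1, S2). of_bool (i : C)) - int k"
  using card_young_content[OF p f(1) inj(1), of i] card_young_content[OF q f(2) inj(2), of i] by simp
qed

context ordered_letters
begin

lemma std_good_shape:
 assumes "p : partitions m" "q : partitions m" "S : std_rtableaux m ord (p, q)"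
 shows "good_shape m (p, q)"
 using std_rtableaux_facts(4)[of p q "fst S" "snd S"] assms by (auto simp: good_shape_def plen_eq_clen)

lemma chain_bidet:
 assumes A: "A : carrier_mat m m" and d: "det A ~= 0"
  and v: "valid_list ws" and srt: "sorted_wrt pair_le ws" and len: "length ws = k + l"
 obtains p q U1 U2 V1 V2 where "p : partitions m" "q : partitions m" "fits p l" "fits q k"
  and "(U1, U2) : std_rtableaux m ord (p, q)" "column_list m k l (p, q) (U1, U2) = map fst ws"
  and "(V1, V2) : std_rtableaux m ord (p, q)" "column_list m k l (p, q) (V1, V2) = map snd ws"
  and "pm_eq (bidet_at A (p, q) (U1, U2) (V1, V2)) ((1 / det A) ^ k * brackets (x_at A) ws)"
proof -
 let ?L = "map fst ws" and ?M = "map snd ws"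
 have cLM: "map card ?L = map card ?M"
  using v by (auto simp: valid_list_def valid_pair_def)
 have L: "C : set ?L ==> C \<subseteq> {1..m}" and M: "C : set ?M ==> C \<subseteq> {1..m}" for C
  using v by (auto simp: valid_list_def valid_pair_def)
 have chain: "sorted_wrt col_le ?L" "sorted_wrt col_le ?M"
  using srt by (auto simp: sorted_wrt_map pair_le_def elim: sorted_wrt_mono_rel[rotated])
 obtain p q where pq: "(p, q) = shape_from_sizes m k l (map card ?L)"
  by (metis surj_pair)
 note tL = chain_tableau[OF L _ chain(1) pq] and tM = chain_tableau[OF M _ chain(2) pq[unfolded cLM]]
 have p: "p : partitions m" and q: "q : partitions m" and f: "fits p l" "fits q k"
  using tL(1-4) len by auto
 obtain U1 U2 where U: "(U1, U2) : std_rtableaux m ord (p, q)" "column_list m k l (p, q) (U1, U2) = ?L"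
  using tL(5) len by auto
 obtain V1 V2 where V: "(V1, V2) : std_rtableaux m ord (p, q)" "column_list m k l (p, q) (V1, V2) = ?M"
  using tM(5) len by auto
 note FU = std_rtableaux_facts[OF p q U(1)] and FV = std_rtableaux_facts[OF p q V(1)]
 have "pm_eq (bidet_at A (p, q) (U1, U2) (V1, V2)) ((1 / det A) ^ k * brackets (x_at A) (zip ?L ?M))"
  unfolding brackets_def
  using bidet_at_brackets[OF A d p q f FU(1) FV(1) FU(2,3) FV(2,3)] U(2) V(2) by simp
 then show thesis
  using that[OF p q f U V] by (simp add: zip_map_fst_snd)
qed

text \<open>Straightening of rational bitableaux: the complementation of columns turns rational standardness
 into ordinary standardness of the sequence of columns, and a common power of the determinant
 accounts for the second tableaux.\<close>

theorem rational_straightening: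
 assumes A: "A : carrier_mat m m" and d: "det A ~= 0" and lam: "lam : Xplus m"
  and S: "S : rtableaux m (shape_of m lam)" and T: "T : rtableaux m (shape_of m lam)"
 shows "bidet_at A (shape_of m lam) S T : zmod.span
  {bidet_at A (shape_of m mu) S' T' | mu S' T'. mu : Xplus m & dom_le mu lam \<and>
    S' : std_rtableaux m ord (shape_of m mu) & T' : std_rtableaux m ord (shape_of m mu) \<and>
    bwt m (shape_of m mu) S' T' = bwt m (shape_of m lam) S T}"
  (is "_ : zmod.span ?R")
proof -
 obtain p q where s: "shape_of m lam = (p, q)" by (cases "shape_of m lam")
 obtain S1 S2 where Se: "S = (S1, S2)" by (cases S)
 obtain T1 T2 where Te: "T = (T1, T2)" by (cases T)
 have p: "p : partitions m" and q: "q : partitions m" and lam_eq: "bracket (p, q) = lam"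
  using shape_of_good[OF lam] s by (auto simp: good_shape_def)
 show ?thesis
 proof (cases "col_inj p S1 & col_inj q S2 & col_inj p T1 & col_inj q T2")
  case False
  then show ?thesis
   unfolding s Se Te bidet_at_not_inj[OF p q False] by (simp add: zmod.span_zero)
 next
  case inj: True
  let ?k = "sum_list q" and ?l = "sum_list p"
  note f = fits_sum_list[of p] fits_sum_list[of q]
  have S': "(S1, S2) : rtableaux m (p, q)" and T': "(T1, T2) : rtableaux m (p, q)"
   using S T s Se Te by auto
  let ?cS = "column_list m ?k ?l (p, q) (S1, S2)" and ?cT = "column_list m ?k ?l (p, q) (T1, T2)"
  let ?ws = "zip ?cS ?cT"
  have cards: "map card ?cS = size_list m ?k ?l (p, q)" "map card ?cT = size_list m ?k ?l (p, q)"
   using card_column_list[OF p q S'] card_column_list[OF p q T'] inj by auto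
  have fst_ws: "map fst ?ws = ?cS" and snd_ws: "map snd ?ws = ?cT" by simp_all
  have valid: "valid_list ?ws"
   unfolding valid_list_def
  proof
   fix x assume "x : set ?ws"
   then obtain i where i: "i < ?k + ?l" "x = (?cS ! i, ?cT ! i)"
    by (auto simp: in_set_conv_nth)
   have "card (?cS ! i) = card (?cT ! i)"
    using arg_cong[OF cards(1), of "%xs. xs ! i"] arg_cong[OF cards(2), of "%xs. xs ! i"] i by simp
   moreover have "?cS ! i \<subseteq> {1..m}"
    by (rule column_list_range[OF p S' nth_mem]) (use i in simp)
   moreover have "?cT ! i \<subseteq> {1..m}"
    by (rule column_list_range[OF p T' nth_mem]) (use i in simp)
   ultimately show "valid_pair m x" using i by (simp add: valid_pair_def)
  qed
  have pm: "pm_eq (bidet_at A (p, q) (S1, S2) (T1, T2)) ((1 / det A) ^ ?k * brackets (x_at A) ?ws)"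
   unfolding brackets_def using bidet_at_brackets[OF A d p q f S' T'] inj by blast
  have "(1 / det A) ^ ?k * brackets (x_at A) ?ws \<in>
    zmod.span ((*) ((1 / det A) ^ ?k) ` {brackets (x_at A) ws' | ws'. improves ws' ?ws & sorted_wrt pair_le ws'})"
   by (rule zspan_mult_left[OF straightening[OF valid]])
  also have "... \<subseteq> zmod.span ?R"
  proof (rule zmod.span_minimal[OF _ zmod.subspace_span], clarify)
   fix ws' assume imp: "improves ws' ?ws" and srt: "sorted_wrt pair_le ws'"
   have v': "valid_list ws'" and len': "length ws' = ?k + ?l" using imp by (auto simp: improves_def)
   let ?L = "map fst ws'" and ?M = "map snd ws'"
   have L: "C : set ?L ==> C \<subseteq> {1..m}" for C
    using v' by (auto simp: valid_list_def valid_pair_def)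
   obtain p' q' U1 U2 V1 V2 where p': "p' : partitions m" and q': "q' : partitions m"
    and f': "fits p' ?l" "fits q' ?k"
    and U: "(U1, U2) : std_rtableaux m ord (p', q')" "column_list m ?k ?l (p', q') (U1, U2) = ?L"
    and V: "(V1, V2) : std_rtableaux m ord (p', q')" "column_list m ?k ?l (p', q') (V1, V2) = ?M"
    and pm': "pm_eq (bidet_at A (p', q') (U1, U2) (V1, V2)) ((1 / det A) ^ ?k * brackets (x_at A) ws')"
    by (rule chain_bidet[OF A d v' srt len'])
   note FU = std_rtableaux_facts[OF p' q' U(1)] and FV = std_rtableaux_facts[OF p' q' V(1)]
   let ?mu = "bracket (p', q')"
   have sh: "shape_of m ?mu = (p', q')"
    by (rule shape_of_bracket[OF std_good_shape[OF p' q' U(1)]])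
   have mu: "?mu : Xplus m" by (rule bracket_in_Xplus[OF p' q'])
   have sz': "size_list m ?k ?l (p', q') = map card ?L"
    using card_column_list[OF p' q' FU(1-3), of ?k ?l] U(2) by simp
   have sz: "size_list m ?k ?l (p, q) = map card (map fst ?ws)"
    using cards by simp
   have cont: "(\<Sum>C\<leftarrow>?L. of_bool (i : C)) = (\<Sum>C\<leftarrow>?cS. of_bool (i : C) :: nat)"
    "(\<Sum>C\<leftarrow>?M. of_bool (i : C)) = (\<Sum>C\<leftarrow>?cT. of_bool (i : C) :: nat)" for i
   proof -
    have "(\<Sum>C\<leftarrow>map fst ws'. of_bool (i : C)) = (\<Sum>C\<leftarrow>map fst ?ws. of_bool (i : C) :: nat)"
     "(\<Sum>C\<leftarrow>map snd ws'. of_bool (i : C)) = (\<Sum>C\<leftarrow>map snd ?ws. of_bool (i : C) :: nat)"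
     using imp unfolding improves_def map_map comp_def by blast+
    then show "(\<Sum>C\<leftarrow>?L. of_bool (i : C)) = (\<Sum>C\<leftarrow>?cS. of_bool (i : C) :: nat)"
     "(\<Sum>C\<leftarrow>?M. of_bool (i : C)) = (\<Sum>C\<leftarrow>?cT. of_bool (i : C) :: nat)"
     by (simp_all only: fst_ws snd_ws)
   qed
   have total: "sum_list (map card Cs) = (\<Sum>i\<in>{1..m}. \<Sum>C\<leftarrow>Cs. of_bool (i : C))"
    if "!!C. C : set Cs ==> C \<subseteq> {1..m}" for Cs :: "nat set list"
    using that
   proof (induction Cs)
    case (Cons C Cs)
    have "C \<subseteq> {1..m}" using Cons.prems[of C] by simp
    then have "{i : {1..m}. i : C} = C" by blast
    then have "card C = (\<Sum>i\<in>{1..m}. of_bool (i : C))"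
     by (simp only: card_eq_sum_of_bool[OF finite_atLeastAtMost, symmetric])
    then show ?case using Cons by (simp add: sum.distrib)
   qed simp
   have "sum_list (size_list m ?k ?l (p', q')) = sum_list (size_list m ?k ?l (p, q))"
    unfolding sz' sz fst_ws using total[of ?L] total[of ?cS] L column_list_range[OF p S'] cont(1) by simp
   moreover have "(\<Sum>r\<leftarrow>size_list m ?k ?l (p', q'). min j r) <= (\<Sum>r\<leftarrow>size_list m ?k ?l (p, q). min j r)" for j
    unfolding sz' sz map_map comp_def using imp by (simp add: improves_def)
   ultimately have dom: "dom_le ?mu lam"
    unfolding lam_eq[symmetric] by (intro dom_le_bracket[OF p q f p' q' f'])
   have "wt m (p', q') (U1, U2) = wt m (p, q) (S1, S2)"
    using wt_column_list[OF p q f S'] inj wt_column_list[OF p' q' f' FU(1-3)] U(2) cont(1) by simp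
   moreover have "wt m (p', q') (V1, V2) = wt m (p, q) (T1, T2)"
    using wt_column_list[OF p q f T'] inj wt_column_list[OF p' q' f' FV(1-3)] V(2) cont(2) by simp
   ultimately have bw: "bwt m (p', q') (U1, U2) (V1, V2) = bwt m (p, q) (S1, S2) (T1, T2)"
    by (simp add: bwt_def)
   have "bidet_at A (p', q') (U1, U2) (V1, V2) : ?R"
    using mu dom U(1) V(1) bw sh s Se Te by (intro CollectI exI[of _ ?mu] exI conjI) auto
   then show "(1 / det A) ^ ?k * brackets (x_at A) ws' : zmod.span ?R"
    by (rule zspan_pm_eq[OF pm_eq_sym[OF pm'] zmod.span_base])
  qed
  finally have "(1 / det A) ^ ?k * brackets (x_at A) ?ws : zmod.span ?R" .
  then show ?thesis unfolding s Se Te by (rule zspan_pm_eq[OF pm])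
 qed
qed

end

section \<open>Comultiplication of bideterminants\<close>

lemma minor_leibniz:
 "minor Z r f g = (\<Sum>p | p permutes {0..<r}. signof p * (\<Prod>a\<in>{0..<r}. Z (f a) (g (p a))))"
proof -
 have "minor Z r f g = (\<Sum>p | p permutes {0..<r}. signof p * (\<Prod>a = 0..<r. mat r r (%(a, b). Z (f a) (g b)) $$ (a, p a)))"
  unfolding minor_def by (rule det_def') simp
 also have "... = (\<Sum>p | p permutes {0..<r}. signof p * (\<Prod>a\<in>{0..<r}. Z (f a) (g (p a))))"
 proof (intro sum.cong refl arg_cong2[of _ _ _ _ "(*)"] prod.cong)
  fix p a assume "p : {p. p permutes {0..<r}}" "a : {0..<r}"
  moreover from this have "p a < r" using permutes_in_image[of p "{0..<r}" a] by simp
  ultimately show "mat r r (%(a, b). Z (f a) (g b)) $$ (a, p a) = Z (f a) (g (p a))" by simp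
 qed
 finally show ?thesis .
qed

text \<open>The Cauchy--Binet formula, for an arbitrary enumeration \<open>e K\<close> of each \<open>r\<close>-element index set
 \<open>K\<close>: reordering \<open>K\<close> changes the signs of both minors.\<close>

lemma cauchy_binet:
 fixes G H :: "nat => nat => 'a::comm_ring_1"
 assumes fin: "finite S" and e: "!!K. K \<subseteq> S ==> card K = r ==> bij_betw (e K) {0..<r} K"
 shows "minor (%i j. \<Sum>u\<in>S. G i u * H u j) r f g =
  (\<Sum>K | K \<subseteq> S & card K = r. minor G r f (e K) * minor H r (e K) g)"
proof -
 let ?P = "{p. p permutes {0..<r}}" and ?F = "{0..<r} \<rightarrow>\<^sub>E S"
 let ?t = "%\<phi>. (\<Prod>a\<in>{0..<r}. G (f a) (\<phi> a)) * minor H r \<phi> g"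
 let ?I = "{\<phi> : ?F. inj_on \<phi> {0..<r}}" and ?K = "{K. K \<subseteq> S & card K = r}"
 have finF: "finite ?F" using fin by (intro finite_PiE) auto
 have finK: "finite ?K" using fin by simp
 have "minor (%i j. \<Sum>u\<in>S. G i u * H u j) r f g =
   (\<Sum>p\<in>?P. signof p * (\<Sum>\<phi>\<in>?F. \<Prod>a\<in>{0..<r}. G (f a) (\<phi> a) * H (\<phi> a) (g (p a))))"
  unfolding minor_leibniz using fin by (intro sum.cong refl arg_cong2[of _ _ _ _ "(*)"] prod_sum_PiE) auto
 also have "... = (\<Sum>\<phi>\<in>?F. \<Sum>p\<in>?P. signof p * (\<Prod>a\<in>{0..<r}. G (f a) (\<phi> a) * H (\<phi> a) (g (p a))))"
  by (simp only: sum_distrib_left) (rule sum.swap)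
 also have "... = (\<Sum>\<phi>\<in>?F. ?t \<phi>)"
  unfolding minor_leibniz sum_distrib_left prod.distrib by (intro sum.cong refl) (simp only: ac_simps)
 also have "... = (\<Sum>\<phi>\<in>?I. ?t \<phi>)"
  by (rule sum.mono_neutral_right[OF finF]) (auto simp: minor_rows_not_inj)
 also have "... = (\<Sum>K\<in>?K. \<Sum>\<phi> | \<phi> : ?I & \<phi> ` {0..<r} = K. ?t \<phi>)"
 proof (rule sum.group[symmetric, OF _ finK])
  show "finite ?I" using finF by simp
  show "(%\<phi>. \<phi> ` {0..<r}) ` ?I \<subseteq> ?K" by (auto simp: card_image)
 qed
 also have "... = (\<Sum>K\<in>?K. minor G r f (e K) * minor H r (e K) g)"
 proof (rule sum.cong[OF refl])
  fix K assume "K : ?K"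
  then have K: "K \<subseteq> S" "card K = r" by auto
  note eK = e[OF K]
  have einj: "inj_on (e K) {0..<r}" and eim: "e K ` {0..<r} = K" using eK by (auto simp: bij_betw_def)
  let ?h = "%p. restrict (e K \<circ> p) {0..<r}"
  have pr: "p a < r" if "p : ?P" "a < r" for p a
   using that permutes_in_image[of p "{0..<r}" a] by simp
  have img: "{\<phi>. \<phi> : ?I & \<phi> ` {0..<r} = K} = ?h ` ?P"
  proof (intro equalityI subsetI)
   fix \<phi> assume "\<phi> : {\<phi>. \<phi> : ?I & \<phi> ` {0..<r} = K}"
   then have \<phi>: "\<phi> : ?F" "inj_on \<phi> {0..<r}" "\<phi> ` {0..<r} = e K ` {0..<r}" using eim by auto
   obtain p where p: "p permutes {0..<r}" "\<forall>a<r. \<phi> a = e K (p a)"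
    using reorder_permutation[OF einj \<phi>(2)] \<phi>(3) by auto
   have "\<phi> = ?h p" using \<phi>(1) p(2) by (auto simp: fun_eq_iff PiE_def extensional_def)
   then show "\<phi> : ?h ` ?P" using p by blast
  next
   fix \<phi> assume "\<phi> : ?h ` ?P"
   then obtain p where p: "p permutes {0..<r}" "\<phi> = ?h p" by auto
   have "\<phi> ` {0..<r} = e K ` p ` {0..<r}" unfolding p(2) by (auto simp: image_iff)
   then have im: "\<phi> ` {0..<r} = K" using permutes_image[OF p(1)] eim by simp
   moreover have "inj_on \<phi> {0..<r}"
    by (rule eq_card_imp_inj_on) (use im K in auto)
   moreover have "\<phi> : ?F" using im K p(2) by (auto simp: PiE_def)
   ultimately show "\<phi> : {\<phi>. \<phi> : ?I & \<phi> ` {0..<r} = K}" by simp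
  qed
  have inj: "inj_on ?h ?P"
  proof (rule inj_onI)
   fix p p' assume p: "p : ?P" "p' : ?P" and eq: "?h p = ?h p'"
   show "p = p'"
   proof
    fix a
    show "p a = p' a"
    proof (cases "a < r")
     case True
     then have "e K (p a) = e K (p' a)" using fun_cong[OF eq, of a] by simp
     then show ?thesis using einj pr[OF p(1) True] pr[OF p(2) True] by (auto simp: inj_on_def)
    next
     case False
     then show ?thesis using p by (auto simp: permutes_def)
    qed
   qed
  qed
  have "(\<Sum>\<phi> | \<phi> : ?I & \<phi> ` {0..<r} = K. ?t \<phi>) = (\<Sum>p\<in>?P. ?t (?h p))"
   unfolding img by (rule sum.reindex_cong[OF inj refl refl])
  also have "... = (\<Sum>p\<in>?P. signof p * (\<Prod>a\<in>{0..<r}. G (f a) (e K (p a))) * minor H r (e K) g)"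
  proof (rule sum.cong[OF refl])
   fix p assume p: "p : ?P"
   have "minor H r (?h p) g = minor H r (e K \<circ> p) g" by (rule minor_cong) auto
   also have "... = signof p * minor H r (e K) g" using p by (intro minor_permute_rows) simp
   finally show "?t (?h p) = signof p * (\<Prod>a\<in>{0..<r}. G (f a) (e K (p a))) * minor H r (e K) g"
    by (simp add: ac_simps)
  qed
  also have "... = minor G r f (e K) * minor H r (e K) g"
   unfolding minor_leibniz[of G] by (simp only: sum_distrib_right)
  finally show "(\<Sum>\<phi> | \<phi> : ?I & \<phi> ` {0..<r} = K. ?t \<phi>) = minor G r f (e K) * minor H r (e K) g" .
 qed
 finally show ?thesis .
qed

text \<open>Column-strict tableaux, one for each choice of the column sets \<open>\<kappa>\<close>.\<close>

definition column_choices :: "nat => nat list => (nat => nat set) set" where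
 "column_choices m p = (\<Pi>\<^sub>E c\<in>{1..sum_list p}. {K. K \<subseteq> {1..m} & card K = clen p c})"

definition tableau_from :: "(nat set => nat => nat) => nat list => (nat => nat set) => tableau" where
 "tableau_from e p \<kappa> = restrict (%(i, c). e (\<kappa> c) (i - 1)) (young p)"

definition enum_rev :: "nat set => nat => nat" where
 "enum_rev I a = rev (sorted_list_of_set I) ! a"

lemma enum_rev_bij: "finite I ==> bij_betw (enum_rev I) {0..<card I} I"
 unfolding enum_rev_def by (rule bij_betw_nth) (auto simp: atLeast0LessThan)

lemma finite_column_choices: "finite (column_choices m p)"
 unfolding column_choices_def by (intro finite_PiE) auto

lemma young_columns_bound: "(i, c) : young p ==> c : {1..sum_list p}"
 using young_le_sum_list by auto

lemma tableau_from:
 assumes p: "p : partitions m" and \<kappa>: "\<kappa> : column_choices m p"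
  and e: "!!K. finite K ==> bij_betw (e K) {0..<card K} K"
 shows "tableau_from e p \<kappa> : tableaux m p"
  and "c : {1..sum_list p} ==> \<kappa> c \<subseteq> {1..m} & card (\<kappa> c) = clen p c"
  and "c : {1..sum_list p} ==> a < clen p c ==> tableau_from e p \<kappa> (a + 1, c) = e (\<kappa> c) a"
  and "c : {1..sum_list p} ==> colset p (tableau_from e p \<kappa>) c = \<kappa> c"
  and "col_inj p (tableau_from e p \<kappa>)"
proof -
 show k: "\<kappa> c \<subseteq> {1..m} & card (\<kappa> c) = clen p c" if "c : {1..sum_list p}" for c
  using \<kappa> that unfolding column_choices_def by (auto dest: PiE_mem)
 have bij: "bij_betw (e (\<kappa> c)) {0..<clen p c} (\<kappa> c)" if "c : {1..sum_list p}" for c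
  using e[of "\<kappa> c"] k[OF that] finite_subset[of "\<kappa> c" "{1..m}"] by auto
 show val: "tableau_from e p \<kappa> (a + 1, c) = e (\<kappa> c) a" if "c : {1..sum_list p}" "a < clen p c" for a c
  using that in_young_iff[OF p, of "a + 1" c] by (simp add: tableau_from_def)
 show cs: "colset p (tableau_from e p \<kappa>) c = \<kappa> c" if "c : {1..sum_list p}" for c
 proof -
  have "colset p (tableau_from e p \<kappa>) c = e (\<kappa> c) ` {0..<clen p c}"
   unfolding colset_image by (intro image_cong refl val that) auto
  then show ?thesis using bij[OF that] by (simp add: bij_betw_def)
 qed
 show "col_inj p (tableau_from e p \<kappa>)"
  unfolding col_inj_def
 proof
  fix c
  show "inj_on (%i. tableau_from e p \<kappa> (i, c)) {1..clen p c}"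
  proof (cases "c : {1..sum_list p}")
   case True
   show ?thesis
    by (rule eq_card_imp_inj_on) (use cs[OF True] k[OF True] in \<open>simp_all add: colset_def\<close>)
  next
   case False
   then have "clen p c = 0"
    using fits_sum_list[of p] clen_0[of p] unfolding fits_def
    by (metis One_nat_def Suc_leI atLeastAtMost_iff gr0I linorder_not_less)
   then show ?thesis by simp
  qed
 qed
 show "tableau_from e p \<kappa> : tableaux m p"
  unfolding tableaux_def tableau_from_def
 proof (rule restrict_PiE_iff[THEN iffD2], rule ballI)
  fix b assume b: "b : young p"
  obtain i c where ic: "b = (i, c)" by (cases b)
  have c: "c : {1..sum_list p}" using b ic young_columns_bound by blast
  have "i - 1 : {0..<clen p c}" using b ic in_young_iff[OF p, of i c] by auto
  then have "e (\<kappa> c) (i - 1) : {1..m}" using bij_betwE[OF bij[OF c]] k[OF c] by blast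
  then show "(case b of (i, c) => e (\<kappa> c) (i - 1)) : {1..m}" using ic by simp
 qed
qed

lemma bidet_factor_product:
 assumes p: "p : partitions m" and e: "!!K. finite K ==> bij_betw (e K) {0..<card K} K"
  and Z: "!!i j. i : {1..m} ==> j : {1..m} ==> Z i j = (\<Sum>u\<in>{1..m}. G i u * H u j)"
  and S: "S : tableaux m p" and T: "T : tableaux m p"
 shows "bidet_factor Z p S T =
  (\<Sum>\<kappa>\<in>column_choices m p. bidet_factor G p S (tableau_from e p \<kappa>) * bidet_factor H p (tableau_from e p \<kappa>) T)"
proof -
 let ?k = "sum_list p"
 note f = fits_sum_list[of p]
 have ent: "U (a + 1, c) : {1..m}" if "U : tableaux m p" "a < clen p c" for U a c
  using that in_young_iff[OF p, of "a + 1" c] by (auto simp: tableaux_def dest!: PiE_mem)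
 have "bidet_factor Z p S T = (\<Prod>c\<in>{1..?k}. \<Sum>K | K \<subseteq> {1..m} & card K = clen p c.
   minor G (clen p c) (%a. S (a + 1, c)) (e K) * minor H (clen p c) (e K) (%b. T (b + 1, c)))"
  unfolding bidet_factor_minors[OF p f]
 proof (rule prod.cong[OF refl])
  fix c
  have "minor Z (clen p c) (%a. S (a + 1, c)) (%b. T (b + 1, c)) =
    minor (%i j. \<Sum>u\<in>{1..m}. G i u * H u j) (clen p c) (%a. S (a + 1, c)) (%b. T (b + 1, c))"
   by (rule minor_cong) (use Z ent S T in auto)
  also have "... = (\<Sum>K | K \<subseteq> {1..m} & card K = clen p c.
   minor G (clen p c) (%a. S (a + 1, c)) (e K) * minor H (clen p c) (e K) (%b. T (b + 1, c)))"
  proof (rule cauchy_binet[OF finite_atLeastAtMost])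
   fix K assume K: "K \<subseteq> {1..m}" "card K = clen p c"
   then show "bij_betw (e K) {0..<clen p c} K" using e[of K] finite_subset[OF K(1)] by simp
  qed
  finally show "minor Z (clen p c) (%a. S (a + 1, c)) (%b. T (b + 1, c)) = (\<Sum>K | K \<subseteq> {1..m} & card K = clen p c.
   minor G (clen p c) (%a. S (a + 1, c)) (e K) * minor H (clen p c) (e K) (%b. T (b + 1, c)))" .
 qed
 also have "... = (\<Sum>\<kappa>\<in>column_choices m p. \<Prod>c\<in>{1..?k}.
   minor G (clen p c) (%a. S (a + 1, c)) (e (\<kappa> c)) * minor H (clen p c) (e (\<kappa> c)) (%b. T (b + 1, c)))"
  unfolding column_choices_def by (rule prod_sum_PiE) auto
 also have "... = (\<Sum>\<kappa>\<in>column_choices m p. bidet_factor G p S (tableau_from e p \<kappa>) * bidet_factor H p (tableau_from e p \<kappa>) T)"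
 proof (rule sum.cong[OF refl])
  fix \<kappa> assume \<kappa>: "\<kappa> : column_choices m p"
  note tf = tableau_from(3)[OF p \<kappa> e]
  show "(\<Prod>c\<in>{1..?k}. minor G (clen p c) (%a. S (a + 1, c)) (e (\<kappa> c)) * minor H (clen p c) (e (\<kappa> c)) (%b. T (b + 1, c))) =
   bidet_factor G p S (tableau_from e p \<kappa>) * bidet_factor H p (tableau_from e p \<kappa>) T"
   unfolding bidet_factor_minors[OF p f] prod.distrib[symmetric]
   by (intro prod.cong refl arg_cong2[of _ _ _ _ "(*)"] minor_cong; simp only: tf)
 qed
 finally show ?thesis .
qed

text \<open>A set of representatives of the column-strict rational tableaux up to reordering of columns,
 chosen so that the canonical tableau is among them: the columns of the first tableau increase, those
 of the second decrease.\<close>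

definition rep_index :: "nat => shape => ((nat => nat set) \<times> (nat => nat set)) set" where
 "rep_index m = (%(p, q). column_choices m p \<times> column_choices m q)"

definition rep :: "shape => (nat => nat set) \<times> (nat => nat set) => rtableau" where
 "rep = (%(p, q) (\<kappa>, \<kappa>'). (tableau_from enum p \<kappa>, tableau_from enum_rev q \<kappa>'))"

lemma finite_rep_index: "finite (rep_index m s)"
 by (cases s) (simp add: rep_index_def finite_column_choices)

definition good_parts :: "nat => shape => bool" where
 "good_parts m s \<longleftrightarrow> fst s : partitions m & snd s : partitions m"

lemma rep_in_rtableaux:
 assumes "good_parts m s" "i : rep_index m s"
 shows "rep s i : rtableaux m s"
 using assms tableau_from(1)[OF _ _ enum_bij] tableau_from(1)[OF _ _ enum_rev_bij]
 by (cases s; cases i) (auto simp: rep_def rep_index_def rtableaux_def good_parts_def)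

lemma x_at_mult:
 assumes "A : carrier_mat m m" "B : carrier_mat m m" "i : {1..m}" "j : {1..m}"
 shows "x_at (A * B) i j = (\<Sum>u\<in>{1..m}. x_at A i u * x_at B u j)"
proof -
 have "i - 1 < m" "j - 1 < m" using assms by auto
 then have "x_at (A * B) i j = (\<Sum>u\<in>{0..<m}. A $$ (i - 1, u) * B $$ (u, j - 1))"
  using assms by (auto simp: x_at_def scalar_prod_def intro!: sum.cong)
 also have "... = (\<Sum>u\<in>{1..m}. x_at A i u * x_at B u j)"
  by (rule sum.reindex_bij_witness[of _ "%u. u - 1" Suc]) (auto simp: x_at_def)
 finally show ?thesis .
qed

lemma matinv_mult:
 fixes A B :: "'a::field mat"
 assumes A: "A : carrier_mat m m" "det A ~= 0" and B: "B : carrier_mat m m" "det B ~= 0"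
 shows "matinv (A * B) = matinv B * matinv A"
proof -
 note a = matinv_eq(2-)[OF A] and b = matinv_eq(2-)[OF B]
 have "B * (matinv B * matinv A) = (B * matinv B) * matinv A"
  by (rule assoc_mult_mat[OF B(1) b(1) a(1), symmetric])
 also have "... = matinv A" using a b by simp
 finally have "A * B * (matinv B * matinv A) = A * matinv A"
  using assoc_mult_mat[OF A(1) B(1), of "matinv B * matinv A" m] a b by simp
 also have "... = 1\<^sub>m m" using a by simp
 finally show ?thesis
  using A B a b by (intro matinv_unique(1)[of _ m]) auto
qed

lemma y_at_eq_x_at:
 assumes "A : carrier_mat m m" "det A ~= 0" "i : {1..m}" "j : {1..m}"
 shows "y_at A i j = x_at (matinv A) j i"
proof -
 have "i - 1 < m" "j - 1 < m" using assms by auto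
 then show ?thesis using matinv_eq(2)[OF assms(1,2)] by (simp add: y_at_def x_at_def)
qed

lemma y_at_mult:
 assumes A: "A : carrier_mat m m" "det A ~= 0" and B: "B : carrier_mat m m" "det B ~= 0"
  and ij: "i : {1..m}" "j : {1..m}"
 shows "y_at (A * B) i j = (\<Sum>u\<in>{1..m}. y_at A i u * y_at B u j)"
proof -
 have AB: "A * B : carrier_mat m m" "det (A * B) ~= 0" using A B det_mult[OF A(1) B(1)] by auto
 have "y_at (A * B) i j = x_at (matinv B * matinv A) j i"
  using y_at_eq_x_at[OF AB ij] matinv_mult[OF A B] by simp
 also have "... = (\<Sum>u\<in>{1..m}. x_at (matinv B) j u * x_at (matinv A) u i)"
  by (rule x_at_mult[OF matinv_eq(2)[OF B] matinv_eq(2)[OF A] ij(2,1)])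
 also have "... = (\<Sum>u\<in>{1..m}. y_at A i u * y_at B u j)"
  by (intro sum.cong refl) (simp only: y_at_eq_x_at[OF A ij(1)] y_at_eq_x_at[OF B _ ij(2)] mult.commute)
 finally show ?thesis .
qed

theorem bidet_at_mult:
 assumes A: "A : carrier_mat m m" "det A ~= 0" and B: "B : carrier_mat m m" "det B ~= 0"
  and s: "good_parts m s" and S: "S : rtableaux m s" and T: "T : rtableaux m s"
 shows "bidet_at (A * B) s S T = (\<Sum>i\<in>rep_index m s. bidet_at A s S (rep s i) * bidet_at B s (rep s i) T)"
proof -
 obtain p q where pq: "s = (p, q)" by (cases s)
 obtain S1 S2 where Se: "S = (S1, S2)" by (cases S)
 obtain T1 T2 where Te: "T = (T1, T2)" by (cases T)
 have p: "p : partitions m" and q: "q : partitions m" using s pq by (auto simp: good_parts_def)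
 have tab: "S1 : tableaux m p" "S2 : tableaux m q" "T1 : tableaux m p" "T2 : tableaux m q"
  using S T by (auto simp: rtableaux_def pq Se Te)
 have 1: "bidet_factor (x_at (A * B)) p S1 T1 =
  (\<Sum>\<kappa>\<in>column_choices m p. bidet_factor (x_at A) p S1 (tableau_from enum p \<kappa>) * bidet_factor (x_at B) p (tableau_from enum p \<kappa>) T1)"
  by (rule bidet_factor_product[OF p enum_bij x_at_mult[OF A(1) B(1)] tab(1,3)])
 have 2: "bidet_factor (y_at (A * B)) q S2 T2 =
  (\<Sum>\<kappa>\<in>column_choices m q. bidet_factor (y_at A) q S2 (tableau_from enum_rev q \<kappa>) * bidet_factor (y_at B) q (tableau_from enum_rev q \<kappa>) T2)"
  by (rule bidet_factor_product[OF q enum_rev_bij y_at_mult[OF A B] tab(2,4)])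
 show ?thesis
  unfolding pq Se Te bidet_at_def rep_index_def rep_def prod.case 1 2 sum_product sum.cartesian_product
  by (intro sum.cong refl) (auto simp: ac_simps)
qed

section \<open>The weight of the diagonal torus\<close>

lemma minor_scale_rows:
 fixes Z :: "'i => 'j => 'a::comm_ring_1"
 shows "minor (%i j. w i * Z i j) r f g = (\<Prod>a\<in>{0..<r}. w (f a)) * minor Z r f g"
 unfolding minor_leibniz sum_distrib_left prod.distrib by (intro sum.cong refl) (simp add: ac_simps)

lemma prod_young:
 fixes h :: "nat \<times> nat => 'a::comm_monoid_mult"
 assumes "p : partitions m"
 shows "(\<Prod>b\<in>young p. h b) = (\<Prod>c\<in>{1..sum_list p}. \<Prod>a\<in>{0..<clen p c}. h (a + 1, c))"
proof -
 have "(\<Prod>b\<in>young p. h b) = (\<Prod>(c, i)\<in>(SIGMA c : {1..sum_list p}. {1..clen p c}). h (i, c))"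
  unfolding young_Sigma[OF assms fits_sum_list]
  by (subst prod.reindex) (auto simp: inj_on_def case_prod_unfold)
 also have "... = (\<Prod>c\<in>{1..sum_list p}. \<Prod>i\<in>{1..clen p c}. h (i, c))"
  by (rule prod.Sigma[symmetric]) auto
 also have "... = (\<Prod>c\<in>{1..sum_list p}. \<Prod>a\<in>{0..<clen p c}. h (a + 1, c))"
 proof (rule prod.cong[OF refl])
  fix c
  show "(\<Prod>i\<in>{1..clen p c}. h (i, c)) = (\<Prod>a\<in>{0..<clen p c}. h (a + 1, c))"
   by (rule prod.reindex_bij_witness[of _ Suc "%i. i - 1"]) auto
 qed
 finally show ?thesis .
qed

lemma bidet_factor_scale:
 assumes p: "p : partitions m" and U: "U : tableaux m p" and T: "T : tableaux m p"
  and Z: "!!i j. i : {1..m} ==> j : {1..m} ==> Z' i j = w i * Z i j"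
 shows "bidet_factor Z' p U T = (\<Prod>b\<in>young p. w (U b)) * bidet_factor Z p U T"
proof -
 have ent: "V (a + 1, c) : {1..m}" if "V : tableaux m p" "a < clen p c" for V a c
  using that in_young_iff[OF p, of "a + 1" c] by (auto simp: tableaux_def dest!: PiE_mem)
 have "minor Z' (clen p c) (%a. U (a + 1, c)) (%b. T (b + 1, c)) =
   (\<Prod>a\<in>{0..<clen p c}. w (U (a + 1, c))) * minor Z (clen p c) (%a. U (a + 1, c)) (%b. T (b + 1, c))" for c
 proof -
  have "minor Z' (clen p c) (%a. U (a + 1, c)) (%b. T (b + 1, c)) =
    minor (%i j. w i * Z i j) (clen p c) (%a. U (a + 1, c)) (%b. T (b + 1, c))"
   by (rule minor_cong) (use Z ent U T in auto)
  then show ?thesis by (simp only: minor_scale_rows)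
 qed
 then show ?thesis
  unfolding bidet_factor_minors[OF p fits_sum_list] prod_young[OF p] by (simp only: prod.distrib)
qed

text \<open>The torus element \<open>diag(d\<^bsup>m-1\<^esup>, \<dots>, d, 1)\<close>.\<close>

definition diag_powers :: "nat => ratfun => ratfun mat" where
 "diag_powers m d = mat m m (%(i, j). if i = j then d ^ (m - 1 - i) else 0)"

definition tab_exponent :: "nat => nat list => tableau => nat" where
 "tab_exponent m p U = (\<Sum>b\<in>young p. m - U b)"

definition exponent :: "nat => shape => rtableau => int" where
 "exponent m = (%(p, q) (U1, U2). int (tab_exponent m p U1) - int (tab_exponent m q U2))"

lemma diag_powers:
 assumes d: "d ~= 0"
 shows "diag_powers m d : carrier_mat m m" "det (diag_powers m d) ~= 0"
  and "i < m ==> j < m ==> matinv (diag_powers m d) $$ (i, j) = (if i = j then 1 / d ^ (m - 1 - i) else 0)"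
proof -
 let ?D = "diag_powers m d"
 let ?E = "mat m m (%(i, j). if i = j then 1 / d ^ (m - 1 - i) else 0) :: ratfun mat"
 show D: "?D : carrier_mat m m" by (simp add: diag_powers_def)
 have E: "?E : carrier_mat m m" by simp
 have "?D * ?E = 1\<^sub>m m"
 proof (rule eq_matI)
  fix i j assume "i < dim_row (1\<^sub>m m)" "j < dim_col (1\<^sub>m m)"
  then have ij: "i < m" "j < m" by auto
  have "(?D * ?E) $$ (i, j) = (\<Sum>k\<in>{0..<m}. (if i = k then d ^ (m - 1 - i) else 0) * (if k = j then 1 / d ^ (m - 1 - k) else 0))"
   using ij by (simp add: scalar_prod_def diag_powers_def)
  also have "... = (\<Sum>k\<in>{0..<m}. if k = i then (if i = j then 1 else 0) else 0)"
   by (rule sum.cong) (use d in auto)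
  also have "... = (if i = j then 1 else 0)" using ij by simp
  finally show "(?D * ?E) $$ (i, j) = 1\<^sub>m m $$ (i, j)" using ij by simp
 qed (auto simp: diag_powers_def)
 note u = matinv_unique[OF D E this]
 show "det ?D ~= 0" by (rule u(2))
 show "i < m ==> j < m ==> matinv ?D $$ (i, j) = (if i = j then 1 / d ^ (m - 1 - i) else 0)"
  unfolding u(1) by simp
qed

lemma bidet_at_diag:
 assumes d: "d ~= 0" and B: "B : carrier_mat m m" "det B ~= 0"
  and s: "good_parts m s" and U: "U : rtableaux m s" and T: "T : rtableaux m s"
 shows "bidet_at (diag_powers m d * B) s U T = d powi exponent m s U * bidet_at B s U T"
proof -
 obtain p q where pq: "s = (p, q)" by (cases s)
 obtain U1 U2 where Ue: "U = (U1, U2)" by (cases U)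
 obtain T1 T2 where Te: "T = (T1, T2)" by (cases T)
 have p: "p : partitions m" and q: "q : partitions m" using s pq by (auto simp: good_parts_def)
 have tab: "U1 : tableaux m p" "U2 : tableaux m q" "T1 : tableaux m p" "T2 : tableaux m q"
  using U T by (auto simp: rtableaux_def pq Ue Te)
 note D = diag_powers[OF d, where m = m]
 have x: "x_at (diag_powers m d * B) i j = d ^ (m - i) * x_at B i j" if ij: "i : {1..m}" "j : {1..m}" for i j
 proof -
  have "x_at (diag_powers m d * B) i j = (\<Sum>u\<in>{1..m}. x_at (diag_powers m d) i u * x_at B u j)"
   by (rule x_at_mult[OF D(1) B(1) ij])
  also have "... = (\<Sum>u\<in>{1..m}. if u = i then d ^ (m - i) * x_at B i j else 0)"
   by (rule sum.cong) (use ij in \<open>auto simp: x_at_def diag_powers_def\<close>)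
  finally show ?thesis using ij by simp
 qed
 have y: "y_at (diag_powers m d * B) i j = (1 / d ^ (m - i)) * y_at B i j" if ij: "i : {1..m}" "j : {1..m}" for i j
 proof -
  have "y_at (diag_powers m d * B) i j = (\<Sum>u\<in>{1..m}. y_at (diag_powers m d) i u * y_at B u j)"
   by (rule y_at_mult[OF D(1,2) B ij])
  also have "... = (\<Sum>u\<in>{1..m}. if u = i then (1 / d ^ (m - i)) * y_at B i j else 0)"
  proof (rule sum.cong[OF refl])
   fix u assume u: "u : {1..m}"
   have "u - 1 < m" "i - 1 < m" "u - 1 = i - 1 \<longleftrightarrow> u = i" "m - 1 - (u - 1) = m - u" using u ij by auto
   then show "y_at (diag_powers m d) i u * y_at B u j = (if u = i then (1 / d ^ (m - i)) * y_at B i j else 0)"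
    unfolding y_at_eq_x_at[OF D(1,2) ij(1) u] x_at_def using D(3)[where i = "u - 1" and j = "i - 1"] by simp
  qed
  finally show ?thesis using ij by simp
 qed
 have 1: "bidet_factor (x_at (diag_powers m d * B)) p U1 T1 = d ^ tab_exponent m p U1 * bidet_factor (x_at B) p U1 T1"
  using bidet_factor_scale[OF p tab(1,3) x] by (simp add: tab_exponent_def power_sum)
 have 2: "bidet_factor (y_at (diag_powers m d * B)) q U2 T2 = (1 / d ^ tab_exponent m q U2) * bidet_factor (y_at B) q U2 T2"
  using bidet_factor_scale[OF q tab(2,4) y] by (simp add: tab_exponent_def power_sum prod_dividef)
 have "d powi exponent m s U = d ^ tab_exponent m p U1 * (1 / d ^ tab_exponent m q U2)"
  using d by (simp add: exponent_def pq Ue power_int_diff)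
 then show ?thesis
  unfolding pq Ue Te bidet_at_def prod.case 1 2 by (simp add: ac_simps)
qed

text \<open>Among the column-strict tableaux the canonical one has the largest exponent.\<close>

lemma sum_initial_min:
 assumes "K \<subseteq> {1..m}" "card K = r"
 shows "(\<Sum>u\<in>{1..r}. u) <= \<Sum>K" and "(\<Sum>u\<in>{1..r}. u) = \<Sum>K ==> K = {1..r}"
proof -
 have fin: "finite K" using assms finite_subset by blast
 let ?A = "K - {1..r}" and ?B = "{1..r} - K"
 have s: "\<Sum>K = \<Sum>(K \<inter> {1..r}) + \<Sum>?A" "\<Sum>{1..r} = \<Sum>(K \<inter> {1..r}) + \<Sum>?B"
  using fin sum.Int_Diff[of K "%x. x" "{1..r}"] sum.Int_Diff[of "{1..r}" "%x. x" K] by (auto simp: Int_commute)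
 have c: "card ?A = card ?B"
 proof -
  have "card K = card (K \<inter> {1..r}) + card ?A" "card {1..r} = card (K \<inter> {1..r}) + card ?B"
   using fin card_Int_Diff[of K "{1..r}"] card_Int_Diff[of "{1..r}" K] by (auto simp: Int_commute)
  then show ?thesis using assms(2) by simp
 qed
 have "card ?A * Suc r <= \<Sum>?A"
  using sum_bounded_below[of ?A "Suc r" "%x. x"] assms(1) by fastforce
 moreover have "\<Sum>?B <= card ?B * r"
  using sum_bounded_above[of ?B "%x. x" r] by auto
 ultimately have ab: "\<Sum>?B + card ?A <= \<Sum>?A" using c by simp
 then show "(\<Sum>u\<in>{1..r}. u) <= \<Sum>K" using s by simp
 assume "(\<Sum>u\<in>{1..r}. u) = \<Sum>K"
 then have "card ?A = 0" using ab s by simp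
 then have "K \<subseteq> {1..r}" using fin by auto
 then show "K = {1..r}" using assms(2) by (intro card_subset_eq) auto
qed

lemma sum_diff_card:
 assumes "K \<subseteq> {1..m}"
 shows "int (\<Sum>u\<in>K. m - u) = int m * int (card K) - int (\<Sum>K)"
proof -
 have "int (\<Sum>u\<in>K. m - u) = (\<Sum>u\<in>K. int m - int u)"
  unfolding of_nat_sum by (rule sum.cong) (use assms in auto)
 then show ?thesis by (simp add: sum_subtractf)
qed

lemma initial_exponent_max:
 assumes "K \<subseteq> {1..m}" "card K = r"
 shows "(\<Sum>u\<in>K. m - u) <= (\<Sum>u\<in>{1..r}. m - u)" and "(\<Sum>u\<in>K. m - u) = (\<Sum>u\<in>{1..r}. m - u) ==> K = {1..r}"
proof -
 have "r <= m" using card_mono[OF _ assms(1)] assms(2) by simp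
 then have "{1..r} \<subseteq> {1..m}" by auto
 note e = sum_diff_card[OF assms(1)] sum_diff_card[OF this]
 show "(\<Sum>u\<in>K. m - u) <= (\<Sum>u\<in>{1..r}. m - u)"
 proof -
  have "int (\<Sum>u\<in>K. m - u) <= int (\<Sum>u\<in>{1..r}. m - u)"
   unfolding e using sum_initial_min(1)[OF assms] assms(2) by (simp flip: of_nat_sum)
  then show ?thesis by (simp only: of_nat_le_iff)
 qed
 assume "(\<Sum>u\<in>K. m - u) = (\<Sum>u\<in>{1..r}. m - u)"
 then have "int m * int (card K) - int (\<Sum>K) = int m * int (card {1..r}) - int (\<Sum>{1..r})"
  by (simp only: e[symmetric])
 then have "(\<Sum>u\<in>{1..r}. u) = \<Sum>K" using assms(2) by (simp flip: of_nat_sum)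
 then show "K = {1..r}" by (rule sum_initial_min(2)[OF assms])
qed

lemma final_exponent_min:
 assumes K: "K \<subseteq> {1..m}" "card K = r"
 shows "(\<Sum>u\<in>{m - r + 1..m}. m - u) <= (\<Sum>u\<in>K. m - u)"
  and "(\<Sum>u\<in>K. m - u) = (\<Sum>u\<in>{m - r + 1..m}. m - u) ==> K = {m - r + 1..m}"
proof -
 have fin: "finite K" using K finite_subset by blast
 have rm: "r <= m" using card_mono[OF _ K(1)] K(2) by simp
 let ?K' = "{1..m} - K"
 have K': "?K' \<subseteq> {1..m}" "card ?K' = m - r" using K fin by (auto simp: card_Diff_subset)
 have split: "(\<Sum>u\<in>K. m - u) + (\<Sum>u\<in>?K'. m - u) = (\<Sum>u\<in>{1..m}. m - u)"
  using sum.subset_diff[OF K(1), of "%u. m - u"] by simp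
 have "{1..m} - {m - r + 1..m} = {1..m - r}" using rm by auto
 then have split': "(\<Sum>u\<in>{m - r + 1..m}. m - u) + (\<Sum>u\<in>{1..m - r}. m - u) = (\<Sum>u\<in>{1..m}. m - u)"
  using sum.subset_diff[of "{m - r + 1..m}" "{1..m}" "%u. m - u"] rm by auto
 note mx = initial_exponent_max[OF K']
 show "(\<Sum>u\<in>{m - r + 1..m}. m - u) <= (\<Sum>u\<in>K. m - u)" using mx(1) split split' by simp
 assume "(\<Sum>u\<in>K. m - u) = (\<Sum>u\<in>{m - r + 1..m}. m - u)"
 then have "?K' = {1..m - r}" using mx(2) split split' by simp
 then have "{1..m} - ?K' = {1..m} - {1..m - r}" by simp
 moreover have "{1..m} - ?K' = K" using K(1) by auto
 moreover have "{1..m} - {1..m - r} = {m - r + 1..m}" using rm by auto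
 ultimately show "K = {m - r + 1..m}" by simp
qed

section \<open>The exponent of the canonical tableau\<close>

definition canonical_index :: "nat => shape => (nat => nat set) \<times> (nat => nat set)" where
 "canonical_index m = (%(p, q). (restrict (%c. {1..clen p c}) {1..sum_list p},
   restrict (%c. {m - clen q c + 1..m}) {1..sum_list q}))"

lemma enum_initial: "a < r ==> enum {1..r} a = a + 1"
proof -
 have "sorted_list_of_set {1..r} = [1..<Suc r]"
  by (metis atLeastLessThanSuc_atLeastAtMost sorted_list_of_set_range)
 then show "a < r ==> enum {1..r} a = a + 1" by (simp add: enum_def del: upt_Suc)
qed

lemma enum_rev_final: "a < r ==> r <= m ==> enum_rev {m - r + 1..m} a = m - a"
proof -
 have "sorted_list_of_set {m - r + 1..m} = [m - r + 1..<Suc m]"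
  by (metis atLeastLessThanSuc_atLeastAtMost sorted_list_of_set_range)
 then show "a < r ==> r <= m ==> enum_rev {m - r + 1..m} a = m - a"
  by (simp add: enum_rev_def rev_nth del: upt_Suc)
qed

lemma canonical_rep:
 assumes s: "good_parts m s"
 shows "canonical_index m s : rep_index m s" "rep s (canonical_index m s) = canonical m s"
proof -
 obtain p q where pq: "s = (p, q)" by (cases s)
 have p: "p : partitions m" and q: "q : partitions m" using s pq by (auto simp: good_parts_def)
 have le: "clen p c <= m" "clen q c <= m" for c
  using young_initial(2)[OF p] young_initial(2)[OF q] by auto
 show "canonical_index m s : rep_index m s"
  unfolding canonical_index_def rep_index_def column_choices_def pq prod.case
  using le by (auto simp: subset_iff intro: order_trans)
 have 1: "tableau_from enum p (restrict (%c. {1..clen p c}) {1..sum_list p}) = restrict (%(i, j). i) (young p)"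
  unfolding tableau_from_def
 proof (rule restrict_ext)
  fix b assume b: "b : young p"
  obtain i c where ic: "b = (i, c)" by (cases b)
  have i: "1 <= i" "i <= clen p c" using b ic in_young_iff[OF p] by auto
  show "(case b of (i, c) => enum (restrict (%c. {1..clen p c}) {1..sum_list p} c) (i - 1)) = (case b of (i, j) => i)"
   using young_columns_bound[of i c p] b ic i enum_initial[of "i - 1" "clen p c"] by simp
 qed
 have 2: "tableau_from enum_rev q (restrict (%c. {m - clen q c + 1..m}) {1..sum_list q}) = restrict (%(i, j). m - i + 1) (young q)"
  unfolding tableau_from_def
 proof (rule restrict_ext)
  fix b assume b: "b : young q"
  obtain i c where ic: "b = (i, c)" by (cases b)
  have i: "1 <= i" "i <= clen q c" using b ic in_young_iff[OF q] by auto
  have "m - (i - 1) = m - i + 1" using i le(2)[of c] by linarith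
  then show "(case b of (i, c) => enum_rev (restrict (%c. {m - clen q c + 1..m}) {1..sum_list q} c) (i - 1)) = (case b of (i, j) => m - i + 1)"
   using young_columns_bound[of i c q] b ic i enum_rev_final[of "i - 1" "clen q c" m] le(2)[of c] by simp
 qed
 show "rep s (canonical_index m s) = canonical m s"
  unfolding pq canonical_index_def rep_def canonical_def prod.case 1 2 ..
qed

lemma canonical_in_rtableaux: "good_parts m s ==> canonical m s : rtableaux m s"
 using canonical_rep rep_in_rtableaux by metis

lemma canonical_columns:
 assumes p: "p : partitions m" and q: "q : partitions m"
 shows "colset p (fst (canonical m (p, q))) c = {1..clen p c}"
  and "colset q (snd (canonical m (p, q))) c = {m - clen q c + 1..m}"
  and "col_inj p (fst (canonical m (p, q)))" "col_inj q (snd (canonical m (p, q)))"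
proof -
 have y: "1 <= i ==> i <= clen r c ==> (i, c) : young r" if "r : partitions m" for r i c
  using in_young_iff[OF that] by simp
 have v1: "fst (canonical m (p, q)) (i, c) = i" if "i : {1..clen p c}" for i c
  using y[OF p] that by (simp add: canonical_def)
 have v2: "snd (canonical m (p, q)) (i, c) = m - i + 1" if "i : {1..clen q c}" for i c
  using y[OF q] that by (simp add: canonical_def)
 show "colset p (fst (canonical m (p, q))) c = {1..clen p c}" for c
 proof -
  have "colset p (fst (canonical m (p, q))) c = (%i. i) ` {1..clen p c}"
   unfolding colset_def by (rule image_cong[OF refl v1])
  then show ?thesis by simp
 qed
 show "colset q (snd (canonical m (p, q))) c = {m - clen q c + 1..m}" for c
 proof -
  have "colset q (snd (canonical m (p, q))) c = (%i. m - i + 1) ` {1..clen q c}"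
   unfolding colset_def by (rule image_cong[OF refl v2])
  also have "... = {m - clen q c + 1..m}"
  proof (intro equalityI subsetI)
   fix x assume "x : {m - clen q c + 1..m}"
   then show "x : (%i. m - i + 1) ` {1..clen q c}"
    using young_initial(2)[OF q, of c] by (intro image_eqI[of _ _ "m + 1 - x"]) auto
  qed (use young_initial(2)[OF q, of c] in auto)
  finally show ?thesis .
 qed
 show "col_inj p (fst (canonical m (p, q)))"
  unfolding col_inj_def by (auto intro!: inj_onI simp del: atLeastAtMost_iff simp add: v1)
 show "col_inj q (snd (canonical m (p, q)))"
  unfolding col_inj_def
 proof (intro allI inj_onI)
  fix c i i' assume "i : {1..clen q c}" "i' : {1..clen q c}"
   "snd (canonical m (p, q)) (i, c) = snd (canonical m (p, q)) (i', c)"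
  then show "i = i'" using v2 young_initial(2)[OF q, of c] by auto
 qed
qed

lemma tab_exponent_columns:
 assumes p: "p : partitions m" and inj: "col_inj p U"
 shows "tab_exponent m p U = (\<Sum>c\<in>{1..sum_list p}. \<Sum>u\<in>colset p U c. m - u)"
proof -
 have "tab_exponent m p U = (\<Sum>(c, i)\<in>(SIGMA c : {1..sum_list p}. {1..clen p c}). m - U (i, c))"
  unfolding tab_exponent_def young_Sigma[OF p fits_sum_list]
  by (subst sum.reindex) (auto simp: inj_on_def case_prod_unfold)
 also have "... = (\<Sum>c\<in>{1..sum_list p}. \<Sum>i\<in>{1..clen p c}. m - U (i, c))"
  by (rule sum.Sigma[symmetric]) auto
 also have "... = (\<Sum>c\<in>{1..sum_list p}. \<Sum>u\<in>colset p U c. m - u)"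
 proof (rule sum.cong[OF refl])
  fix c
  have "inj_on (%i. U (i, c)) {1..clen p c}" using inj by (simp only: col_inj_def)
  then show "(\<Sum>i\<in>{1..clen p c}. m - U (i, c)) = (\<Sum>u\<in>colset p U c. m - u)"
   unfolding colset_def by (simp only: sum.reindex comp_def)
 qed
 finally show ?thesis .
qed

lemma exponent_max:
 assumes p: "p : partitions m" and q: "q : partitions m" and U: "(U1, U2) : rtableaux m (p, q)"
  and inj: "col_inj p U1" "col_inj q U2"
 shows "exponent m (p, q) (U1, U2) <= exponent m (p, q) (canonical m (p, q))"
  and "exponent m (p, q) (U1, U2) = exponent m (p, q) (canonical m (p, q)) ==>
   (\<forall>c\<in>{1..sum_list p}. colset p U1 c = {1..clen p c}) & (\<forall>c\<in>{1..sum_list q}. colset q U2 c = {m - clen q c + 1..m})"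
proof -
 obtain C1 C2 where C: "canonical m (p, q) = (C1, C2)" by (cases "canonical m (p, q)")
 note cc = canonical_columns[OF p q, unfolded C fst_conv snd_conv]
 have tab: "U1 : tableaux m p" "U2 : tableaux m q" using U by (auto simp: rtableaux_def)
 note r1 = colset_range[OF p tab(1)] and r2 = colset_range[OF q tab(2)]
 note k1 = card_colset[OF inj(1)] and k2 = card_colset[OF inj(2)]
 note e = tab_exponent_columns[OF p inj(1)] tab_exponent_columns[OF p cc(3)]
  tab_exponent_columns[OF q inj(2)] tab_exponent_columns[OF q cc(4)]
 have le1: "(\<Sum>u\<in>colset p U1 c. m - u) <= (\<Sum>u\<in>colset p C1 c. m - u)" for c
  unfolding cc using initial_exponent_max(1)[OF r1 k1] .
 have le2: "(\<Sum>u\<in>colset q C2 c. m - u) <= (\<Sum>u\<in>colset q U2 c. m - u)" for c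
  unfolding cc using final_exponent_min(1)[OF r2 k2] .
 have t: "tab_exponent m p U1 <= tab_exponent m p C1" "tab_exponent m q C2 <= tab_exponent m q U2"
  unfolding e by (intro sum_mono le1 le2)+
 then show "exponent m (p, q) (U1, U2) <= exponent m (p, q) (canonical m (p, q))"
  by (simp add: exponent_def C)
 assume "exponent m (p, q) (U1, U2) = exponent m (p, q) (canonical m (p, q))"
 then have eq: "tab_exponent m p U1 = tab_exponent m p C1" "tab_exponent m q C2 = tab_exponent m q U2"
  using t by (auto simp: exponent_def C)
 show "(\<forall>c\<in>{1..sum_list p}. colset p U1 c = {1..clen p c}) & (\<forall>c\<in>{1..sum_list q}. colset q U2 c = {m - clen q c + 1..m})"
 proof (intro conjI ballI)
  fix c assume c: "c : {1..sum_list p}"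
  have "(\<Sum>u\<in>colset p U1 c. m - u) = (\<Sum>u\<in>colset p C1 c. m - u)"
   by (rule sum_mono_inv[OF eq(1)[unfolded e] le1 c]) simp
  then show "colset p U1 c = {1..clen p c}"
   unfolding cc by (rule initial_exponent_max(2)[OF r1 k1])
 next
  fix c assume c: "c : {1..sum_list q}"
  have "(\<Sum>u\<in>colset q C2 c. m - u) = (\<Sum>u\<in>colset q U2 c. m - u)"
   by (rule sum_mono_inv[OF eq(2)[unfolded e] le2 c]) simp
  then show "colset q U2 c = {m - clen q c + 1..m}"
   unfolding cc using final_exponent_min(2)[OF r2 k2, of c] by simp
 qed
qed

lemma rep_exponent_max:
 assumes s: "good_parts m s" and i: "i : rep_index m s"
 shows "exponent m s (rep s i) <= exponent m s (canonical m s)"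
  and "exponent m s (rep s i) = exponent m s (canonical m s) ==> i = canonical_index m s"
proof -
 obtain p q where pq: "s = (p, q)" by (cases s)
 obtain \<kappa> \<kappa>' where ik: "i = (\<kappa>, \<kappa>')" by (cases i)
 have p: "p : partitions m" and q: "q : partitions m" using s pq by (auto simp: good_parts_def)
 have k: "\<kappa> : column_choices m p" "\<kappa>' : column_choices m q" using i by (auto simp: rep_index_def pq ik)
 note t1 = tableau_from[OF p k(1) enum_bij] and t2 = tableau_from[OF q k(2) enum_rev_bij]
 have r: "rep s i = (tableau_from enum p \<kappa>, tableau_from enum_rev q \<kappa>')" by (simp add: rep_def pq ik)
 have "(tableau_from enum p \<kappa>, tableau_from enum_rev q \<kappa>') : rtableaux m (p, q)"
  using rep_in_rtableaux[OF s i] r pq by simp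
 note em = exponent_max[OF p q this t1(5) t2(5)]
 show "exponent m s (rep s i) <= exponent m s (canonical m s)"
  using em(1) r pq by simp
 assume "exponent m s (rep s i) = exponent m s (canonical m s)"
 then have "exponent m (p, q) (tableau_from enum p \<kappa>, tableau_from enum_rev q \<kappa>') = exponent m (p, q) (canonical m (p, q))"
  using r pq by simp
 then have c: "\<forall>c\<in>{1..sum_list p}. \<kappa> c = {1..clen p c}" "\<forall>c\<in>{1..sum_list q}. \<kappa>' c = {m - clen q c + 1..m}"
  using em(2) t1(4) t2(4) by simp_all
 have "\<kappa> = restrict (%c. {1..clen p c}) {1..sum_list p}"
  using k(1) c(1) unfolding column_choices_def by (intro extensionalityI[of _ "{1..sum_list p}"]) (auto simp: PiE_def)
 moreover have "\<kappa>' = restrict (%c. {m - clen q c + 1..m}) {1..sum_list q}"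
  using k(2) c(2) unfolding column_choices_def by (intro extensionalityI[of _ "{1..sum_list q}"]) (auto simp: PiE_def)
 ultimately show "i = canonical_index m s" by (simp add: canonical_index_def pq ik)
qed

lemma sum_young_rows:
 fixes h :: "nat => nat"
 assumes "p : partitions m"
 shows "(\<Sum>b\<in>young p. h (fst b)) = (\<Sum>i\<in>{0..<m}. p ! i * h (i + 1))"
proof -
 have "young p = (%(i, j). (i + 1, j)) ` (SIGMA i : {0..<m}. {1..p ! i})"
 proof (intro equalityI subsetI)
  fix b assume "b : young p"
  then show "b : (%(i, j). (i + 1, j)) ` (SIGMA i : {0..<m}. {1..p ! i})"
   using assms by (intro image_eqI[of _ _ "(fst b - 1, snd b)"]) (auto simp: young_def partitions_length)
 qed (use assms in \<open>auto simp: young_def partitions_length\<close>)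
 then have "(\<Sum>b\<in>young p. h (fst b)) = (\<Sum>(i, j)\<in>(SIGMA i : {0..<m}. {1..p ! i}). h (i + 1))"
  by (simp add: sum.reindex inj_on_def case_prod_unfold)
 also have "... = (\<Sum>i\<in>{0..<m}. \<Sum>j\<in>{1..p ! i}. h (i + 1))"
  by (rule sum.Sigma[symmetric]) auto
 finally show ?thesis by simp
qed

lemma canonical_exponent:
 assumes p: "p : partitions m" and q: "q : partitions m"
 shows "exponent m (p, q) (canonical m (p, q)) = (\<Sum>j\<in>{0..<m}. sum_list (take j (bracket (p, q))))"
proof -
 let ?b = "bracket (p, q)"
 have len: "length p = m" "length q = m" using p q by (auto simp: partitions_length)
 have 1: "tab_exponent m p (restrict (%(i, j). i) (young p)) = (\<Sum>i\<in>{0..<m}. p ! i * (m - (i + 1)))"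
  unfolding tab_exponent_def sum_young_rows[OF p, symmetric] by (intro sum.cong) auto
 have 2: "tab_exponent m q (restrict (%(i, j). m - i + 1) (young q)) = (\<Sum>i\<in>{0..<m}. q ! i * i)"
 proof -
  have "tab_exponent m q (restrict (%(i, j). m - i + 1) (young q)) = (\<Sum>b\<in>young q. fst b - 1)"
   unfolding tab_exponent_def using len by (intro sum.cong) (auto simp: young_def)
  then show ?thesis using sum_young_rows[OF q, of "%i. i - 1"] by simp
 qed
 have 3: "(\<Sum>i\<in>{0..<m}. q ! i * i) = (\<Sum>i\<in>{0..<m}. q ! (m - 1 - i) * (m - (i + 1)))"
  by (rule sum.reindex_bij_witness[of _ "%i. m - 1 - i" "%i. m - 1 - i"]) auto
 have "(\<Sum>j\<in>{0..<m}. sum_list (take j ?b)) = (\<Sum>j\<in>{0..<m}. \<Sum>i\<in>{0..<m}. if i < j then ?b ! i else 0)"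
 proof (rule sum.cong[OF refl])
  fix j assume j: "j : {0..<m}"
  have "sum_list (take j ?b) = (\<Sum>i\<in>{0..<j}. ?b ! i)"
   using j len by (simp add: sum_list_sum_nth)
  also have "... = (\<Sum>i\<in>{0..<m}. if i < j then ?b ! i else 0)"
   using j by (intro sum.mono_neutral_cong_left) auto
  finally show "sum_list (take j ?b) = (\<Sum>i\<in>{0..<m}. if i < j then ?b ! i else 0)" .
 qed
 also have "... = (\<Sum>i\<in>{0..<m}. \<Sum>j\<in>{0..<m}. if i < j then ?b ! i else 0)"
  by (rule sum.swap)
 also have "... = (\<Sum>i\<in>{0..<m}. int (m - (i + 1)) * ?b ! i)"
 proof (rule sum.cong[OF refl])
  fix i assume i: "i : {0..<m}"
  have "(\<Sum>j\<in>{0..<m}. if i < j then ?b ! i else 0) = (\<Sum>j\<in>{i + 1..<m}. ?b ! i)"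
   by (rule sum.mono_neutral_cong_right) auto
  then show "(\<Sum>j\<in>{0..<m}. if i < j then ?b ! i else 0) = int (m - (i + 1)) * ?b ! i" by simp
 qed
 also have "... = (\<Sum>i\<in>{0..<m}. int (p ! i * (m - (i + 1))) - int (q ! (m - 1 - i) * (m - (i + 1))))"
 proof (rule sum.cong[OF refl])
  fix i assume "i : {0..<m}"
  then have b: "?b ! i = int (p ! i) - int (q ! (m - 1 - i))" using len by (intro bracket_nth) auto
  show "int (m - (i + 1)) * ?b ! i = int (p ! i * (m - (i + 1))) - int (q ! (m - 1 - i) * (m - (i + 1)))"
   by (simp only: b right_diff_distrib of_nat_mult mult.commute)
 qed
 also have "... = exponent m (p, q) (canonical m (p, q))"
  unfolding exponent_def canonical_def prod.case 1 2 3 by (simp add: sum_subtractf)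
 finally show ?thesis by simp
qed

lemma canonical_exponent_mono:
 assumes s: "good_parts m s" and s': "good_parts m s'"
 shows "dom_le (bracket s') (bracket s) ==> exponent m s' (canonical m s') <= exponent m s (canonical m s)"
  and "dom_less (bracket s') (bracket s) ==> exponent m s' (canonical m s') < exponent m s (canonical m s)"
proof -
 obtain p q where pq: "s = (p, q)" by (cases s)
 obtain p' q' where pq': "s' = (p', q')" by (cases s')
 have p: "p : partitions m" "q : partitions m" "p' : partitions m" "q' : partitions m"
  using s s' pq pq' by (auto simp: good_parts_def)
 let ?b = "bracket s" and ?b' = "bracket s'"
 have len: "length ?b = m" "length ?b' = m" using p by (auto simp: pq pq' partitions_length)
 note e = canonical_exponent[OF p(1,2), folded pq] canonical_exponent[OF p(3,4), folded pq']
 have le: "sum_list (take j ?b') <= sum_list (take j ?b)" if "dom_le ?b' ?b" for j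
 proof (cases "1 <= j & j <= m")
  case True
  then show ?thesis using that len by (simp add: dom_le_def)
 next
  case False
  then have "j = 0 \<or> m < j" by auto
  then show ?thesis using that len by (auto simp: dom_le_def)
 qed
 show mono: "exponent m s' (canonical m s') <= exponent m s (canonical m s)" if "dom_le ?b' ?b"
  unfolding e by (intro sum_mono le that)
 assume dl: "dom_less ?b' ?b"
 then have d: "dom_le ?b' ?b" and ne: "?b' ~= ?b" by (auto simp: dom_less_def)
 have "exponent m s' (canonical m s') ~= exponent m s (canonical m s)"
 proof
  assume eq: "exponent m s' (canonical m s') = exponent m s (canonical m s)"
  have t: "sum_list (take j ?b') = sum_list (take j ?b)" if "j <= m" for j
  proof (cases "j = m")
   case True
   then show ?thesis using d len by (simp add: dom_le_def)
  next
   case False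
   then show ?thesis
    using sum_mono_inv[OF eq[unfolded e] le[OF d], of j] that by simp
  qed
  have "?b' = ?b"
  proof (rule nth_equalityI)
   fix i assume i: "i < length ?b'"
   have "sum_list (take (Suc i) xs) = sum_list (take i xs) + xs ! i" if "i < length xs" for xs :: "int list"
    using that by (simp add: take_Suc_conv_app_nth)
   from this[of ?b] this[of ?b'] show "?b' ! i = ?b ! i"
    using t[of i] t[of "Suc i"] i len by simp
  qed (simp add: len)
  then show False using ne by simp
 qed
 then show "exponent m s' (canonical m s') < exponent m s (canonical m s)" using mono[OF d] by simp
qed

section \<open>Extraction of the highest torus weight\<close>

lemma evaluable_bidet_factor:
 assumes p: "p : partitions m" and S: "S : tableaux m p" and T: "T : tableaux m p"
  and z: "!!i j. i : {1..m} ==> j : {1..m} ==> evaluable A (z i j) & eval_at (z i j) A = z' i j"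
 shows "evaluable A (bidet_factor z p S T) & eval_at (bidet_factor z p S T) A = bidet_factor z' p S T"
proof -
 have ent: "V (a + 1, c) : {1..m}" if "V : tableaux m p" "a < clen p c" for V a c
  using that in_young_iff[OF p, of "a + 1" c] by (auto simp: tableaux_def dest!: PiE_mem)
 have "evaluable A (minor z (clen p c) (%a. S (a + 1, c)) (%b. T (b + 1, c))) \<and>
   eval_at (minor z (clen p c) (%a. S (a + 1, c)) (%b. T (b + 1, c))) A =
   minor z' (clen p c) (%a. S (a + 1, c)) (%b. T (b + 1, c))" for c
 proof -
  let ?M = "mat (clen p c) (clen p c) (%(a, b). z (S (a + 1, c)) (T (b + 1, c)))"
  have M: "?M : carrier_mat (clen p c) (clen p c)" by simp
  have e: "evaluable A (?M $$ (a, b)) & eval_at (?M $$ (a, b)) A = z' (S (a + 1, c)) (T (b + 1, c))"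
   if "a < clen p c" "b < clen p c" for a b
   using z[OF ent[OF S that(1)] ent[OF T that(2)]] that by simp
  have "map_mat (%f. eval_at f A) ?M = mat (clen p c) (clen p c) (%(a, b). z' (S (a + 1, c)) (T (b + 1, c)))"
   by (rule eq_matI) (use e in auto)
  then show ?thesis
   unfolding minor_def using evaluable_det[OF M, of A] e by auto
 qed
 then show ?thesis
  unfolding bidet_factor_minors[OF p fits_sum_list]
  using evaluable_prod[of "{1..sum_list p}" A] by (metis (mono_tags, lifting) prod.cong)
qed

lemma eval_bidet:
 assumes A: "A : carrier_mat m m" "det A ~= 0" and s: "good_parts m s"
  and S: "S : rtableaux m s" and T: "T : rtableaux m s"
 shows "evaluable A (bidet_at (gen m b) s S T)" "eval_at (bidet_at (gen m b) s S T) A = bidet_at A s S T"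
proof -
 obtain p q where pq: "s = (p, q)" by (cases s)
 obtain S1 S2 where Se: "S = (S1, S2)" by (cases S)
 obtain T1 T2 where Te: "T = (T1, T2)" by (cases T)
 have p: "p : partitions m" and q: "q : partitions m" using s pq by (auto simp: good_parts_def)
 have tab: "S1 : tableaux m p" "S2 : tableaux m q" "T1 : tableaux m p" "T2 : tableaux m q"
  using S T by (auto simp: rtableaux_def pq Se Te)
 have x: "evaluable A (x_at (gen m b) i j) & eval_at (x_at (gen m b) i j) A = x_at A i j"
  if "i : {1..m}" "j : {1..m}" for i j
 proof -
  have "i - 1 < m" "j - 1 < m" using that by auto
  then show ?thesis using evaluable_gen by (simp add: x_at_def)
 qed
 have y: "evaluable A (y_at (gen m b) i j) & eval_at (y_at (gen m b) i j) A = y_at A i j"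
  if ij: "i : {1..m}" "j : {1..m}" for i j
 proof -
  have "i - 1 < m" "j - 1 < m" using that by auto
  then show ?thesis
   unfolding y_at_eq_x_at[OF gen_carrier det_gen_nonzero ij] y_at_eq_x_at[OF A ij]
   using evaluable_matinv_gen[OF A] by (simp add: x_at_def)
 qed
 show "evaluable A (bidet_at (gen m b) s S T)" "eval_at (bidet_at (gen m b) s S T) A = bidet_at A s S T"
  unfolding bidet_at_def pq Se Te prod.case
  using evaluable_bidet_factor[OF p tab(1,3) x] evaluable_bidet_factor[OF q tab(2,4) y]
  by (auto simp: evaluable_ops)
qed

lemma bidet_factor_in_coord:
 assumes p: "p : partitions m" and S: "S : tableaux m p" and T: "T : tableaux m p"
  and z: "!!i j. i : {1..m} ==> j : {1..m} ==> z i j : coord m B"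
 shows "bidet_factor z p S T : coord m B"
proof -
 have ent: "V (a + 1, c) : {1..m}" if "V : tableaux m p" "a < clen p c" for V a c
  using that in_young_iff[OF p, of "a + 1" c] by (auto simp: tableaux_def dest!: PiE_mem)
 have e: "mat (clen p c) (clen p c) (%(a, b). z (S (a + 1, c)) (T (b + 1, c))) $$ (a, b) : coord m B"
  if "a < clen p c" "b < clen p c" for a b c
  using z[OF ent[OF S that(1)] ent[OF T that(2)]] that by simp
 show ?thesis
  unfolding bidet_factor_minors[OF p fits_sum_list] minor_def
  by (intro coord_prod coord_det[OF mat_carrier] e)
qed

lemma bidet_in_coord:
 assumes b: "b : B" and s: "good_parts m s" and S: "S : rtableaux m s" and T: "T : rtableaux m s"
 shows "bidet_at (gen m b) s S T : coord m B" "bidet_at (matinv (gen m b)) s S T : coord m B"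
proof -
 obtain p q where pq: "s = (p, q)" by (cases s)
 obtain S1 S2 where Se: "S = (S1, S2)" by (cases S)
 obtain T1 T2 where Te: "T = (T1, T2)" by (cases T)
 have p: "p : partitions m" and q: "q : partitions m" using s pq by (auto simp: good_parts_def)
 have tab: "S1 : tableaux m p" "S2 : tableaux m q" "T1 : tableaux m p" "T2 : tableaux m q"
  using S T by (auto simp: rtableaux_def pq Se Te)
 let ?G = "gen m b"
 note inv = matinv_eq(2-)[OF gen_carrier det_gen_nonzero, of m b]
 note dinv = det_matinv(2)[OF gen_carrier det_gen_nonzero, of m b]
 have mm: "matinv (matinv ?G) = ?G" by (rule matinv_unique(1)[OF inv(1) gen_carrier inv(3)])
 have x: "x_at ?G i j : coord m B" "x_at (matinv ?G) i j : coord m B" if "i : {1..m}" "j : {1..m}" for i j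
 proof -
  have "i - 1 < m" "j - 1 < m" using that by auto
  then show "x_at ?G i j : coord m B" "x_at (matinv ?G) i j : coord m B"
   unfolding x_at_def by (rule coord.entry[OF b], rule coord_matinv_gen[OF b])
 qed
 have y: "y_at ?G i j : coord m B" "y_at (matinv ?G) i j : coord m B" if ij: "i : {1..m}" "j : {1..m}" for i j
  unfolding y_at_eq_x_at[OF gen_carrier det_gen_nonzero ij] y_at_eq_x_at[OF inv(1) dinv ij] mm
  by (rule x(2)[OF ij(2,1)], rule x(1)[OF ij(2,1)])
 show "bidet_at ?G s S T : coord m B" "bidet_at (matinv ?G) s S T : coord m B"
  unfolding bidet_at_def pq Se Te prod.case
  by (intro coord.mult bidet_factor_in_coord[OF p tab(1,3)] bidet_factor_in_coord[OF q tab(2,4)] x y; assumption)+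
qed

lemma Fract_sum_1: "(\<Sum>i\<in>I. Fract (f i) 1) = Fract (\<Sum>i\<in>I. f i) (1 :: zpoly)"
 by (induction I rule: infinite_finite_induct) (simp_all add: Zero_fract_def)

lemma Fract_prod_1: "(\<Prod>i\<in>I. Fract (f i) 1) = Fract (\<Prod>i\<in>I. f i) (1 :: zpoly)"
 by (induction I rule: infinite_finite_induct) (simp_all add: One_fract_def)

lemma Fract_1_eq_0: "Fract p (1 :: zpoly) = 0 \<longleftrightarrow> p = 0"
 by (simp add: Zero_fract_def eq_fract)

lemma var_power: "var b i j ^ k = Fract (Poly_Mapping.single (Poly_Mapping.single (b, i, j) k) 1) 1"
proof (induction k)
 case 0
 then show ?case by (simp add: One_fract_def)
next
 case (Suc k)
 then show ?case by (simp add: var_def mult_single single_add[symmetric])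
qed

lemma var_nonzero: "var b i j ~= 0"
proof -
 have "Poly_Mapping.single (Poly_Mapping.single (b, i, j) (1::nat)) (1::int) ~= 0"
  by (metis lookup_single_eq lookup_zero zero_neq_one)
 then show ?thesis by (simp add: var_def Fract_1_eq_0)
qed

lemma ratfun_in_power: "f : ratfun_in B ==> f ^ n : ratfun_in B"
 by (induction n) (auto intro: ratfun_in_1 ratfun_in_ops)

lemma var_powers_split:
 assumes fin: "finite I" and c: "!!i. i : I ==> c i : ratfun_in B" and b: "b \<notin> B"
  and rel: "(\<Sum>i\<in>I. var b j l powi e i * c i) = 0"
 shows "(\<Sum>i | i : I & e i = n. c i) = 0"
proof -
 let ?d = "var b j l" and ?E = "e ` I"
 have d: "?d : ratfun_in {b}" by (rule ratfun_in_var) simp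
 have dp: "?d powi k : ratfun_in {b}" for k
  using ratfun_in_power[OF d] ratfun_in_power[OF ratfun_in_inverse[OF d var_nonzero]]
  by (auto simp: power_int_def inverse_eq_divide)
 have "(\<Sum>k\<in>?E. ?d powi k * (\<Sum>i | i : I & e i = k. c i)) = (\<Sum>k\<in>?E. \<Sum>i | i : I & e i = k. ?d powi e i * c i)"
  by (intro sum.cong refl) (simp add: sum_distrib_left)
 also have "... = (\<Sum>i\<in>I. ?d powi e i * c i)"
  by (rule sum.group) (use fin in auto)
 finally have "(\<Sum>k\<in>?E. ?d powi k * (\<Sum>i | i : I & e i = k. c i)) = 0" using rel by simp
 moreover have "\<forall>k\<in>?E. a k = 0" if a: "(\<Sum>k\<in>?E. of_int (a k) * ?d powi k) = 0" for a :: "int => int"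
 proof -
  obtain M where M: "!!k. k : ?E ==> 0 <= k + int M"
  proof -
   have "0 <= k + int (\<Sum>k\<in>?E. nat \<bar>k\<bar>)" if "k : ?E" for k
   proof -
    have "nat \<bar>k\<bar> <= (\<Sum>k\<in>?E. nat \<bar>k\<bar>)" using fin that by (intro member_le_sum) auto
    then show ?thesis by linarith
   qed
   then show thesis using that by blast
  qed
  let ?v = "(b, j, l)"
  let ?t = "%k. Poly_Mapping.single ?v (nat (k + int M))"
  have "(\<Sum>k\<in>?E. Fract (Poly_Mapping.single (?t k) (a k)) 1) = (\<Sum>k\<in>?E. ?d ^ M * (of_int (a k) * ?d powi k))"
  proof (rule sum.cong[OF refl])
   fix k assume k: "k : ?E"
   have "?d ^ M * ?d powi k = ?d powi (int M + k)"
    by (simp only: power_int_add[OF disjI1[OF var_nonzero]] power_int_of_nat)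
   also have "... = ?d ^ nat (k + int M)" using M[OF k] by (simp add: power_int_def add.commute)
   finally have "?d ^ M * ?d powi k = ?d ^ nat (k + int M)" .
   moreover have "of_int (a k) * ?d ^ nat (k + int M) = Fract (Poly_Mapping.single (?t k) (a k)) 1"
   proof -
    have "of_int (a k) = (Poly_Mapping.single 0 (a k) :: zpoly)"
     by (rule poly_mapping_eqI) (simp add: lookup_of_int lookup_single when_def)
    then show ?thesis by (simp add: var_power ratfun_of_int mult_single)
   qed
   ultimately show "Fract (Poly_Mapping.single (?t k) (a k)) 1 = ?d ^ M * (of_int (a k) * ?d powi k)"
    by (simp add: ac_simps)
  qed
  also have "... = 0" using a by (simp add: sum_distrib_left[symmetric])
  finally have z: "(\<Sum>k\<in>?E. Poly_Mapping.single (?t k) (a k)) = 0"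
   by (simp add: Fract_sum_1 Fract_1_eq_0)
  show ?thesis
  proof
   fix k assume k: "k : ?E"
   have inj: "?t k' = ?t k \<longleftrightarrow> k' = k" if "k' : ?E" for k'
   proof
    assume "?t k' = ?t k"
    then have "plook (?t k') ?v = plook (?t k) ?v" by simp
    then show "k' = k" using M[OF k] M[OF that] by simp
   qed simp
   have "0 = plook (\<Sum>k\<in>?E. Poly_Mapping.single (?t k) (a k)) (?t k)" using z by simp
   also have "... = (\<Sum>k'\<in>?E. if k' = k then a k else 0)"
    unfolding lookup_sum lookup_single when_def by (intro sum.cong refl) (use inj in auto)
   also have "... = a k" using k fin by simp
   finally show "a k = 0" by simp
  qed
 qed
 ultimately have "\<forall>k\<in>?E. (\<Sum>i | i : I & e i = k. c i) = 0"
  using b by (intro linearly_disjoint[where e = "%k. ?d powi k" and B = "{b}" and B' = B])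
   (use fin dp c in \<open>auto intro!: ratfun_in_sum\<close>)
 then show ?thesis
 proof (cases "n : ?E")
  case False
  then have "{i : I. e i = n} = {}" by auto
  then show ?thesis by (simp only: sum.empty)
 qed auto
qed

text \<open>Evaluate a relation between bideterminants at the product of a generic matrix, a generic
 element of a one-parameter torus and a second generic matrix. The coefficient at the power \<open>N\<close> of
 the parameter only sees the shapes whose canonical tableau has exponent \<open>N\<close>, and of the
 intermediate tableaux only the canonical ones.\<close>

theorem highest_component:
 assumes fin: "finite J" and s: "!!j. j : J ==> good_parts m (s j)"
  and S: "!!j. j : J ==> S j : rtableaux m (s j)" and T: "!!j. j : J ==> T j : rtableaux m (s j)"
  and le: "!!j. j : J ==> exponent m (s j) (canonical m (s j)) <= N"
  and rel: "(\<Sum>j\<in>J. of_int (a j) * bidet m (s j) (S j) (T j)) = 0"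
 shows "(\<Sum>j | j : J & exponent m (s j) (canonical m (s j)) = N. of_int (a j) *
  (bidet_at (gen m 1) (s j) (S j) (canonical m (s j)) * bidet_at (gen m 2) (s j) (canonical m (s j)) (T j))) = 0"
proof -
 let ?G = "gen m 1" and ?H = "gen m 2" and ?d = "var 3 1 1"
 let ?D = "diag_powers m ?d"
 note D = diag_powers(1,2)[OF var_nonzero, of m 3 1 1]
 note G = gen_carrier[of m 1] det_gen_nonzero[of m 1] and H = gen_carrier[of m 2] det_gen_nonzero[of m 2]
 have DH: "?D * ?H : carrier_mat m m" "det (?D * ?H) ~= 0" using D H det_mult[OF D(1) H(1)] by auto
 have A: "?G * (?D * ?H) : carrier_mat m m" "det (?G * (?D * ?H)) ~= 0"
  using G DH det_mult[OF G(1) DH(1)] by auto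
 let ?A = "?G * (?D * ?H)"
 let ?I = "SIGMA j : J. rep_index m (s j)"
 let ?c = "%(j, i). of_int (a j) * (bidet_at ?G (s j) (S j) (rep (s j) i) * bidet_at ?H (s j) (rep (s j) i) (T j))"
 let ?e = "%(j, i). exponent m (s j) (rep (s j) i)"
 have finI: "finite ?I" using fin finite_rep_index by auto
 have rp: "rep (s j) i : rtableaux m (s j)" if "j : J" "i : rep_index m (s j)" for j i
  using rep_in_rtableaux[OF s] that by blast
 have ev: "evaluable ?A (of_int (a j) * bidet m (s j) (S j) (T j)) \<and>
   eval_at (of_int (a j) * bidet m (s j) (S j) (T j)) ?A = of_int (a j) * bidet_at ?A (s j) (S j) (T j)" if "j : J" for j
  unfolding bidet_eq
  using eval_bidet[OF A s S T, of j 0] evaluable_of_int[where A = ?A and n = "a j"] that by (simp add: evaluable_ops)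
 have "0 = eval_at (\<Sum>j\<in>J. of_int (a j) * bidet m (s j) (S j) (T j)) ?A" by (simp add: rel)
 also have "... = (\<Sum>j\<in>J. eval_at (of_int (a j) * bidet m (s j) (S j) (T j)) ?A)"
  by (rule evaluable_sum[THEN conjunct2]) (use ev in blast)
 also have "... = (\<Sum>j\<in>J. of_int (a j) * bidet_at ?A (s j) (S j) (T j))"
  by (rule sum.cong) (use ev in auto)
 also have "... = (\<Sum>j\<in>J. \<Sum>i\<in>rep_index m (s j). ?d powi ?e (j, i) * ?c (j, i))"
 proof (rule sum.cong[OF refl])
  fix j assume j: "j : J"
  have "bidet_at ?A (s j) (S j) (T j) = (\<Sum>i\<in>rep_index m (s j). bidet_at ?G (s j) (S j) (rep (s j) i) *
    bidet_at (?D * ?H) (s j) (rep (s j) i) (T j))"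
   by (rule bidet_at_mult[OF G DH s[OF j] S[OF j] T[OF j]])
  also have "... = (\<Sum>i\<in>rep_index m (s j). bidet_at ?G (s j) (S j) (rep (s j) i) *
    (?d powi ?e (j, i) * bidet_at ?H (s j) (rep (s j) i) (T j)))"
   by (intro sum.cong refl) (simp add: bidet_at_diag[OF var_nonzero H s[OF j] rp[OF j] T[OF j]])
  finally show "of_int (a j) * bidet_at ?A (s j) (S j) (T j) = (\<Sum>i\<in>rep_index m (s j). ?d powi ?e (j, i) * ?c (j, i))"
   by (simp add: sum_distrib_left ac_simps)
 qed
 also have "... = (\<Sum>x\<in>?I. ?d powi ?e x * ?c x)"
  using fin finite_rep_index by (simp add: sum.Sigma case_prod_unfold)
 finally have "(\<Sum>x\<in>?I. ?d powi ?e x * ?c x) = 0" by simp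
 moreover have "?c x : ratfun_in {1, 2}" if "x : ?I" for x
 proof -
  obtain j i where xe: "x = (j, i)" by (cases x)
  then have x: "x = (j, i)" "j : J" "i : rep_index m (s j)" using that by auto
  have "bidet_at ?G (s j) (S j) (rep (s j) i) : coord m {1, 2}" "bidet_at ?H (s j) (rep (s j) i) (T j) : coord m {1, 2}"
   using bidet_in_coord(1)[OF _ s[OF x(2)]] S T rp x by auto
  then have "of_int (a j) * (bidet_at ?G (s j) (S j) (rep (s j) i) * bidet_at ?H (s j) (rep (s j) i) (T j)) : coord m {1, 2}"
   by (intro coord.mult coord_of_int)
  then show ?thesis unfolding x(1) prod.case by (rule coord_ratfun_in)
 qed
 ultimately have "(\<Sum>x | x : ?I & ?e x = N. ?c x) = 0"
  by (intro var_powers_split[OF finI, where B = "{1, 2}" and b = 3]) auto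
 moreover have "{x. x : ?I & ?e x = N} =
   (%j. (j, canonical_index m (s j))) ` {j. j : J & exponent m (s j) (canonical m (s j)) = N}"
 proof (intro equalityI subsetI)
  fix x assume "x : {x. x : ?I & ?e x = N}"
  moreover obtain j i where xe: "x = (j, i)" by (cases x)
  ultimately have x: "x = (j, i)" "j : J" "i : rep_index m (s j)" "exponent m (s j) (rep (s j) i) = N" by auto
  have "exponent m (s j) (rep (s j) i) = exponent m (s j) (canonical m (s j))"
   using rep_exponent_max(1)[OF s[OF x(2)] x(3)] le[OF x(2)] x(4) by simp
  then show "x : (%j. (j, canonical_index m (s j))) ` {j. j : J & exponent m (s j) (canonical m (s j)) = N}"
   using rep_exponent_max(2)[OF s[OF x(2)] x(3)] x by auto
 qed (use canonical_rep[OF s] in auto)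
 ultimately have "(\<Sum>j | j : J & exponent m (s j) (canonical m (s j)) = N. ?c (j, canonical_index m (s j))) = 0"
  by (simp add: sum.reindex inj_on_def)
 moreover have "(\<Sum>j | j : J & exponent m (s j) (canonical m (s j)) = N. ?c (j, canonical_index m (s j))) =
   (\<Sum>j | j : J & exponent m (s j) (canonical m (s j)) = N. of_int (a j) *
    (bidet_at ?G (s j) (S j) (canonical m (s j)) * bidet_at ?H (s j) (canonical m (s j)) (T j)))"
  by (rule sum.cong) (use canonical_rep(2)[OF s] in auto)
 ultimately show ?thesis by simp
qed

section \<open>Leading monomials and linear independence\<close>

text \<open>The weight of a monomial is measured multiplicatively, as the value of the monomial at powers
 of 2, so that it inherits multiplicativity from evaluation.\<close>

definition leading :: "('v => int) => (('v \<Rightarrow>\<^sub>0 nat) \<Rightarrow>\<^sub>0 int) => ('v \<Rightarrow>\<^sub>0 nat) => bool" where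
 "leading \<omega> p M \<longleftrightarrow> \<bar>plook p M\<bar> = 1 \<and>
   (\<forall>t \<in> pkeys p. t ~= M --> monom_ev \<omega> M < monom_ev \<omega> t)"

lemma monom_ev_pos: "(!!v. 0 < \<omega> v) ==> 0 < monom_ev \<omega> t" for \<omega> :: "'v => int"
 unfolding monom_ev_def by (intro prod_pos ballI zero_less_power)

lemma leading_mult:
 fixes p q :: "('v \<Rightarrow>\<^sub>0 nat) \<Rightarrow>\<^sub>0 int"
 assumes pos: "!!v. 0 < \<omega> v" and p: "leading \<omega> p M" and q: "leading \<omega> q N"
 shows "leading \<omega> (p * q) (M + N)"
proof -
 have lt: "monom_ev \<omega> (M + N) < monom_ev \<omega> (s + t)"
  if "s : pkeys p" "t : pkeys q" "\<not> (s = M & t = N)" for s t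
 proof -
  note posm = monom_ev_pos[of \<omega>, OF pos]
  have le: "monom_ev \<omega> M <= monom_ev \<omega> s" "monom_ev \<omega> N <= monom_ev \<omega> t"
   using p q that(1,2) by (auto simp: leading_def order_le_less)
  have "monom_ev \<omega> M < monom_ev \<omega> s \<or> monom_ev \<omega> N < monom_ev \<omega> t"
   using p q that by (auto simp: leading_def)
  then show ?thesis
   unfolding monom_ev_add using le posm
   by (metis mult_less_le_imp_less mult_le_less_imp_less order_less_imp_le)
 qed
 have "plook (p * q) (M + N) = (\<Sum>s \<in> pkeys p. \<Sum>t \<in> pkeys q.
   if s = M & t = N then plook p M * plook q N else 0)"
  unfolding poly_mult_sum[of p q] lookup_sum lookup_single when_def
 proof (intro sum.cong refl)
  fix s t assume "s : pkeys p" "t : pkeys q"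
  then have "s + t = M + N ==> s = M & t = N" using lt[of s t] by auto
  then show "(if s + t = M + N then plook p s * plook q t else 0) =
    (if s = M & t = N then plook p M * plook q N else 0)" by auto
 qed
 also have "... = (\<Sum>s \<in> pkeys p. if s = M then
   (\<Sum>t \<in> pkeys q. if t = N then plook p M * plook q N else 0) else 0)"
  by (intro sum.cong refl) auto
 also have "... = plook p M * plook q N"
  by (auto simp: in_keys_iff)
 finally have "\<bar>plook (p * q) (M + N)\<bar> = 1"
  using p q by (simp add: leading_def abs_mult)
 moreover have "monom_ev \<omega> (M + N) < monom_ev \<omega> u" if u: "u : pkeys (p * q)" "u ~= M + N" for u
 proof -
  obtain s t where "u = s + t" "s : pkeys p" "t : pkeys q"
   using u(1) keys_mult[of p q] by auto
  then show ?thesis using lt[of s t] u(2) by auto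
 qed
 ultimately show ?thesis by (simp add: leading_def)
qed

lemma leading_prod_list:
 fixes f :: "'i => ('v \<Rightarrow>\<^sub>0 nat) \<Rightarrow>\<^sub>0 int"
 assumes "!!v. 0 < \<omega> v" "!!x. x : set xs ==> leading \<omega> (f x) (g x)"
 shows "leading \<omega> (\<Prod>x\<leftarrow>xs. f x) (\<Sum>x\<leftarrow>xs. g x)"
 using assms(2)
proof (induction xs)
 case Nil
 then show ?case by (simp add: leading_def)
next
 case (Cons x xs)
 then show ?case using leading_mult[where \<omega> = \<omega>, OF assms(1)] by simp
qed

lemma rearrangement:
 fixes g :: "nat => nat"
 assumes "p permutes {0..<r}" "p ~= id" "!!a b. a < b ==> b < r ==> g b < g a" "!!a. a < r ==> g a <= m"
 shows "(\<Sum>a\<in>{0..<r}. g a * (m + 1) ^ (a + 1)) < (\<Sum>a\<in>{0..<r}. g (p a) * (m + 1) ^ (a + 1))"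
 using assms
proof (induction r arbitrary: p)
 case 0
 then show ?case by simp
next
 case (Suc r)
 have im: "p a < Suc r" if "a < Suc r" for a
  using permutes_in_image[OF Suc.prems(1), of a] that by simp
 show ?case
 proof (cases "p r = r")
  case True
  have "p permutes {0..<r}"
   by (rule permutes_superset[OF Suc.prems(1)]) (use True in \<open>auto simp: less_Suc_eq\<close>)
  then have "(\<Sum>a\<in>{0..<r}. g a * (m + 1) ^ (a + 1)) < (\<Sum>a\<in>{0..<r}. g (p a) * (m + 1) ^ (a + 1))"
   by (rule Suc.IH) (use Suc.prems in auto)
  then show ?thesis using True by simp
 next
  case False
  then have "p r < r" using im[of r] by simp
  then have "g r + 1 <= g (p r)" using Suc.prems(3)[of "p r" r] by simp
  then have 1: "(g r + 1) * (m + 1) ^ (r + 1) <= g (p r) * (m + 1) ^ (r + 1)" by (rule mult_right_mono) simp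
  have "(\<Sum>a\<in>{0..<r}. g a * (m + 1) ^ (a + 1)) <= (\<Sum>a\<in>{0..<r}. m * (m + 1) ^ (a + 1))"
   by (intro sum_mono mult_right_mono) (use Suc.prems(4) in auto)
  also have "... < (m + 1) ^ (r + 1)"
   by (induction r) (auto simp: algebra_simps)
  finally have 2: "(\<Sum>a\<in>{0..<r}. g a * (m + 1) ^ (a + 1)) < (m + 1) ^ (r + 1)" .
  have "(\<Sum>a\<in>{0..<Suc r}. g a * (m + 1) ^ (a + 1)) < (g r + 1) * (m + 1) ^ (r + 1)"
   using 2 by (simp add: algebra_simps)
  also have "... <= (\<Sum>a\<in>{0..<Suc r}. g (p a) * (m + 1) ^ (a + 1))"
   using 1 by (simp add: algebra_simps)
  finally show ?thesis .
 qed
qed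

context ordered_letters
begin

definition zgen :: "nat => nat => zpoly" where
 "zgen i j = Poly_Mapping.single (Poly_Mapping.single (0, i, j) 1) 1"

text \<open>The weight of the variable in row \<open>i\<close> and column \<open>j\<close>, chosen so that in a minor with rows
 \<open>1, \<dots>, r\<close> the product along the diagonal has the smallest weight.\<close>

definition var_weight :: "nat \<times> nat \<times> nat => int" where
 "var_weight = (%(b, i, j). 2 ^ ((m - pos j) * (m + 1) ^ i))"

definition col_monom :: "nat set => (nat \<times> nat \<times> nat) \<Rightarrow>\<^sub>0 nat" where
 "col_monom J = (\<Sum>j\<in>J. Poly_Mapping.single (0, below J j, j) 1)"

definition top_minor :: "nat set => zpoly" where
 "top_minor J = minor zgen (card J) Suc (%a. nth_letter J (Suc a))"

lemma monom_ev_sum: "monom_ev \<alpha> (sum f A) = (\<Prod>a\<in>A. monom_ev \<alpha> (f a))"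
proof -
 have "monom_ev \<alpha> 0 = 1" by (simp add: monom_ev_def)
 then show ?thesis by (induction A rule: infinite_finite_induct) (auto simp: monom_ev_add)
qed

lemma prod_single: "(\<Prod>a\<in>A. Poly_Mapping.single (f a) 1) = Poly_Mapping.single (sum f A) (1 :: int)"
 for f :: "'i => 'v \<Rightarrow>\<^sub>0 nat"
 by (induction A rule: infinite_finite_induct) (auto simp: mult_single)

lemma nth_letter_bij:
 assumes "J \<subseteq> {1..m}"
 shows "bij_betw (%a. nth_letter J (Suc a)) {0..<card J} J"
proof -
 have "bij_betw Suc {0..<card J} {1..card J}"
  by (rule bij_betw_byWitness[where f' = "%i. i - 1"]) auto
 moreover have "bij_betw (nth_letter J) {1..card J} J"
  unfolding nth_letter_def[abs_def] by (rule bij_betw_inv_into[OF below_bij[OF assms]])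
 ultimately show ?thesis using bij_betw_trans[of Suc _ _ "nth_letter J"] by (simp add: comp_def)
qed

lemma top_minor_leading:
 assumes J: "J \<subseteq> {1..m}"
 shows "leading var_weight (top_minor J) (col_monom J)"
proof -
 let ?r = "card J" and ?n = "%a. nth_letter J (Suc a)"
 let ?P = "{p. p permutes {0..<?r}}"
 let ?t = "%p. \<Sum>a\<in>{0..<?r}. Poly_Mapping.single (0::nat, Suc a, ?n (p a)) (1::nat)"
 have fin: "finite J" using J finite_subset by blast
 have top: "top_minor J = (\<Sum>p\<in>?P. Poly_Mapping.single (?t p) (sign p))"
  unfolding top_minor_def minor_leibniz
 proof (rule sum.cong[OF refl])
  fix p :: "nat => nat"
  have "of_int (sign p) = (Poly_Mapping.single 0 (sign p) :: zpoly)"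
   by (rule poly_mapping_eqI) (simp add: lookup_of_int lookup_single when_def)
  then show "of_int (sign p) * (\<Prod>a\<in>{0..<?r}. zgen (Suc a) (?n (p a))) = Poly_Mapping.single (?t p) (sign p)"
   unfolding zgen_def prod_single by (simp add: mult_single)
 qed
 have M: "col_monom J = ?t id"
 proof -
  have "col_monom J = (\<Sum>a\<in>{0..<?r}. Poly_Mapping.single (0, below J (?n a), ?n a) 1)"
   unfolding col_monom_def by (rule sum.reindex_bij_betw[OF nth_letter_bij[OF J], symmetric])
  also have "... = ?t id"
   by (rule sum.cong) (use nth_letter(2)[OF J] in auto)
  finally show ?thesis .
 qed
 have w: "monom_ev var_weight (?t p) = 2 ^ (\<Sum>a\<in>{0..<?r}. (m - pos (?n (p a))) * (m + 1) ^ (a + 1))" for p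
  unfolding monom_ev_sum power_sum by (intro prod.cong refl) (simp add: monom_ev_def var_weight_def)
 have n: "?n a : J" "below J (?n a) = Suc a" if "a < ?r" for a
  using nth_letter[OF J, of "Suc a"] that by auto
 have dec: "m - pos (?n b) < m - pos (?n a)" if "a < b" "b < ?r" for a b
 proof -
  have "\<not> (?n b, ?n a) : ord"
   using below_mono[OF fin, of "?n b" "?n a"] n[of a] n[of b] that by auto
  moreover have na: "?n a : {1..m}" "?n b : {1..m}"
   by (rule subsetD[OF J n(1)]; use that in simp)+
  ultimately have "(?n a, ?n b) : ord" using ord_total[OF na] by blast
  moreover have "?n a ~= ?n b" using n(2)[of a] n(2)[of b] that by auto
  ultimately have "pos (?n a) < pos (?n b)" by (rule pos_less)
  moreover have "pos (?n b) <= m" using pos_range[OF na(2)] by simp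
  ultimately show ?thesis by simp
 qed
 have lt: "monom_ev var_weight (?t id) < monom_ev var_weight (?t p)" if "p : ?P" "p ~= id" for p
 proof -
  have "(\<Sum>a\<in>{0..<?r}. (m - pos (?n a)) * (m + 1) ^ (a + 1)) < (\<Sum>a\<in>{0..<?r}. (m - pos (?n (p a))) * (m + 1) ^ (a + 1))"
   by (rule rearrangement) (use that dec in auto)
  then show ?thesis unfolding w by simp
 qed
 have finP: "finite ?P" by (simp add: finite_permutations)
 have "plook (top_minor J) (?t id) = (\<Sum>p\<in>?P. if p = id then 1 else 0)"
  unfolding top lookup_sum lookup_single when_def
  by (intro sum.cong refl) (use lt in fastforce)
 also have "... = 1" using finP by (simp add: permutes_id)
 finally have 1: "\<bar>plook (top_minor J) (?t id)\<bar> = 1" by simp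
 have "monom_ev var_weight (?t id) < monom_ev var_weight u"
  if u: "u : pkeys (top_minor J)" "u ~= ?t id" for u
 proof -
  have "plook (top_minor J) u ~= 0" using u(1) by (simp add: in_keys_iff)
  moreover have "plook (top_minor J) u = 0" if none: "\<forall>p\<in>?P. ?t p ~= u"
   unfolding top lookup_sum lookup_single when_def by (rule sum.neutral) (use none in simp)
  ultimately obtain p where p: "p : ?P" "?t p = u" by blast
  have pid: "p ~= id"
  proof
   assume "p = id"
   then show False using p(2) u(2) by (simp only:)
  qed
  show ?thesis using lt[OF p(1) pid] unfolding p(2) .
 qed
 then show ?thesis unfolding M leading_def using 1 by blast
qed

lemma lookup_col_monom:
 assumes "finite J"
 shows "plook (col_monom J) (0, a, j) = of_bool (j : J & below J j = a)"
proof -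
 have "plook (col_monom J) (0, a, j) = (\<Sum>j'\<in>J. if j' = j then of_bool (below J j = a) else 0)"
  unfolding col_monom_def lookup_sum lookup_single when_def by (intro sum.cong refl) auto
 then show ?thesis using assms by auto
qed

text \<open>In a chain of column sets the number of letters up to \<open>t\<close> in row \<open>a\<close>, which can be read off
 from the leading monomial, determines how many of the columns have at least \<open>a\<close> letters up to \<open>t\<close>;
 in a chain these are the first ones.\<close>

lemma chain_determined:
 assumes L: "!!C. C : set L ==> C \<subseteq> {1..m}" and L': "!!C. C : set L' ==> C \<subseteq> {1..m}"
  and chain: "sorted_wrt col_le L" "sorted_wrt col_le L'" and len: "length L = length L'"
  and eq: "(\<Sum>C\<leftarrow>L. col_monom C) = (\<Sum>C\<leftarrow>L'. col_monom C)"
 shows "L = L'"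
proof -
 have count: "(\<Sum>j | j : {1..m} & (j, t) : ord. plook (\<Sum>C\<leftarrow>K. col_monom C) (0, a, j)) =
   (\<Sum>C\<leftarrow>K. of_bool (a <= below C t))"
  if K: "!!C. C : set K ==> C \<subseteq> {1..m}" and a: "1 <= a" and t: "t : {1..m}" for K a t
  using K
 proof (induction K)
  case (Cons C K)
  have C: "C \<subseteq> {1..m}" using Cons.prems by simp
  then have fin: "finite C" using finite_subset by blast
  have "(\<Sum>j | j : {1..m} & (j, t) : ord. plook (col_monom C) (0, a, j)) =
    (\<Sum>j | j : {1..m} & (j, t) : ord. of_bool (j : C & below C j = a))"
   by (simp only: lookup_col_monom[OF fin])
  also have "... = card {j : {j : {1..m}. (j, t) : ord}. j : C & below C j = a}"
   by (rule card_eq_sum_of_bool[symmetric]) simp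
  also have "... = of_bool (a <= below C t)"
  proof (cases "a <= below C t")
   case True
   then have n: "a <= card C" "(nth_letter C a, t) : ord" using le_below_iff[OF C t a] by auto
   have "{j : {j : {1..m}. (j, t) : ord}. j : C & below C j = a} = {nth_letter C a}"
   proof (intro equalityI subsetI)
    fix j assume "j : {j : {j : {1..m}. (j, t) : ord}. j : C & below C j = a}"
    then show "j : {nth_letter C a}" using nth_letter_eqI[OF C, of j a] by auto
   next
    fix j assume "j : {nth_letter C a}"
    then show "j : {j : {j : {1..m}. (j, t) : ord}. j : C & below C j = a}"
     using nth_letter[OF C a n(1)] n C by auto
   qed
   then show ?thesis using True by simp
  next
   case False
   have "{j : {j : {1..m}. (j, t) : ord}. j : C & below C j = a} = {}"
    using below_mono[OF fin, of _ t] False by auto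
   then show ?thesis using False by (simp only: card.empty) simp
  qed
  finally show ?case using Cons by (simp add: lookup_add sum.distrib)
 qed simp
 have initial: "a <= below (K ! c) t \<longleftrightarrow> c < (\<Sum>C\<leftarrow>K. of_bool (a <= below C t))"
  if K: "sorted_wrt col_le K" and c: "c < length K" and t: "t : {1..m}" for K a c t
 proof -
  let ?S = "{i. i < length K & a <= below (K ! i) t}"
  have sum: "(\<Sum>C\<leftarrow>K. of_bool (a <= below C t)) = card ?S"
  proof -
   have "(\<Sum>C\<leftarrow>K. of_bool (a <= below C t)) = (\<Sum>i\<in>{0..<length K}. of_bool (a <= below (K ! i) t))"
    by (simp add: sum_list_sum_nth)
   also have "... = card {i : {0..<length K}. a <= below (K ! i) t}"
    by (rule card_eq_sum_of_bool[symmetric]) simp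
   finally show ?thesis by simp
  qed
  have down: "i : ?S" if "j : ?S" "i <= j" for i j
  proof (cases "i = j")
   case False
   then have "col_le (K ! i) (K ! j)" using K that by (auto simp: sorted_wrt_iff_nth_less)
   then show ?thesis using that t unfolding col_le_def by (auto intro: order_trans)
  qed (use that in simp)
  have finS: "finite ?S" by simp
  show ?thesis
   unfolding sum
  proof
   assume "a <= below (K ! c) t"
   then have "{0..c} \<subseteq> ?S" using down[of c] c by auto
   then show "c < card ?S" using card_mono[OF finS, of "{0..c}"] by simp
  next
   assume h: "c < card ?S"
   show "a <= below (K ! c) t"
   proof (rule ccontr)
    assume n: "\<not> a <= below (K ! c) t"
    have "?S \<subseteq> {0..<c}"
    proof
     fix i assume i: "i : ?S"
     then have "\<not> c <= i" using down[of i c] n by auto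
     then show "i : {0..<c}" by simp
    qed
    then show False using card_mono[of "{0..<c}" ?S] h by simp
   qed
  qed
 qed
 show ?thesis
 proof (rule nth_equalityI[OF len])
  fix c assume c: "c < length L"
  have C: "L ! c \<subseteq> {1..m}" "L' ! c \<subseteq> {1..m}" using L L' c len by auto
  have b: "below (L ! c) t = below (L' ! c) t" if t: "t : {1..m}" for t
  proof -
   have "a <= below (L ! c) t \<longleftrightarrow> a <= below (L' ! c) t" if a: "1 <= a" for a
   proof -
    have "(\<Sum>C\<leftarrow>L. of_bool (a <= below C t)) = (\<Sum>C\<leftarrow>L'. of_bool (a <= below C t) :: nat)"
     using count[of L a t, OF L a t] count[of L' a t, OF L' a t] unfolding eq by (simp only:)
    then show ?thesis
     using initial[OF chain(1) c t, of a] initial[OF chain(2) _ t, of c a] c len by simp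
   qed
   from this[of "below (L ! c) t"] this[of "below (L' ! c) t"] show ?thesis
    by (cases "below (L ! c) t"; cases "below (L' ! c) t") auto
  qed
  then have le: "col_le (L ! c) (L' ! c)" "col_le (L' ! c) (L ! c)" by (auto simp: col_le_def)
  have cd: "card (L ! c) = card (L' ! c)"
   using col_le_card[OF C le(1)] col_le_card[OF C(2,1) le(2)] by simp
  have "nth_letter (L ! c) i = nth_letter (L' ! c) i" if "i : {1..card (L ! c)}" for i
   using le that cd unfolding col_le_iff_nth[OF C] col_le_iff_nth[OF C(2,1)] by (auto intro: ord_antisym)
  moreover have "nth_letter K ` {1..card K} = K" if "K \<subseteq> {1..m}" for K
   using bij_betw_inv_into[OF below_bij[OF that]] unfolding nth_letter_def[abs_def] by (simp add: bij_betw_def)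
  ultimately show "L ! c = L' ! c" using C cd by (metis image_cong)
 qed
qed

lemma top_minor_bracket:
 assumes J: "J \<subseteq> {1..m}"
 shows "pm_eq (bracket_minor (xfun m) ({1..card J}, J)) (Fract (top_minor J) 1)"
proof -
 let ?n = "%a. nth_letter J (Suc a)"
 note bij = nth_letter_bij[OF J]
 have r: "card J <= m" using card_mono[OF _ J] by simp
 have s: "Suc ` {0..<card J} = {1..card J}" by (simp add: image_Suc_atLeastLessThan atLeastLessThanSuc_atLeastAtMost)
 have x: "xfun m (Suc a) (?n b) = Fract (zgen (Suc a) (?n b)) 1" if "a < card J" "b < card J" for a b
 proof -
  have "?n b : J" using bij_betwE[OF bij] that by auto
  then have "?n b : {1..m}" using J by blast
  then show ?thesis using that r by (auto simp: xfun_def gen_def var_def zgen_def)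
 qed
 have "minor (xfun m) (card J) Suc ?n = Fract (top_minor J) 1"
 proof -
  have "minor (xfun m) (card J) Suc ?n = (\<Sum>p | p permutes {0..<card J}. signof p * (\<Prod>a\<in>{0..<card J}. xfun m (Suc a) (?n (p a))))"
   by (rule minor_leibniz)
  also have "... = (\<Sum>p | p permutes {0..<card J}. Fract (signof p * (\<Prod>a\<in>{0..<card J}. zgen (Suc a) (?n (p a)))) 1)"
  proof (rule sum.cong[OF refl])
   fix p assume "p : {p. p permutes {0..<card J}}"
   then have "(\<Prod>a\<in>{0..<card J}. xfun m (Suc a) (?n (p a))) = (\<Prod>a\<in>{0..<card J}. Fract (zgen (Suc a) (?n (p a))) 1)"
    using permutes_in_image[of p "{0..<card J}"] by (intro prod.cong refl x) auto
   then show "signof p * (\<Prod>a\<in>{0..<card J}. xfun m (Suc a) (?n (p a))) = Fract (signof p * (\<Prod>a\<in>{0..<card J}. zgen (Suc a) (?n (p a)))) 1"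
    by (simp add: Fract_prod_1 ratfun_of_int)
  qed
  finally show ?thesis by (simp add: Fract_sum_1 top_minor_def minor_leibniz)
 qed
 moreover have "pm_eq (minor (xfun m) (card J) Suc ?n) (bracket_minor (xfun m) (Suc ` {0..<card J}, ?n ` {0..<card J}))"
  by (rule minor_bracket) (use bij in \<open>auto simp: bij_betw_def\<close>)
 ultimately show ?thesis using bij s by (simp add: bij_betw_def pm_eq_sym)
qed

lemma pm_eq_prod_list:
 fixes f g :: "'i => 'a::comm_ring_1"
 shows "(!!x. x : set xs ==> pm_eq (f x) (g x)) ==> pm_eq (\<Prod>x\<leftarrow>xs. f x) (\<Prod>x\<leftarrow>xs. g x)"
 by (induction xs) (auto intro: pm_eq_mult)

lemma canonical_bidet_top_minors:
 assumes p: "p : partitions m" and q: "q : partitions m" and f: "fits p l" "fits q k"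
  and T: "(T1, T2) : std_rtableaux m ord (p, q)"
 shows "pm_eq (bidet m (p, q) (canonical m (p, q)) (T1, T2))
  ((1 / det (gen m 0)) ^ k * Fract (\<Prod>C\<leftarrow>column_list m k l (p, q) (T1, T2). top_minor C) 1)"
proof -
 obtain C1 C2 where C: "canonical m (p, q) = (C1, C2)" by (cases "canonical m (p, q)")
 note cc = canonical_columns[OF p q, unfolded C fst_conv snd_conv]
 note F = std_rtableaux_facts[OF p q T]
 let ?L = "column_list m k l (p, q) (T1, T2)"
 have Cr: "(C1, C2) : rtableaux m (p, q)"
  using canonical_in_rtableaux[of m "(p, q)"] p q C by (simp add: good_parts_def)
 have "column_list m k l (p, q) (C1, C2) = map (%n. {1..n}) (size_list m k l (p, q))"
 proof -
  have "{1..m} - {m - clen q c + 1..m} = {1..m - clen q c}" for c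
   using young_initial(2)[OF q, of c] by auto
  then show ?thesis by (simp add: column_list_def size_list_def cc)
 qed
 then have z: "zip (column_list m k l (p, q) (C1, C2)) ?L = map (%J. ({1..card J}, J)) ?L"
  unfolding card_column_list[OF p q F(1-3), of k l, symmetric] by (simp add: zip_map1 zip_same_conv_map comp_def)
 have "pm_eq (bidet m (p, q) (C1, C2) (T1, T2)) ((1 / det (gen m 0)) ^ k *
   (\<Prod>x\<leftarrow>map (%J. ({1..card J}, J)) ?L. bracket_minor (x_at (gen m 0)) x))"
  unfolding bidet_eq z[symmetric]
  by (rule bidet_at_brackets[OF gen_carrier det_gen_nonzero p q f Cr F(1) cc(3,4) F(2,3)])
 also have "pm_eq ... ((1 / det (gen m 0)) ^ k * (\<Prod>C\<leftarrow>?L. Fract (top_minor C) 1))"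
  unfolding map_map comp_def xfun_eq[symmetric]
  by (intro pm_eq_mult pm_eq_refl pm_eq_prod_list top_minor_bracket) (rule column_list_range[OF p F(1)])
 also have "(\<Prod>C\<leftarrow>?L. Fract (top_minor C) 1) = Fract (\<Prod>C\<leftarrow>?L. top_minor C) 1"
 proof -
  have "(\<Prod>C\<leftarrow>Cs. Fract (top_minor C) 1) = Fract (\<Prod>C\<leftarrow>Cs. top_minor C) 1" for Cs
   by (induction Cs) (simp_all add: One_fract_def)
  then show ?thesis .
 qed
 finally show ?thesis unfolding C .
qed

end

section \<open>Independence of the standard bideterminants\<close>

lemma bidet_factor_transpose:
 assumes p: "p : partitions m" and S: "S : tableaux m p" and T: "T : tableaux m p"
  and z: "!!i j. i : {1..m} ==> j : {1..m} ==> z i j = z' j i"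
 shows "bidet_factor z p S T = bidet_factor z' p T S"
proof -
 have ent: "V (a + 1, c) : {1..m}" if "V : tableaux m p" "a < clen p c" for V a c
  using that in_young_iff[OF p, of "a + 1" c] by (auto simp: tableaux_def dest!: PiE_mem)
 have "minor z (clen p c) (%a. S (a + 1, c)) (%b. T (b + 1, c)) =
   minor z' (clen p c) (%b. T (b + 1, c)) (%a. S (a + 1, c))" for c
  unfolding minor_transpose[of z' "clen p c"] by (rule minor_cong) (use z ent S T in auto)
 then show ?thesis unfolding bidet_factor_minors[OF p fits_sum_list] by (simp only:)
qed

lemma bidet_at_transpose:
 assumes A: "A : carrier_mat m m" "det A ~= 0" and s: "good_parts m s"
  and S: "S : rtableaux m s" and T: "T : rtableaux m s"
 shows "bidet_at (transpose_mat A) s S T = bidet_at A s T S"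
proof -
 obtain p q where pq: "s = (p, q)" by (cases s)
 obtain S1 S2 where Se: "S = (S1, S2)" by (cases S)
 obtain T1 T2 where Te: "T = (T1, T2)" by (cases T)
 have p: "p : partitions m" and q: "q : partitions m" using s pq by (auto simp: good_parts_def)
 have tab: "S1 : tableaux m p" "S2 : tableaux m q" "T1 : tableaux m p" "T2 : tableaux m q"
  using S T by (auto simp: rtableaux_def pq Se Te)
 note inv = matinv_eq(2-)[OF A]
 have At: "transpose_mat A : carrier_mat m m" "det (transpose_mat A) ~= 0"
  using A det_transpose[OF A(1)] by auto
 have it: "matinv (transpose_mat A) = transpose_mat (matinv A)"
 proof (rule matinv_unique(1)[OF At(1)])
  show "transpose_mat (matinv A) : carrier_mat m m" using inv by simp
  show "transpose_mat A * transpose_mat (matinv A) = 1\<^sub>m m"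
   using transpose_mult[OF inv(1) A(1)] inv(3) by simp
 qed
 have x: "x_at (transpose_mat A) i j = x_at A j i" if "i : {1..m}" "j : {1..m}" for i j
 proof -
  have "i - 1 < m" "j - 1 < m" using that by auto
  then show ?thesis using A by (simp add: x_at_def)
 qed
 have y: "y_at (transpose_mat A) i j = y_at A j i" if ij: "i : {1..m}" "j : {1..m}" for i j
 proof -
  have "i - 1 < m" "j - 1 < m" using that by auto
  then show ?thesis
   unfolding y_at_eq_x_at[OF At ij] y_at_eq_x_at[OF A ij(2,1)] it using inv by (simp add: x_at_def)
 qed
 show ?thesis
  unfolding bidet_at_def pq Se Te prod.case
  using bidet_factor_transpose[OF p tab(1,3) x] bidet_factor_transpose[OF q tab(2,4) y] by simp
qed

lemma eval_bidet_relation: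
 assumes A: "A : carrier_mat m m" "det A ~= 0" and s: "!!x. x : X ==> good_parts m (s x)"
  and S: "!!x. x : X ==> S x : rtableaux m (s x)" and T: "!!x. x : X ==> T x : rtableaux m (s x)"
 shows "eval_at (\<Sum>x\<in>X. of_int (a x) * bidet_at (gen m b) (s x) (S x) (T x)) A =
  (\<Sum>x\<in>X. of_int (a x) * bidet_at A (s x) (S x) (T x))"
proof -
 have ev: "evaluable A (of_int (a x) * bidet_at (gen m b) (s x) (S x) (T x)) \<and>
   eval_at (of_int (a x) * bidet_at (gen m b) (s x) (S x) (T x)) A = of_int (a x) * bidet_at A (s x) (S x) (T x)"
  if "x : X" for x
  using eval_bidet[OF A s S T, of x b] evaluable_of_int[where A = A and n = "a x"] that
  by (simp add: evaluable_ops)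
 have "eval_at (\<Sum>x\<in>X. of_int (a x) * bidet_at (gen m b) (s x) (S x) (T x)) A =
   (\<Sum>x\<in>X. eval_at (of_int (a x) * bidet_at (gen m b) (s x) (S x) (T x)) A)"
  by (rule evaluable_sum[THEN conjunct2]) (use ev in blast)
 also have "... = (\<Sum>x\<in>X. of_int (a x) * bidet_at A (s x) (S x) (T x))"
  by (rule sum.cong) (use ev in auto)
 finally show ?thesis .
qed

context ordered_letters
begin

lemma std_in_rtableaux: "S : std_rtableaux m ord s ==> S : rtableaux m s"
 using std_rtableaux_subset by blast

lemma right_independent_0:
 assumes fin: "finite X" and s: "!!x. x : X ==> good_parts m (s x)"
  and T: "!!x. x : X ==> T x : std_rtableaux m ord (s x)" and inj: "inj_on (%x. (s x, T x)) X"
  and rel: "(\<Sum>x\<in>X. of_int (a x) * bidet m (s x) (canonical m (s x)) (T x)) = 0"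
 shows "\<forall>x\<in>X. a x = 0"
proof -
 define k where "k = (\<Sum>x\<in>X. sum_list (snd (s x)))"
 define l where "l = (\<Sum>x\<in>X. sum_list (fst (s x)))"
 have parts: "fst (s x) : partitions m" "snd (s x) : partitions m" if "x : X" for x
  using s[OF that] by (auto simp: good_parts_def)
 have f: "fits (fst (s x)) l" "fits (snd (s x)) k" if "x : X" for x
  unfolding k_def l_def
  by (rule fits_mono[OF fits_sum_list]; rule member_le_sum[of x X]; use that fin in simp)+
 have T': "(fst (T x), snd (T x)) : std_rtableaux m ord (fst (s x), snd (s x))" if "x : X" for x
  using T[OF that] by simp
 define L where "L x = column_list m k l (s x) (T x)" for x
 define Q where "Q x = (\<Prod>C\<leftarrow>L x. top_minor C)" for x
 define M where "M x = (\<Sum>C\<leftarrow>L x. col_monom C)" for x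
 have Lr: "C \<subseteq> {1..m}" if "x : X" "C : set (L x)" for x C
  by (rule column_list_range[OF parts(1)[OF that(1)] std_rtableaux_facts(1)[OF parts[OF that(1)] T'[OF that(1)]]])
   (use that in \<open>simp add: L_def\<close>)
 have wpos: "0 < var_weight v" for v
  by (cases v) (simp add: var_weight_def)
 have lead: "leading var_weight (Q x) (M x)" if "x : X" for x
  unfolding Q_def M_def by (rule leading_prod_list[OF wpos top_minor_leading]) (use Lr that in blast)
 have M_inj: "x = y" if xy: "x : X" "y : X" and eq: "M x = M y" for x y
 proof -
  have ch: "sorted_wrt col_le (L z)" if "z : X" for z
   using std_rtableaux_facts(5)[OF parts[OF that] T'[OF that], of k l] by (simp add: L_def)
  have "L x = L y"
   by (rule chain_determined[OF Lr[OF xy(1)] Lr[OF xy(2)] ch[OF xy(1)] ch[OF xy(2)] _ eq[unfolded M_def]])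
    (simp_all add: L_def)
  then have "(s x, T x) = (s y, T y)"
   using column_list_inj[OF parts[OF xy(1)] f[OF xy(1)] parts[OF xy(2)] f[OF xy(2)] T'[OF xy(1)] T'[OF xy(2)]]
   by (simp add: L_def)
  then show ?thesis using inj xy by (auto simp: inj_on_def)
 qed
 let ?c = "(1 / det (gen m 0)) ^ k"
 define \<epsilon> :: "'a => int" where
  "\<epsilon> x = (if bidet m (s x) (canonical m (s x)) (T x) = ?c * Fract (Q x) 1 then 1 else -1)" for x
 have b: "bidet m (s x) (canonical m (s x)) (T x) = of_int (\<epsilon> x) * (?c * Fract (Q x) 1)" if "x : X" for x
  using canonical_bidet_top_minors[OF parts[OF that] f[OF that] T'[OF that]]
  by (auto simp: pm_eq_def \<epsilon>_def Q_def L_def)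
 have "(\<Sum>x\<in>X. of_int (a x) * bidet m (s x) (canonical m (s x)) (T x)) =
   (\<Sum>x\<in>X. ?c * Fract (of_int (a x * \<epsilon> x) * Q x) 1)"
  by (rule sum.cong[OF refl]) (simp add: b ratfun_of_int mult.assoc)
 also have "... = ?c * Fract (\<Sum>x\<in>X. of_int (a x * \<epsilon> x) * Q x) 1"
  by (simp only: sum_distrib_left[symmetric] Fract_sum_1)
 finally have Qrel: "(\<Sum>x\<in>X. of_int (a x * \<epsilon> x) * Q x) = 0"
  using rel det_gen_nonzero[of m 0] by (simp add: Fract_1_eq_0)
 show ?thesis
 proof (rule ccontr)
  let ?Y = "{x : X. a x ~= 0}" and ?w = "%x. monom_ev var_weight (M x)"
  assume "\<not> ?thesis"
  then have Y: "finite ?Y" "?Y ~= {}" using fin by auto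
  have "Min (?w ` ?Y) : ?w ` ?Y" using Y by (intro Min_in) auto
  then obtain x0 where x0: "x0 : X" "a x0 ~= 0" and w0: "?w x0 = Min (?w ` ?Y)" by auto
  have mn: "?w x0 <= ?w x" if "x : X" "a x ~= 0" for x
   unfolding w0 using Y that by (intro Min_le) auto
  have z: "a x * plook (Q x) (M x0) = 0" if x: "x : X" "x ~= x0" for x
  proof (rule ccontr)
   assume "\<not> ?thesis"
   then have ax: "a x ~= 0" and "M x0 : pkeys (Q x)" by (auto simp: in_keys_iff)
   moreover have "M x0 ~= M x" using M_inj[OF x0(1) x(1)] x by auto
   ultimately have "?w x < ?w x0" using lead[OF x(1)] by (auto simp: leading_def)
   then show False using mn[OF x(1) ax] by simp
  qed
  have "0 = plook (\<Sum>x\<in>X. of_int (a x * \<epsilon> x) * Q x) (M x0)" unfolding Qrel by simp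
  also have "... = (\<Sum>x\<in>X. if x = x0 then a x0 * \<epsilon> x0 * plook (Q x0) (M x0) else 0)"
   unfolding lookup_sum lookup_of_int_mult by (rule sum.cong) (use z in auto)
  also have "... = a x0 * \<epsilon> x0 * plook (Q x0) (M x0)" using fin x0 by simp
  finally have "a x0 * \<epsilon> x0 * plook (Q x0) (M x0) = 0" by simp
  then have "plook (Q x0) (M x0) = 0" using x0 by (simp add: \<epsilon>_def split: if_splits)
  then show False using lead[OF x0(1)] by (simp add: leading_def)
 qed
qed

lemma right_independent:
 assumes "finite X" and s: "!!x. x : X ==> good_parts m (s x)"
  and T: "!!x. x : X ==> T x : std_rtableaux m ord (s x)" and "inj_on (%x. (s x, T x)) X"
  and rel: "(\<Sum>x\<in>X. of_int (a x) * bidet_at (gen m b) (s x) (canonical m (s x)) (T x)) = 0"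
 shows "\<forall>x\<in>X. a x = 0"
proof (rule right_independent_0[OF assms(1) s T assms(4)])
 have "(\<Sum>x\<in>X. of_int (a x) * bidet m (s x) (canonical m (s x)) (T x)) =
   eval_at (\<Sum>x\<in>X. of_int (a x) * bidet_at (gen m b) (s x) (canonical m (s x)) (T x)) (gen m 0)"
  unfolding bidet_eq
  by (rule eval_bidet_relation[OF gen_carrier det_gen_nonzero, symmetric])
   (use s T canonical_in_rtableaux std_in_rtableaux in auto)
 then show "(\<Sum>x\<in>X. of_int (a x) * bidet m (s x) (canonical m (s x)) (T x)) = 0"
  using rel by simp
qed

lemma left_independent:
 assumes "finite X" and s: "!!x. x : X ==> good_parts m (s x)"
  and S: "!!x. x : X ==> S x : std_rtableaux m ord (s x)" and "inj_on (%x. (s x, S x)) X"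
  and rel: "(\<Sum>x\<in>X. of_int (a x) * bidet_at (gen m b) (s x) (S x) (canonical m (s x))) = 0"
 shows "\<forall>x\<in>X. a x = 0"
proof (rule right_independent_0[OF assms(1) s S assms(4)])
 let ?A = "transpose_mat (gen m 0)"
 have A: "?A : carrier_mat m m" "det ?A ~= 0"
  using det_transpose[OF gen_carrier, of m 0] det_gen_nonzero[of m 0] by auto
 have "(\<Sum>x\<in>X. of_int (a x) * bidet m (s x) (canonical m (s x)) (S x)) =
   (\<Sum>x\<in>X. of_int (a x) * bidet_at ?A (s x) (S x) (canonical m (s x)))"
  unfolding bidet_eq
  by (intro sum.cong refl arg_cong2[of _ _ _ _ "(*)"] bidet_at_transpose[OF gen_carrier det_gen_nonzero, symmetric])
   (use s S canonical_in_rtableaux std_in_rtableaux in auto)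
 also have "... = eval_at (\<Sum>x\<in>X. of_int (a x) * bidet_at (gen m b) (s x) (S x) (canonical m (s x))) ?A"
  by (rule eval_bidet_relation[OF A, symmetric])
   (use s S canonical_in_rtableaux std_in_rtableaux in auto)
 finally show "(\<Sum>x\<in>X. of_int (a x) * bidet m (s x) (canonical m (s x)) (S x)) = 0"
  using rel by simp
qed

text \<open>Products of left and right bideterminants in two independent generic matrices. Linear
 disjointness separates the two factors.\<close>

lemma tensor_independent:
 assumes fin: "finite X" and s: "!!x. x : X ==> good_parts m (s x)"
  and S: "!!x. x : X ==> S x : std_rtableaux m ord (s x)" and T: "!!x. x : X ==> T x : std_rtableaux m ord (s x)"
  and inj: "inj_on (%x. (s x, S x, T x)) X"
  and rel: "(\<Sum>x\<in>X. of_int (a x) * (bidet_at (gen m 1) (s x) (S x) (canonical m (s x)) *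
    bidet_at (gen m 2) (s x) (canonical m (s x)) (T x))) = 0"
 shows "\<forall>x\<in>X. a x = 0"
proof -
 let ?Y = "(%x. (s x, T x)) ` X"
 let ?X = "%y. {x : X. (s x, T x) = y}"
 let ?e = "%y. bidet_at (gen m 2) (fst y) (canonical m (fst y)) (snd y)"
 let ?c = "%y. \<Sum>x\<in>?X y. of_int (a x) * bidet_at (gen m 1) (s x) (S x) (canonical m (s x))"
 have finY: "finite ?Y" using fin by simp
 have good: "good_parts m (fst y)" "snd y : std_rtableaux m ord (fst y)" if "y : ?Y" for y
  using that s T by auto
 have "(\<Sum>y\<in>?Y. ?e y * ?c y) = (\<Sum>y\<in>?Y. \<Sum>x\<in>?X y. of_int (a x) * (bidet_at (gen m 1) (s x) (S x) (canonical m (s x)) *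
    bidet_at (gen m 2) (s x) (canonical m (s x)) (T x)))"
  by (intro sum.cong refl) (auto simp: sum_distrib_left ac_simps intro!: sum.cong)
 also have "... = (\<Sum>x\<in>X. of_int (a x) * (bidet_at (gen m 1) (s x) (S x) (canonical m (s x)) *
    bidet_at (gen m 2) (s x) (canonical m (s x)) (T x)))"
  by (rule sum.group[OF fin finY]) simp
 finally have r: "(\<Sum>y\<in>?Y. ?e y * ?c y) = 0" using rel by simp
 have cz: "\<forall>y\<in>?Y. ?c y = 0"
 proof (rule linearly_disjoint[OF finY _ _ _ r, where B = "{2}" and B' = "{1}"])
  fix y assume y: "y : ?Y"
  have "?e y : coord m {2}"
   by (rule bidet_in_coord(1)[OF _ good(1)[OF y] canonical_in_rtableaux[OF good(1)[OF y]] std_in_rtableaux[OF good(2)[OF y]]]) simp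
  then show "?e y : ratfun_in {2}" by (rule coord_ratfun_in)
  have "bidet_at (gen m 1) (s x) (S x) (canonical m (s x)) : coord m {1}" if "x : X" for x
   by (rule bidet_in_coord(1)[OF _ s[OF that] std_in_rtableaux[OF S[OF that]] canonical_in_rtableaux[OF s[OF that]]]) simp
  then have "?c y : coord m {1}" by (intro coord_sum coord.mult coord_of_int) auto
  then show "?c y : ratfun_in {1}" by (rule coord_ratfun_in)
 next
  fix n :: "shape \<times> rtableau => int"
  assume "(\<Sum>y\<in>?Y. of_int (n y) * ?e y) = 0"
  then show "\<forall>y\<in>?Y. n y = 0"
   by (intro right_independent[OF finY, where s = fst and T = snd and b = 2]) (use good in auto)
 qed simp
 show ?thesis
 proof
  fix x assume x: "x : X"
  let ?Z = "?X (s x, T x)"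
  have "\<forall>z\<in>?Z. a z = 0"
  proof (rule left_independent[where s = s and S = S and b = 1])
   show "finite ?Z" using fin by simp
   show "good_parts m (s z)" "S z : std_rtableaux m ord (s z)" if "z : ?Z" for z
    using that s[of z] S[of z] by blast+
   show "inj_on (%x. (s x, S x)) ?Z" using inj by (auto simp: inj_on_def)
   show "?c (s x, T x) = 0" using cz x by blast
  qed
  then show "a x = 0" using x by blast
 qed
qed

theorem standard_independent:
 assumes fin: "finite X" and s: "!!x. x : X ==> good_parts m (s x)"
  and S: "!!x. x : X ==> S x : std_rtableaux m ord (s x)" and T: "!!x. x : X ==> T x : std_rtableaux m ord (s x)"
  and inj: "inj_on (%x. (s x, S x, T x)) X"
  and rel: "(\<Sum>x\<in>X. of_int (a x) * bidet m (s x) (S x) (T x)) = 0"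
 shows "\<forall>x\<in>X. a x = 0"
proof (rule ccontr)
 let ?Y = "{x : X. a x ~= 0}" and ?N = "%x. exponent m (s x) (canonical m (s x))"
 assume "\<not> ?thesis"
 then have Y: "finite ?Y" "?Y ~= {}" using fin by auto
 let ?top = "Max (?N ` ?Y)"
 have "(\<Sum>x\<in>?Y. of_int (a x) * bidet m (s x) (S x) (T x)) = (\<Sum>x\<in>X. of_int (a x) * bidet m (s x) (S x) (T x))"
  by (rule sum.mono_neutral_left) (use fin in auto)
 then have "(\<Sum>x\<in>?Y. of_int (a x) * bidet m (s x) (S x) (T x)) = 0" using rel by simp
 then have "(\<Sum>x | x : ?Y & ?N x = ?top. of_int (a x) *
   (bidet_at (gen m 1) (s x) (S x) (canonical m (s x)) * bidet_at (gen m 2) (s x) (canonical m (s x)) (T x))) = 0"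
  by (intro highest_component[OF Y(1)]) (use s S T std_in_rtableaux Y in \<open>auto intro!: Max_ge\<close>)
 then have "\<forall>x\<in>{x. x : ?Y & ?N x = ?top}. a x = 0"
  by (intro tensor_independent) (use s S T fin inj in \<open>auto simp: inj_on_def\<close>)
 moreover have "?top : ?N ` ?Y" using Y by (intro Max_in) auto
 ultimately show False by auto
qed

end

section \<open>Bases\<close>

lemma zspan_image_explicit:
 assumes "x : zmod.span (f ` Y)"
 shows "\<exists>I a. finite I & I \<subseteq> Y & x = (\<Sum>i\<in>I. of_int (a i) * f i)"
 using assms
proof (induction rule: zmod.span_induct_alt)
 case base
 show ?case by (intro exI[of _ "{}"] exI[of _ "%_. 0"]) simp
next
 case (step n y x)
 then obtain j I a where j: "j : Y" "y = f j" and I: "finite I" "I \<subseteq> Y" "x = (\<Sum>i\<in>I. of_int (a i) * f i)"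
  by auto
 define b where "b i = (if i : I then a i else 0) + (if i = j then n else 0)" for i
 have "(\<Sum>i\<in>insert j I. of_int (b i) * f i) =
   (\<Sum>i\<in>insert j I. (if i : I then of_int (a i) * f i else 0) + (if i = j then of_int n * f j else 0))"
  by (rule sum.cong) (auto simp: b_def algebra_simps)
 also have "... = (\<Sum>i\<in>insert j I. if i : I then of_int (a i) * f i else 0) + of_int n * f j"
  using I(1) by (simp only: sum.distrib sum.delta finite_insert) simp
 also have "(\<Sum>i\<in>insert j I. if i : I then of_int (a i) * f i else 0) = (\<Sum>i\<in>I. of_int (a i) * f i)"
  using I(1) by (intro sum.mono_neutral_cong_right) auto
 finally show ?case
  using I j by (intro exI[of _ "insert j I"] exI[of _ b]) (auto simp: zscale_def)
qed

lemma zspan_sum_of_int: "(!!i. i : I ==> f i : zmod.span S) ==> (\<Sum>i\<in>I. of_int (a i) * f i) : zmod.span S"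
 using zmod.span_scale by (intro zmod.span_sum) (auto simp: zscale_def)

lemma is_zbasisI:
 assumes indep: "!!I a. finite I ==> I \<subseteq> Y ==> (\<Sum>i\<in>I. of_int (a i) * f i) = 0 ==> \<forall>i\<in>I. a i = (0::int)"
  and span: "zmod.span (f ` Y) = M"
 shows "is_zbasis Y f M"
 unfolding is_zbasis_def
proof (intro conjI span)
 show inj: "inj_on f Y"
 proof (rule inj_onI, rule ccontr)
  fix x y assume xy: "x : Y" "y : Y" "f x = f y" "x ~= y"
  have "(\<Sum>i\<in>{x, y}. of_int (if i = x then 1 else -1) * f i) = 0" using xy by simp
  then have "\<forall>i\<in>{x, y}. (if i = x then 1 else -1) = (0::int)"
   using xy by (intro indep) auto
  then show False by auto
 qed
 show "\<not> zmod.dependent (f ` Y)"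
 proof
  assume "zmod.dependent (f ` Y)"
  then obtain S u where S: "finite S" "S \<subseteq> f ` Y" "\<exists>v\<in>S. u v ~= 0" "(\<Sum>v\<in>S. zscale (u v) v) = 0"
   by (auto simp: zmod.dependent_explicit)
  obtain I where I: "I \<subseteq> Y" "S = f ` I" using S(2) by (auto simp: subset_image_iff)
  have injI: "inj_on f I" using inj I(1) by (rule inj_on_subset)
  have "finite I" using S(1) I(2) injI by (simp add: finite_image_iff)
  moreover have "(\<Sum>i\<in>I. of_int (u (f i)) * f i) = 0"
   using S(4) unfolding I(2) by (simp add: sum.reindex[OF injI] zscale_def)
  ultimately have "\<forall>i\<in>I. u (f i) = 0" using I(1) by (intro indep)
  then show False using S(3) I(2) by auto
 qed
qed

lemma good_shape_parts_imp: "good_shape m s ==> good_parts m s"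
 by (cases s) (auto simp: good_shape_def good_parts_def)

lemma shape_of_parts: "lam : Xplus m ==> good_parts m (shape_of m lam)"
 by (intro good_shape_parts_imp shape_of_good(1))

lemma finite_rtableaux: "good_parts m s ==> finite (rtableaux m s)"
 by (cases s) (auto simp: rtableaux_def tableaux_def good_parts_def intro!: finite_PiE finite_young)

lemma subspace_coord: "zmod.subspace (coord m B)"
 unfolding zmod.subspace_def zscale_def by (auto intro: coord_0 coord_add coord.mult coord_of_int)

text \<open>The exponent is the pairing of the weight with \<open>(m - 1, \<dots>, 1, 0)\<close>.\<close>

lemma exponent_wt:
 assumes s: "good_parts m s" and U: "U : rtableaux m s"
 shows "exponent m s U = (\<Sum>i\<in>{1..m}. int (m - i) * wt m s U ! (i - 1))"
proof -
 obtain p q where pq: "s = (p, q)" by (cases s)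
 obtain U1 U2 where Ue: "U = (U1, U2)" by (cases U)
 have p: "p : partitions m" and q: "q : partitions m" using s pq by (auto simp: good_parts_def)
 have tab: "U1 : tableaux m p" "U2 : tableaux m q" using U by (auto simp: rtableaux_def pq Ue)
 have t: "int (tab_exponent m r V) = (\<Sum>i\<in>{1..m}. int (m - i) * int (card {b : young r. V b = i}))"
  if r: "r : partitions m" and V: "V : tableaux m r" for r V
 proof -
  have "tab_exponent m r V = (\<Sum>i\<in>{1..m}. \<Sum>b | b : young r & V b = i. m - V b)"
   unfolding tab_exponent_def
   by (rule sum.group[symmetric, OF finite_young[OF r]]) (use V in \<open>auto simp: tableaux_def dest!: PiE_mem\<close>)
  also have "... = (\<Sum>i\<in>{1..m}. card {b : young r. V b = i} * (m - i))"
   by (intro sum.cong refl) simp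
  finally show ?thesis by (simp add: mult.commute)
 qed
 have "wt m s U ! (i - 1) = int (card {b : young p. U1 b = i}) - int (card {b : young q. U2 b = i})"
  if "i : {1..m}" for i
  using that by (auto simp: wt_def pq Ue simp del: upt_Suc)
 then have "(\<Sum>i\<in>{1..m}. int (m - i) * wt m s U ! (i - 1)) =
   (\<Sum>i\<in>{1..m}. int (m - i) * int (card {b : young p. U1 b = i}) - int (m - i) * int (card {b : young q. U2 b = i}))"
  by (intro sum.cong refl) (simp only: right_diff_distrib)
 then show ?thesis
  by (simp add: exponent_def pq Ue t[OF p tab(1)] t[OF q tab(2)] sum_subtractf)
qed

context ordered_letters
begin

abbreviation shp :: "int list => shape" where
 "shp \<equiv> shape_of m"

abbreviation can :: "int list => rtableau" where
 "can lam \<equiv> canonical m (shape_of m lam)"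

abbreviation std :: "int list => rtableau set" where
 "std lam \<equiv> std_rtableaux m ord (shape_of m lam)"

lemma finite_std: "lam : Xplus m ==> finite (std lam)"
 by (rule finite_subset[OF std_rtableaux_subset finite_rtableaux[OF shape_of_parts]])

lemma can_in: "lam : Xplus m ==> can lam : rtableaux m (shp lam)"
 by (intro canonical_in_rtableaux shape_of_parts)

theorem straightening_explicit:
 assumes lam: "lam : Xplus m" and S: "S : rtableaux m (shp lam)" and T: "T : rtableaux m (shp lam)"
 shows "\<exists>I a. finite I & I \<subseteq> {(mu, S', T'). mu : Xplus m & dom_le mu lam & S' : std mu & T' : std mu \<and>
   bwt m (shp mu) S' T' = bwt m (shp lam) S T} \<and>
  bidet m (shp lam) S T = (\<Sum>(mu, S', T') \<in> I. of_int (a (mu, S', T')) * bidet m (shp mu) S' T')"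
proof -
 define Y where "Y = {(mu, S', T'). mu : Xplus m & dom_le mu lam & S' : std mu & T' : std mu \<and>
   bwt m (shp mu) S' T' = bwt m (shp lam) S T}"
 define f where "f = (%(mu, S', T'). bidet m (shp mu) S' T')"
 have "{bidet m (shp mu) S' T' | mu S' T'. mu : Xplus m & dom_le mu lam & S' : std mu & T' : std mu \<and>
   bwt m (shp mu) S' T' = bwt m (shp lam) S T} = f ` Y"
  by (force simp: image_iff f_def Y_def)
 then have h: "bidet m (shp lam) S T : zmod.span (f ` Y)"
  using rational_straightening[OF gen_carrier det_gen_nonzero lam S T, of 0] unfolding bidet_eq by simp
 obtain I a where I: "finite I" "I \<subseteq> Y" "bidet m (shp lam) S T = (\<Sum>i\<in>I. of_int (a i) * f i)"
  using zspan_image_explicit[OF h] by blast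
 have "(\<Sum>i\<in>I. of_int (a i) * f i) = (\<Sum>(mu, S', T') \<in> I. of_int (a (mu, S', T')) * bidet m (shp mu) S' T')"
  by (rule sum.cong) (auto simp: f_def)
 then show ?thesis using I unfolding Y_def by (intro exI[of _ I] exI[of _ a] conjI) simp_all
qed

text \<open>Straightening preserves the number of factors. In each resulting chain the first \<open>k\<close> factors
 absorb one inverse determinant each and become columns of second tableaux.\<close>

lemma bracket_products_in_span:
 assumes v: "valid_list ws" and k: "k <= length ws"
 shows "(1 / det (gen m 0)) ^ k * brackets (x_at (gen m 0)) ws : zmod.span ((%(s, S, T). bidet m s S T) `
  {(s, S, T). s : partitions m \<times> partitions m & S : std_rtableaux m ord s & T : std_rtableaux m ord s})"
  (is "_ : zmod.span ?B")
proof -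
 let ?c = "(1 / det (gen m 0)) ^ k" and ?X = "x_at (gen m 0)"
 have "?c * brackets ?X ws : zmod.span ((*) ?c ` {brackets ?X ws' | ws'. improves ws' ws & sorted_wrt pair_le ws'})"
  by (rule zspan_mult_left[OF straightening[OF v]])
 also have "... \<subseteq> zmod.span ?B"
 proof (rule zmod.span_minimal[OF _ zmod.subspace_span], clarify)
  fix ws' assume imp: "improves ws' ws" and srt: "sorted_wrt pair_le ws'"
  have v': "valid_list ws'" and len: "length ws' = k + (length ws - k)" using imp k by (auto simp: improves_def)
  obtain p q U1 U2 V1 V2 where c: "p : partitions m" "q : partitions m"
   "(U1, U2) : std_rtableaux m ord (p, q)" "(V1, V2) : std_rtableaux m ord (p, q)"
   and pm: "pm_eq (bidet_at (gen m 0) (p, q) (U1, U2) (V1, V2)) (?c * brackets ?X ws')"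
   by (rule chain_bidet[OF gen_carrier det_gen_nonzero v' srt len])
  have "bidet_at (gen m 0) (p, q) (U1, U2) (V1, V2) : ?B"
   unfolding bidet_eq[symmetric] by (rule image_eqI[of _ _ "((p, q), (U1, U2), (V1, V2))"]) (use c in auto)
  then show "?c * brackets ?X ws' : zmod.span ?B"
   by (rule zspan_pm_eq[OF pm_eq_sym[OF pm] zmod.span_base])
 qed
 finally show ?thesis .
qed

theorem standard_bideterminants_basis:
 "is_zbasis {(s, S, T). s : partitions m \<times> partitions m & S : std_rtableaux m ord s & T : std_rtableaux m ord s}
   (%(s, S, T). bidet m s S T) (ZGL m)"
 (is "is_zbasis ?Y ?f _")
proof (rule is_zbasisI)
 fix I a assume I: "finite I" "I \<subseteq> ?Y" and rel: "(\<Sum>i\<in>I. of_int (a i) * ?f i) = 0"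
 show "\<forall>i\<in>I. a i = 0"
 proof (rule standard_independent[OF I(1), where s = fst and S = "%x. fst (snd x)" and T = "%x. snd (snd x)"])
  show "(\<Sum>x\<in>I. of_int (a x) * bidet m (fst x) (fst (snd x)) (snd (snd x))) = 0"
   using rel by (simp add: case_prod_unfold)
  show "good_parts m (fst x)" "fst (snd x) : std_rtableaux m ord (fst x)" "snd (snd x) : std_rtableaux m ord (fst x)"
   if "x : I" for x
   using I(2) that by (auto simp: good_parts_def)
 qed (auto simp: inj_on_def)
next
 let ?X = "x_at (gen m 0)" and ?d = "1 / det (gen m 0)"
 let ?Q = "{?d ^ k * brackets ?X ws | k ws. valid_list ws & k <= length ws}"
 have mult: "x * y : zmod.span ?Q" if x: "x : zmod.span ?Q" and y: "y : zmod.span ?Q" for x y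
  using x
 proof (induction rule: zmod.span_induct_alt)
  case base
  show ?case by (simp add: zmod.span_zero)
 next
  case (step n u x)
  then obtain k ws where u: "u = ?d ^ k * brackets ?X ws" "valid_list ws" "k <= length ws" by auto
  have "(*) u ` ?Q \<subseteq> ?Q"
  proof clarify
   fix k' ws' assume w: "valid_list ws'" "k' <= length ws'"
   have "u * (?d ^ k' * brackets ?X ws') = ?d ^ (k + k') * brackets ?X (ws @ ws')"
    by (simp add: u brackets_def power_add)
   moreover have "valid_list (ws @ ws')" using u w by (auto simp: valid_list_def)
   ultimately show "\<exists>k'' ws''. u * (?d ^ k' * brackets ?X ws') = ?d ^ k'' * brackets ?X ws'' \<and>
     valid_list ws'' & k'' <= length ws''"
    using u w by (intro exI[of _ "k + k'"] exI[of _ "ws @ ws'"]) auto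
  qed
  then have "u * y : zmod.span ?Q"
   using zspan_mult_left[OF y, of u] zmod.span_mono by blast
  moreover have "(zscale n u + x) * y = zscale n (u * y) + x * y"
   by (simp add: zscale_def algebra_simps)
  ultimately show ?case
   using step.IH by (simp only:) (intro zmod.span_add zmod.span_scale)
 qed
 have "f : zmod.span ?Q" if "f : ZGL m" for f
  using that
 proof induction
  case one
  show ?case by (rule zmod.span_base, intro CollectI exI[of _ 0] exI[of _ "[]"]) (simp add: brackets_def valid_list_def)
 next
  case (entry b i j)
  have "bracket_minor ?X ({Suc i}, {Suc j}) = gen m 0 $$ (i, j)"
  proof -
   have "bracket_minor ?X ({Suc i}, {Suc j}) = minor ?X 1 (enum {Suc i}) (enum {Suc j})"
    by (simp add: bracket_minor_def)
   also have "... = mat 1 1 (%(a, b). ?X (enum {Suc i} a) (enum {Suc j} b)) $$ (0, 0)"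
    unfolding minor_def by (rule det_single) simp
   finally show ?thesis by (simp add: enum_def x_at_def)
  qed
  then have "gen m b $$ (i, j) = ?d ^ 0 * brackets ?X [({Suc i}, {Suc j})]"
   using entry by (simp add: brackets_def)
  moreover have "valid_list [({Suc i}, {Suc j})]" using entry by (simp add: valid_list_def valid_pair_def)
  ultimately show ?case by (intro zmod.span_base CollectI exI[of _ 0] exI[of _ "[({Suc i}, {Suc j})]"]) simp
 next
  case (inv_det b)
  have "1 / det (gen m b) = ?d ^ 1 * brackets ?X [({}, {})]"
   using inv_det by (simp add: brackets_def bracket_minor_def)
  moreover have "valid_list [({}, {})]" by (simp add: valid_list_def valid_pair_def)
  ultimately show ?case by (intro zmod.span_base CollectI exI[of _ 1] exI[of _ "[({}, {})]"]) simp
 qed (auto intro: zmod.span_diff mult)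
 moreover have "zmod.span ?Q \<subseteq> zmod.span (?f ` ?Y)"
  by (rule zmod.span_minimal[OF _ zmod.subspace_span], clarify) (rule bracket_products_in_span)
 moreover have "zmod.span (?f ` ?Y) \<subseteq> ZGL m"
 proof (rule zmod.span_minimal[OF _ subspace_coord], clarify)
  fix p q S T assume "p : partitions m" "q : partitions m" "S : std_rtableaux m ord (p, q)" "T : std_rtableaux m ord (p, q)"
  then show "bidet m (p, q) S T : ZGL m"
   unfolding bidet_eq by (intro bidet_in_coord(1)) (auto simp: good_parts_def std_in_rtableaux)
 qed
 ultimately show "zmod.span (?f ` ?Y) = ZGL m" by blast
qed

text \<open>A standard tableau of a shape below \<open>lam\<close> with the weight of the canonical tableau has the
 column sets of the canonical tableau, as it attains the largest exponent.\<close>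

lemma canonical_weight:
 assumes lam: "lam : Xplus m" and mu: "mu : Xplus m" and le: "dom_le mu lam"
  and S: "S : std mu" and w: "wt m (shp mu) S = wt m (shp lam) (can lam)"
 shows "mu = lam"
  and "T : std mu ==> pm_eq (bidet m (shp lam) S T) (bidet m (shp lam) (can lam) T)"
  and "T : std mu ==> pm_eq (bidet m (shp lam) T S) (bidet m (shp lam) T (can lam))"
proof -
 note gl = shape_of_parts[OF lam] and gm = shape_of_parts[OF mu]
 obtain p q where pq: "shp mu = (p, q)" by (cases "shp mu")
 obtain S1 S2 where Se: "S = (S1, S2)" by (cases S)
 have p: "p : partitions m" and q: "q : partitions m" using gm pq by (auto simp: good_parts_def)
 have S': "(S1, S2) : std_rtableaux m ord (p, q)" using S pq Se by simp
 note F = std_rtableaux_facts[OF p q S']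
 have e: "exponent m (shp mu) S = exponent m (shp lam) (can lam)"
  using exponent_wt[OF gm std_in_rtableaux[OF S]] exponent_wt[OF gl can_in[OF lam]] w by simp
 have a: "exponent m (shp mu) S <= exponent m (shp mu) (can mu)"
  using exponent_max(1)[OF p q F(1-3)] pq Se by simp
 note b = canonical_exponent_mono[OF gl gm, unfolded shape_of_good(2)[OF lam] shape_of_good(2)[OF mu]]
 show eq: "mu = lam"
 proof (rule ccontr)
  assume "mu ~= lam"
  then have "dom_less mu lam" using le by (simp add: dom_less_def)
  then show False using b(2) a e by simp
 qed
 have pql: "shp lam = (p, q)" using pq eq by simp
 obtain C1 C2 where C: "canonical m (p, q) = (C1, C2)" by (cases "canonical m (p, q)")
 note cc = canonical_columns[OF p q, unfolded C fst_conv snd_conv]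
 have em: "(\<forall>c\<in>{1..sum_list p}. colset p S1 c = {1..clen p c}) & (\<forall>c\<in>{1..sum_list q}. colset q S2 c = {m - clen q c + 1..m})"
  by (rule exponent_max(2)[OF p q F(1-3)]) (use e pql eq Se in simp)
 have Cr: "(C1, C2) : rtableaux m (p, q)"
  using can_in[OF lam] C pql by simp
 let ?k = "sum_list q" and ?l = "sum_list p"
 note f = fits_sum_list[of p] fits_sum_list[of q]
 have cl: "column_list m ?k ?l (p, q) (S1, S2) = column_list m ?k ?l (p, q) (C1, C2)"
  using em by (auto simp: column_list_def cc)
 fix T assume T: "T : std mu"
 obtain T1 T2 where Te: "T = (T1, T2)" by (cases T)
 have T': "(T1, T2) : std_rtableaux m ord (p, q)" using T pq Te by simp
 note G = std_rtableaux_facts[OF p q T']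
 note br = bidet_at_brackets[OF gen_carrier det_gen_nonzero p q f]
 have "pm_eq (bidet m (p, q) (S1, S2) (T1, T2)) (bidet m (p, q) (C1, C2) (T1, T2))"
  unfolding bidet_eq
  by (rule pm_eq_trans[OF br[OF F(1) G(1) F(2,3) G(2,3), unfolded cl] pm_eq_sym[OF br[OF Cr G(1) cc(3,4) G(2,3)]]])
 then show "pm_eq (bidet m (shp lam) S T) (bidet m (shp lam) (can lam) T)" by (simp add: pql Se Te C)
 have "pm_eq (bidet m (p, q) (T1, T2) (S1, S2)) (bidet m (p, q) (T1, T2) (C1, C2))"
  unfolding bidet_eq
  by (rule pm_eq_trans[OF br[OF G(1) F(1) G(2,3) F(2,3), unfolded cl] pm_eq_sym[OF br[OF G(1) Cr G(2,3) cc(3,4)]]])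
 then show "pm_eq (bidet m (shp lam) T S) (bidet m (shp lam) T (can lam))" by (simp add: pql Se Te C)
qed

lemma nabla_generated:
 assumes lam: "lam : Xplus m" and S: "S : rtableaux m (shp lam)"
 shows "bidet m (shp lam) (can lam) S : zmod.span ((%T. bidet m (shp lam) (can lam) T) ` std lam)"
  and "bidet m (shp lam) S (can lam) : zmod.span ((%T. bidet m (shp lam) T (can lam)) ` std lam)"
proof -
 let ?f = "%T. bidet m (shp lam) (can lam) T" and ?g = "%T. bidet m (shp lam) T (can lam)"
 have len: "map uminus x = map uminus y \<longleftrightarrow> x = y" for x y :: "int list"
  by (simp add: inj_map_eq_map)
 have "bidet m (shp lam) (can lam) S : zmod.span
  {bidet m (shp mu) S' T' | mu S' T'. mu : Xplus m & dom_le mu lam & S' : std mu & T' : std mu \<and>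
    bwt m (shp mu) S' T' = bwt m (shp lam) (can lam) S}"
  using rational_straightening[OF gen_carrier det_gen_nonzero lam can_in[OF lam] S, of 0] unfolding bidet_eq .
 also have "... \<subseteq> zmod.span (?f ` std lam)"
 proof (rule zmod.span_minimal[OF _ zmod.subspace_span], clarify)
  fix mu S' T' assume h: "mu : Xplus m" "dom_le mu lam" "S' : std mu" "T' : std mu"
   and w: "bwt m (shp mu) S' T' = bwt m (shp lam) (can lam) S"
  have w': "wt m (shp mu) S' = wt m (shp lam) (can lam)" using w by (simp add: bwt_def len)
  note c = canonical_weight[OF lam h(1-3) w']
  have "?f T' : zmod.span (?f ` std lam)" using h(4) c(1) by (intro zmod.span_base) simp
  then have "bidet m (shp lam) S' T' : zmod.span (?f ` std lam)" by (rule zspan_pm_eq[OF c(2)[OF h(4)]])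
  then show "bidet m (shp mu) S' T' : zmod.span (?f ` std lam)" using c(1) by simp
 qed
 finally show "bidet m (shp lam) (can lam) S : zmod.span (?f ` std lam)" .
 have "bidet m (shp lam) S (can lam) : zmod.span
  {bidet m (shp mu) S' T' | mu S' T'. mu : Xplus m & dom_le mu lam & S' : std mu & T' : std mu \<and>
    bwt m (shp mu) S' T' = bwt m (shp lam) S (can lam)}"
  using rational_straightening[OF gen_carrier det_gen_nonzero lam S can_in[OF lam], of 0] unfolding bidet_eq .
 also have "... \<subseteq> zmod.span (?g ` std lam)"
 proof (rule zmod.span_minimal[OF _ zmod.subspace_span], clarify)
  fix mu S' T' assume h: "mu : Xplus m" "dom_le mu lam" "S' : std mu" "T' : std mu"
   and w: "bwt m (shp mu) S' T' = bwt m (shp lam) S (can lam)"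
  have w': "wt m (shp mu) T' = wt m (shp lam) (can lam)" using w by (simp add: bwt_def)
  note c = canonical_weight[OF lam h(1,2,4) w']
  have "?g S' : zmod.span (?g ` std lam)" using h(3) c(1) by (intro zmod.span_base) simp
  then have "bidet m (shp lam) S' T' : zmod.span (?g ` std lam)" by (rule zspan_pm_eq[OF c(3)[OF h(3)]])
  then show "bidet m (shp mu) S' T' : zmod.span (?g ` std lam)" using c(1) by simp
 qed
 finally show "bidet m (shp lam) S (can lam) : zmod.span (?g ` std lam)" .
qed

theorem nabla_bases:
 assumes lam: "lam : Xplus m"
 shows "is_zbasis (std lam) (%T. bidet m (shp lam) (can lam) T) (nabla m lam)"
  and "is_zbasis (std lam) (%T. bidet m (shp lam) T (can lam)) (nabla_tilde m lam)"
proof -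
 let ?f = "%T. bidet m (shp lam) (can lam) T" and ?g = "%T. bidet m (shp lam) T (can lam)"
 note gl = shape_of_parts[OF lam]
 show "is_zbasis (std lam) ?f (nabla m lam)"
 proof (rule is_zbasisI)
  fix I a assume "finite I" "I \<subseteq> std lam" "(\<Sum>i\<in>I. of_int (a i) * ?f i) = 0"
  then show "\<forall>i\<in>I. a i = 0"
   by (intro right_independent[where s = "%_. shp lam" and T = "%x. x" and b = 0])
    (use gl in \<open>auto simp: bidet_eq inj_on_def\<close>)
 next
  have "zmod.span (?f ` rtableaux m (shp lam)) \<subseteq> zmod.span (?f ` std lam)"
   by (rule zmod.span_minimal[OF _ zmod.subspace_span], clarify) (rule nabla_generated(1)[OF lam])
  moreover have "zmod.span (?f ` std lam) \<subseteq> zmod.span (?f ` rtableaux m (shp lam))"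
   by (intro zmod.span_mono image_mono std_rtableaux_subset)
  ultimately show "zmod.span (?f ` std lam) = nabla m lam" by (simp add: nabla_def)
 qed
 show "is_zbasis (std lam) ?g (nabla_tilde m lam)"
 proof (rule is_zbasisI)
  fix I a assume "finite I" "I \<subseteq> std lam" "(\<Sum>i\<in>I. of_int (a i) * ?g i) = 0"
  then show "\<forall>i\<in>I. a i = 0"
   by (intro left_independent[where s = "%_. shp lam" and S = "%x. x" and b = 0])
    (use gl in \<open>auto simp: bidet_eq inj_on_def\<close>)
 next
  have "zmod.span (?g ` rtableaux m (shp lam)) \<subseteq> zmod.span (?g ` std lam)"
   by (rule zmod.span_minimal[OF _ zmod.subspace_span], clarify) (rule nabla_generated(2)[OF lam])
  moreover have "zmod.span (?g ` std lam) \<subseteq> zmod.span (?g ` rtableaux m (shp lam))"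
   by (intro zmod.span_mono image_mono std_rtableaux_subset)
  ultimately show "zmod.span (?g ` std lam) = nabla_tilde m lam" by (simp add: nabla_tilde_def)
 qed
qed

text \<open>Modulo smaller shapes the coefficients of the straightening of \<open>(S|T)\<close> are the products of the
 coefficients of the straightenings of \<open>(S|T\<^sub>\<lambda>)\<close> and \<open>(T\<^sub>\<lambda>|T)\<close>, because the highest component of
 \<open>(S|T)\<close> is the product of \<open>(S|T\<^sub>\<lambda>)\<close> and \<open>(T\<^sub>\<lambda>|T)\<close> in independent variables.\<close>

theorem straightening_coefficients:
 assumes lam: "lam : Xplus m" and S: "S : rtableaux m (shp lam)" and T: "T : rtableaux m (shp lam)"
  and c: "bidet m (shp lam) S (can lam) = (\<Sum>i\<in>std lam. of_int (c i) * bidet m (shp lam) i (can lam))"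
  and d: "bidet m (shp lam) (can lam) T = (\<Sum>j\<in>std lam. of_int (d j) * bidet m (shp lam) (can lam) j)"
 shows "bidet m (shp lam) S T - (\<Sum>i\<in>std lam. \<Sum>j\<in>std lam. of_int (c i * d j) * bidet m (shp lam) i j) : A_less m lam"
proof -
 note gl = shape_of_parts[OF lam]
 let ?B = "std lam" and ?s = "shp lam" and ?C = "can lam"
 have finB: "finite ?B" by (rule finite_std[OF lam])
 obtain I a where I: "finite I" "I \<subseteq> {(mu, S', T'). mu : Xplus m & dom_le mu lam & S' : std mu & T' : std mu \<and>
   bwt m (shp mu) S' T' = bwt m (shp lam) S T}"
  and exp: "bidet m ?s S T = (\<Sum>(mu, S', T') \<in> I. of_int (a (mu, S', T')) * bidet m (shp mu) S' T')"
  using straightening_explicit[OF lam S T] by blast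
 have Ix: "fst x : Xplus m" "dom_le (fst x) lam" "fst (snd x) : std (fst x)" "snd (snd x) : std (fst x)" if "x : I" for x
  using I(2) that by auto
 let ?G = "%S. bidet_at (gen m 1) ?s S ?C" and ?H = "%T. bidet_at (gen m 2) ?s ?C T"
 define J where "J = insert None (Some ` I)"
 define sh where "sh y = (case y of None => ?s | Some x => shp (fst x))" for y :: "(int list \<times> rtableau \<times> rtableau) option"
 define SS where "SS y = (case y of None => S | Some x => fst (snd x))" for y :: "(int list \<times> rtableau \<times> rtableau) option"
 define TT where "TT y = (case y of None => T | Some x => snd (snd x))" for y :: "(int list \<times> rtableau \<times> rtableau) option"
 define b where "b y = (case y of None => 1 | Some x => - a x)" for y
 let ?N = "exponent m ?s ?C"
 have sumJ: "sum h J = h None + (\<Sum>x\<in>I. h (Some x))" for h :: "(int list \<times> rtableau \<times> rtableau) option => ratfun"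
  unfolding J_def using I(1) by (simp add: sum.reindex)
 have hc: "(\<Sum>y | y : J & exponent m (sh y) (canonical m (sh y)) = ?N. of_int (b y) *
   (bidet_at (gen m 1) (sh y) (SS y) (canonical m (sh y)) * bidet_at (gen m 2) (sh y) (canonical m (sh y)) (TT y))) = 0"
 proof (rule highest_component)
  show "finite J" using I(1) by (simp add: J_def)
  fix y assume y: "y : J"
  show "good_parts m (sh y)" using y gl Ix(1) shape_of_parts by (auto simp: J_def sh_def)
  show "SS y : rtableaux m (sh y)" "TT y : rtableaux m (sh y)"
   using y S T std_in_rtableaux[OF Ix(3)] std_in_rtableaux[OF Ix(4)]
   by (cases y; simp add: J_def sh_def SS_def TT_def image_iff)+
  show "exponent m (sh y) (canonical m (sh y)) <= ?N"
  proof (cases y)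
   case (Some x)
   then have x: "x : I" using y by (auto simp: J_def)
   show ?thesis
    using canonical_exponent_mono(1)[OF gl shape_of_parts[OF Ix(1)[OF x]]] Ix(2)[OF x] Some
    by (simp add: shape_of_good(2)[OF lam] shape_of_good(2)[OF Ix(1)[OF x]] sh_def)
  qed (simp add: sh_def)
 next
  show "(\<Sum>y\<in>J. of_int (b y) * bidet m (sh y) (SS y) (TT y)) = 0"
   unfolding sumJ using exp by (simp add: b_def sh_def SS_def TT_def case_prod_unfold sum_negf)
 qed
 let ?I0 = "{x : I. fst x = lam}"
 have Neq: "exponent m (shp (fst x)) (can (fst x)) = ?N \<longleftrightarrow> fst x = lam" if x: "x : I" for x
 proof
  assume eq: "exponent m (shp (fst x)) (can (fst x)) = ?N"
  show "fst x = lam"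
  proof (rule ccontr)
   assume "fst x ~= lam"
   then have "dom_less (fst x) lam" using Ix(2)[OF x] by (simp add: dom_less_def)
   then show False
    using canonical_exponent_mono(2)[OF gl shape_of_parts[OF Ix(1)[OF x]]] eq
    by (simp add: shape_of_good(2)[OF lam] shape_of_good(2)[OF Ix(1)[OF x]])
  qed
 qed simp
 have Jtop: "{y. y : J & exponent m (sh y) (canonical m (sh y)) = ?N} = insert None (Some ` ?I0)"
  using Neq by (auto simp: J_def sh_def)
 define a' where "a' = (%(i, j). if (lam, i, j) : I then a (lam, i, j) else 0)"
 have I0: "(\<Sum>x\<in>?I0. of_int (a x) * h (fst (snd x)) (snd (snd x))) = (\<Sum>(i, j)\<in>?B \<times> ?B. of_int (a' (i, j)) * h i j)"
  for h :: "rtableau => rtableau => ratfun"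
 proof -
  have "(\<Sum>x\<in>?I0. of_int (a x) * h (fst (snd x)) (snd (snd x))) = (\<Sum>z\<in>snd ` ?I0. of_int (a (lam, z)) * h (fst z) (snd z))"
   by (subst sum.reindex) (auto simp: inj_on_def intro!: sum.cong)
  also have "... = (\<Sum>z\<in>?B \<times> ?B. of_int (a' z) * h (fst z) (snd z))"
  proof (rule sum.mono_neutral_cong_left)
   show "finite (?B \<times> ?B)" using finB by simp
   show "snd ` ?I0 \<subseteq> ?B \<times> ?B"
   proof
    fix z assume "z : snd ` ?I0"
    then obtain x where x: "x : I" "fst x = lam" "z = snd x" by blast
    then show "z : ?B \<times> ?B" using Ix(3,4)[OF x(1)] by (simp add: mem_Times_iff)
   qed
   show "\<forall>z\<in>?B \<times> ?B - snd ` ?I0. of_int (a' z) * h (fst z) (snd z) = 0"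
    by (force simp: a'_def)
   show "of_int (a (lam, z)) * h (fst z) (snd z) = of_int (a' z) * h (fst z) (snd z)" if "z : snd ` ?I0" for z
    using that by (auto simp: a'_def)
  qed
  finally show ?thesis by (simp add: case_prod_unfold)
 qed
 have "?G S * ?H T - (\<Sum>x\<in>?I0. of_int (a x) * (?G (fst (snd x)) * ?H (snd (snd x)))) = 0"
 proof -
  have "(\<Sum>y\<in>insert None (Some ` ?I0). of_int (b y) *
   (bidet_at (gen m 1) (sh y) (SS y) (canonical m (sh y)) * bidet_at (gen m 2) (sh y) (canonical m (sh y)) (TT y))) =
   ?G S * ?H T + (\<Sum>x\<in>?I0. - (of_int (a x) * (?G (fst (snd x)) * ?H (snd (snd x)))))"
   using I(1) by (simp add: sum.reindex b_def sh_def SS_def TT_def)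
  then show ?thesis using hc unfolding Jtop by (simp add: sum_negf)
 qed
 moreover have "(\<Sum>x\<in>?I0. of_int (a x) * (?G (fst (snd x)) * ?H (snd (snd x)))) =
   (\<Sum>(i, j)\<in>?B \<times> ?B. of_int (a' (i, j)) * (?G i * ?H j))"
  by (rule I0)
 moreover have "?G S * ?H T = (\<Sum>(i, j)\<in>?B \<times> ?B. of_int (c i * d j) * (?G i * ?H j))"
 proof -
  have ev: "eval_at (bidet_at (gen m 0) ?s U V) (gen m k) = bidet_at (gen m k) ?s U V"
   if "U : rtableaux m ?s" "V : rtableaux m ?s" for U V k
   by (rule eval_bidet(2)[OF gen_carrier det_gen_nonzero gl that])
  have "?G S = (\<Sum>i\<in>?B. of_int (c i) * ?G i)"
   using ev[OF S can_in[OF lam], of 1] c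
    eval_bidet_relation[OF gen_carrier[of m 1] det_gen_nonzero, where X = ?B and s = "%_. ?s" and S = "%i. i" and T = "%_. ?C" and a = c and b = 0]
    gl std_in_rtableaux can_in[OF lam]
   unfolding bidet_eq by simp
  moreover have "?H T = (\<Sum>j\<in>?B. of_int (d j) * ?H j)"
   using ev[OF can_in[OF lam] T, of 2] d
    eval_bidet_relation[OF gen_carrier[of m 2] det_gen_nonzero, where X = ?B and s = "%_. ?s" and S = "%_. ?C" and T = "%j. j" and a = d and b = 0]
    gl std_in_rtableaux can_in[OF lam]
   unfolding bidet_eq by simp
  ultimately have "?G S * ?H T = (\<Sum>i\<in>?B. \<Sum>j\<in>?B. of_int (c i) * ?G i * (of_int (d j) * ?H j))"
   by (simp add: sum_product)
  also have "... = (\<Sum>(i, j)\<in>?B \<times> ?B. of_int (c i * d j) * (?G i * ?H j))"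
   unfolding sum.cartesian_product by (intro sum.cong refl) (auto simp: ac_simps)
  finally show ?thesis .
 qed
 ultimately have "(\<Sum>(i, j)\<in>?B \<times> ?B. of_int (c i * d j) * (?G i * ?H j)) - (\<Sum>(i, j)\<in>?B \<times> ?B. of_int (a' (i, j)) * (?G i * ?H j)) = 0"
  by simp
 then have "(\<Sum>z\<in>?B \<times> ?B. of_int (c (fst z) * d (snd z) - a' z) * (?G (fst z) * ?H (snd z))) = 0"
  by (simp add: sum_subtractf[symmetric] case_prod_unfold left_diff_distrib)
 then have cd: "\<forall>z\<in>?B \<times> ?B. c (fst z) * d (snd z) - a' z = 0"
  by (intro tensor_independent[where s = "%_. ?s" and S = fst and T = snd]) (use finB gl in \<open>auto simp: inj_on_def\<close>)
 have split: "bidet m ?s S T = (\<Sum>x\<in>?I0. of_int (a x) * bidet m ?s (fst (snd x)) (snd (snd x))) +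
   (\<Sum>x\<in>I - ?I0. of_int (a x) * bidet m (shp (fst x)) (fst (snd x)) (snd (snd x)))"
 proof -
  have "bidet m ?s S T = (\<Sum>x\<in>I. of_int (a x) * bidet m (shp (fst x)) (fst (snd x)) (snd (snd x)))"
   unfolding exp by (simp add: case_prod_unfold)
  also have "... = (\<Sum>x\<in>I - ?I0. of_int (a x) * bidet m (shp (fst x)) (fst (snd x)) (snd (snd x))) +
    (\<Sum>x\<in>?I0. of_int (a x) * bidet m (shp (fst x)) (fst (snd x)) (snd (snd x)))"
   by (rule sum.subset_diff) (use I(1) in auto)
  finally show ?thesis by simp
 qed
 have "(\<Sum>x\<in>?I0. of_int (a x) * bidet m ?s (fst (snd x)) (snd (snd x))) = (\<Sum>(i, j)\<in>?B \<times> ?B. of_int (a' (i, j)) * bidet m ?s i j)"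
  by (rule I0)
 also have "... = (\<Sum>(i, j)\<in>?B \<times> ?B. of_int (c i * d j) * bidet m ?s i j)"
 proof (rule sum.cong[OF refl])
  fix z assume "z : ?B \<times> ?B"
  then have "a' z = c (fst z) * d (snd z)" using bspec[OF cd \<open>z : ?B \<times> ?B\<close>] by linarith
  then show "(case z of (i, j) => of_int (a' (i, j)) * bidet m ?s i j) =
    (case z of (i, j) => of_int (c i * d j) * bidet m ?s i j)"
   by (simp add: case_prod_unfold)
 qed
 finally have "bidet m ?s S T - (\<Sum>i\<in>?B. \<Sum>j\<in>?B. of_int (c i * d j) * bidet m ?s i j) =
   (\<Sum>x\<in>I - ?I0. of_int (a x) * bidet m (shp (fst x)) (fst (snd x)) (snd (snd x)))"
  unfolding split by (simp add: sum.cartesian_product)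
 also have "... : A_less m lam"
  unfolding A_less_def
 proof (intro zspan_sum_of_int zmod.span_base)
  fix x assume x: "x : I - ?I0"
  then have "dom_less (fst x) lam" using Ix(2) by (auto simp: dom_less_def)
  then show "bidet m (shp (fst x)) (fst (snd x)) (snd (snd x)) \<in>
   {bidet m (shp mu) S T | mu S T. mu : Xplus m & dom_less mu lam & S : rtableaux m (shp mu) & T : rtableaux m (shp mu)}"
   using x Ix std_in_rtableaux by blast
 qed
 finally show ?thesis .
qed

end

section \<open>Tensor products of abelian groups\<close>

definition biadditive :: "('a, 'c) monoid_scheme => ('b, 'd) monoid_scheme => ('e, 'f) monoid_scheme =>
  ('a => 'b => 'e) => bool" where
 "biadditive G H K \<beta> \<longleftrightarrow> (\<forall>a\<in>carrier G. \<beta> a : hom H K) & (\<forall>b\<in>carrier H. (%a. \<beta> a b) : hom G K)"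

lemma biadditiveD:
 assumes "biadditive G H K \<beta>"
 shows "a : carrier G ==> \<beta> a : hom H K" "b : carrier H ==> (%a. \<beta> a b) : hom G K"
  and "a : carrier G ==> b : carrier H ==> \<beta> a b : carrier K"
  and "a : carrier G ==> a' : carrier G ==> b : carrier H ==> \<beta> (a \<otimes>\<^bsub>G\<^esub> a') b = \<beta> a b \<otimes>\<^bsub>K\<^esub> \<beta> a' b"
  and "a : carrier G ==> b : carrier H ==> b' : carrier H ==> \<beta> a (b \<otimes>\<^bsub>H\<^esub> b') = \<beta> a b \<otimes>\<^bsub>K\<^esub> \<beta> a b'"
 using assms by (auto simp: biadditive_def hom_def Pi_def)

lemma biadditiveI:
 assumes "!!a b. a : carrier G ==> b : carrier H ==> \<beta> a b : carrier K"
  and "!!a a' b. a : carrier G ==> a' : carrier G ==> b : carrier H ==> \<beta> (a \<otimes>\<^bsub>G\<^esub> a') b = \<beta> a b \<otimes>\<^bsub>K\<^esub> \<beta> a' b"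
  and "!!a b b'. a : carrier G ==> b : carrier H ==> b' : carrier H ==> \<beta> a (b \<otimes>\<^bsub>H\<^esub> b') = \<beta> a b \<otimes>\<^bsub>K\<^esub> \<beta> a b'"
 shows "biadditive G H K \<beta>"
 using assms by (auto simp: biadditive_def hom_def Pi_def)

lemma hom_group_hom: "comm_group G ==> comm_group K ==> h : hom G K ==> group_hom G K h"
 by (simp add: group_hom_def group_hom_axioms_def comm_group_def)

lemma hom_mult': "h : hom G K ==> x : carrier G ==> y : carrier G ==> h (x \<otimes>\<^bsub>G\<^esub> y) = h x \<otimes>\<^bsub>K\<^esub> h y"
 and hom_closed': "h : hom G K ==> x : carrier G ==> h x : carrier K"
 by (auto simp: hom_def)

lemma hom_one': "comm_group G ==> comm_group K ==> h : hom G K ==> h \<one>\<^bsub>G\<^esub> = \<one>\<^bsub>K\<^esub>"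
 by (rule group_hom.hom_one[OF hom_group_hom])

lemma hom_inv': "comm_group G ==> comm_group K ==> h : hom G K ==> x : carrier G ==> h (inv\<^bsub>G\<^esub> x) = inv\<^bsub>K\<^esub> h x"
 by (rule group_hom.hom_inv[OF hom_group_hom])

lemma hom_finprod:
 assumes G: "comm_group G" and K: "comm_group K" and h: "h : hom G K" and f: "!!i. i : I ==> f i : carrier G"
 shows "h (finprod G f I) = finprod K (%i. h (f i)) I"
proof -
 interpret G: comm_group G by fact
 interpret K: comm_group K by fact
 show ?thesis
  using f
 proof (induction I rule: infinite_finite_induct)
  case (insert x F)
  then show ?case
   by (simp add: Pi_def hom_mult'[OF h] hom_closed'[OF h])
 qed (simp_all add: hom_one'[OF G K h])
qed

context
 fixes G :: "('a, 'c) monoid_scheme" and H :: "('b, 'd) monoid_scheme"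
 assumes G: "comm_group G" and H: "comm_group H"
begin

abbreviation (input) free_pairs :: "('a \<times> 'b \<Rightarrow>\<^sub>0 int) monoid" where
 "free_pairs \<equiv> free_Abelian_group (carrier G \<times> carrier H)"

lemma tensor_relations_carrier: "tensor_relations G H \<subseteq> carrier free_pairs"
proof -
 interpret G: comm_group G by (rule G)
 interpret H: comm_group H by (rule H)
 have d: "pkeys (x - y) \<subseteq> A" if "pkeys x \<subseteq> A" "pkeys y \<subseteq> A"
  for x y :: "'a \<times> 'b \<Rightarrow>\<^sub>0 int" and A
  using that keys_diff[of x y] by blast
 show ?thesis
  unfolding tensor_relations_def by (auto intro!: d simp del: diff_diff_eq simp: keys_frag_of subset_iff dest!: subsetD[OF keys_diff])
qed

lemma tensor_null_normal: "tensor_null G H \<lhd> free_pairs"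
 unfolding tensor_null_def
 by (intro comm_group.normal_iff_subgroup[THEN iffD2] abelian_free_Abelian_group
   group.generate_is_subgroup group_free_Abelian_group tensor_relations_carrier)

lemma tensor_group: "comm_group (tensor G H)"
 unfolding tensor_def
 by (rule comm_group.abelian_FactGroup[OF abelian_free_Abelian_group normal_imp_subgroup[OF tensor_null_normal]])

lemma coset_hom: "(%x. tensor_null G H #>\<^bsub>free_pairs\<^esub> x) : hom free_pairs (tensor G H)"
 unfolding tensor_def by (rule normal.r_coset_hom_Mod[OF tensor_null_normal])

lemma coset_eq_1: "x : tensor_null G H ==> tensor_null G H #>\<^bsub>free_pairs\<^esub> x = \<one>\<^bsub>tensor G H\<^esub>"
 using group.coset_join2[OF group_free_Abelian_group _ normal_imp_subgroup[OF tensor_null_normal]]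
  subgroup.subset[OF normal_imp_subgroup[OF tensor_null_normal]] by (auto simp: tensor_def FactGroup_def)

lemma tens_closed: "a : carrier G ==> b : carrier H ==> tens G H a b : carrier (tensor G H)"
 unfolding tens_def by (rule hom_closed'[OF coset_hom]) simp

lemma coset_relation:
 assumes "frag_of x - frag_of y - frag_of z : tensor_relations G H"
  and x: "x : carrier G \<times> carrier H" and y: "y : carrier G \<times> carrier H" and z: "z : carrier G \<times> carrier H"
 shows "tensor_null G H #>\<^bsub>free_pairs\<^esub> frag_of x =
  (tensor_null G H #>\<^bsub>free_pairs\<^esub> frag_of y) \<otimes>\<^bsub>tensor G H\<^esub> (tensor_null G H #>\<^bsub>free_pairs\<^esub> frag_of z)"
proof -
 interpret T: comm_group "tensor G H" by (rule tensor_group)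
 let ?c = "%x. tensor_null G H #>\<^bsub>free_pairs\<^esub> x" and ?r = "frag_of x - frag_of y - frag_of z"
 have r: "?r : tensor_null G H" unfolding tensor_null_def using assms(1) by (rule generate.incl)
 have rc: "?r : carrier free_pairs" using assms(1) tensor_relations_carrier by blast
 have yz: "frag_of y + frag_of z : carrier free_pairs"
  using y z keys_add[of "frag_of y" "frag_of z"] by auto
 have "?c (frag_of x) = ?c (?r \<otimes>\<^bsub>free_pairs\<^esub> (frag_of y \<otimes>\<^bsub>free_pairs\<^esub> frag_of z))" by simp
 also have "... = ?c ?r \<otimes>\<^bsub>tensor G H\<^esub> ?c (frag_of y \<otimes>\<^bsub>free_pairs\<^esub> frag_of z)"
  using yz by (intro hom_mult'[OF coset_hom] rc) simp
 also have "?c ?r = \<one>\<^bsub>tensor G H\<^esub>" by (rule coset_eq_1[OF r])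
 also have "?c (frag_of y \<otimes>\<^bsub>free_pairs\<^esub> frag_of z) = ?c (frag_of y) \<otimes>\<^bsub>tensor G H\<^esub> ?c (frag_of z)"
  by (rule hom_mult'[OF coset_hom]) (use y z in simp_all)
 finally show ?thesis
  using hom_closed'[OF coset_hom] y z by (simp add: T.m_closed)
qed

lemma tens_biadditive: "biadditive G H (tensor G H) (tens G H)"
proof (rule biadditiveI)
 interpret G: comm_group G by (rule G)
 interpret H: comm_group H by (rule H)
 show "tens G H (a \<otimes>\<^bsub>G\<^esub> a') b = tens G H a b \<otimes>\<^bsub>tensor G H\<^esub> tens G H a' b"
  if "a : carrier G" "a' : carrier G" "b : carrier H" for a a' b
  unfolding tens_def by (rule coset_relation) (use that in \<open>auto simp: tensor_relations_def\<close>)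
 show "tens G H a (b \<otimes>\<^bsub>H\<^esub> b') = tens G H a b \<otimes>\<^bsub>tensor G H\<^esub> tens G H a b'"
  if "a : carrier G" "b : carrier H" "b' : carrier H" for a b b'
  unfolding tens_def by (rule coset_relation) (use that in \<open>auto simp: tensor_relations_def\<close>)
qed (rule tens_closed)

lemma tensor_induct [consumes 1, case_names one diff tens]:
 assumes t: "t : carrier (tensor G H)"
  and one: "P \<one>\<^bsub>tensor G H\<^esub>"
  and diff: "!!x y. x : carrier (tensor G H) ==> y : carrier (tensor G H) ==> P x ==> P y ==> P (x \<otimes>\<^bsub>tensor G H\<^esub> inv\<^bsub>tensor G H\<^esub> y)"
  and tens: "!!a b. a : carrier G ==> b : carrier H ==> P (tens G H a b)"
 shows "P t"
proof -
 let ?c = "%x. tensor_null G H #>\<^bsub>free_pairs\<^esub> x"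
 have ci: "?c x \<otimes>\<^bsub>tensor G H\<^esub> inv\<^bsub>tensor G H\<^esub> ?c y = ?c (x - y)"
  if "x : carrier free_pairs" "y : carrier free_pairs" for x y
 proof -
  have "?c (x - y) = ?c (x \<otimes>\<^bsub>free_pairs\<^esub> inv\<^bsub>free_pairs\<^esub> y)" using that by simp
  also have "... = ?c x \<otimes>\<^bsub>tensor G H\<^esub> ?c (inv\<^bsub>free_pairs\<^esub> y)"
   using that by (intro hom_mult'[OF coset_hom] group.inv_closed[OF group_free_Abelian_group])
  also have "?c (inv\<^bsub>free_pairs\<^esub> y) = inv\<^bsub>tensor G H\<^esub> ?c y"
   by (rule hom_inv'[OF abelian_free_Abelian_group tensor_group coset_hom that(2)])
  finally show ?thesis by simp
 qed
 obtain x where x: "pkeys x \<subseteq> carrier G \<times> carrier H" "t = ?c x"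
  using t by (auto simp: tensor_def carrier_FactGroup)
 have "P (?c x)"
 proof (rule free_Abelian_group_induct[OF x(1), where P = "%x. P (?c x)"])
  show "P (?c 0)"
   using one hom_one'[OF abelian_free_Abelian_group tensor_group coset_hom] by simp
  show "P (?c (x - y))" if "pkeys x \<subseteq> carrier G \<times> carrier H"
    "pkeys y \<subseteq> carrier G \<times> carrier H" "P (?c x)" "P (?c y)" for x y
   using that diff[of "?c x" "?c y"] ci[of x y] hom_closed'[OF coset_hom, of x] hom_closed'[OF coset_hom, of y] by simp
  show "P (?c (frag_of a))" if "a : carrier G \<times> carrier H" for a
   using that tens by (auto simp: tens_def)
 qed
 then show ?thesis by (simp add: x(2))
qed

lemma tensor_induct_mult [consumes 1, case_names one mult tens]:
 assumes t: "t : carrier (tensor G H)"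
  and one: "P \<one>\<^bsub>tensor G H\<^esub>"
  and mult: "!!x y. x : carrier (tensor G H) ==> y : carrier (tensor G H) ==> P x ==> P y ==> P (x \<otimes>\<^bsub>tensor G H\<^esub> y)"
  and tens: "!!a b. a : carrier G ==> b : carrier H ==> P (tens G H a b)"
 shows "P t"
proof -
 interpret T: comm_group "tensor G H" by (rule tensor_group)
 interpret G: comm_group G by (rule G)
 have "P t & P (inv\<^bsub>tensor G H\<^esub> t)"
  using t
 proof (induction rule: tensor_induct)
  case (diff x y)
  then show ?case using mult by (simp add: T.inv_mult)
 next
  case (tens a b)
  then show ?case
   using assms(4)[of a b] assms(4)[of "inv\<^bsub>G\<^esub> a" b] hom_inv'[OF G tensor_group biadditiveD(2)[OF tens_biadditive]] by simp
 qed (use one in simp)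
 then show ?thesis ..
qed

lemma tensor_hom_eqI:
 assumes K: "comm_group K" and h: "h : hom (tensor G H) K" and k: "k : hom (tensor G H) K"
  and eq: "!!a b. a : carrier G ==> b : carrier H ==> h (tens G H a b) = k (tens G H a b)"
  and t: "t : carrier (tensor G H)"
 shows "h t = k t"
 using t
proof (induction rule: tensor_induct)
 case one
 then show ?case by (simp add: hom_one'[OF tensor_group K h] hom_one'[OF tensor_group K k])
next
 case (diff x y)
 then show ?case
  by (simp add: hom_mult'[OF h] hom_mult'[OF k] hom_inv'[OF tensor_group K h] hom_inv'[OF tensor_group K k]
    group.inv_closed[OF comm_group.axioms(2)[OF tensor_group]])
qed (rule eq)

text \<open>The universal property: a biadditive map extends to the free abelian group on the pairs,
 and the extension kills the defining relations.\<close>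

lemma tensor_lift:
 assumes K: "comm_group K" and \<beta>: "biadditive G H K \<beta>"
 shows "tensor_lift G H K \<beta> : hom (tensor G H) K"
  and "!!a b. a : carrier G ==> b : carrier H ==> tensor_lift G H K \<beta> (tens G H a b) = \<beta> a b"
proof -
 interpret G: comm_group G by (rule G)
 interpret H: comm_group H by (rule H)
 interpret K: comm_group K by (rule K)
 obtain h where h: "h : hom free_pairs K" and hx: "!!x. x : carrier G \<times> carrier H ==> h (frag_of x) = case_prod \<beta> x"
 proof (rule K.free_Abelian_group_universal[of "case_prod \<beta>" "carrier G \<times> carrier H"])
  show "case_prod \<beta> ` (carrier G \<times> carrier H) \<subseteq> carrier K" using biadditiveD(3)[OF \<beta>] by auto
 qed (rule that)
 have minus: "h (x - y) = h x \<otimes>\<^bsub>K\<^esub> inv\<^bsub>K\<^esub> h y" if "x : carrier free_pairs" "y : carrier free_pairs" for x y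
 proof -
  have "h (x \<otimes>\<^bsub>free_pairs\<^esub> inv\<^bsub>free_pairs\<^esub> y) = h x \<otimes>\<^bsub>K\<^esub> h (inv\<^bsub>free_pairs\<^esub> y)"
   using that by (intro hom_mult'[OF h] group.inv_closed[OF group_free_Abelian_group])
  also have "h (inv\<^bsub>free_pairs\<^esub> y) = inv\<^bsub>K\<^esub> h y"
   by (rule hom_inv'[OF abelian_free_Abelian_group K h that(2)])
  finally show ?thesis using that by simp
 qed
 have rel: "h (frag_of x - frag_of y - frag_of z) = \<one>\<^bsub>K\<^esub>"
  if "x : carrier G \<times> carrier H" "y : carrier G \<times> carrier H" "z : carrier G \<times> carrier H"
   "case_prod \<beta> x = case_prod \<beta> y \<otimes>\<^bsub>K\<^esub> case_prod \<beta> z" for x y z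
 proof -
  have xy: "frag_of x - frag_of y : carrier free_pairs"
   using that keys_diff[of "frag_of x" "frag_of y"] by auto
  have c: "case_prod \<beta> y : carrier K" "case_prod \<beta> z : carrier K" using that biadditiveD(3)[OF \<beta>] by auto
  have "h (frag_of x - frag_of y - frag_of z) = case_prod \<beta> x \<otimes>\<^bsub>K\<^esub> inv\<^bsub>K\<^esub> case_prod \<beta> y \<otimes>\<^bsub>K\<^esub> inv\<^bsub>K\<^esub> case_prod \<beta> z"
   using minus[OF xy, of "frag_of z"] minus[of "frag_of x" "frag_of y"] that hx by simp
  also have "... = \<one>\<^bsub>K\<^esub>" unfolding that(4) using c
   by (metis K.inv_closed K.inv_solve_right' K.l_inv K.m_closed K.m_comm K.r_inv)
  finally show ?thesis .
 qed
 have "tensor_null G H \<subseteq> kernel free_pairs K h"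
  unfolding tensor_null_def
 proof (rule group.generate_subgroup_incl[OF group_free_Abelian_group])
  show "subgroup (kernel free_pairs K h) free_pairs"
   by (rule group_hom.subgroup_kernel[OF hom_group_hom[OF abelian_free_Abelian_group K h]])
  show "tensor_relations G H \<subseteq> kernel free_pairs K h"
  proof
   fix r assume r: "r : tensor_relations G H"
   have "h r = \<one>\<^bsub>K\<^esub>"
    using r unfolding tensor_relations_def by (auto intro!: rel simp: biadditiveD[OF \<beta>])
   moreover have "r : carrier free_pairs" using tensor_relations_carrier r by (rule subsetD)
   ultimately show "r : kernel free_pairs K h" unfolding kernel_def by blast
  qed
 qed
 then obtain g where g: "g : hom (tensor G H) K"
   "!!x. x : carrier free_pairs ==> g (tensor_null G H #>\<^bsub>free_pairs\<^esub> x) = h x"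
  using group_hom.FactGroup_universal_kernel[OF hom_group_hom[OF abelian_free_Abelian_group K h] tensor_null_normal]
  unfolding tensor_def by blast
 have "g : hom (tensor G H) K & (\<forall>a \<in> carrier G. \<forall>b \<in> carrier H. g (tens G H a b) = \<beta> a b)"
  using g hx by (auto simp: tens_def)
 from someI[where P = "%h. h : hom (tensor G H) K & (\<forall>a \<in> carrier G. \<forall>b \<in> carrier H. h (tens G H a b) = \<beta> a b)", OF this]
 show "tensor_lift G H K \<beta> : hom (tensor G H) K"
  and "!!a b. a : carrier G ==> b : carrier H ==> tensor_lift G H K \<beta> (tens G H a b) = \<beta> a b"
  unfolding tensor_lift_def by auto
qed

lemma tensor_lift_mult:
 assumes K: "comm_group K" and \<beta>: "biadditive G H K \<beta>" and \<beta>': "biadditive G H K \<beta>'" and \<gamma>: "biadditive G H K \<gamma>"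
  and eq: "!!a b. a : carrier G ==> b : carrier H ==> \<gamma> a b = \<beta> a b \<otimes>\<^bsub>K\<^esub> \<beta>' a b"
  and t: "t : carrier (tensor G H)"
 shows "tensor_lift G H K \<gamma> t = tensor_lift G H K \<beta> t \<otimes>\<^bsub>K\<^esub> tensor_lift G H K \<beta>' t"
proof (rule tensor_hom_eqI[OF K tensor_lift(1)[OF K \<gamma>] _ _ t])
 interpret K: comm_group K by (rule K)
 interpret T: comm_group "tensor G H" by (rule tensor_group)
 let ?b = "tensor_lift G H K \<beta>" and ?b' = "tensor_lift G H K \<beta>'"
 show "(%t. ?b t \<otimes>\<^bsub>K\<^esub> ?b' t) : hom (tensor G H) K"
  using tensor_lift(1)[OF K \<beta>] tensor_lift(1)[OF K \<beta>']
  by (auto simp: hom_def Pi_def K.m_ac)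
qed (simp add: tensor_lift(2)[OF K] \<beta> \<beta>' \<gamma> eq)

lemma tens_one:
 shows "b : carrier H ==> tens G H \<one>\<^bsub>G\<^esub> b = \<one>\<^bsub>tensor G H\<^esub>"
  and "a : carrier G ==> tens G H a \<one>\<^bsub>H\<^esub> = \<one>\<^bsub>tensor G H\<^esub>"
 using hom_one'[OF G tensor_group biadditiveD(2)[OF tens_biadditive]]
  hom_one'[OF H tensor_group biadditiveD(1)[OF tens_biadditive]] by auto

end

lemma tensor_map_left_hom:
 assumes G: "comm_group G" and H: "comm_group H" and K: "comm_group K" and f: "f : hom G K"
 shows "tensor_map_left G K H f : hom (tensor G H) (tensor K H)"
  and "!!a b. a : carrier G ==> b : carrier H ==> tensor_map_left G K H f (tens G H a b) = tens K H (f a) b"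
proof -
 have b: "biadditive G H (tensor K H) (%a b. tens K H (f a) b)"
  by (rule biadditiveI)
   (simp_all add: biadditiveD[OF tens_biadditive[OF K H]] hom_closed'[OF f] hom_mult'[OF f])
 show "tensor_map_left G K H f : hom (tensor G H) (tensor K H)"
  and "!!a b. a : carrier G ==> b : carrier H ==> tensor_map_left G K H f (tens G H a b) = tens K H (f a) b"
  unfolding tensor_map_left_def
  using tensor_lift[OF G H tensor_group[OF K H] b] by auto
qed

section \<open>Coactions on spans of linearly independent functions\<close>

(* keeps the index set {1, 2} of the acting group in the form in which it is stated *)
declare One_nat_def [simp del]

lemma addgrp_simps [simp]: "carrier (addgrp M) = M" "x \<otimes>\<^bsub>addgrp M\<^esub> y = x + y" "\<one>\<^bsub>addgrp M\<^esub> = 0"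
 by (simp_all add: addgrp_def)

lemma subspace_of_int_mult: "zmod.subspace M ==> x : M ==> of_int n * x : M"
 using zmod.subspace_scale[of M x n] by (simp add: zscale_def)

lemma subspaceI_diff:
 assumes 0: "0 : M" and d: "!!x y. x : M ==> y : M ==> x - y : M"
 shows "zmod.subspace M"
proof -
 have u: "- x : M" if "x : M" for x using d[OF 0 that] by simp
 have a: "x + y : M" if "x : M" "y : M" for x y using d[OF that(1) u[OF that(2)]] by simp
 have "of_int n * x : M" if "x : M" for n x
  by (induction n rule: int_induct[of _ 0]) (use that 0 a d in \<open>auto simp: algebra_simps\<close>)
 then show ?thesis unfolding zmod.subspace_def zscale_def using 0 a by blast
qed

lemma addgrp_group:
 assumes "zmod.subspace M"
 shows "comm_group (addgrp M)"
proof (rule comm_groupI)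
 show "\<exists>y\<in>carrier (addgrp M). y \<otimes>\<^bsub>addgrp M\<^esub> x = \<one>\<^bsub>addgrp M\<^esub>" if "x : carrier (addgrp M)" for x
  by (rule bexI[of _ "- x"]) (use that zmod.subspace_neg[OF assms] in simp_all)
qed (use assms in \<open>auto simp: zmod.subspace_0 zmod.subspace_add\<close>)

lemma addgrp_inv:
 assumes "zmod.subspace M" "x : M"
 shows "inv\<^bsub>addgrp M\<^esub> x = - x"
 by (rule group.inv_equality[OF comm_group.axioms(2)[OF addgrp_group[OF assms(1)]]])
  (use assms zmod.subspace_neg in simp_all)

lemma finprod_addgrp:
 assumes "zmod.subspace M" "!!i. i : I ==> f i : M"
 shows "finprod (addgrp M) f I = sum f I"
proof -
 interpret comm_group "addgrp M" by (rule addgrp_group[OF assms(1)])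
 show ?thesis using assms(2)
  by (induction I rule: infinite_finite_induct) (simp_all add: Pi_def)
qed

lemma hom_eq_on_span:
 assumes K: "comm_group K" and h: "h : hom (addgrp (zmod.span A)) K" and k: "k : hom (addgrp (zmod.span A)) K"
  and eq: "!!a. a : A ==> h a = k a" and x: "x : zmod.span A"
 shows "h x = k x"
proof -
 note G = addgrp_group[OF zmod.subspace_span[of A]]
 interpret K: comm_group K by fact
 have d: "h (x - y) = h x \<otimes>\<^bsub>K\<^esub> inv\<^bsub>K\<^esub> h y" if h: "h : hom (addgrp (zmod.span A)) K" and "x : zmod.span A" "y : zmod.span A" for h x y
  using hom_mult'[OF h, of x "- y"] hom_inv'[OF G K h, of y] addgrp_inv[OF zmod.subspace_span, of y A] zmod.span_neg[of y A] that by simp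
 have "zmod.subspace {x : zmod.span A. h x = k x}"
  by (rule subspaceI_diff)
   (use hom_one'[OF G K h] hom_one'[OF G K k] in \<open>simp_all add: zmod.span_zero zmod.span_diff d h k\<close>)
 then have "zmod.span A \<subseteq> {x : zmod.span A. h x = k x}"
  by (intro zmod.span_minimal) (auto simp: eq zmod.span_base)
 then show ?thesis using x by blast
qed

lemma tensor_hom_eq_on_generators:
 assumes K: "comm_group K" and h: "h : hom (tensor (addgrp (zmod.span A)) (addgrp (zmod.span B))) K"
  and k: "k : hom (tensor (addgrp (zmod.span A)) (addgrp (zmod.span B))) K"
  and eq: "!!a b. a : A ==> b : B ==>
   h (tens (addgrp (zmod.span A)) (addgrp (zmod.span B)) a b) = k (tens (addgrp (zmod.span A)) (addgrp (zmod.span B)) a b)"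
  and t: "t : carrier (tensor (addgrp (zmod.span A)) (addgrp (zmod.span B)))"
 shows "h t = k t"
proof (rule tensor_hom_eqI[OF _ _ K h k _ t])
 note G = addgrp_group[OF zmod.subspace_span[of A]] and H = addgrp_group[OF zmod.subspace_span[of B]]
 show "comm_group (addgrp (zmod.span A))" "comm_group (addgrp (zmod.span B))" by (fact G, fact H)
 let ?t = "tens (addgrp (zmod.span A)) (addgrp (zmod.span B))"
 note b = biadditiveD[OF tens_biadditive[OF G H]]
 have c1: "(%a. h (?t a b)) : hom (addgrp (zmod.span A)) K"
  if h: "h : hom (tensor (addgrp (zmod.span A)) (addgrp (zmod.span B))) K" and "b : zmod.span B" for h b
  using hom_compose[OF b(2) h] that by (simp add: comp_def)
 have c2: "(%b. h (?t a b)) : hom (addgrp (zmod.span B)) K"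
  if h: "h : hom (tensor (addgrp (zmod.span A)) (addgrp (zmod.span B))) K" and "a : zmod.span A" for h a
  using hom_compose[OF b(1) h] that by (simp add: comp_def)
 fix a b assume "a : carrier (addgrp (zmod.span A))" "b : carrier (addgrp (zmod.span B))"
 then have a: "a : zmod.span A" and b: "b : zmod.span B" by simp_all
 have gen: "h (?t a' b) = k (?t a' b)" if a': "a' : A" for a'
  by (rule hom_eq_on_span[OF K c2[OF h zmod.span_base[OF a']] c2[OF k zmod.span_base[OF a']] eq[OF a'] b])
 show "h (?t a b) = k (?t a b)"
  by (rule hom_eq_on_span[OF K c1[OF h b] c1[OF k b] gen a])
qed

lemma tens_of_int:
 assumes M: "zmod.subspace M" and N: "zmod.subspace N" and x: "x : M" and y: "y : N"
 shows "tens (addgrp M) (addgrp N) (of_int n * x) y = tens (addgrp M) (addgrp N) x (of_int n * y)"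
proof -
 let ?t = "tens (addgrp M) (addgrp N)" and ?T = "tensor (addgrp M) (addgrp N)"
 note G = addgrp_group[OF M] and H = addgrp_group[OF N]
 interpret T: comm_group ?T by (rule tensor_group[OF G H])
 note b = biadditiveD[OF tens_biadditive[OF G H], simplified]
 have cx: "of_int n * x : M" for n by (rule subspace_of_int_mult[OF M x])
 have cy: "of_int n * y : N" for n by (rule subspace_of_int_mult[OF N y])
 have step: "?t (of_int (n + 1) * x) y = ?t (of_int n * x) y \<otimes>\<^bsub>?T\<^esub> ?t x y"
  "?t x (of_int (n + 1) * y) = ?t x (of_int n * y) \<otimes>\<^bsub>?T\<^esub> ?t x y" for n
  using b(4)[OF cx[of n] x y] b(5)[OF x cy[of n] y] by (simp_all add: algebra_simps)
 show ?thesis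
 proof (induction n rule: int_induct[of _ 0])
  case base
  then show ?case using tens_one[OF G H] x y by simp
 next
  case (step1 i)
  then show ?case using step[of i] by simp
 next
  case (step2 i)
  have "?t (of_int (i - 1) * x) y \<otimes>\<^bsub>?T\<^esub> ?t x y = ?t x (of_int (i - 1) * y) \<otimes>\<^bsub>?T\<^esub> ?t x y"
   using step[of "i - 1"] step2 by simp
  then show ?case using T.right_cancel b(3) cx cy x y by metis
 qed
qed

text \<open>Coefficients are collected in the second factor, which leaves one term for each generator.\<close>

lemma tensor_expansion:
 assumes M: "M = zmod.span (f ` X)" and N: "zmod.subspace N"
  and t: "t : carrier (tensor (addgrp M) (addgrp N))"
 shows "\<exists>I c. finite I & I \<subseteq> X & (\<forall>i. c i : N) \<and>
  t = finprod (tensor (addgrp M) (addgrp N)) (%i. tens (addgrp M) (addgrp N) (f i) (c i)) I"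
proof -
 let ?t = "tens (addgrp M) (addgrp N)" and ?T = "tensor (addgrp M) (addgrp N)"
 have MS: "zmod.subspace M" unfolding M by (rule zmod.subspace_span)
 note G = addgrp_group[OF MS] and H = addgrp_group[OF N]
 interpret T: comm_group ?T by (rule tensor_group[OF G H])
 note b = biadditiveD[OF tens_biadditive[OF G H], simplified]
 have fM: "f i : M" if "i : X" for i unfolding M using that by (intro zmod.span_base) simp
 have N0: "0 : N" by (rule zmod.subspace_0[OF N])
 have extend: "finprod ?T (%i. ?t (f i) (c i)) I = finprod ?T (%i. ?t (f i) (if i : I then c i else 0)) J"
  if "finite J" "I \<subseteq> J" "J \<subseteq> X" "\<forall>i. c i : N" for c I J
  using that fM N0 b(3) tens_one(2)[OF G H] by (intro T.finprod_mono_neutral_cong_left) (auto simp: subset_iff)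
 show ?thesis
  using t
 proof (induction rule: tensor_induct_mult[OF G H, consumes 1, case_names one mult tens])
  case one
  show ?case by (intro exI[of _ "{}"] exI[of _ "%_. 0"]) (simp add: N0)
 next
  case (mult x y)
  then obtain I c J d where I: "finite I" "I \<subseteq> X" "\<forall>i. c i : N" "x = finprod ?T (%i. ?t (f i) (c i)) I"
   and J: "finite J" "J \<subseteq> X" "\<forall>i. d i : N" "y = finprod ?T (%i. ?t (f i) (d i)) J" by auto
  let ?c = "%i. if i : I then c i else 0" and ?d = "%i. if i : J then d i else 0"
  have cd: "?c i : N" "?d i : N" for i using I(3) J(3) N0 by auto
  have "x \<otimes>\<^bsub>?T\<^esub> y = finprod ?T (%i. ?t (f i) (?c i)) (I \<union> J) \<otimes>\<^bsub>?T\<^esub> finprod ?T (%i. ?t (f i) (?d i)) (I \<union> J)"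
   unfolding I(4) J(4) using I J by (intro arg_cong2[where f = "monoid.mult ?T"] extend) auto
  also have "... = finprod ?T (%i. ?t (f i) (?c i) \<otimes>\<^bsub>?T\<^esub> ?t (f i) (?d i)) (I \<union> J)"
   by (rule T.finprod_multf[symmetric]) (use I(2) J(2) fM b(3) cd in blast)+
  also have "... = finprod ?T (%i. ?t (f i) (?c i + ?d i)) (I \<union> J)"
  proof (rule T.finprod_cong'[OF refl])
   show "?t (f i) (?c i) \<otimes>\<^bsub>?T\<^esub> ?t (f i) (?d i) = ?t (f i) (?c i + ?d i)" if "i : I \<union> J" for i
    using that I(2) J(2) b(5)[OF fM cd] by blast
   show "(%i. ?t (f i) (?c i + ?d i)) : I \<union> J \<rightarrow> carrier ?T"
    using I(2) J(2) b(3)[OF fM zmod.subspace_add[OF N cd]] by blast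
  qed
  finally show ?case
   using I J cd zmod.subspace_add[OF N] by (intro exI[of _ "I \<union> J"] exI[of _ "%i. ?c i + ?d i"]) blast
 next
  case (tens a y)
  then obtain I n where I: "finite I" "I \<subseteq> X" "a = (\<Sum>i\<in>I. of_int (n i) * f i)"
   using zspan_image_explicit[of a f X] unfolding M by auto
  have y: "y : N" using tens by simp
  have mem: "of_int (n i) * f i : M" if "i : I" for i
   using that I(2) by (intro subspace_of_int_mult[OF MS] fM) blast
  have "?t a y = ?t (finprod (addgrp M) (%i. of_int (n i) * f i) I) y"
   unfolding I(3) by (subst finprod_addgrp[OF MS]) (use mem in auto)
  also have "... = finprod ?T (%i. ?t (of_int (n i) * f i) y) I"
   by (rule hom_finprod[OF G T.comm_group_axioms biadditiveD(2)[OF tens_biadditive[OF G H]]])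
    (use mem y in auto)
  also have "... = finprod ?T (%i. ?t (f i) (of_int (n i) * y)) I"
   by (rule T.finprod_cong')
    (use I(2) fM y b(3) subspace_of_int_mult[OF N y] tens_of_int[OF MS N] in auto)
  finally show ?case using I subspace_of_int_mult[OF N y] by (intro exI[of _ I] exI[of _ "%i. of_int (n i) * y"]) auto
 qed
qed

lemma is_zbasis_independent:
 assumes "is_zbasis X f M" "finite I" "I \<subseteq> X" "(\<Sum>i\<in>I. of_int (n i) * f i) = 0"
 shows "\<forall>i\<in>I. n i = 0"
proof (rule ccontr)
 assume nz: "\<not> ?thesis"
 have inj: "inj_on f I" using assms(1,3) by (auto simp: is_zbasis_def inj_on_def)
 let ?u = "%v. n (the_inv_into I f v)"
 have u: "?u (f i) = n i" if "i : I" for i using the_inv_into_f_f[OF inj that] by simp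
 have "(\<Sum>v\<in>f ` I. zscale (?u v) v) = 0"
  using assms(4) by (simp add: sum.reindex[OF inj] zscale_def u cong: sum.cong)
 moreover have "\<exists>v\<in>f ` I. ?u v ~= 0" using nz u by auto
 ultimately have "zmod.dependent (f ` X)"
  unfolding zmod.dependent_explicit using assms(2,3) by (intro exI[of _ "f ` I"] exI[of _ ?u]) auto
 then show False using assms(1) by (simp add: is_zbasis_def)
qed

lemma is_zbasis_subspace: "is_zbasis X f M ==> zmod.subspace M"
 unfolding is_zbasis_def using zmod.subspace_span by blast

lemma times_biadditive:
 "zmod.subspace M ==> zmod.subspace N ==> biadditive (addgrp M) (addgrp N) (addgrp UNIV) (*)"
 by (rule biadditiveI) (auto simp: algebra_simps)

text \<open>Expanded along the basis, an element of the kernel is a relation between the basis with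
 coefficients that are functions of other variables, which linear disjointness excludes.\<close>

lemma multiplication_injective:
 assumes basis: "is_zbasis X f M" and M: "M \<subseteq> ZGL m"
  and t: "t : carrier (tensor (addgrp M) (ZGG m))" and t': "t' : carrier (tensor (addgrp M) (ZGG m))"
  and eq: "tensor_lift (addgrp M) (ZGG m) (addgrp UNIV) (*) t = tensor_lift (addgrp M) (ZGG m) (addgrp UNIV) (*) t'"
 shows "t = t'"
proof -
 let ?t = "tens (addgrp M) (ZGG m)" and ?T = "tensor (addgrp M) (ZGG m)"
 let ?l = "tensor_lift (addgrp M) (ZGG m) (addgrp UNIV) (*)"
 have U: "zmod.subspace (UNIV :: ratfun set)" by (rule subspaceI_diff) simp_all
 note MS = is_zbasis_subspace[OF basis]
 note G = addgrp_group[OF MS] and H = addgrp_group[OF subspace_coord[of m "{1, 2}"]] and K = addgrp_group[OF U]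
 interpret T: comm_group ?T by (rule tensor_group[OF G H])
 note l = tensor_lift[OF G H K times_biadditive[OF MS subspace_coord]]
 have span: "M = zmod.span (f ` X)" using basis by (simp add: is_zbasis_def)
 have ker: "x = \<one>\<^bsub>?T\<^esub>" if x: "x : carrier ?T" and lx: "?l x = 0" for x
 proof -
  obtain I c where I: "finite I" "I \<subseteq> X" "\<forall>i. c i : coord m {1, 2}" "x = finprod ?T (%i. ?t (f i) (c i)) I"
   using tensor_expansion[OF span subspace_coord x] by blast
  have fM: "f i : M" if "i : I" for i unfolding span using that I(2) by (intro zmod.span_base) auto
  have tc: "?t (f i) (c i) : carrier ?T" if "i : I" for i
   using that I(3) fM by (intro tens_closed[OF G H]) auto
  have "?l x = finprod (addgrp UNIV) (%i. ?l (?t (f i) (c i))) I"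
   unfolding I(4) by (rule hom_finprod[OF T.comm_group_axioms K l(1) tc])
  also have "... = (\<Sum>i\<in>I. ?l (?t (f i) (c i)))" by (rule finprod_addgrp[OF U]) simp
  also have "... = (\<Sum>i\<in>I. f i * c i)" by (rule sum.cong[OF refl]) (use I(3) fM in \<open>simp add: l(2)\<close>)
  finally have rel: "(\<Sum>i\<in>I. f i * c i) = 0" using lx by simp
  have "\<forall>i\<in>I. c i = 0"
  proof (rule linearly_disjoint[OF I(1) _ _ _ rel, where B = "{0}" and B' = "{1, 2}"])
   show "f i : ratfun_in {0}" if "i : I" for i using fM[OF that] M by (intro coord_ratfun_in[of _ m]) auto
   show "c i : ratfun_in {1, 2}" if "i : I" for i using I(3) by (intro coord_ratfun_in[of _ m]) auto
   show "\<forall>i\<in>I. n i = 0" if "(\<Sum>i\<in>I. of_int (n i) * f i) = 0" for n :: "_ => int"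
    by (rule is_zbasis_independent[OF basis I(1,2) that])
  qed simp
  then show ?thesis unfolding I(4) using fM tens_one(2)[OF G H]
   by (intro T.finprod_one_eqI) simp
 qed
 have "t \<otimes>\<^bsub>?T\<^esub> inv\<^bsub>?T\<^esub> t' = \<one>\<^bsub>?T\<^esub>"
 proof (rule ker)
  show "?l (t \<otimes>\<^bsub>?T\<^esub> inv\<^bsub>?T\<^esub> t') = 0"
   using t t' eq hom_mult'[OF l(1), of t "inv\<^bsub>?T\<^esub> t'"] hom_inv'[OF T.comm_group_axioms K l(1) t'] addgrp_inv[OF U]
   by simp
 qed (use t t' in simp)
 then show ?thesis using t t' by (metis T.inv_closed T.inv_inv T.inv_equality)
qed

lemma coact_eqI:
 assumes basis: "is_zbasis X f M" and M: "M \<subseteq> ZGL m"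
  and t: "t : carrier (tensor (addgrp M) (ZGG m))"
  and l: "tensor_lift (addgrp M) (ZGG m) (addgrp UNIV) (*) t = act g"
 shows "coact m act M g = t"
 unfolding coact_def
 by (rule the_equality) (use t l multiplication_injective[OF basis M] in auto)

lemma coact_sum:
 assumes basis: "is_zbasis X f M" and M: "M \<subseteq> ZGL m" and I: "finite I"
  and e: "!!i. i : I ==> e i : M" and c: "!!i. i : I ==> c i : coord m {1, 2}"
  and g: "act g = (\<Sum>i\<in>I. e i * c i)"
 shows "coact m act M g = finprod (tensor (addgrp M) (ZGG m)) (%i. tens (addgrp M) (ZGG m) (e i) (c i)) I"
  and "coact m act M g : carrier (tensor (addgrp M) (ZGG m))"
  and "tensor_lift (addgrp M) (ZGG m) (addgrp UNIV) (*) (coact m act M g) = act g"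
proof -
 let ?t = "tens (addgrp M) (ZGG m)" and ?T = "tensor (addgrp M) (ZGG m)"
 let ?l = "tensor_lift (addgrp M) (ZGG m) (addgrp UNIV) (*)" and ?s = "finprod ?T (%i. ?t (e i) (c i)) I"
 have U: "zmod.subspace (UNIV :: ratfun set)" by (rule subspaceI_diff) simp_all
 note MS = is_zbasis_subspace[OF basis]
 note G = addgrp_group[OF MS] and H = addgrp_group[OF subspace_coord[of m "{1, 2}"]] and K = addgrp_group[OF U]
 interpret T: comm_group ?T by (rule tensor_group[OF G H])
 note l = tensor_lift[OF G H K times_biadditive[OF MS subspace_coord]]
 have tc: "?t (e i) (c i) : carrier ?T" if "i : I" for i
  using that e c by (intro tens_closed[OF G H]) auto
 have s: "?s : carrier ?T" using tc by (intro T.finprod_closed) auto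
 have "?l ?s = finprod (addgrp UNIV) (%i. ?l (?t (e i) (c i))) I"
  by (rule hom_finprod[OF T.comm_group_axioms K l(1) tc])
 also have "... = (\<Sum>i\<in>I. ?l (?t (e i) (c i)))" by (rule finprod_addgrp[OF U]) simp
 also have "... = (\<Sum>i\<in>I. e i * c i)" by (rule sum.cong[OF refl]) (use e c in \<open>simp add: l(2)\<close>)
 finally have ls: "?l ?s = act g" using g by simp
 show eq: "coact m act M g = ?s" by (rule coact_eqI[where act = act and g = g, OF basis M s ls])
 show "coact m act M g : carrier ?T" "?l (coact m act M g) = act g" unfolding eq by (fact s, fact ls)
qed

text \<open>It suffices to lift the action on generators: differences of lifts lift differences.\<close>

lemma coact_hom:
 assumes basis: "is_zbasis X f M" and M: "M \<subseteq> ZGL m" and A: "M = zmod.span A"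
  and add: "!!x y. x : M ==> y : M ==> act (x - y) = act x - act y"
  and gen: "!!a. a : A ==> coact m act M a : carrier (tensor (addgrp M) (ZGG m)) \<and>
   tensor_lift (addgrp M) (ZGG m) (addgrp UNIV) (*) (coact m act M a) = act a"
 shows "coact m act M : hom (addgrp M) (tensor (addgrp M) (ZGG m))"
proof -
 let ?T = "tensor (addgrp M) (ZGG m)" and ?l = "tensor_lift (addgrp M) (ZGG m) (addgrp UNIV) (*)"
 let ?c = "coact m act M"
 have U: "zmod.subspace (UNIV :: ratfun set)" by (rule subspaceI_diff) simp_all
 note MS = is_zbasis_subspace[OF basis]
 note G = addgrp_group[OF MS] and H = addgrp_group[OF subspace_coord[of m "{1, 2}"]] and K = addgrp_group[OF U]
 interpret T: comm_group ?T by (rule tensor_group[OF G H])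
 note l = tensor_lift[OF G H K times_biadditive[OF MS subspace_coord]]
 have M0: "0 : M" by (rule zmod.subspace_0[OF MS])
 have act0: "act 0 = 0" using add[OF M0 M0] by simp
 have minus: "?l (x \<otimes>\<^bsub>?T\<^esub> inv\<^bsub>?T\<^esub> y) = ?l x - ?l y" if "x : carrier ?T" "y : carrier ?T" for x y
  using that hom_mult'[OF l(1), of x "inv\<^bsub>?T\<^esub> y"] hom_inv'[OF T.comm_group_axioms K l(1), of y] addgrp_inv[OF U]
  by (simp)
 have lift0: "?c 0 = \<one>\<^bsub>?T\<^esub>"
  by (rule coact_eqI[OF basis M]) (use hom_one'[OF T.comm_group_axioms K l(1)] act0 in simp_all)
 have diff: "?c (x - y) = ?c x \<otimes>\<^bsub>?T\<^esub> inv\<^bsub>?T\<^esub> ?c y"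
  if "x : M" "y : M" "?c x : carrier ?T" "?c y : carrier ?T" "?l (?c x) = act x" "?l (?c y) = act y" for x y
  by (rule coact_eqI[OF basis M]) (use that minus add in simp_all)
 have "zmod.subspace {x : M. ?c x : carrier ?T & ?l (?c x) = act x}"
 proof (rule subspaceI_diff)
  show "0 : {x : M. ?c x : carrier ?T & ?l (?c x) = act x}"
   using lift0 act0 M0 hom_one'[OF T.comm_group_axioms K l(1)] by simp
  show "x - y : {x : M. ?c x : carrier ?T & ?l (?c x) = act x}"
   if "x : {x : M. ?c x : carrier ?T & ?l (?c x) = act x}" "y : {x : M. ?c x : carrier ?T & ?l (?c x) = act x}" for x y
   using that diff[of x y] minus add zmod.subspace_diff[OF MS] by simp
 qed
 then have "M \<subseteq> {x : M. ?c x : carrier ?T & ?l (?c x) = act x}"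
  using gen zmod.span_base[of _ A] unfolding A by (intro zmod.span_minimal) auto
 then have c: "?c x : carrier ?T" "?l (?c x) = act x" if "x : M" for x using that by auto
 have neg: "?c (- y) = inv\<^bsub>?T\<^esub> ?c y" if "y : M" for y
  using diff[OF M0 that c(1)[OF M0] c(1)[OF that] c(2)[OF M0] c(2)[OF that]] c(1)[OF that] unfolding lift0 by simp
 show ?thesis
 proof (rule homI)
  fix x y assume xy: "x : carrier (addgrp M)" "y : carrier (addgrp M)"
  then have "- y : M" using zmod.subspace_neg[OF MS] by simp
  then show "?c (x \<otimes>\<^bsub>addgrp M\<^esub> y) = ?c x \<otimes>\<^bsub>?T\<^esub> ?c y"
   using diff[of x "- y"] neg[of y] xy c by simp
 qed (use c in simp)
qed

lemma finprod_Times: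
 assumes K: "comm_group K" and I: "finite I" and J: "finite J"
  and f: "!!i j. i : I ==> j : J ==> f i j : carrier K"
 shows "finprod K (%z. f (fst z) (snd z)) (I \<times> J) = finprod K (%i. finprod K (f i) J) I"
proof -
 interpret K: comm_group K by fact
 show ?thesis
  using I f
 proof (induction I)
  case (insert i I)
  have s: "insert i I \<times> J = Pair i ` J \<union> I \<times> J" by auto
  have "finprod K (%z. f (fst z) (snd z)) (insert i I \<times> J) =
    finprod K (%z. f (fst z) (snd z)) (Pair i ` J) \<otimes>\<^bsub>K\<^esub> finprod K (%z. f (fst z) (snd z)) (I \<times> J)"
   unfolding s by (rule K.finprod_Un_disjoint) (use insert J in auto)
  also have "finprod K (%z. f (fst z) (snd z)) (Pair i ` J) = finprod K (f i) J"
   by (subst K.finprod_reindex) (use insert.prems in \<open>auto simp: inj_on_def\<close>)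
  finally show ?case using insert J by (simp add: Pi_def)
 qed simp
qed

text \<open>The nested maps of the definition are biadditive step by step, from the inside out. On a pair of
 expanded coactions the result is the expected double sum.\<close>

lemma tensor_coact_hom:
 assumes G: "comm_group G" and H: "comm_group H"
  and \<rho>: "\<rho> : hom G (tensor G (ZGG m))" and \<sigma>: "\<sigma> : hom H (tensor H (ZGG m))"
 shows "tensor_coact m G H \<rho> \<sigma> : hom (tensor G H) (tensor (tensor G H) (ZGG m))"
  and "!!a b I J e c f d. a : carrier G ==> b : carrier H ==>
   (!!i. i : I ==> e i : carrier G) ==> (!!i. i : I ==> c i : coord m {1, 2}) ==>
   (!!j. j : J ==> f j : carrier H) ==> (!!j. j : J ==> d j : coord m {1, 2}) ==>
   \<rho> a = finprod (tensor G (ZGG m)) (%i. tens G (ZGG m) (e i) (c i)) I ==>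
   \<sigma> b = finprod (tensor H (ZGG m)) (%j. tens H (ZGG m) (f j) (d j)) J ==>
   tensor_coact m G H \<rho> \<sigma> (tens G H a b) =
    finprod (tensor (tensor G H) (ZGG m)) (%i. finprod (tensor (tensor G H) (ZGG m))
     (%j. tens (tensor G H) (ZGG m) (tens G H (e i) (f j)) (c i * d j)) J) I"
proof -
 let ?Z = "ZGG m" and ?V = "tensor G H" and ?W = "tensor (tensor G H) (ZGG m)"
 note Z = addgrp_group[OF subspace_coord[of m "{1, 2}"]]
 note V = tensor_group[OF G H]
 note W = tensor_group[OF V Z] and TG = tensor_group[OF G Z] and TH = tensor_group[OF H Z]
 note tV = biadditiveD[OF tens_biadditive[OF G H]] and tW = biadditiveD[OF tens_biadditive[OF V Z], simplified]
 define \<beta> where "\<beta> a' c b' d = tens ?V ?Z (tens G H a' b') (c * d)" for a' c b' d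
 have mult: "c * d : coord m {1, 2}" if "c : coord m {1, 2}" "d : coord m {1, 2}" for c d
  using that by (rule coord.mult)
 have \<beta>b: "biadditive H ?Z ?W (\<beta> a' c)" if "a' : carrier G" "c : coord m {1, 2}" for a' c
  unfolding \<beta>_def by (rule biadditiveI) (use that in \<open>simp_all add: tV tW mult distrib_left\<close>)
 define L where "L y a' c = tensor_lift H ?Z ?W (\<beta> a' c) y" for y a' c
 have Lb: "biadditive G ?Z ?W (L y)" if y: "y : carrier (tensor H ?Z)" for y
 proof (rule biadditiveI)
  show "L y a c : carrier ?W" if "a : carrier G" "c : carrier ?Z" for a c
   unfolding L_def using hom_closed'[OF tensor_lift(1)[OF H Z W \<beta>b] y] that by simp
  show "L y (a \<otimes>\<^bsub>G\<^esub> a') c = L y a c \<otimes>\<^bsub>?W\<^esub> L y a' c" if "a : carrier G" "a' : carrier G" "c : carrier ?Z" for a a' c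
   unfolding L_def
  proof (rule tensor_lift_mult[OF H Z W \<beta>b \<beta>b \<beta>b _ y])
   show "a \<otimes>\<^bsub>G\<^esub> a' : carrier G" using that comm_group.axioms(2)[OF G] by (simp add: group.is_monoid monoid.m_closed)
  qed (use that in \<open>simp_all add: \<beta>_def tV tW mult\<close>)
  show "L y a (c \<otimes>\<^bsub>?Z\<^esub> c') = L y a c \<otimes>\<^bsub>?W\<^esub> L y a c'" if "a : carrier G" "c : carrier ?Z" "c' : carrier ?Z" for a c c'
   unfolding L_def
  proof (rule tensor_lift_mult[OF H Z W \<beta>b \<beta>b \<beta>b _ y])
   show "c \<otimes>\<^bsub>?Z\<^esub> c' : coord m {1, 2}" using that by (simp add: coord_add)
  qed (use that in \<open>simp_all add: \<beta>_def tV tW mult distrib_right\<close>)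
 qed
 define M where "M y x = tensor_lift G ?Z ?W (L y) x" for y x
 have Mc: "M y x : carrier ?W" if "y : carrier (tensor H ?Z)" "x : carrier (tensor G ?Z)" for x y
  unfolding M_def by (rule hom_closed'[OF tensor_lift(1)[OF G Z W Lb[OF that(1)]] that(2)])
 have Madd: "M (y \<otimes>\<^bsub>tensor H ?Z\<^esub> y') x = M y x \<otimes>\<^bsub>?W\<^esub> M y' x"
  if y: "y : carrier (tensor H ?Z)" "y' : carrier (tensor H ?Z)" and x: "x : carrier (tensor G ?Z)" for x y y'
  unfolding M_def
 proof (rule tensor_lift_mult[OF G Z W Lb[OF y(1)] Lb[OF y(2)] Lb _ x])
  show "y \<otimes>\<^bsub>tensor H ?Z\<^esub> y' : carrier (tensor H ?Z)"
   using y comm_group.axioms(2)[OF TH] by (simp add: group.is_monoid monoid.m_closed)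
  show "L (y \<otimes>\<^bsub>tensor H ?Z\<^esub> y') a c = L y a c \<otimes>\<^bsub>?W\<^esub> L y' a c" if "a : carrier G" "c : carrier ?Z" for a c
   unfolding L_def using that by (intro hom_mult'[OF tensor_lift(1)[OF H Z W \<beta>b] y]) simp_all
 qed
 have co: "tensor_coact m G H \<rho> \<sigma> = tensor_lift G H ?W (%a b. M (\<sigma> b) (\<rho> a))"
  unfolding tensor_coact_def Let_def M_def L_def \<beta>_def ..
 have b: "biadditive G H ?W (%a b. M (\<sigma> b) (\<rho> a))"
 proof (rule biadditiveI)
  show "M (\<sigma> b) (\<rho> a) : carrier ?W" if "a : carrier G" "b : carrier H" for a b
   by (rule Mc[OF hom_closed'[OF \<sigma> that(2)] hom_closed'[OF \<rho> that(1)]])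
  show "M (\<sigma> b) (\<rho> (a \<otimes>\<^bsub>G\<^esub> a')) = M (\<sigma> b) (\<rho> a) \<otimes>\<^bsub>?W\<^esub> M (\<sigma> b) (\<rho> a')"
   if "a : carrier G" "a' : carrier G" "b : carrier H" for a a' b
   unfolding hom_mult'[OF \<rho> that(1,2)] M_def
   by (rule hom_mult'[OF tensor_lift(1)[OF G Z W Lb[OF hom_closed'[OF \<sigma> that(3)]]] hom_closed'[OF \<rho> that(1)] hom_closed'[OF \<rho> that(2)]])
  show "M (\<sigma> (b \<otimes>\<^bsub>H\<^esub> b')) (\<rho> a) = M (\<sigma> b) (\<rho> a) \<otimes>\<^bsub>?W\<^esub> M (\<sigma> b') (\<rho> a)"
   if "a : carrier G" "b : carrier H" "b' : carrier H" for a b b'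
   unfolding hom_mult'[OF \<sigma> that(2,3)]
   by (rule Madd[OF hom_closed'[OF \<sigma> that(2)] hom_closed'[OF \<sigma> that(3)] hom_closed'[OF \<rho> that(1)]])
 qed
 show "tensor_coact m G H \<rho> \<sigma> : hom (tensor G H) ?W"
  unfolding co by (rule tensor_lift(1)[OF G H W b])
 fix a b I J e c f d
 assume a: "a : carrier G" and bH: "b : carrier H"
  and e: "!!i. i : I ==> e i : carrier G" and c: "!!i. i : I ==> c i : coord m {1, 2}"
  and f: "!!j. j : J ==> f j : carrier H" and d: "!!j. j : J ==> d j : coord m {1, 2}"
  and \<rho>a: "\<rho> a = finprod (tensor G ?Z) (%i. tens G ?Z (e i) (c i)) I"
  and \<sigma>b: "\<sigma> b = finprod (tensor H ?Z) (%j. tens H ?Z (f j) (d j)) J"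
 interpret W: comm_group ?W by (rule W)
 have y: "\<sigma> b : carrier (tensor H ?Z)" by (rule hom_closed'[OF \<sigma> bH])
 have Lval: "L (\<sigma> b) (e i) (c i) = finprod ?W (%j. tens ?V ?Z (tens G H (e i) (f j)) (c i * d j)) J" if i: "i : I" for i
 proof -
  note l = tensor_lift[OF H Z W \<beta>b[OF e[OF i] c[OF i]]]
  have "L (\<sigma> b) (e i) (c i) = finprod ?W (%j. tensor_lift H ?Z ?W (\<beta> (e i) (c i)) (tens H ?Z (f j) (d j))) J"
   unfolding L_def \<sigma>b by (rule hom_finprod[OF TH W l(1) tens_closed[OF H Z]]) (use f d in simp_all)
  also have "... = finprod ?W (%j. tens ?V ?Z (tens G H (e i) (f j)) (c i * d j)) J"
   by (rule W.finprod_cong') (use e c f d i l(2) in \<open>auto simp: \<beta>_def intro!: tW(3) tV(3) mult\<close>)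
  finally show ?thesis .
 qed
 have "tensor_coact m G H \<rho> \<sigma> (tens G H a b) = M (\<sigma> b) (\<rho> a)"
  unfolding co by (rule tensor_lift(2)[OF G H W b a bH])
 also have "... = finprod ?W (%i. tensor_lift G ?Z ?W (L (\<sigma> b)) (tens G ?Z (e i) (c i))) I"
  unfolding M_def \<rho>a by (rule hom_finprod[OF TG W tensor_lift(1)[OF G Z W Lb[OF y]] tens_closed[OF G Z]]) (use e c in simp_all)
 also have "... = finprod ?W (%i. finprod ?W (%j. tens ?V ?Z (tens G H (e i) (f j)) (c i * d j)) J) I"
 proof (rule W.finprod_cong'[OF refl])
  show "tensor_lift G ?Z ?W (L (\<sigma> b)) (tens G ?Z (e i) (c i)) = finprod ?W (%j. tens ?V ?Z (tens G H (e i) (f j)) (c i * d j)) J"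
   if i: "i : I" for i
   using tensor_lift(2)[OF G Z W Lb[OF y] e[OF i], of "c i"] c[OF i] Lval[OF i] by simp
  show "(%i. finprod ?W (%j. tens ?V ?Z (tens G H (e i) (f j)) (c i * d j)) J) : I \<rightarrow> carrier ?W"
   using e c f d by (auto intro!: W.finprod_closed tW(3) tV(3) mult)
 qed
 finally show "tensor_coact m G H \<rho> \<sigma> (tens G H a b) = ..." .
qed

lemma subspace_subgroup:
 assumes N: "zmod.subspace N" and M: "zmod.subspace M" and NM: "N \<subseteq> M"
 shows "subgroup N (addgrp M)"
proof (rule group.subgroupI[OF comm_group.axioms(2)[OF addgrp_group[OF M]]])
 show "inv\<^bsub>addgrp M\<^esub> a : N" if "a : N" for a
  using that NM addgrp_inv[OF M, of a] zmod.subspace_neg[OF N] by auto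
qed (use NM zmod.subspace_0[OF N] zmod.subspace_add[OF N] in auto)

lemma quotient_map:
 assumes N: "zmod.subspace N" and M: "zmod.subspace M" and NM: "N \<subseteq> M"
 shows "comm_group (addgrp M Mod N)"
  and "(%x. N #>\<^bsub>addgrp M\<^esub> x) : hom (addgrp M) (addgrp M Mod N)"
  and "!!x. x : N ==> N #>\<^bsub>addgrp M\<^esub> x = \<one>\<^bsub>addgrp M Mod N\<^esub>"
  and "!!x. N #>\<^bsub>addgrp M\<^esub> x = \<one>\<^bsub>addgrp M Mod N\<^esub> ==> x : N"
  and "!!x y. x : M ==> y : M ==> x - y : N ==> N #>\<^bsub>addgrp M\<^esub> x = N #>\<^bsub>addgrp M\<^esub> y"
proof -
 note G = addgrp_group[OF M]
 note sub = subspace_subgroup[OF assms]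
 have nor: "N \<lhd> addgrp M" using comm_group.normal_iff_subgroup[OF G] sub by blast
 show Q: "comm_group (addgrp M Mod N)" by (rule comm_group.abelian_FactGroup[OF G sub])
 show hom: "(%x. N #>\<^bsub>addgrp M\<^esub> x) : hom (addgrp M) (addgrp M Mod N)"
  by (rule normal.r_coset_hom_Mod[OF nor])
 show one: "N #>\<^bsub>addgrp M\<^esub> x = \<one>\<^bsub>addgrp M Mod N\<^esub>" if "x : N" for x
  using group.coset_join2[OF comm_group.axioms(2)[OF G] _ sub that] that NM by auto
 show "x : N" if "N #>\<^bsub>addgrp M\<^esub> x = \<one>\<^bsub>addgrp M Mod N\<^esub>" for x
 proof -
  have "0 + x : N #>\<^bsub>addgrp M\<^esub> x" unfolding r_coset_def using zmod.subspace_0[OF N] by auto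
  then show ?thesis using that by simp
 qed
 show "N #>\<^bsub>addgrp M\<^esub> x = N #>\<^bsub>addgrp M\<^esub> y" if "x : M" "y : M" "x - y : N" for x y
 proof -
  interpret Q: comm_group "addgrp M Mod N" by (rule Q)
  have "N #>\<^bsub>addgrp M\<^esub> x = (N #>\<^bsub>addgrp M\<^esub> (x - y)) \<otimes>\<^bsub>addgrp M Mod N\<^esub> (N #>\<^bsub>addgrp M\<^esub> y)"
   using hom_mult'[OF hom, of "x - y" y] that NM by auto
  then show ?thesis using one[OF that(3)] hom_closed'[OF hom, of y] that(2) Q.l_one by (simp del: mult_FactGroup one_FactGroup)
 qed
qed

text \<open>A coaction that becomes trivial on \<open>N\<close> takes a single value on each coset.\<close>

lemma quot_coact_hom:
 assumes N: "zmod.subspace N" and M: "zmod.subspace M" and NM: "N \<subseteq> M"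
  and \<rho>: "\<rho> : hom (addgrp M) (tensor (addgrp M) (ZGG m))"
  and kill: "!!x. x : N ==> tensor_map_left (addgrp M) (addgrp M Mod N) (ZGG m) (%a. N #>\<^bsub>addgrp M\<^esub> a) (\<rho> x) =
   \<one>\<^bsub>tensor (addgrp M Mod N) (ZGG m)\<^esub>"
 shows "!!x. x : M ==> quot_coact m M N \<rho> (N #>\<^bsub>addgrp M\<^esub> x) =
   tensor_map_left (addgrp M) (addgrp M Mod N) (ZGG m) (%a. N #>\<^bsub>addgrp M\<^esub> a) (\<rho> x)"
  and "quot_coact m M N \<rho> : hom (addgrp M Mod N) (tensor (addgrp M Mod N) (ZGG m))"
proof -
 let ?Q = "addgrp M Mod N" and ?\<pi> = "%a. N #>\<^bsub>addgrp M\<^esub> a"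
 define h where "h x = tensor_map_left (addgrp M) ?Q (ZGG m) ?\<pi> (\<rho> x)" for x
 note Z = addgrp_group[OF subspace_coord[of m "{1, 2}"]]
 note G = addgrp_group[OF M]
 note q = quotient_map[OF N M NM]
 note T = tensor_group[OF q(1) Z]
 interpret T: comm_group "tensor ?Q (ZGG m)" by (rule T)
 have h: "h : hom (addgrp M) (tensor ?Q (ZGG m))"
  using hom_compose[OF \<rho> tensor_map_left_hom(1)[OF G Z q(1,2)]] by (simp add: h_def[abs_def] comp_def)
 have kill': "h x = \<one>\<^bsub>tensor ?Q (ZGG m)\<^esub>" if "x : N" for x unfolding h_def by (rule kill[OF that])
 have val: "quot_coact m M N \<rho> (?\<pi> x) = h x" if x: "x : M" for x
 proof -
  have "h y = h x" if y: "y : ?\<pi> x" for y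
  proof -
   obtain n where n: "n : N" "y = n + x" using y by (auto simp: r_coset_def)
   then show ?thesis
    using hom_mult'[OF h, of n x] x NM kill'[OF n(1)] hom_closed'[OF h, of x] by auto
  qed
  moreover have "?\<pi> x ~= {}" using zmod.subspace_0[OF N] by (auto simp: r_coset_def)
  ultimately have "h ` ?\<pi> x = {h x}" by auto
  then show ?thesis unfolding quot_coact_def h_def by simp
 qed
 show "quot_coact m M N \<rho> (?\<pi> x) = tensor_map_left (addgrp M) ?Q (ZGG m) ?\<pi> (\<rho> x)" if "x : M" for x
  using val[OF that] unfolding h_def .
 show "quot_coact m M N \<rho> : hom ?Q (tensor ?Q (ZGG m))"
 proof (rule homI)
  fix X Y assume "X : carrier ?Q" "Y : carrier ?Q"
  then obtain x y where xy: "x : M" "X = ?\<pi> x" "y : M" "Y = ?\<pi> y" by (auto simp: carrier_FactGroup)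
  then have "X \<otimes>\<^bsub>?Q\<^esub> Y = ?\<pi> (x + y)" using hom_mult'[OF q(2), of x y] by simp
  then show "quot_coact m M N \<rho> (X \<otimes>\<^bsub>?Q\<^esub> Y) = quot_coact m M N \<rho> X \<otimes>\<^bsub>tensor ?Q (ZGG m)\<^esub> quot_coact m M N \<rho> Y"
   using xy val hom_mult'[OF h, of x y] zmod.subspace_add[OF M] by simp
 next
  fix X assume "X : carrier ?Q"
  then obtain x where "x : M" "X = ?\<pi> x" by (auto simp: carrier_FactGroup)
  then show "quot_coact m M N \<rho> X : carrier (tensor ?Q (ZGG m))" using val hom_closed'[OF h, of x] by simp
 qed
qed

section \<open>The generic group element acts on bideterminants\<close>

definition left_coeff :: "nat => shape => rtableau => rtableau => ratfun" where
 "left_coeff m s S U = bidet_at (matinv (gen m 1)) s S U"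

definition right_coeff :: "nat => shape => rtableau => rtableau => ratfun" where
 "right_coeff m s U T = bidet_at (gen m 2) s U T"

text \<open>Under both factors, \<open>(S | T)\<close> becomes \<open>\<Sum> (U | W) \<otimes> c\<close> over pairs of representatives \<open>U\<close>, \<open>W\<close>.\<close>

definition rep_pairs :: "nat => shape => _" where
 "rep_pairs m s = rep_index m s \<times> rep_index m s"

definition pair_bidet :: "nat => shape => _ => ratfun" where
 "pair_bidet m s z = bidet m s (rep s (fst z)) (rep s (snd z))"

definition pair_coeff :: "nat => shape => rtableau => rtableau => _ => ratfun" where
 "pair_coeff m s S T z = left_coeff m s S (rep s (fst z)) * right_coeff m s (rep s (snd z)) T"

lemma coeff_in_coord:
 assumes "good_parts m s" "S : rtableaux m s" "T : rtableaux m s"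
 shows "left_coeff m s S T : coord m {1, 2}" "right_coeff m s S T : coord m {1, 2}"
 unfolding left_coeff_def right_coeff_def using assms by (auto intro: bidet_in_coord)

lemma pair_coeff_in_coord:
 assumes "good_parts m s" "S : rtableaux m s" "T : rtableaux m s" "z : rep_pairs m s"
 shows "pair_coeff m s S T z : coord m {1, 2}"
 unfolding pair_coeff_def
 using assms by (intro coord.mult coeff_in_coord rep_in_rtableaux) (auto simp: rep_pairs_def)

lemma bidet_in_ZGL: "good_parts m s ==> S : rtableaux m s ==> T : rtableaux m s ==> bidet m s S T : ZGL m"
 unfolding bidet_eq by (rule bidet_in_coord) simp

lemma gen_product:
 shows "matinv (gen m 1) * gen m 0 : carrier_mat m m" "det (matinv (gen m 1) * gen m 0) ~= 0"
  and "gen m 0 * gen m 2 : carrier_mat m m" "det (gen m 0 * gen m 2) ~= 0"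
  and "matinv (gen m 1) * gen m 0 * gen m 2 : carrier_mat m m" "det (matinv (gen m 1) * gen m 0 * gen m 2) ~= 0"
proof -
 note i = matinv_eq(2)[OF gen_carrier det_gen_nonzero] det_matinv(2)[OF gen_carrier det_gen_nonzero]
 show 1: "matinv (gen m 1) * gen m 0 : carrier_mat m m" "det (matinv (gen m 1) * gen m 0) ~= 0"
  using i[of m 1] det_mult[OF i(1)[of m 1] gen_carrier[of m 0]] by (auto simp: det_gen_nonzero)
 show "gen m 0 * gen m 2 : carrier_mat m m" "det (gen m 0 * gen m 2) ~= 0"
  using det_mult[OF gen_carrier[of m 0] gen_carrier[of m 2]] by (auto simp: det_gen_nonzero intro: mult_carrier_mat)
 show "matinv (gen m 1) * gen m 0 * gen m 2 : carrier_mat m m" "det (matinv (gen m 1) * gen m 0 * gen m 2) ~= 0"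
  using 1 det_mult[OF 1(1) gen_carrier[of m 2]] by (auto simp: det_gen_nonzero intro: mult_carrier_mat)
qed

lemma act_diff:
 assumes "x : ZGL m" "y : ZGL m"
 shows "left_act m (x - y) = left_act m x - left_act m y" "right_act m (x - y) = right_act m x - right_act m y"
  "both_act m (x - y) = both_act m x - both_act m y"
 unfolding left_act_def right_act_def both_act_def
 using evaluable_ops(4)[OF evaluable_coord[OF assms(1)] evaluable_coord[OF assms(2)]] gen_product by auto

text \<open>Comultiplication applied to \<open>g\<inverse> A h\<close>: the coefficients are bideterminants in \<open>g\<inverse>\<close> and \<open>h\<close>.\<close>

lemma act_bidet:
 assumes s: "good_parts m s" and S: "S : rtableaux m s" and T: "T : rtableaux m s"
 shows "left_act m (bidet m s S T) = (\<Sum>i\<in>rep_index m s. bidet m s (rep s i) T * left_coeff m s S (rep s i))"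
  and "right_act m (bidet m s S T) = (\<Sum>j\<in>rep_index m s. bidet m s S (rep s j) * right_coeff m s (rep s j) T)"
  and "both_act m (bidet m s S T) = (\<Sum>z\<in>rep_pairs m s. pair_bidet m s z * pair_coeff m s S T z)"
proof -
 note i = matinv_eq(2)[OF gen_carrier det_gen_nonzero] det_matinv(2)[OF gen_carrier det_gen_nonzero]
 note R = rep_in_rtableaux[OF s]
 have left: "bidet_at (matinv (gen m 1) * gen m 0) s S U = (\<Sum>i\<in>rep_index m s. bidet m s (rep s i) U * left_coeff m s S (rep s i))"
  if "U : rtableaux m s" for U
  unfolding bidet_at_mult[OF i gen_carrier det_gen_nonzero s S that] bidet_eq left_coeff_def by (simp add: mult.commute)
 show "left_act m (bidet m s S T) = (\<Sum>i\<in>rep_index m s. bidet m s (rep s i) T * left_coeff m s S (rep s i))"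
  unfolding left_act_def left[OF T, symmetric] unfolding bidet_eq by (rule eval_bidet(2)[OF gen_product(1,2) s S T])
 show "right_act m (bidet m s S T) = (\<Sum>j\<in>rep_index m s. bidet m s S (rep s j) * right_coeff m s (rep s j) T)"
  unfolding right_act_def bidet_eq eval_bidet(2)[OF gen_product(3,4) s S T]
  unfolding bidet_at_mult[OF gen_carrier det_gen_nonzero gen_carrier det_gen_nonzero s S T] right_coeff_def ..
 have "both_act m (bidet m s S T) = bidet_at (matinv (gen m 1) * gen m 0 * gen m 2) s S T"
  unfolding both_act_def bidet_eq by (rule eval_bidet(2)[OF gen_product(5,6) s S T])
 also have "... = (\<Sum>j\<in>rep_index m s. bidet_at (matinv (gen m 1) * gen m 0) s S (rep s j) * bidet_at (gen m 2) s (rep s j) T)"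
  by (rule bidet_at_mult[OF gen_product(1,2) gen_carrier det_gen_nonzero s S T])
 also have "... = (\<Sum>j\<in>rep_index m s. \<Sum>i\<in>rep_index m s.
   bidet m s (rep s i) (rep s j) * (left_coeff m s S (rep s i) * right_coeff m s (rep s j) T))"
 proof (rule sum.cong[OF refl])
  fix j assume j: "j : rep_index m s"
  show "bidet_at (matinv (gen m 1) * gen m 0) s S (rep s j) * bidet_at (gen m 2) s (rep s j) T =
   (\<Sum>i\<in>rep_index m s. bidet m s (rep s i) (rep s j) * (left_coeff m s S (rep s i) * right_coeff m s (rep s j) T))"
   unfolding left[OF R[OF j]] sum_distrib_right right_coeff_def by (intro sum.cong refl) (simp add: ac_simps)
 qed
 also have "... = (\<Sum>i\<in>rep_index m s. \<Sum>j\<in>rep_index m s.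
   bidet m s (rep s i) (rep s j) * (left_coeff m s S (rep s i) * right_coeff m s (rep s j) T))"
  by (rule sum.swap)
 finally show "both_act m (bidet m s S T) = (\<Sum>z\<in>rep_pairs m s. pair_bidet m s z * pair_coeff m s S T z)"
  by (simp add: sum.cartesian_product case_prod_unfold rep_pairs_def pair_bidet_def pair_coeff_def)
qed

section \<open>Sections of the filtration by dominance\<close>

lemma dom_le_trans: "dom_le x y ==> dom_le y z ==> dom_le x z"
 unfolding dom_le_def by (force intro: order_trans)

lemma dom_le_refl: "dom_le x x"
 by (simp add: dom_le_def)

lemma dom_le_less_trans:
 assumes X: "nu : Xplus m" "mu : Xplus m" "lam : Xplus m" and 1: "dom_le nu mu" and 2: "dom_less mu lam"
 shows "dom_less nu lam"
proof -
 have "dom_le nu lam" using 1 2 dom_le_trans unfolding dom_less_def by blast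
 moreover have "nu ~= lam"
 proof
  assume "nu = lam"
  then have "exponent m (shape_of m mu) (canonical m (shape_of m mu)) < exponent m (shape_of m mu) (canonical m (shape_of m mu))"
   using canonical_exponent_mono(1)[OF shape_of_parts[OF X(2)] shape_of_parts[OF X(1)]]
    canonical_exponent_mono(2)[OF shape_of_parts[OF X(3)] shape_of_parts[OF X(2)]] 1 2
   by (simp add: shape_of_good(2) X)
  then show False by simp
 qed
 ultimately show ?thesis by (simp add: dom_less_def)
qed

lemma zbasis_coordinates:
 assumes basis: "is_zbasis X f M" and X: "finite X"
 shows "\<exists>c :: ratfun => 'i => int. (\<forall>x\<in>M. x = (\<Sum>i\<in>X. of_int (c x i) * f i)) \<and>
  (\<forall>x\<in>M. \<forall>y\<in>M. \<forall>i\<in>X. c (x + y) i = c x i + c y i) \<and>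
  (\<forall>n. \<forall>i\<in>X. c (\<Sum>i\<in>X. of_int (n i) * f i) i = n i)"
proof -
 have span: "M = zmod.span (f ` X)" using basis by (simp add: is_zbasis_def)
 have "\<exists>n :: 'i => int. x = (\<Sum>i\<in>X. of_int (n i) * f i)" if "x : M" for x
 proof -
  obtain I n where I: "finite I" "I \<subseteq> X" "x = (\<Sum>i\<in>I. of_int (n i) * f i)"
   using zspan_image_explicit[of x f X] \<open>x : M\<close> unfolding span by auto
  have "x = (\<Sum>i\<in>X. of_int (if i : I then n i else 0) * f i)"
   unfolding I(3) by (rule sum.mono_neutral_cong_left) (use X I(2) in auto)
  then show ?thesis by (intro exI[of _ "%i. if i : I then n i else 0"])
 qed
 then have "\<forall>x\<in>M. \<exists>n :: 'i => int. x = (\<Sum>i\<in>X. of_int (n i) * f i)" by blast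
 from bchoice[OF this] obtain c :: "ratfun => 'i => int"
  where "\<forall>x\<in>M. x = (\<Sum>i\<in>X. of_int (c x i) * f i)" by (rule exE)
 then have c: "!!x. x : M ==> x = (\<Sum>i\<in>X. of_int (c x i) * f i)" by (rule bspec)
 have unique: "a i = b i" if eq: "(\<Sum>i\<in>X. of_int (a i) * f i) = (\<Sum>i\<in>X. of_int (b i) * f i)" and i: "i : X"
  for a b :: "'i => int" and i
  using is_zbasis_independent[OF basis X subset_refl, of "%i. a i - b i"] eq i
  by (simp add: left_diff_distrib sum_subtractf)
 have MS: "zmod.subspace M" by (rule is_zbasis_subspace[OF basis])
 have fM: "f i : M" if "i : X" for i unfolding span using that by (intro zmod.span_base) simp
 show ?thesis
 proof (intro exI[of _ c] conjI ballI allI)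
  show "x = (\<Sum>i\<in>X. of_int (c x i) * f i)" if "x : M" for x by (rule c[OF that])
  show "c (x + y) i = c x i + c y i" if "x : M" "y : M" "i : X" for x y i
  proof (rule unique[OF _ that(3)])
   have "(\<Sum>i\<in>X. of_int (c (x + y) i) * f i) = x + y" using c zmod.subspace_add[OF MS that(1,2)] by simp
   also have "... = (\<Sum>i\<in>X. of_int (c x i) * f i) + (\<Sum>i\<in>X. of_int (c y i) * f i)"
    using c[OF that(1)] c[OF that(2)] by simp
   finally show "(\<Sum>i\<in>X. of_int (c (x + y) i) * f i) = (\<Sum>i\<in>X. of_int (c x i + c y i) * f i)"
    by (simp add: distrib_right sum.distrib)
  qed
  show "c (\<Sum>i\<in>X. of_int (n i) * f i) i = n i" if "i : X" for n i
   by (rule unique[OF c[symmetric] that]) (intro zmod.subspace_sum[OF MS] subspace_of_int_mult[OF MS] fM)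
 qed
qed

context ordered_letters
begin

definition std_bitableaux :: "(int list => bool) => (int list \<times> rtableau \<times> rtableau) set" where
 "std_bitableaux P = {(mu, S, T). mu : Xplus m & P mu & S : std mu & T : std mu}"

abbreviation val :: "int list \<times> rtableau \<times> rtableau => ratfun" where
 "val \<equiv> %x. bidet m (shp (fst x)) (fst (snd x)) (snd (snd x))"

lemma std_bitableaux_independent:
 assumes I: "finite I" "I \<subseteq> std_bitableaux P" and rel: "(\<Sum>x\<in>I. of_int (a x) * val x) = 0"
 shows "\<forall>x\<in>I. a x = 0"
proof (rule standard_independent[OF I(1) _ _ _ _ rel])
 have x: "fst x : Xplus m" "fst (snd x) : std (fst x)" "snd (snd x) : std (fst x)" if "x : I" for x
  using that I(2) by (auto simp: std_bitableaux_def)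
 show "good_parts m (shp (fst x))" "fst (snd x) : std (fst x)" "snd (snd x) : std (fst x)" if "x : I" for x
  using x[OF that] shape_of_parts by auto
 show "inj_on (%x. (shp (fst x), fst (snd x), snd (snd x))) I"
 proof (rule inj_onI)
  fix x y assume xy: "x : I" "y : I" "(shp (fst x), fst (snd x), snd (snd x)) = (shp (fst y), fst (snd y), snd (snd y))"
  then have "bracket (shp (fst x)) = bracket (shp (fst y))" by simp
  then have "fst x = fst y" unfolding shape_of_good(2)[OF x(1)[OF xy(1)]] shape_of_good(2)[OF x(1)[OF xy(2)]] .
  then show "x = y" using xy(3) by (simp add: prod_eq_iff)
 qed
qed

text \<open>Straightening stays within a set of weights that is closed downwards.\<close>

lemma order_ideal_basis:
 assumes P: "!!mu nu. mu : Xplus m ==> nu : Xplus m ==> P mu ==> dom_le nu mu ==> P nu"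
 shows "is_zbasis (std_bitableaux P) val (zmod.span {bidet m (shp mu) S T | mu S T. mu : Xplus m & P mu \<and>
   S : rtableaux m (shp mu) & T : rtableaux m (shp mu)})" (is "is_zbasis _ _ (zmod.span ?A)")
proof (rule is_zbasisI)
 show "\<forall>i\<in>I. a i = 0" if "finite I" "I \<subseteq> std_bitableaux P" "(\<Sum>i\<in>I. of_int (a i) * val i) = 0" for I a
  by (rule std_bitableaux_independent[OF that])
 have 1: "?A \<subseteq> zmod.span (val ` std_bitableaux P)"
 proof
  fix x assume "x : ?A"
  then obtain mu S T where x: "x = bidet m (shp mu) S T" "mu : Xplus m" "P mu" "S : rtableaux m (shp mu)" "T : rtableaux m (shp mu)"
   by blast
  obtain I a where I: "I \<subseteq> {(nu, S', T'). nu : Xplus m & dom_le nu mu & S' : std nu & T' : std nu \<and>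
    bwt m (shp nu) S' T' = bwt m (shp mu) S T}"
   and e: "bidet m (shp mu) S T = (\<Sum>(nu, S', T') \<in> I. of_int (a (nu, S', T')) * bidet m (shp nu) S' T')"
   using straightening_explicit[OF x(2,4,5)] by blast
  have "x = (\<Sum>z\<in>I. of_int (a z) * val z)" unfolding x(1) e by (simp add: case_prod_unfold)
  also have "... : zmod.span (val ` std_bitableaux P)"
  proof (intro zspan_sum_of_int zmod.span_base imageI)
   fix z assume "z : I"
   then show "z : std_bitableaux P" using I P[OF x(2) _ x(3)] by (auto simp: std_bitableaux_def)
  qed
  finally show "x : zmod.span (val ` std_bitableaux P)" .
 qed
 have 2: "val ` std_bitableaux P \<subseteq> ?A"
 proof
  fix v assume "v : val ` std_bitableaux P"
  then obtain mu S T where "v = bidet m (shp mu) S T" "mu : Xplus m" "P mu" "S : std mu" "T : std mu"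
   by (auto simp: std_bitableaux_def)
  then show "v : ?A" using std_in_rtableaux by blast
 qed
 show "zmod.span (val ` std_bitableaux P) = zmod.span ?A"
  by (rule subset_antisym[OF zmod.span_mono[OF 2] zmod.span_minimal[OF 1 zmod.subspace_span]])
qed

lemma A_le_basis: "is_zbasis (std_bitableaux (%mu. dom_le mu lam)) val (A_le m lam)"
 unfolding A_le_def by (rule order_ideal_basis) (rule dom_le_trans)

lemma A_less_basis: "lam : Xplus m ==> is_zbasis (std_bitableaux (%mu. dom_less mu lam)) val (A_less m lam)"
 unfolding A_less_def by (rule order_ideal_basis) (rule dom_le_less_trans)

lemma A_le_ZGL: "A_le m lam \<subseteq> ZGL m"
 unfolding A_le_def by (rule zmod.span_minimal[OF _ subspace_coord]) (auto intro!: bidet_in_ZGL shape_of_parts)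

lemma A_less_subset: "A_less m lam \<subseteq> A_le m lam"
 unfolding A_less_def A_le_def dom_less_def by (rule zmod.span_mono) blast

lemma bidet_in_A:
 assumes "mu : Xplus m" "S : rtableaux m (shp mu)" "T : rtableaux m (shp mu)"
 shows "dom_le mu lam ==> bidet m (shp mu) S T : A_le m lam"
  and "dom_less mu lam ==> bidet m (shp mu) S T : A_less m lam"
 unfolding A_le_def A_less_def by (rule zmod.span_base, use assms in blast)+

lemma pair_bidet_in_A:
 assumes mu: "mu : Xplus m" and z: "z : rep_pairs m (shp mu)"
 shows "dom_le mu lam ==> pair_bidet m (shp mu) z : A_le m lam"
  and "dom_less mu lam ==> pair_bidet m (shp mu) z : A_less m lam"
proof -
 have "rep (shp mu) (fst z) : rtableaux m (shp mu)" "rep (shp mu) (snd z) : rtableaux m (shp mu)"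
  using z rep_in_rtableaux[OF shape_of_parts[OF mu]] by (auto simp: rep_pairs_def)
 note b = bidet_in_A[OF mu this, of lam]
 show "dom_le mu lam ==> pair_bidet m (shp mu) z : A_le m lam"
  unfolding pair_bidet_def by (rule b(1))
 show "dom_less mu lam ==> pair_bidet m (shp mu) z : A_less m lam"
  unfolding pair_bidet_def by (rule b(2))
qed

text \<open>Elements of \<open>A_less\<close> are combinations of standard bideterminants of lower shapes, which are
 independent of those of shape \<open>lam\<close>.\<close>

lemma top_layer_independent:
 assumes lam: "lam : Xplus m" and rel: "(\<Sum>z\<in>std lam \<times> std lam. of_int (a z) * bidet m (shp lam) (fst z) (snd z)) : A_less m lam"
 shows "\<forall>z\<in>std lam \<times> std lam. a z = 0"
proof
 let ?top = "Pair lam ` (std lam \<times> std lam)"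
 have "(\<Sum>z\<in>std lam \<times> std lam. of_int (a z) * bidet m (shp lam) (fst z) (snd z)) \<in>
   zmod.span (val ` std_bitableaux (%mu. dom_less mu lam))"
  using rel A_less_basis[OF lam] by (simp only: is_zbasis_def)
 from zspan_image_explicit[OF this] obtain I b where I: "finite I" "I \<subseteq> std_bitableaux (%mu. dom_less mu lam)"
  "(\<Sum>z\<in>std lam \<times> std lam. of_int (a z) * bidet m (shp lam) (fst z) (snd z)) = (\<Sum>x\<in>I. of_int (b x) * val x)"
  by blast
 have disj: "?top \<inter> I = {}" using I(2) by (auto simp: std_bitableaux_def dom_less_def)
 let ?a = "%x. if x : I then - b x else a (snd x)"
 have fin: "finite ?top" using finite_std[OF lam] by simp
 have "(\<Sum>x\<in>?top \<union> I. of_int (?a x) * val x) = (\<Sum>x\<in>?top. of_int (?a x) * val x) + (\<Sum>x\<in>I. of_int (?a x) * val x)"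
  by (rule sum.union_disjoint[OF fin I(1) disj])
 also have "(\<Sum>x\<in>?top. of_int (?a x) * val x) = (\<Sum>x\<in>?top. of_int (a (snd x)) * val x)"
  by (rule sum.cong) (use disj in auto)
 also have "... = (\<Sum>z\<in>std lam \<times> std lam. of_int (a z) * bidet m (shp lam) (fst z) (snd z))"
  by (subst sum.reindex) (auto simp: inj_on_def)
 also have "(\<Sum>x\<in>I. of_int (?a x) * val x) = - (\<Sum>x\<in>I. of_int (b x) * val x)"
  by (simp add: sum_negf)
 finally have "(\<Sum>x\<in>?top \<union> I. of_int (?a x) * val x) = 0" using I(3) by simp
 then have 0: "\<forall>x\<in>?top \<union> I. ?a x = 0"
 proof (intro std_bitableaux_independent[where P = "%mu. dom_le mu lam"])
  show "?top \<union> I \<subseteq> std_bitableaux (%mu. dom_le mu lam)"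
   using I(2) lam by (auto simp: std_bitableaux_def dom_less_def dom_le_refl)
 qed (use fin I(1) in auto)
 fix z assume z: "z : std lam \<times> std lam"
 then have "(lam, z) : ?top" by blast
 then have "(lam, z) \<notin> I" "?a (lam, z) = 0" using disj 0 by blast+
 then show "a z = 0" by simp
qed

end

section \<open>The sections of the filtration are tensor products\<close>

context ordered_letters
begin

context
 fixes lam :: "int list"
 assumes lam: "lam : Xplus m"
begin

abbreviation (input) "LG \<equiv> addgrp (nabla_tilde m lam)"
abbreviation (input) "RG \<equiv> addgrp (nabla m lam)"
abbreviation (input) "AG \<equiv> addgrp (A_le m lam)"
abbreviation (input) "lelt \<equiv> %S. bidet m (shp lam) S (can lam)"
abbreviation (input) "relt \<equiv> %T. bidet m (shp lam) (can lam) T"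
abbreviation (input) "lower_coset x \<equiv> A_less m lam #>\<^bsub>addgrp (A_le m lam)\<^esub> x"

lemma nabla_subspaces: "zmod.subspace (nabla m lam)" "zmod.subspace (nabla_tilde m lam)"
  "zmod.subspace (A_le m lam)" "zmod.subspace (A_less m lam)"
 unfolding nabla_def nabla_tilde_def A_le_def A_less_def by (rule zmod.subspace_span)+

lemma elts_in_nabla:
 "S : rtableaux m (shp lam) ==> lelt S : nabla_tilde m lam"
 "S : rtableaux m (shp lam) ==> relt S : nabla m lam"
 unfolding nabla_def nabla_tilde_def by (rule zmod.span_base; simp)+

lemma nabla_ZGL: "nabla m lam \<subseteq> ZGL m" "nabla_tilde m lam \<subseteq> ZGL m"
 unfolding nabla_def nabla_tilde_def
 by (rule zmod.span_minimal[OF _ subspace_coord];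
  use bidet_in_ZGL[OF shape_of_parts[OF lam]] can_in[OF lam] in blast)+

lemma groups:
 shows LG: "comm_group LG" and RG: "comm_group RG" and A_le_group: "comm_group (addgrp (A_le m lam))"
  and V: "comm_group (nabla_tensor m lam)" and Z: "comm_group (ZGG m)"
  and Q: "comm_group (A_quot m lam)"
 unfolding nabla_tensor_def A_quot_def
 by (intro addgrp_group tensor_group nabla_subspaces subspace_coord quotient_map(1) A_less_subset)+

lemma class_hom: "lower_coset : hom (addgrp (A_le m lam)) (A_quot m lam)"
 unfolding A_quot_def by (rule quotient_map(2)[OF nabla_subspaces(4,3) A_less_subset])

lemma class_one: "x : A_less m lam ==> lower_coset x = \<one>\<^bsub>A_quot m lam\<^esub>"
 unfolding A_quot_def by (rule quotient_map(3)[OF nabla_subspaces(4,3) A_less_subset])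

lemma carrier_A_quot: "carrier (A_quot m lam) = lower_coset ` A_le m lam"
 by (simp add: A_quot_def carrier_FactGroup)

lemma coact_nabla_tilde:
 shows "coact m (left_act m) (nabla_tilde m lam) : hom LG (tensor LG (ZGG m))"
  and "!!S. S : rtableaux m (shp lam) ==> coact m (left_act m) (nabla_tilde m lam) (lelt S) =
   finprod (tensor LG (ZGG m)) (%i. tens LG (ZGG m) (lelt (rep (shp lam) i)) (left_coeff m (shp lam) S (rep (shp lam) i)))
    (rep_index m (shp lam))"
proof -
 note s = shape_of_parts[OF lam]
 note cs = coact_sum[where act = "left_act m", OF nabla_bases(2)[OF lam] nabla_ZGL(2) finite_rep_index
   elts_in_nabla(1)[OF rep_in_rtableaux[OF s]] coeff_in_coord(1)[OF s _ rep_in_rtableaux[OF s]] act_bidet(1)[OF s _ can_in[OF lam]]]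
 show "coact m (left_act m) (nabla_tilde m lam) (lelt S) =
   finprod (tensor LG (ZGG m)) (%i. tens LG (ZGG m) (lelt (rep (shp lam) i)) (left_coeff m (shp lam) S (rep (shp lam) i)))
    (rep_index m (shp lam))" if "S : rtableaux m (shp lam)" for S
  by (rule cs(1)) (use that in simp_all)
 show "coact m (left_act m) (nabla_tilde m lam) : hom LG (tensor LG (ZGG m))"
 proof (rule coact_hom[OF nabla_bases(2)[OF lam] nabla_ZGL(2) nabla_tilde_def])
  show "left_act m (x - y) = left_act m x - left_act m y" if "x : nabla_tilde m lam" "y : nabla_tilde m lam" for x y
   by (rule act_diff(1)) (use that nabla_ZGL in auto)
  fix a assume "a : lelt ` rtableaux m (shp lam)"
  then obtain S where S: "S : rtableaux m (shp lam)" and a: "a = lelt S" by blast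
  show "coact m (left_act m) (nabla_tilde m lam) a : carrier (tensor LG (ZGG m)) \<and>
   tensor_lift LG (ZGG m) (addgrp UNIV) (*) (coact m (left_act m) (nabla_tilde m lam) a) = left_act m a"
   unfolding a by (intro conjI; rule cs(2) cs(3)) (use S in simp_all)
 qed
qed

lemma coact_nabla:
 shows "coact m (right_act m) (nabla m lam) : hom RG (tensor RG (ZGG m))"
  and "!!T. T : rtableaux m (shp lam) ==> coact m (right_act m) (nabla m lam) (relt T) =
   finprod (tensor RG (ZGG m)) (%i. tens RG (ZGG m) (relt (rep (shp lam) i)) (right_coeff m (shp lam) (rep (shp lam) i) T))
    (rep_index m (shp lam))"
proof -
 note s = shape_of_parts[OF lam]
 note cs = coact_sum[where act = "right_act m", OF nabla_bases(1)[OF lam] nabla_ZGL(1) finite_rep_index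
   elts_in_nabla(2)[OF rep_in_rtableaux[OF s]] coeff_in_coord(2)[OF s rep_in_rtableaux[OF s]] act_bidet(2)[OF s can_in[OF lam]]]
 show "coact m (right_act m) (nabla m lam) (relt T) =
   finprod (tensor RG (ZGG m)) (%i. tens RG (ZGG m) (relt (rep (shp lam) i)) (right_coeff m (shp lam) (rep (shp lam) i) T))
    (rep_index m (shp lam))" if "T : rtableaux m (shp lam)" for T
  by (rule cs(1)) (use that in simp_all)
 show "coact m (right_act m) (nabla m lam) : hom RG (tensor RG (ZGG m))"
 proof (rule coact_hom[OF nabla_bases(1)[OF lam] nabla_ZGL(1) nabla_def])
  show "right_act m (x - y) = right_act m x - right_act m y" if "x : nabla m lam" "y : nabla m lam" for x y
   by (rule act_diff(2)) (use that nabla_ZGL in auto)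
  fix a assume "a : relt ` rtableaux m (shp lam)"
  then obtain T where T: "T : rtableaux m (shp lam)" and a: "a = relt T" by blast
  show "coact m (right_act m) (nabla m lam) a : carrier (tensor RG (ZGG m)) \<and>
   tensor_lift RG (ZGG m) (addgrp UNIV) (*) (coact m (right_act m) (nabla m lam) a) = right_act m a"
   unfolding a by (intro conjI; rule cs(2) cs(3)) (use T in simp_all)
 qed
qed

lemma coact_A_le_bidet:
 assumes mu: "mu : Xplus m" "dom_le mu lam" and S: "S : rtableaux m (shp mu)" and T: "T : rtableaux m (shp mu)"
 defines "g \<equiv> coact m (both_act m) (A_le m lam) (bidet m (shp mu) S T)"
 shows "g = finprod (tensor AG (ZGG m)) (%z. tens AG (ZGG m) (pair_bidet m (shp mu) z) (pair_coeff m (shp mu) S T z))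
   (rep_pairs m (shp mu))"
  and "g : carrier (tensor AG (ZGG m))"
  and "tensor_lift AG (ZGG m) (addgrp UNIV) (*) g = both_act m (bidet m (shp mu) S T)"
 unfolding g_def using coact_sum[where act = "both_act m", OF A_le_basis A_le_ZGL _
   pair_bidet_in_A(1)[OF mu(1) _ mu(2)] pair_coeff_in_coord[OF shape_of_parts[OF mu(1)] S T]
   act_bidet(3)[OF shape_of_parts[OF mu(1)] S T]] finite_rep_index
 by (simp_all add: rep_pairs_def)

lemma coact_A_le: "coact m (both_act m) (A_le m lam) : hom AG (tensor AG (ZGG m))"
proof (rule coact_hom[OF A_le_basis A_le_ZGL A_le_def])
 show "both_act m (x - y) = both_act m x - both_act m y" if "x : A_le m lam" "y : A_le m lam" for x y
  by (rule act_diff(3)) (use that A_le_ZGL in auto)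
 fix a assume "a : {bidet m (shp mu) S T | mu S T. mu : Xplus m & dom_le mu lam \<and>
  S : rtableaux m (shp mu) & T : rtableaux m (shp mu)}"
 then obtain mu S T where a: "a = bidet m (shp mu) S T" and x: "mu : Xplus m" "dom_le mu lam"
  "S : rtableaux m (shp mu)" "T : rtableaux m (shp mu)" by blast
 show "coact m (both_act m) (A_le m lam) a : carrier (tensor AG (ZGG m)) \<and>
  tensor_lift AG (ZGG m) (addgrp UNIV) (*) (coact m (both_act m) (A_le m lam) a) = both_act m a"
  unfolding a using coact_A_le_bidet(2,3)[OF x] by (rule conjI)
qed

text \<open>Applied to a bideterminant of shape \<open>mu\<close>, the coaction produces bideterminants of the same
 shape. The lower ones therefore vanish in the quotient, so the coaction descends.\<close>

lemma coact_A_quot: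
 shows "A_quot_coact m lam : hom (A_quot m lam) (tensor (A_quot m lam) (ZGG m))"
  and "!!S T. S : rtableaux m (shp lam) ==> T : rtableaux m (shp lam) ==>
   A_quot_coact m lam (lower_coset (bidet m (shp lam) S T)) =
   finprod (tensor (A_quot m lam) (ZGG m)) (%z. tens (A_quot m lam) (ZGG m)
    (lower_coset (pair_bidet m (shp lam) z)) (pair_coeff m (shp lam) S T z)) (rep_pairs m (shp lam))"
proof -
 let ?Q = "A_quot m lam" and ?\<rho> = "coact m (both_act m) (A_le m lam)"
 let ?q = "%mu S T z. tens ?Q (ZGG m) (lower_coset (pair_bidet m (shp mu) z)) (pair_coeff m (shp mu) S T z)"
 note T = tensor_group[OF A_le_group Z] and TQ = tensor_group[OF Q Z]
 interpret TQ: comm_group "tensor ?Q (ZGG m)" by (rule TQ)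
 note tm = tensor_map_left_hom[OF A_le_group Z Q class_hom]
 define h where "h x = tensor_map_left AG ?Q (ZGG m) lower_coset (?\<rho> x)" for x
 have h: "h : hom AG (tensor ?Q (ZGG m))"
  using hom_compose[OF coact_A_le tm(1)] by (simp add: h_def[abs_def] comp_def)
 have hval: "h (bidet m (shp mu) S T) = finprod (tensor ?Q (ZGG m)) (?q mu S T) (rep_pairs m (shp mu))"
  if mu: "mu : Xplus m" "dom_le mu lam" and S: "S : rtableaux m (shp mu)" and T': "T : rtableaux m (shp mu)" for mu S T
 proof -
  let ?t = "%z. tens AG (ZGG m) (pair_bidet m (shp mu) z) (pair_coeff m (shp mu) S T z)"
  note e = pair_bidet_in_A(1)[OF mu(1) _ mu(2)] pair_coeff_in_coord[OF shape_of_parts[OF mu(1)] S T']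
  have "?t z : carrier (tensor AG (ZGG m))" if "z : rep_pairs m (shp mu)" for z
   using e[OF that] by (intro tens_closed[OF A_le_group Z]) simp_all
  then have "h (bidet m (shp mu) S T) =
    finprod (tensor ?Q (ZGG m)) (%z. tensor_map_left AG ?Q (ZGG m) lower_coset (?t z)) (rep_pairs m (shp mu))"
   unfolding h_def coact_A_le_bidet(1)[OF mu S T'] by (rule hom_finprod[OF T TQ tm(1)])
  also have "... = finprod (tensor ?Q (ZGG m)) (?q mu S T) (rep_pairs m (shp mu))"
  proof (rule TQ.finprod_cong'[OF refl])
   show "tensor_map_left AG ?Q (ZGG m) lower_coset (?t z) = ?q mu S T z" if "z : rep_pairs m (shp mu)" for z
    by (rule tm(2)) (use e[OF that] in simp_all)
   show "?q mu S T : rep_pairs m (shp mu) \<rightarrow> carrier (tensor ?Q (ZGG m))"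
    using e by (intro Pi_I tens_closed[OF Q Z] hom_closed'[OF class_hom]) simp_all
  qed
  finally show ?thesis .
 qed
 have kill: "h x = \<one>\<^bsub>tensor ?Q (ZGG m)\<^esub>" if x: "x : A_less m lam" for x
 proof -
  let ?B = "{bidet m (shp mu) S T | mu S T. mu : Xplus m & dom_less mu lam \<and>
   S : rtableaux m (shp mu) & T : rtableaux m (shp mu)}"
  have hr: "h : hom (addgrp (zmod.span ?B)) (tensor ?Q (ZGG m))"
  proof (rule homI)
   have sub: "x : A_le m lam" if "x : carrier (addgrp (zmod.span ?B))" for x
    by (rule subsetD[OF A_less_subset]) (use that in \<open>simp only: addgrp_simps A_less_def\<close>)
   show "h x : carrier (tensor ?Q (ZGG m))" if "x : carrier (addgrp (zmod.span ?B))" for x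
    using hom_closed'[OF h] sub[OF that] by simp
   show "h (x \<otimes>\<^bsub>addgrp (zmod.span ?B)\<^esub> y) = h x \<otimes>\<^bsub>tensor ?Q (ZGG m)\<^esub> h y"
    if "x : carrier (addgrp (zmod.span ?B))" "y : carrier (addgrp (zmod.span ?B))" for x y
    using hom_mult'[OF h, of x y] sub[OF that(1)] sub[OF that(2)] by simp
  qed
  have one: "(%_. \<one>\<^bsub>tensor ?Q (ZGG m)\<^esub>) : hom (addgrp (zmod.span ?B)) (tensor ?Q (ZGG m))"
   by (rule homI) simp_all
  show ?thesis
  proof (rule hom_eq_on_span[OF TQ hr one])
   show "x : zmod.span ?B" using x unfolding A_less_def .
   fix a assume "a : ?B"
   then obtain mu S T where a: "a = bidet m (shp mu) S T" and mu: "mu : Xplus m" "dom_less mu lam"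
    and S: "S : rtableaux m (shp mu)" and T: "T : rtableaux m (shp mu)" by blast
   have le: "dom_le mu lam" using mu(2) by (simp add: dom_less_def)
   show "h a = \<one>\<^bsub>tensor ?Q (ZGG m)\<^esub>"
    unfolding a hval[OF mu(1) le S T]
   proof (rule TQ.finprod_one_eqI)
    fix z assume z: "z : rep_pairs m (shp mu)"
    show "?q mu S T z = \<one>\<^bsub>tensor ?Q (ZGG m)\<^esub>"
     unfolding class_one[OF pair_bidet_in_A(2)[OF mu(1) z mu(2)]]
     by (rule tens_one(1)[OF Q Z]) (use pair_coeff_in_coord[OF shape_of_parts[OF mu(1)] S T z] in simp)
   qed
  qed
 qed
 note qc = quot_coact_hom[OF nabla_subspaces(4,3) A_less_subset coact_A_le kill[unfolded h_def A_quot_def]]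
 show "A_quot_coact m lam : hom ?Q (tensor ?Q (ZGG m))"
  unfolding A_quot_coact_def A_quot_def by (rule qc(2))
 show "A_quot_coact m lam (lower_coset (bidet m (shp lam) S T)) =
   finprod (tensor ?Q (ZGG m)) (?q lam S T) (rep_pairs m (shp lam))"
  if S: "S : rtableaux m (shp lam)" and T: "T : rtableaux m (shp lam)" for S T
 proof -
  have "A_quot_coact m lam (lower_coset (bidet m (shp lam) S T)) = h (bidet m (shp lam) S T)"
   unfolding A_quot_coact_def h_def A_quot_def by (rule qc(1)) (use bidet_in_A(1)[OF lam S T dom_le_refl] in simp_all)
  then show ?thesis using hval[OF lam dom_le_refl S T] by simp
 qed
qed

end

end

context ordered_letters
begin

text \<open>The map of the theorem is well defined because straightening is compatible with products:
 the coordinates of \<open>(S | T)\<close> modulo lower shapes are the products of the coordinates of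
 \<open>(S | T\<^sub>\<lambda>)\<close> and \<open>(T\<^sub>\<lambda> | T)\<close>.\<close>

lemma section_isomorphism:
 assumes lam: "lam : Xplus m"
 shows "\<exists>\<phi>\<in>iso (nabla_tensor m lam) (A_quot m lam). \<forall>S\<in>rtableaux m (shp lam). \<forall>T\<in>rtableaux m (shp lam).
   \<phi> (tens (addgrp (nabla_tilde m lam)) (addgrp (nabla m lam)) (bidet m (shp lam) S (can lam)) (bidet m (shp lam) (can lam) T)) =
    A_less m lam #>\<^bsub>addgrp (A_le m lam)\<^esub> bidet m (shp lam) S T"
proof -
 let ?G = "addgrp (nabla_tilde m lam)" and ?H = "addgrp (nabla m lam)"
 let ?l = "%S. bidet m (shp lam) S (can lam)" and ?r = "%T. bidet m (shp lam) (can lam) T"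
 let ?\<pi> = "%x. A_less m lam #>\<^bsub>addgrp (A_le m lam)\<^esub> x" and ?Q = "A_quot m lam" and ?V = "nabla_tensor m lam"
 note G = LG[OF lam] and H = RG[OF lam] and Q = Q[OF lam] and V = V[OF lam] and sub = nabla_subspaces[OF lam]
 note \<pi> = class_hom[OF lam]
 interpret V: comm_group ?V by (rule V)
 interpret Q: comm_group ?Q by (rule Q)
 have std_in: "S : rtableaux m (shp lam)" if "S : std lam" for S by (rule std_in_rtableaux[OF that])
 note fin = finite_std[OF lam]
 obtain c where c0: "\<forall>x\<in>nabla_tilde m lam. x = (\<Sum>i\<in>std lam. of_int (c x i) * ?l i)"
  "\<forall>x\<in>nabla_tilde m lam. \<forall>y\<in>nabla_tilde m lam. \<forall>i\<in>std lam. c (x + y) i = c x i + c y i"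
  "\<forall>n. \<forall>i\<in>std lam. c (\<Sum>i\<in>std lam. of_int (n i) * ?l i) i = n i"
  using zbasis_coordinates[OF nabla_bases(2)[OF lam] fin] by (elim exE conjE)
 note c = bspec[OF c0(1)] and cadd = c0(2)[THEN bspec, THEN bspec, THEN bspec] and cval = c0(3)[THEN spec, THEN bspec]
 obtain d where d0: "\<forall>x\<in>nabla m lam. x = (\<Sum>j\<in>std lam. of_int (d x j) * ?r j)"
  "\<forall>x\<in>nabla m lam. \<forall>y\<in>nabla m lam. \<forall>j\<in>std lam. d (x + y) j = d x j + d y j"
  using zbasis_coordinates[OF nabla_bases(1)[OF lam] fin] by (elim exE conjE)
 note d = bspec[OF d0(1)] and dadd = d0(2)[THEN bspec, THEN bspec, THEN bspec]
 define B where "B a b = (\<Sum>i\<in>std lam. \<Sum>j\<in>std lam. of_int (c a i * d b j) * bidet m (shp lam) i j)" for a b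
 have bA: "bidet m (shp lam) S T : A_le m lam" if "S : rtableaux m (shp lam)" "T : rtableaux m (shp lam)" for S T
  by (rule bidet_in_A(1)[OF lam that dom_le_refl])
 have BA: "B a b : A_le m lam" for a b
  unfolding B_def by (intro zmod.subspace_sum[OF sub(3)] subspace_of_int_mult[OF sub(3)] bA std_in)
 have B_add: "B (a + a') b = B a b + B a' b" if "a : nabla_tilde m lam" "a' : nabla_tilde m lam" for a a' b
  unfolding B_def sum.distrib[symmetric] by (intro sum.cong refl) (simp add: cadd[OF that] distrib_left distrib_right)
 have B_add': "B a (b + b') = B a b + B a b'" if "b : nabla m lam" "b' : nabla m lam" for a b b'
  unfolding B_def sum.distrib[symmetric] by (intro sum.cong refl) (simp add: dadd[OF that] distrib_left distrib_right)
 have \<beta>: "biadditive ?G ?H ?Q (%a b. ?\<pi> (B a b))"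
 proof (rule biadditiveI)
  show "?\<pi> (B a b) : carrier ?Q" for a b by (rule hom_closed'[OF \<pi>]) (use BA in simp)
  show "?\<pi> (B (a \<otimes>\<^bsub>?G\<^esub> a') b) = ?\<pi> (B a b) \<otimes>\<^bsub>?Q\<^esub> ?\<pi> (B a' b)" if "a : carrier ?G" "a' : carrier ?G" for a a' b
   using hom_mult'[OF \<pi>, of "B a b" "B a' b"] BA B_add that by simp
  show "?\<pi> (B a (b \<otimes>\<^bsub>?H\<^esub> b')) = ?\<pi> (B a b) \<otimes>\<^bsub>?Q\<^esub> ?\<pi> (B a b')" if "b : carrier ?H" "b' : carrier ?H" for a b b'
   using hom_mult'[OF \<pi>, of "B a b" "B a b'"] BA B_add' that by simp
 qed
 define \<phi> where "\<phi> = tensor_lift ?G ?H ?Q (%a b. ?\<pi> (B a b))"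
 have \<phi>: "\<phi> : hom ?V ?Q" unfolding \<phi>_def nabla_tensor_def by (rule tensor_lift(1)[OF G H Q \<beta>])
 have \<phi>t: "\<phi> (tens ?G ?H a b) = ?\<pi> (B a b)" if "a : nabla_tilde m lam" "b : nabla m lam" for a b
  unfolding \<phi>_def using tensor_lift(2)[OF G H Q \<beta>] that by simp
 have tV: "tens ?G ?H a b : carrier ?V" if "a : nabla_tilde m lam" "b : nabla m lam" for a b
  unfolding nabla_tensor_def using tens_closed[OF G H] that by simp
 note elts = elts_in_nabla[OF lam]
 have gen: "\<phi> (tens ?G ?H (?l S) (?r T)) = ?\<pi> (bidet m (shp lam) S T)"
  if S: "S : rtableaux m (shp lam)" and T: "T : rtableaux m (shp lam)" for S T
 proof -
  have "bidet m (shp lam) S T - B (?l S) (?r T) : A_less m lam"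
   unfolding B_def by (rule straightening_coefficients[OF lam S T c[OF elts(1)[OF S]] d[OF elts(2)[OF T]]])
  from quotient_map(5)[OF sub(4,3) A_less_subset bA[OF S T] BA this]
  show ?thesis using \<phi>t[OF elts(1)[OF S] elts(2)[OF T]] by simp
 qed
 have inj: "inj_on \<phi> (carrier ?V)"
 proof (subst group_hom.inj_on_one_iff[OF hom_group_hom[OF V Q \<phi>]], intro allI impI)
  fix t assume t: "t : carrier ?V" and ker: "\<phi> t = \<one>\<^bsub>?Q\<^esub>"
  have span: "nabla_tilde m lam = zmod.span (?l ` std lam)"
   using nabla_bases(2)[OF lam] by (simp add: is_zbasis_def)
  obtain I b where I: "finite I" "I \<subseteq> std lam" "\<forall>i. b i : nabla m lam" "t = finprod ?V (%i. tens ?G ?H (?l i) (b i)) I"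
   using tensor_expansion[OF span sub(1) t[unfolded nabla_tensor_def]] unfolding nabla_tensor_def by blast
  have cl: "c (?l i) k = (if k = i then 1 else 0)" if "i : std lam" "k : std lam" for i k
  proof -
   have "(\<Sum>k\<in>std lam. of_int (if k = i then 1 else 0) * ?l k) = (\<Sum>k\<in>std lam. if k = i then ?l k else 0)"
    by (rule sum.cong) auto
   also have "... = ?l i" using fin that(1) by simp
   finally have "?l i = (\<Sum>k\<in>std lam. of_int (if k = i then 1 else 0) * ?l k)" ..
   then show ?thesis using cval[OF that(2), of "%k. if k = i then 1 else 0"] by simp
  qed
  have Bl: "B (?l i) y = (\<Sum>j\<in>std lam. of_int (d y j) * bidet m (shp lam) i j)" if i: "i : std lam" for i y
  proof -
   have "B (?l i) y = (\<Sum>k\<in>std lam. if k = i then (\<Sum>j\<in>std lam. of_int (d y j) * bidet m (shp lam) k j) else 0)"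
    unfolding B_def by (rule sum.cong) (use cl[OF i] in auto)
   then show ?thesis using fin i by (simp add: sum.delta)
  qed
  have li: "?l i : nabla_tilde m lam" if "i : I" for i using that I(2) elts(1) std_in by blast
  have "\<phi> t = finprod ?Q (%i. \<phi> (tens ?G ?H (?l i) (b i))) I"
   unfolding I(4) by (rule hom_finprod[OF V Q \<phi>]) (use li I(3) tV in blast)
  also have "... = finprod ?Q (%i. ?\<pi> (B (?l i) (b i))) I"
   by (rule Q.finprod_cong') (use li I(3) \<phi>t BA carrier_A_quot[OF lam] in auto)
  also have "... = ?\<pi> (finprod (addgrp (A_le m lam)) (%i. B (?l i) (b i)) I)"
   by (rule hom_finprod[OF A_le_group[OF lam] Q \<pi>, symmetric]) (use BA in simp)
  also have "finprod (addgrp (A_le m lam)) (%i. B (?l i) (b i)) I = (\<Sum>i\<in>I. B (?l i) (b i))"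
   by (rule finprod_addgrp[OF sub(3) BA])
  finally have "(\<Sum>i\<in>I. B (?l i) (b i)) : A_less m lam"
   using quotient_map(4)[OF sub(4,3) A_less_subset] ker unfolding A_quot_def by simp
  moreover have "(\<Sum>i\<in>I. B (?l i) (b i)) =
   (\<Sum>z\<in>std lam \<times> std lam. of_int (if fst z : I then d (b (fst z)) (snd z) else 0) * bidet m (shp lam) (fst z) (snd z))"
  proof -
   have "(\<Sum>i\<in>I. B (?l i) (b i)) = (\<Sum>i\<in>I. \<Sum>j\<in>std lam. of_int (d (b i) j) * bidet m (shp lam) i j)"
    using I(2) by (intro sum.cong refl Bl) blast
   also have "... = (\<Sum>i\<in>std lam. \<Sum>j\<in>std lam. of_int (if i : I then d (b i) j else 0) * bidet m (shp lam) i j)"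
    by (rule sum.mono_neutral_cong_left) (use fin I(2) in auto)
   finally show ?thesis by (simp add: sum.cartesian_product case_prod_unfold)
  qed
  ultimately have "\<forall>z\<in>std lam \<times> std lam. (if fst z : I then d (b (fst z)) (snd z) else 0) = 0"
   by (intro top_layer_independent[OF lam]) simp
  then have d0: "d (b i) j = 0" if "i : I" "j : std lam" for i j
   using that I(2) by (metis (no_types, lifting) SigmaI fst_conv snd_conv subsetD)
  have "b i = 0" if "i : I" for i
   using d[OF I(3)[rule_format]] d0[OF that] by (metis (no_types, lifting) mult_zero_left of_int_0 sum.neutral)
  then show "t = \<one>\<^bsub>?V\<^esub>"
   unfolding I(4) using tens_one(2)[OF G H] li by (intro V.finprod_one_eqI) (simp add: nabla_tensor_def)
 qed
 have surj: "carrier ?Q \<subseteq> \<phi> ` carrier ?V"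
 proof -
  let ?R = "{q : A_le m lam. ?\<pi> q : \<phi> ` carrier ?V}"
  have one: "?\<pi> q : \<phi> ` carrier ?V" if "q : A_less m lam" for q
   using class_one[OF lam that] hom_one'[OF V Q \<phi>] V.one_closed by (metis imageI)
  have neg: "?\<pi> (x - y) = ?\<pi> x \<otimes>\<^bsub>?Q\<^esub> inv\<^bsub>?Q\<^esub> ?\<pi> y" if "x : A_le m lam" "y : A_le m lam" for x y
   using hom_mult'[OF \<pi>, of x "- y"] hom_inv'[OF A_le_group[OF lam] Q \<pi>, of y] addgrp_inv[OF sub(3)]
    that zmod.subspace_neg[OF sub(3)] by simp
  have "zmod.subspace ?R"
  proof (rule subspaceI_diff)
   show "0 : ?R" using zmod.subspace_0[OF sub(3)] zmod.subspace_0[OF sub(4)] one by simp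
   fix x y assume "x : ?R" "y : ?R"
   then obtain u v where x: "x : A_le m lam" "u : carrier ?V" "?\<pi> x = \<phi> u"
    and y: "y : A_le m lam" "v : carrier ?V" "?\<pi> y = \<phi> v" by blast
   have "?\<pi> (x - y) = \<phi> (u \<otimes>\<^bsub>?V\<^esub> inv\<^bsub>?V\<^esub> v)"
    unfolding neg[OF x(1) y(1)] x(3) y(3) using x(2) y(2) by (simp add: hom_mult'[OF \<phi>] hom_inv'[OF V Q \<phi>])
   then show "x - y : ?R" using x y zmod.subspace_diff[OF sub(3)] by auto
  qed
  moreover have "{bidet m (shp mu) S T | mu S T. mu : Xplus m & dom_le mu lam \<and>
    S : rtableaux m (shp mu) & T : rtableaux m (shp mu)} \<subseteq> ?R"
  proof
   fix x assume "x : {bidet m (shp mu) S T | mu S T. mu : Xplus m & dom_le mu lam \<and>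
    S : rtableaux m (shp mu) & T : rtableaux m (shp mu)}"
   then obtain mu S T where x: "x = bidet m (shp mu) S T" and mu: "mu : Xplus m" "dom_le mu lam"
    and ST: "S : rtableaux m (shp mu)" "T : rtableaux m (shp mu)" by blast
   have "?\<pi> x : \<phi> ` carrier ?V"
   proof (cases "mu = lam")
    case True
    then have "?\<pi> x = \<phi> (tens ?G ?H (?l S) (?r T))" unfolding x using gen ST by simp
    then show ?thesis using tV elts ST True by blast
   next
    case False
    then show ?thesis unfolding x using mu by (intro one bidet_in_A(2)[OF mu(1) ST]) (simp add: dom_less_def)
   qed
   then show "x : ?R" unfolding x using bidet_in_A(1)[OF mu(1) ST mu(2)] by simp
  qed
  ultimately have "A_le m lam \<subseteq> ?R" unfolding A_le_def by (rule zmod.span_minimal[rotated])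
  then show ?thesis unfolding carrier_A_quot[OF lam] by blast
 qed
 have "\<phi> : iso ?V ?Q"
  using \<phi> inj surj hom_closed'[OF \<phi>] by (auto simp: iso_def bij_betw_def)
 then show ?thesis using gen by blast
qed

text \<open>Both sides of the equivariance are homomorphisms, so they are compared on the tensors of
 generators, where both become the same sum over pairs of representatives.\<close>

theorem section_GG_iso:
 assumes lam: "lam : Xplus m"
 shows "\<exists>\<phi>. GG_iso m (nabla_tensor m lam) (nabla_tensor_coact m lam) (A_quot m lam) (A_quot_coact m lam) \<phi> \<and>
  (\<forall>S \<in> rtableaux m (shp lam). \<forall>T \<in> rtableaux m (shp lam).
   \<phi> (tens (addgrp (nabla_tilde m lam)) (addgrp (nabla m lam)) (bidet m (shp lam) S (can lam)) (bidet m (shp lam) (can lam) T)) =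
    A_less m lam #>\<^bsub>addgrp (A_le m lam)\<^esub> bidet m (shp lam) S T)"
proof -
 let ?G = "addgrp (nabla_tilde m lam)" and ?H = "addgrp (nabla m lam)" and ?Z = "ZGG m"
 let ?l = "%S. bidet m (shp lam) S (can lam)" and ?r = "%T. bidet m (shp lam) (can lam) T"
 let ?\<pi> = "%x. A_less m lam #>\<^bsub>addgrp (A_le m lam)\<^esub> x" and ?Q = "A_quot m lam" and ?V = "nabla_tensor m lam"
 let ?s = "shp lam" and ?I = "rep_index m (shp lam)" and ?R = "rep (shp lam)"
 note G = LG[OF lam] and H = RG[OF lam] and Q = Q[OF lam] and V = V[OF lam] and Z = Z[OF lam]
 note elts = elts_in_nabla[OF lam] and s = shape_of_parts[OF lam]
 obtain \<phi> where \<phi>: "\<phi> : iso ?V ?Q"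
  and gen0: "\<forall>S\<in>rtableaux m ?s. \<forall>T\<in>rtableaux m ?s. \<phi> (tens ?G ?H (?l S) (?r T)) = ?\<pi> (bidet m ?s S T)"
  using section_isomorphism[OF lam] by (elim bexE)
 note gen = gen0[THEN bspec, THEN bspec]
 have \<phi>h: "\<phi> : hom ?V ?Q" using \<phi> by (simp add: iso_def)
 note TQ = tensor_group[OF Q Z] and W = tensor_group[OF V Z]
 interpret TQ: comm_group "tensor ?Q ?Z" by (rule TQ)
 interpret W: comm_group "tensor ?V ?Z" by (rule W)
 note tm = tensor_map_left_hom[OF V Z Q \<phi>h]
 note tc = tensor_coact_hom[OF G H coact_nabla_tilde(1)[OF lam] coact_nabla(1)[OF lam]]
 have tch: "nabla_tensor_coact m lam : hom ?V (tensor ?V ?Z)"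
  unfolding nabla_tensor_coact_def nabla_tensor_def by (rule tc(1))
 have lh: "(%v. A_quot_coact m lam (\<phi> v)) : hom ?V (tensor ?Q ?Z)"
  using hom_compose[OF \<phi>h coact_A_quot(1)[OF lam]] by (simp add: comp_def)
 have rh: "(%v. tensor_map_left ?V ?Q ?Z \<phi> (nabla_tensor_coact m lam v)) : hom ?V (tensor ?Q ?Z)"
  using hom_compose[OF tch tm(1)] by (simp add: comp_def)
 have eq: "A_quot_coact m lam (\<phi> (tens ?G ?H (?l S) (?r T))) =
   tensor_map_left ?V ?Q ?Z \<phi> (nabla_tensor_coact m lam (tens ?G ?H (?l S) (?r T)))"
  if S: "S : rtableaux m ?s" and T: "T : rtableaux m ?s" for S T
 proof -
  note R = rep_in_rtableaux[OF s]
  have lc: "left_coeff m ?s S (?R i) : coord m {1, 2}" if "i : ?I" for i by (rule coeff_in_coord(1)[OF s S R[OF that]])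
  have rc: "right_coeff m ?s (?R j) T : coord m {1, 2}" if "j : ?I" for j by (rule coeff_in_coord(2)[OF s R[OF that] T])
  have cc: "left_coeff m ?s S (?R i) * right_coeff m ?s (?R j) T : coord m {1, 2}" if "i : ?I" "j : ?I" for i j
   by (rule coord.mult[OF lc[OF that(1)] rc[OF that(2)]])
  have vV: "tens ?G ?H (?l (?R i)) (?r (?R j)) : carrier ?V" if "i : ?I" "j : ?I" for i j
   unfolding nabla_tensor_def by (rule tens_closed[OF G H]) (use elts R that in simp_all)
  let ?w = "%i j. tens ?V ?Z (tens ?G ?H (?l (?R i)) (?r (?R j))) (left_coeff m ?s S (?R i) * right_coeff m ?s (?R j) T)"
  let ?q = "%i j. tens ?Q ?Z (?\<pi> (bidet m ?s (?R i) (?R j))) (left_coeff m ?s S (?R i) * right_coeff m ?s (?R j) T)"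
  have wW: "?w i j : carrier (tensor ?V ?Z)" if "i : ?I" "j : ?I" for i j
   by (rule tens_closed[OF V Z vV[OF that]]) (use cc[OF that] in simp)
  have wq: "tensor_map_left ?V ?Q ?Z \<phi> (?w i j) = ?q i j" if "i : ?I" "j : ?I" for i j
   using tm(2)[OF vV[OF that], of "left_coeff m ?s S (?R i) * right_coeff m ?s (?R j) T"] cc[OF that] gen[OF R R] that by simp
  have qc: "?q i j : carrier (tensor ?Q ?Z)" if "i : ?I" "j : ?I" for i j
   using hom_closed'[OF tm(1) wW[OF that]] wq[OF that] by simp
  have "nabla_tensor_coact m lam (tens ?G ?H (?l S) (?r T)) = finprod (tensor ?V ?Z) (%i. finprod (tensor ?V ?Z) (?w i) ?I) ?I"
   unfolding nabla_tensor_coact_def nabla_tensor_def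
   by (rule tc(2)[OF _ _ _ _ _ _ coact_nabla_tilde(2)[OF lam S] coact_nabla(2)[OF lam T]])
    (use S T elts R lc rc in simp_all)
  also have "... = finprod (tensor ?V ?Z) (%z. ?w (fst z) (snd z)) (?I \<times> ?I)"
   by (rule finprod_Times[OF W finite_rep_index finite_rep_index wW, symmetric])
  finally have "tensor_map_left ?V ?Q ?Z \<phi> (nabla_tensor_coact m lam (tens ?G ?H (?l S) (?r T))) =
    finprod (tensor ?Q ?Z) (%z. tensor_map_left ?V ?Q ?Z \<phi> (?w (fst z) (snd z))) (?I \<times> ?I)"
   by (simp only:) (rule hom_finprod[OF W TQ tm(1)], use wW in auto)
  also have "... = finprod (tensor ?Q ?Z) (%z. ?q (fst z) (snd z)) (?I \<times> ?I)"
   by (rule TQ.finprod_cong') (use wq qc in auto)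
  finally show ?thesis unfolding gen[OF S T] coact_A_quot(2)[OF lam S T] rep_pairs_def pair_bidet_def pair_coeff_def by simp
 qed
 have "A_quot_coact m lam (\<phi> v) = tensor_map_left ?V ?Q ?Z \<phi> (nabla_tensor_coact m lam v)" if v: "v : carrier ?V" for v
 proof (rule tensor_hom_eq_on_generators[OF TQ, where A = "?l ` rtableaux m ?s" and B = "?r ` rtableaux m ?s"])
  show "(%v. A_quot_coact m lam (\<phi> v)) \<in>
    hom (tensor (addgrp (zmod.span (?l ` rtableaux m ?s))) (addgrp (zmod.span (?r ` rtableaux m ?s)))) (tensor ?Q ?Z)"
   using lh unfolding nabla_tensor_def nabla_tilde_def nabla_def .
  show "(%v. tensor_map_left ?V ?Q ?Z \<phi> (nabla_tensor_coact m lam v)) \<in>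
    hom (tensor (addgrp (zmod.span (?l ` rtableaux m ?s))) (addgrp (zmod.span (?r ` rtableaux m ?s)))) (tensor ?Q ?Z)"
   using rh unfolding nabla_tensor_def nabla_tilde_def nabla_def .
  show "v : carrier (tensor (addgrp (zmod.span (?l ` rtableaux m ?s))) (addgrp (zmod.span (?r ` rtableaux m ?s))))"
   using v unfolding nabla_tensor_def nabla_tilde_def nabla_def .
  fix a b assume "a : ?l ` rtableaux m ?s" "b : ?r ` rtableaux m ?s"
  then obtain S T where "S : rtableaux m ?s" "T : rtableaux m ?s" "a = ?l S" "b = ?r T" by blast
  then show "A_quot_coact m lam (\<phi> (tens (addgrp (zmod.span (?l ` rtableaux m ?s))) (addgrp (zmod.span (?r ` rtableaux m ?s))) a b)) =
   tensor_map_left ?V ?Q ?Z \<phi> (nabla_tensor_coact m lam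
    (tens (addgrp (zmod.span (?l ` rtableaux m ?s))) (addgrp (zmod.span (?r ` rtableaux m ?s))) a b))"
   using eq[of S T] by (simp only: nabla_tilde_def[symmetric] nabla_def[symmetric])
 qed
 then show ?thesis using \<phi> gen0 unfolding GG_iso_def by blast
qed

end

theorem theorem3p2:
  fixes m :: nat and ord :: "nat rel" and lam :: "int list"
  assumes "m \<ge> 1"
    and "linear_order_on {1..m} ord"
    and "lam \<in> Xplus m"
  shows
    "(\<forall>S \<in> rtableaux m (shape_of m lam). \<forall>T \<in> rtableaux m (shape_of m lam).
        \<exists>I a. finite I \<and>
          I \<subseteq> {(mu, S', T'). mu \<in> Xplus m \<and> dom_le mu lam \<and>
                 S' \<in> std_rtableaux m ord (shape_of m mu) \<and>
                 T' \<in> std_rtableaux m ord (shape_of m mu) \<and>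
                 bwt m (shape_of m mu) S' T' = bwt m (shape_of m lam) S T} \<and>
          bidet m (shape_of m lam) S T =
            (\<Sum>(mu, S', T') \<in> I. of_int (a (mu, S', T')) * bidet m (shape_of m mu) S' T'))
     \<and>
     is_zbasis {(s, S, T). s \<in> partitions m \<times> partitions m \<and>
                  S \<in> std_rtableaux m ord s \<and> T \<in> std_rtableaux m ord s}
       (\<lambda>(s, S, T). bidet m s S T) (ZGL m)
     \<and>
     (is_zbasis (std_rtableaux m ord (shape_of m lam))
        (\<lambda>T. bidet m (shape_of m lam) (canonical m (shape_of m lam)) T) (nabla m lam) \<and>
      is_zbasis (std_rtableaux m ord (shape_of m lam))
        (\<lambda>T. bidet m (shape_of m lam) T (canonical m (shape_of m lam))) (nabla_tilde m lam))
     \<and>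
     (\<exists>\<phi>. GG_iso m (nabla_tensor m lam) (nabla_tensor_coact m lam)
               (A_quot m lam) (A_quot_coact m lam) \<phi> \<and>
        (\<forall>S \<in> rtableaux m (shape_of m lam). \<forall>T \<in> rtableaux m (shape_of m lam).
           \<phi> (tens (addgrp (nabla_tilde m lam)) (addgrp (nabla m lam))
                (bidet m (shape_of m lam) S (canonical m (shape_of m lam)))
                (bidet m (shape_of m lam) (canonical m (shape_of m lam)) T)) =
           A_less m lam #>\<^bsub>addgrp (A_le m lam)\<^esub> bidet m (shape_of m lam) S T))"
proof -
 interpret ordered_letters m ord using assms(2) by unfold_locales
 show ?thesis
  using straightening_explicit[OF assms(3)]
  by (intro conjI ballI standard_bideterminants_basis nabla_bases[OF assms(3)] section_GG_iso[OF assms(3)])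
qed

end
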